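(* Let $P=([n],\prec)$ be a partially ordered set with $i\prec j\Rightarrow i<j$, $\Delta$ its order complex, and $A=k[\Delta]=S/\mathfrak a$ with $S=k[x_i:i\in P]$ and $\mathfrak a=\langle x_ix_j:i<j,\ i\not\prec j\rangle$. Let $\mathcal M=\mathcal M_1\cup\mathcal M_2$ be a standard matching on the Taylor resolution of $\mathfrak a$. Then \[P^A_k(\underline x,t)=\frac{\prod_{i\in P}(1+t\,x_i)}{W(t,\underline x)},\qquad \mathrm{Hilb}_A(\underline x,t)=\frac{W(-t,\underline x)}{\prod_{i\in P}(1-t\,x_i)},\] where \[W(t,\underline x)=1+\sum_{I\notin\mathcal M}(-1)^{cl(I)}m_It^{cl(I)+|I|}=1+\sum_{I\notin\mathcal M_1}(-1)^{cl(I)}m_It^{cl(I)+|I|}=1+\sum_{I\in\mathcal B}(-1)^{cl(I)}m_It^{cl(I)+|I|}=1+\sum_{I\ \text{nbc-set}}(-1)^{cl(I)}m_It^{cl(I)+|I|}.\]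
   Context: Sums run over nonempty $I\subseteq\mathrm{MinGen}(\mathfrak a)=\{x_ix_j:i<j,i\not\prec j\}$; $m_I=\mathrm{lcm}(I)$; $cl(I)$ is the number of classes of $I$ under the transitive closure of $m\sim m'\iff\gcd(m,m')\neq1$. $P^A_k(\underline x,t)=\sum_{i,\alpha}\dim_k\mathrm{Tor}^A_i(k,k)_\alpha\underline x^\alpha t^i$ and $\mathrm{Hilb}_A(\underline x,t)=\sum_\alpha\dim_kA_\alpha\underline x^\alpha t^{\|\alpha\|}$ ($\|\alpha\|=\sum\alpha_i$). Taylor resolution $T_\bullet$: basis indexed by nonempty $I\subseteq\mathrm{MinGen}(\mathfrak a)$, degree $|I|-1$, $\partial(I)=\sum_j(-1)^{j+1}\frac{m_I}{m_{I\setminus\{m_{i_j}\}}}(I\setminus\{m_{i_j}\})$. Acyclic matching: set of edges $c\to c'$ (nonzero coefficient of $c'$ in $\partial c$), each basis element in at most one, matched coefficients central units, no directed cycle after reversing matched edges; Morse complex: free on unmatched elements with weighted-path-sum differential, homotopy equivalent to the original. Standard matching: $\mathcal M=\bigcup_i\mathcal M_i$, $\mathcal M_i$ (sequences of) acyclic matchings on the Morse complex from $T_\bullet$ via $\bigcup_{j<i}\mathcal M_j$, such that matched edges $I\to J$ satisfy $m_I=m_J$, $|I|=|J|+1$, $cl(J)-cl(I)=i-1$ for edges in $\mathcal M_i$; the final Morse complex has no edge $I\to J$ with $m_I=m_J$; and $\mathcal M_i=\mathcal B_i\cup\{I\cup K\to J\cup K:I\to J\in\mathcal B_i,\gcd(m_I,m_K)=1\}$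 for some $\mathcal B_i$ whose edges have $cl(I)=1$, $cl(J)=i$. $I\notin\mathcal M$ means $I$ is unmatched. Sting-chain: $I\subseteq\mathrm{MinGen}(\mathfrak a)$ such that there are $x_{i_1}x_{i_2},\dots,x_{i_{\nu-1}}x_{i_\nu}\in I$ with $i_1<\dots<i_\nu$, $i_1=\min\{j:x_j\mid m_I\}$, $i_\nu=\max\{j:x_j\mid m_I\}$, and every $x_rx_s\in I$ ($r<s$) satisfies for some $j$: $x_rx_s=x_{i_j}x_{i_{j+1}}$, or ($r=i_j$, $s<i_{j+1}$, $x_sx_{i_{j+1}}\notin I$), or ($r>i_j$, $s=i_{j+1}$, $i_j\prec r$). $\mathcal B$ is the set of tuples $(I_1,\dots,I_l)$ of sting-chains with $\max(I_j)<\min(I_{j+1})$, where $\max(I)=\max\{i:x_i\mid m_I\}$, $\min(I)=\min\{i:x_i\mid m_I\}$; such a tuple is identified with $I=I_1\cup\dots\cup I_l$. nbc-set (w.r.t. the lexicographic order with $x_1\succ\dots\succ x_n$): to $I$ associate the graph on $[n]$ with edges $\{i,j\}$ for $x_ix_j\in I$; $I$ is an nbc-set if there is no $x_ix_j\in\mathrm{MinGen}(\mathfrak a)$ such that the edge set together with $\{i,j\}$ contains a circuit $c$ whose $\prec$-largest monomial $x_{i'}x_{j'}$, $\{i',j'\}\in c$, is $x_ix_j$. *)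

theory Defs
  imports
    "HOL-Library.Poly_Mapping"
    "HOL-Computational_Algebra.Formal_Power_Series"
begin

section \<open>Monomials and polynomials\<close>

text \<open>
  The ground set $[n]$ is a type \<open>'n\<close> of classes \<open>finite\<close> and \<open>linorder\<close> (its elements, in
  increasing order, are $1, \dots, n$).  A monomial is its exponent vector, so monomials are written
  additively and the monomial $1$ is \<open>0\<close>.  The library order on exponent vectors is the
  lexicographic order in which the variables of smaller index are larger.
\<close>

type_synonym 'n monom = "'n \<Rightarrow>\<^sub>0 nat"
type_synonym ('n, 'k) mpoly = "'n monom \<Rightarrow>\<^sub>0 'k"

definition pvar :: "'n \<Rightarrow> ('n, 'k :: zero_neq_one) mpoly" where
  "pvar i = Poly_Mapping.single (Poly_Mapping.single i 1) 1"

definition pmonom :: "'n monom \<Rightarrow> ('n, 'k :: zero_neq_one) mpoly" where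
  "pmonom m = Poly_Mapping.single m 1"

definition edge_monom :: "'n \<Rightarrow> 'n \<Rightarrow> 'n monom" where
  "edge_monom i j = Poly_Mapping.single i 1 + Poly_Mapping.single j 1"

definition total_deg :: "'n :: finite monom \<Rightarrow> nat" where
  "total_deg m = (\<Sum>i\<in>UNIV. Poly_Mapping.lookup m i)"

definition mlcm :: "'n :: finite monom set \<Rightarrow> 'n monom" where
  "mlcm I = Abs_poly_mapping (\<lambda>v. Max (insert 0 ((\<lambda>m. Poly_Mapping.lookup m v) ` I)))"

definition mgcd :: "'n :: finite monom \<Rightarrow> 'n monom \<Rightarrow> 'n monom" where
  "mgcd m m' = Abs_poly_mapping (\<lambda>v. min (Poly_Mapping.lookup m v) (Poly_Mapping.lookup m' v))"

text \<open>The indices \<open>j\<close> such that $x_j$ divides $m_I$.\<close>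

definition support :: "'n :: finite monom set \<Rightarrow> 'n set" where
  "support I = Poly_Mapping.keys (mlcm I)"

text \<open>Scalar multiplication on any space of finitely supported families.\<close>

definition pscale :: "'r \<Rightarrow> ('b \<Rightarrow>\<^sub>0 'r) \<Rightarrow> ('b \<Rightarrow>\<^sub>0 'r :: mult_zero)" where
  "pscale c v = Poly_Mapping.map (\<lambda>a. c * a) v"

text \<open>The dimension of \<open>V / U\<close>, for subspaces \<open>U \<subseteq> V\<close>: the set \<open>B\<close> represents a basis of \<open>V / U\<close>.\<close>

definition quot_dim :: "('b \<Rightarrow>\<^sub>0 'k :: field) set \<Rightarrow> ('b \<Rightarrow>\<^sub>0 'k) set \<Rightarrow> nat" where
  "quot_dim V U = card (SOME B. B \<subseteq> V \<and> \<not> module.dependent pscale B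
     \<and> module.span pscale B \<inter> U = {0} \<and> V \<subseteq> module.span pscale (B \<union> U))"


section \<open>The ring \<open>A = S / \<aa>\<close> and its Hilbert series\<close>

definition mingens :: "('n :: linorder \<Rightarrow> 'n \<Rightarrow> bool) \<Rightarrow> 'n monom set" where
  "mingens prec = {edge_monom i j | i j. i < j \<and> \<not> prec i j}"

definition ideal_a :: "('n :: linorder \<Rightarrow> 'n \<Rightarrow> bool) \<Rightarrow> ('n, 'k :: field) mpoly set" where
  "ideal_a prec = {\<Sum>g\<in>mingens prec. s g * pmonom g | s. True}"

definition hilb_dim :: "'k :: field itself \<Rightarrow> ('n :: linorder \<Rightarrow> 'n \<Rightarrow> bool) \<Rightarrow> 'n monom \<Rightarrow> nat" where
  "hilb_dim _ prec \<alpha> =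
     (let S\<^sub>\<alpha> = {p :: ('n, 'k) mpoly. Poly_Mapping.keys p \<subseteq> {\<alpha>}} in quot_dim S\<^sub>\<alpha> (ideal_a prec \<inter> S\<^sub>\<alpha>))"

text \<open>
  Both series have finitely many monomials in \<open>x\<close> for each power of \<open>t\<close>; they are formal power
  series in \<open>t\<close> over the polynomial ring $\mathbb{Z}[\underline x]$.
\<close>

definition hilbert_series ::
    "'k :: field itself \<Rightarrow> ('n :: {finite, linorder} \<Rightarrow> 'n \<Rightarrow> bool) \<Rightarrow> ('n, int) mpoly fps" where
  "hilbert_series K prec = Abs_fps (\<lambda>d. Abs_poly_mapping
     (\<lambda>\<alpha>. if total_deg \<alpha> = d then int (hilb_dim K prec \<alpha>) else 0))"


section \<open>Multigraded free resolutions of \<open>k\<close> over \<open>A\<close>, Tor and the Poincare series\<close>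

text \<open>
  A sequence \<open>F\<close> of multigraded free \<open>A\<close>-modules $F_i$ with homogeneous bases, basis labels in \<open>'b\<close>.
  An element of $F_i$ is represented by its coefficient family with entries in \<open>S\<close>, and two families
  represent the same element iff they agree modulo \<open>\<aa>\<close> in every entry.  For \<open>i \<ge> 1\<close>, \<open>fdiff F i b\<close>
  represents the image in $F_{i-1}$ of the basis element \<open>b\<close> of $F_i$; \<open>faug F b\<close> is the image in \<open>k\<close>
  of the basis element \<open>b\<close> of $F_0$.
\<close>

record (overloaded) ('b, 'n, 'k) gfree =
  fbasis :: "nat \<Rightarrow> 'b set"
  fdeg :: "nat \<Rightarrow> 'b \<Rightarrow> 'n monom"
  fdiff :: "nat \<Rightarrow> 'b \<Rightarrow> ('b \<Rightarrow>\<^sub>0 ('n, 'k) mpoly)"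
  faug :: "'b \<Rightarrow> 'k"

definition fcarrier :: "('b, 'n, 'k :: field) gfree \<Rightarrow> nat \<Rightarrow> ('b \<Rightarrow>\<^sub>0 ('n, 'k) mpoly) set" where
  "fcarrier F i = {v. Poly_Mapping.keys v \<subseteq> fbasis F i}"

definition fd ::
    "('b, 'n, 'k :: field) gfree \<Rightarrow> nat \<Rightarrow> ('b \<Rightarrow>\<^sub>0 ('n, 'k) mpoly) \<Rightarrow> ('b \<Rightarrow>\<^sub>0 ('n, 'k) mpoly)" where
  "fd F i v = (\<Sum>b\<in>Poly_Mapping.keys v. pscale (Poly_Mapping.lookup v b) (fdiff F i b))"

definition feps :: "('b, 'n, 'k :: field) gfree \<Rightarrow> ('b \<Rightarrow>\<^sub>0 ('n, 'k) mpoly) \<Rightarrow> 'k" where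
  "feps F v =
     (\<Sum>b\<in>Poly_Mapping.keys v. Poly_Mapping.lookup (Poly_Mapping.lookup v b) 0 * faug F b)"

definition fzero ::
    "('n :: linorder \<Rightarrow> 'n \<Rightarrow> bool) \<Rightarrow> ('b \<Rightarrow>\<^sub>0 ('n, 'k :: field) mpoly) \<Rightarrow> bool" where
  "fzero prec v \<longleftrightarrow> (\<forall>b. Poly_Mapping.lookup v b \<in> ideal_a prec)"

definition graded_free_resolution ::
    "('n :: linorder \<Rightarrow> 'n \<Rightarrow> bool) \<Rightarrow> ('b, 'n, 'k :: field) gfree \<Rightarrow> bool" where
  "graded_free_resolution prec F \<longleftrightarrow>
     \<comment> \<open>the maps are well defined and multigraded\<close>
     (\<forall>i. \<forall>b\<in>fbasis F (Suc i). fdiff F (Suc i) b \<in> fcarrier F i \<and>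
        (\<forall>b'. \<forall>m\<in>Poly_Mapping.keys (Poly_Mapping.lookup (fdiff F (Suc i) b) b').
           m + fdeg F i b' = fdeg F (Suc i) b)) \<and>
     (\<forall>b\<in>fbasis F 0. faug F b \<noteq> 0 \<longrightarrow> fdeg F 0 b = 0) \<and>
     \<comment> \<open>exactness of the augmented complex over \<open>A\<close>\<close>
     (\<forall>c. \<exists>v\<in>fcarrier F 0. feps F v = c) \<and>
     (\<forall>v\<in>fcarrier F 0. feps F v = 0 \<longleftrightarrow> (\<exists>w\<in>fcarrier F 1. fzero prec (v - fd F 1 w))) \<and>
     (\<forall>i\<ge>1. \<forall>v\<in>fcarrier F i.
        fzero prec (fd F i v) \<longleftrightarrow> (\<exists>w\<in>fcarrier F (Suc i). fzero prec (v - fd F (Suc i) w)))"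

text \<open>
  The complex $F \otimes_A k$: in homological degree \<open>i\<close> and multidegree \<open>\<alpha>\<close> it has the basis elements
  of $F_i$ of degree \<open>\<alpha>\<close> as a \<open>k\<close>-basis, and the matrix entries are replaced by their constant terms.
\<close>

definition tensor_part ::
    "('b, 'n, 'k :: field) gfree \<Rightarrow> nat \<Rightarrow> 'n monom \<Rightarrow> ('b \<Rightarrow>\<^sub>0 'k) set" where
  "tensor_part F i \<alpha> = {v. Poly_Mapping.keys v \<subseteq> {b \<in> fbasis F i. fdeg F i b = \<alpha>}}"

definition tensor_d :: "('b, 'n, 'k :: field) gfree \<Rightarrow> nat \<Rightarrow> ('b \<Rightarrow>\<^sub>0 'k) \<Rightarrow> ('b \<Rightarrow>\<^sub>0 'k)" where
  "tensor_d F i v = (if i = 0 then 0 else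
     (\<Sum>b\<in>Poly_Mapping.keys v. pscale (Poly_Mapping.lookup v b)
        (Poly_Mapping.map (\<lambda>p. Poly_Mapping.lookup p 0) (fdiff F i b))))"

definition tensor_homology_dim ::
    "('b, 'n, 'k :: field) gfree \<Rightarrow> nat \<Rightarrow> 'n monom \<Rightarrow> nat" where
  "tensor_homology_dim F i \<alpha> = quot_dim
     {v \<in> tensor_part F i \<alpha>. tensor_d F i v = 0} (tensor_d F (Suc i) ` tensor_part F (Suc i) \<alpha>)"

text \<open>
  $\dim_k \mathrm{Tor}^A_i(k,k)_\alpha$ is computed from a chosen multigraded free resolution of \<open>k\<close>.
  The type of the labels is immaterial as long as it is rich enough; lists of monomials accommodate
  the basis of the bar resolution.
\<close>

definition tor_dim ::
    "'k :: field itself \<Rightarrow> ('n :: linorder \<Rightarrow> 'n \<Rightarrow> bool) \<Rightarrow> nat \<Rightarrow> 'n monom \<Rightarrow> nat" where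
  "tor_dim _ prec i \<alpha> = tensor_homology_dim
     (SOME F :: ('n monom list, 'n, 'k) gfree. graded_free_resolution prec F) i \<alpha>"

definition poincare_series ::
    "'k :: field itself \<Rightarrow> ('n :: {finite, linorder} \<Rightarrow> 'n \<Rightarrow> bool) \<Rightarrow> ('n, int) mpoly fps" where
  "poincare_series K prec =
     Abs_fps (\<lambda>i. Abs_poly_mapping (\<lambda>\<alpha>. int (tor_dim K prec i \<alpha>)))"


section \<open>Algebraic discrete Morse theory\<close>

text \<open>
  A complex of free modules over a commutative ring with chosen bases; \<open>bd X c c'\<close> is the coefficient
  of \<open>c'\<close> in the differential of \<open>c\<close>.
\<close>

record ('c, 'r) based_complex =
  cells :: "'c set"
  cdim :: "'c \<Rightarrow> nat"
  bd :: "'c \<Rightarrow> 'c \<Rightarrow> 'r"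

definition cedges :: "('c, 'r :: comm_ring_1) based_complex \<Rightarrow> ('c \<times> 'c) set" where
  "cedges X = {(c, c'). c \<in> cells X \<and> c' \<in> cells X \<and> cdim X c = Suc (cdim X c') \<and> bd X c c' \<noteq> 0}"

definition reversed_graph ::
    "('c, 'r :: comm_ring_1) based_complex \<Rightarrow> ('c \<times> 'c) set \<Rightarrow> ('c \<times> 'c) set" where
  "reversed_graph X M = (cedges X - M) \<union> M\<inverse>"

definition acyclic_matching ::
    "('c, 'r :: comm_ring_1) based_complex \<Rightarrow> ('c \<times> 'c) set \<Rightarrow> bool" where
  "acyclic_matching X M \<longleftrightarrow> M \<subseteq> cedges X \<and>
     (\<forall>e\<in>M. \<forall>e'\<in>M. e \<noteq> e' \<longrightarrow> {fst e, snd e} \<inter> {fst e', snd e'} = {}) \<and>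
     (\<forall>(c, c')\<in>M. bd X c c' dvd 1) \<and>
     acyclic (reversed_graph X M)"

definition unit_inverse :: "'r :: comm_ring_1 \<Rightarrow> 'r" where
  "unit_inverse u = (THE v. u * v = 1)"

definition step_weight ::
    "('c, 'r :: comm_ring_1) based_complex \<Rightarrow> ('c \<times> 'c) set \<Rightarrow> 'c \<Rightarrow> 'c \<Rightarrow> 'r" where
  "step_weight X M c c' = (if (c', c) \<in> M then - unit_inverse (bd X c' c) else bd X c c')"

definition graph_paths ::
    "('c, 'r :: comm_ring_1) based_complex \<Rightarrow> ('c \<times> 'c) set \<Rightarrow> 'c \<Rightarrow> 'c \<Rightarrow> 'c list set" where
  "graph_paths X M c c' = {p. p \<noteq> [] \<and> hd p = c \<and> last p = c' \<and> distinct p \<and>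
     successively (\<lambda>a b. (a, b) \<in> reversed_graph X M) p}"

definition morse_complex ::
    "('c, 'r :: comm_ring_1) based_complex \<Rightarrow> ('c \<times> 'c) set \<Rightarrow> ('c, 'r) based_complex" where
  "morse_complex X M = \<lparr>
     cells = cells X - Field M,
     cdim = cdim X,
     bd = (\<lambda>c c'. if cdim X c = Suc (cdim X c')
        then \<Sum>p\<in>graph_paths X M c c'. \<Prod>i<length p - 1. step_weight X M (p ! i) (p ! Suc i)
        else 0)\<rparr>"

text \<open>Every matching of the list lives on the Morse complex of its predecessors.\<close>

fun matching_sequence ::
    "('c, 'r :: comm_ring_1) based_complex \<Rightarrow> ('c \<times> 'c) set list \<Rightarrow> bool" where
  "matching_sequence X [] \<longleftrightarrow> True"
| "matching_sequence X (M # Ms) \<longleftrightarrow>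
     acyclic_matching X M \<and> matching_sequence (morse_complex X M) Ms"


section \<open>Standard matchings on the Taylor resolution\<close>

definition taylor ::
    "('n :: {finite, linorder} \<Rightarrow> 'n \<Rightarrow> bool) \<Rightarrow> ('n monom set, ('n, 'k :: field) mpoly) based_complex" where
  "taylor prec = \<lparr>
     cells = {I. I \<noteq> {} \<and> I \<subseteq> mingens prec},
     cdim = (\<lambda>I. card I - 1),
     bd = (\<lambda>I J. \<Sum>g\<in>I. if J = I - {g} \<and> J \<noteq> {}
        then (- 1) ^ (card {h \<in> I. h \<le> g} + 1) * pmonom (mlcm I - mlcm J) else 0)\<rparr>"

definition cl :: "'n :: finite monom set \<Rightarrow> nat" where
  "cl I = card (I // {(m, m'). m \<in> I \<and> m' \<in> I \<and> mgcd m m' \<noteq> 0}\<^sup>+)"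

definition coprime_extensions ::
    "('n :: {finite, linorder} \<Rightarrow> 'n \<Rightarrow> bool) \<Rightarrow> ('n monom set \<times> 'n monom set) set \<Rightarrow>
     ('n monom set \<times> 'n monom set) set" where
  "coprime_extensions prec B =
     {(I \<union> K, J \<union> K) | I J K. (I, J) \<in> B \<and> K \<subseteq> mingens prec \<and> mgcd (mlcm I) (mlcm K) = 0}"

text \<open>
  The condition $M = B \cup \{I \cup K \to J \cup K\}$ on a matching \<open>M\<close> obtained after \<open>M'\<close>.  Two
  edges $I \to J$, $I' \to J'$ of \<open>B\<close> with $\gcd(m_I, m_{I'}) = 1$ yield extensions that meet in
  $I \cup I'$, so not all extensions can belong to a matching.  An extension may therefore be missing
  from \<open>M\<close>, provided that both of its ends have been matched.  If all extensions belong to \<open>M\<close>, the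
  condition holds (first lemma below).
\<close>

definition generated_by ::
    "('n :: {finite, linorder} \<Rightarrow> 'n \<Rightarrow> bool) \<Rightarrow> ('n monom set \<times> 'n monom set) set \<Rightarrow>
     ('n monom set \<times> 'n monom set) set \<Rightarrow> ('n monom set \<times> 'n monom set) set \<Rightarrow> bool" where
  "generated_by prec M' M B \<longleftrightarrow>
     B \<subseteq> M \<and> M \<subseteq> B \<union> coprime_extensions prec B \<and>
     Field (coprime_extensions prec B) \<subseteq> Field (M' \<union> M)"

lemma generated_by_if_eq:
  "M = B \<union> coprime_extensions prec B \<Longrightarrow> generated_by prec M' M B"
  by (auto simp: generated_by_def Field_def)

lemma eq_if_generated_by:
  "generated_by prec M' M B \<Longrightarrow> coprime_extensions prec B \<subseteq> M \<Longrightarrow>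
     M = B \<union> coprime_extensions prec B"
  by (auto simp: generated_by_def)

text \<open>
  \<open>\<M>\<close> lists $\mathcal M_1, \dots, \mathcal M_r$, each of them as a sequence of matchings; since list
  positions start with \<open>0\<close>, the number \<open>i\<close> below is the index of $\mathcal M_{i+1}$.
\<close>

definition standard_matching ::
    "'k :: field itself \<Rightarrow> ('n :: {finite, linorder} \<Rightarrow> 'n \<Rightarrow> bool) \<Rightarrow>
     ('n monom set \<times> 'n monom set) set list list \<Rightarrow> bool" where
  "standard_matching _ prec \<M> \<longleftrightarrow>
     (let T = (taylor prec :: ('n monom set, ('n, 'k) mpoly) based_complex) in
      matching_sequence T (concat \<M>) \<and>
      (\<forall>i<length \<M>. \<forall>(I, J)\<in>\<Union>(set (\<M> ! i)).
         mlcm I = mlcm J \<and> card I = card J + 1 \<and> cl J = cl I + i) \<and>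
      (\<forall>(I, J)\<in>cedges (foldl morse_complex T (concat \<M>)). mlcm I \<noteq> mlcm J) \<and>
      (\<forall>i<length \<M>. \<exists>B.
         generated_by prec (\<Union>(set (concat (take i \<M>)))) (\<Union>(set (\<M> ! i))) B \<and>
         (\<forall>(I, J)\<in>B. cl I = 1 \<and> cl J = i + 1)))"

definition unmatched ::
    "('n :: {finite, linorder} \<Rightarrow> 'n \<Rightarrow> bool) \<Rightarrow> ('n monom set \<times> 'n monom set) set \<Rightarrow>
     'n monom set set" where
  "unmatched prec M = {I. I \<noteq> {} \<and> I \<subseteq> mingens prec \<and> I \<notin> Field M}"


section \<open>Sting-chains and nbc-sets\<close>

definition sting_chain ::
    "('n :: {finite, linorder} \<Rightarrow> 'n \<Rightarrow> bool) \<Rightarrow> 'n monom set \<Rightarrow> bool" where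
  "sting_chain prec I \<longleftrightarrow> I \<subseteq> mingens prec \<and>
     (\<exists>c. length c \<ge> 2 \<and> sorted_wrt (<) c \<and>
        (\<forall>j. Suc j < length c \<longrightarrow> edge_monom (c ! j) (c ! Suc j) \<in> I) \<and>
        hd c = Min (support I) \<and> last c = Max (support I) \<and>
        (\<forall>r s. r < s \<and> edge_monom r s \<in> I \<longrightarrow>
           (\<exists>j. Suc j < length c \<and>
              (edge_monom r s = edge_monom (c ! j) (c ! Suc j) \<or>
               r = c ! j \<and> s < c ! Suc j \<and> edge_monom s (c ! Suc j) \<notin> I \<or>
               r > c ! j \<and> s = c ! Suc j \<and> prec (c ! j) r))))"

text \<open>
  Nonempty tuples of sting-chains, identified with their unions.
\<close>

definition sting_unions :: "('n :: {finite, linorder} \<Rightarrow> 'n \<Rightarrow> bool) \<Rightarrow> 'n monom set set" where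
  "sting_unions prec = {\<Union>(set Is) | Is. Is \<noteq> [] \<and> (\<forall>I\<in>set Is. sting_chain prec I) \<and>
     successively (\<lambda>I J. Max (support I) < Min (support J)) Is}"

definition graph_of :: "'n monom set \<Rightarrow> 'n set set" where
  "graph_of I = {{i, j} | i j. edge_monom i j \<in> I}"

definition circuit :: "'v set set \<Rightarrow> bool" where
  "circuit C \<longleftrightarrow> (\<exists>p. distinct p \<and> length p \<ge> 3 \<and>
     C = {{p ! i, p ! (Suc i mod length p)} | i. i < length p})"

definition nbc_set :: "('n :: {finite, linorder} \<Rightarrow> 'n \<Rightarrow> bool) \<Rightarrow> 'n monom set \<Rightarrow> bool" where
  "nbc_set prec I \<longleftrightarrow> I \<noteq> {} \<and> I \<subseteq> mingens prec \<and>
     \<not> (\<exists>i j. edge_monom i j \<in> mingens prec \<and>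
        (\<exists>C. circuit C \<and> C \<subseteq> graph_of I \<union> {{i, j}} \<and> {i, j} \<in> C \<and>
           (\<forall>i' j'. {i', j'} \<in> C \<longrightarrow> edge_monom i' j' \<le> edge_monom i j)))"


section \<open>The denominator \<open>W(t, x)\<close>\<close>

definition W_series :: "'n :: finite monom set set \<Rightarrow> ('n, int) mpoly fps" where
  "W_series \<F> =
     1 + (\<Sum>I\<in>\<F>. (- 1) ^ cl I * fps_const (pmonom (mlcm I)) * fps_X ^ (cl I + card I))"

end

theory Submission
  imports Defs "HOL-Library.Transitive_Closure_Table"
begin

text \<open>
  For a set \<open>V\<close> of vertices let \<open>f V\<close> be the sum of $(-1)^{|F|}$ over all chains $F \subseteq V$.  All
  series $W$ are equal to $\sum_V f(V)\, t^{|V|} \prod_{v \in V} x_v$.  By inclusion-exclusion, the sum of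
  $(-1)^{|I|}$ over all $I \subseteq \mathrm{MinGen}(\mathfrak a)$ with support \<open>V\<close> is $(-1)^{|V|} f(V)$, so
  it suffices that the members \<open>I\<close> of a family satisfy $cl(I) + |I| = |\mathrm{supp}(I)|$, that is, are
  forests, and that the remaining sets cancel for every support.  For nbc-sets, adding or removing the smallest
  edge that is the maximum of a circuit is a sign-reversing involution.  For sting-chains, scanning the vertices
  yields the recursion satisfied by \<open>f\<close>.  Matched sets cancel in pairs; that all sets unmatched by
  $\mathcal M_1$ are forests reduces to connected sets \<open>I\<close>.  If $\mathcal M_2$ matches \<open>I\<close>, then with a
  set that has the same support and two classes, to which induction applies.  Otherwise \<open>I\<close> survives to the end.  There the
  multidegree strand of the final Morse complex has zero differential, whereas the strand of the Taylor
  resolution, and hence that of the Morse complex, is exact from the number of edges $|V|$ on.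

  On the algebraic side let $A_W$ be the span of the monomials of \<open>A\<close> in variables from \<open>W\<close>.  For
  $v \in W$ there is an exact sequence
  $0 \to A_{W \cap N[v]}(-x_v) \to A_W \to A_{W \setminus v} \to 0$,
  where $N[v]$ consists of the elements comparable to \<open>v\<close>.  It shows by induction that $\mathrm{Tor}^A(A_W, k)$
  is concentrated on the diagonal, and that its series satisfies the same recursion as
  $\mathrm{Hilb}_{A_W}(\underline x, -t)$.  The case $W = \emptyset$ gives
  $P^A_k(\underline x, t) \cdot \mathrm{Hilb}_A(\underline x, -t) = 1$.
\<close>

section \<open>Edge monomials and connected classes\<close>

text \<open>\<open>tor_dim\<close> refers to an arbitrarily chosen resolution that need not be
  minimal, so all of Tor is obtained from long exact sequences valid for every resolution; the bar
  resolution only shows that there is something to choose. Dimensions can be read off because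
  concentration on the diagonal makes the outer terms of these sequences vanish. The threshold |V|
  for the Taylor strand is sharp enough for a reason of counting. Edge sets that have to cover a
  vertex set T are exact beyond cardinality |T| for any kind of edges. An edge uses up one unit of
  cardinality but two vertices, which gains one more degree for T = V. A connected forest has |V| -
  1 edges, so exactness from |V| on excludes exactly the connected sets with a cycle. In the
  induction on supports, a connected set matched by the second matching has a partner with the same
  support. The induction hypothesis therefore reaches only the two parts of the partner, and this
  needs that being unmatched by the first matching passes to the parts of a disconnected
  set.\<close>

abbreviation "lk \<equiv> Poly_Mapping.lookup"
abbreviation "ks \<equiv> Poly_Mapping.keys"

lemma lookup_Abs_finite [simp]:
  fixes f :: "'n::finite \<Rightarrow> 'a::zero"
  shows "lk (Abs_poly_mapping f) = f"
  by (rule lookup_Abs_poly_mapping) simp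

lemma lookup_edge_monom: "lk (edge_monom i j) v = (if v = i then 1 else 0) + (if v = j then 1 else 0)"
  by (auto simp: edge_monom_def lookup_add lookup_single when_def)

lemma keys_edge_monom [simp]: "ks (edge_monom i j) = {i, j}"
  by (auto simp: in_keys_iff lookup_edge_monom split: if_splits)

definition sqf :: "'n set \<Rightarrow> 'n::finite monom" where
  "sqf V = Abs_poly_mapping (\<lambda>v. if v \<in> V then 1 else 0)"

lemma lookup_sqf [simp]: "lk (sqf V) v = (if v \<in> V then 1 else 0)"
  by (simp add: sqf_def)

lemma keys_sqf [simp]: "ks (sqf V) = V"
  by (auto simp: in_keys_iff split: if_splits)

lemma sqf_inject [simp]: "sqf V = sqf V' \<longleftrightarrow> V = V'"
  by (metis keys_sqf)

lemma edge_monom_sqf: "i \<noteq> j \<Longrightarrow> edge_monom i j = sqf {i, j}"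
  by (rule poly_mapping_eqI) (auto simp: lookup_edge_monom)

lemma mingensE:
  assumes "g \<in> mingens prec"
  obtains i j where "i < j" "\<not> prec i j" "g = edge_monom i j" "g = sqf {i, j}" "ks g = {i, j}"
proof -
  obtain i j where "i < j" "\<not> prec i j" "g = edge_monom i j" using assms by (auto simp: mingens_def)
  moreover have "edge_monom i j = sqf {i, j}" using \<open>i < j\<close> by (intro edge_monom_sqf) simp
  ultimately show ?thesis using that keys_edge_monom by metis
qed

lemma mingens_sqf: "g \<in> mingens prec \<Longrightarrow> g = sqf (ks g)"
  by (erule mingensE) (simp only: keys_sqf)

lemma mingens_card:
  assumes "g \<in> mingens (prec :: 'n::{finite,linorder} \<Rightarrow> 'n \<Rightarrow> bool)"
  shows "card (ks g) = 2"
proof -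
  obtain i j where "i < j" "ks g = {i, j}" using assms by (rule mingensE)
  then show ?thesis by simp
qed

lemma mingens_keys: "g \<in> mingens (prec :: 'n::{finite,linorder} \<Rightarrow> 'n \<Rightarrow> bool) \<Longrightarrow> ks g \<noteq> {}"
  using mingens_card[of g prec] by auto

lemma finite_mingens [simp]: "finite (mingens (prec :: 'n::{finite,linorder} \<Rightarrow> 'n \<Rightarrow> bool))"
proof -
  have "mingens prec \<subseteq> range sqf" using mingens_sqf by blast
  then show ?thesis by (rule finite_subset) simp
qed

lemma finite_edges: "I \<subseteq> mingens (prec :: 'n::{finite,linorder} \<Rightarrow> 'n \<Rightarrow> bool) \<Longrightarrow> finite I"
  by (rule finite_subset[OF _ finite_mingens])

lemma edge_in_mingens: "i < j \<Longrightarrow> edge_monom i j \<in> mingens prec \<longleftrightarrow> \<not> prec i j"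
proof -
  assume ij: "i < j"
  have "i' = i \<and> j' = j" if "edge_monom i j = edge_monom i' j'" "i' < j'" for i' j'
  proof -
    have "{i, j} = {i', j'}" using that(1) by (metis keys_edge_monom)
    then show ?thesis using ij that(2) by (auto simp: doubleton_eq_iff)
  qed
  then show ?thesis using ij by (auto simp: mingens_def)
qed

section \<open>Gcd, lcm and supports of sets of edges\<close>

lemma mgcd_nonzero: "mgcd m m' \<noteq> 0 \<longleftrightarrow> ks m \<inter> ks m' \<noteq> {}"
proof -
  have "mgcd m m' = 0 \<longleftrightarrow> (\<forall>v. min (lk m v) (lk m' v) = 0)"
    by (auto simp: mgcd_def poly_mapping_eq_iff fun_eq_iff)
  moreover have "min a b = 0 \<longleftrightarrow> a = 0 \<or> b = 0" for a b :: nat by (auto simp: min_def)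
  ultimately show ?thesis by (auto simp: in_keys_iff)
qed

lemma support_eq: "finite I \<Longrightarrow> support I = \<Union>(ks ` I)"
proof -
  assume I: "finite I"
  have "Max (insert 0 ((\<lambda>m. lk m v) ` I)) \<noteq> 0 \<longleftrightarrow> (\<exists>m\<in>I. lk m v \<noteq> 0)" for v
  proof -
    have "Max (insert 0 ((\<lambda>m. lk m v) ` I)) > 0 \<longleftrightarrow> (\<exists>a\<in>insert 0 ((\<lambda>m. lk m v) ` I). a > 0)"
      using I by (intro Max_gr_iff) auto
    then show ?thesis by auto
  qed
  then show ?thesis by (auto simp: support_def mlcm_def in_keys_iff)
qed

text \<open>Generators are squarefree, so their lcm carries no information beyond its support;
  multidegrees can be treated as vertex sets.\<close>

lemma mlcm_sqf: assumes "I \<subseteq> mingens prec" shows "mlcm I = sqf (support I)"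
proof (rule poly_mapping_eqI)
  fix v
  have fin: "finite I" using assms by (rule finite_edges)
  have le: "lk (mlcm I) v \<le> 1"
  proof -
    have "lk m v \<le> 1" if "m \<in> I" for m
    proof -
      have "m = sqf (ks m)" using that assms mingens_sqf by blast
      then have "lk m v = lk (sqf (ks m)) v" by (rule arg_cong)
      then show ?thesis unfolding lookup_sqf by simp
    qed
    then show ?thesis using fin by (simp add: mlcm_def)
  qed
  have "v \<in> support I \<longleftrightarrow> lk (mlcm I) v \<noteq> 0" by (simp add: support_def in_keys_iff)
  then show "lk (mlcm I) v = lk (sqf (support I)) v" using le by auto
qed

lemma mlcm_eq_iff: "I \<subseteq> mingens prec \<Longrightarrow> J \<subseteq> mingens prec \<Longrightarrow> mlcm I = mlcm J \<longleftrightarrow> support I = support J"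
  using mlcm_sqf[of I prec] mlcm_sqf[of J prec] by (simp only: sqf_inject)

lemma mgcd_mlcm: "mgcd (mlcm I) (mlcm K) = 0 \<longleftrightarrow> support I \<inter> support K = {}"
  unfolding support_def using mgcd_nonzero[of "mlcm I" "mlcm K"] by blast

lemma support_empty [simp]: "support {} = {}"
  using support_eq[of "{}"] by simp

lemma support_Un: "finite I \<Longrightarrow> finite J \<Longrightarrow> support (I \<union> J) = support I \<union> support J"
  using support_eq[of I] support_eq[of J] support_eq[of "I \<union> J"] by auto

lemma support_nonempty:
  assumes "I \<subseteq> mingens (prec :: 'n::{finite,linorder} \<Rightarrow> 'n \<Rightarrow> bool)" "I \<noteq> {}"
  shows "support I \<noteq> {}"
proof -
  obtain m where m: "m \<in> I" using assms(2) by blast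
  then have "m \<in> mingens prec" using assms(1) by blast
  then show ?thesis using mingens_keys[of m prec] m by (auto simp: support_eq finite_edges[OF assms(1)])
qed

section \<open>Connected classes of a set of edges\<close>

definition adj :: "'n::finite monom set \<Rightarrow> ('n monom \<times> 'n monom) set" where
  "adj I = {(m, m'). m \<in> I \<and> m' \<in> I \<and> ks m \<inter> ks m' \<noteq> {}}"

definition comps :: "'n::finite monom set \<Rightarrow> 'n monom set set" where
  "comps I = I // (adj I)\<^sup>+"

lemma cl_comps: "cl I = card (comps I)"
  unfolding cl_def comps_def adj_def mgcd_nonzero ..

lemma adj_mono: "I \<subseteq> J \<Longrightarrow> adj I \<subseteq> adj J" by (auto simp: adj_def)

lemma adj_trancl_mono: "(a, b) \<in> (adj I)\<^sup>+ \<Longrightarrow> I \<subseteq> J \<Longrightarrow> (a, b) \<in> (adj J)\<^sup>+"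
  by (rule trancl_mono[OF _ adj_mono])

lemma adj_sym: "sym ((adj I)\<^sup>+)"
  by (rule sym_trancl, rule symI) (simp add: adj_def Int_commute)

lemma adj_in: "(a, b) \<in> (adj I)\<^sup>+ \<Longrightarrow> a \<in> I \<and> b \<in> I"
  by (induction rule: trancl_induct) (auto simp: adj_def)

lemma adj_equiv: assumes "I \<subseteq> mingens prec" shows "equiv I ((adj I)\<^sup>+)"
proof (rule equivI)
  have "(m, m) \<in> adj I" if "m \<in> I" for m
  proof -
    have "m \<in> mingens prec" using that assms by blast
    then show ?thesis using mingens_keys that by (auto simp: adj_def)
  qed
  then show "refl_on I ((adj I)\<^sup>+)" by (intro refl_onI) blast
  show "(adj I)\<^sup>+ \<subseteq> I \<times> I" by (auto dest: adj_in)
qed (use adj_sym in auto)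

text \<open>Lets the classes of a composed set be guessed and then checked, instead of analysing the
  transitive closure each time: a decomposition into nonempty, internally connected pieces that
  share no vertices must be the one into classes.\<close>

lemma comps_char:
  assumes ne: "\<And>C. C \<in> \<C> \<Longrightarrow> C \<noteq> {}" and un: "\<Union>\<C> = I"
    and dis: "\<And>C C' m m'. C \<in> \<C> \<Longrightarrow> C' \<in> \<C> \<Longrightarrow> m \<in> C \<Longrightarrow> m' \<in> C' \<Longrightarrow> ks m \<inter> ks m' \<noteq> {} \<Longrightarrow> C = C'"
    and con: "\<And>C m m'. C \<in> \<C> \<Longrightarrow> m \<in> C \<Longrightarrow> m' \<in> C \<Longrightarrow> (m, m') \<in> (adj I)\<^sup>+"
    and I: "I \<subseteq> mingens prec"
  shows "comps I = \<C>"
proof -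
  have cls: "(adj I)\<^sup>+ `` {m} = C" if "C \<in> \<C>" "m \<in> C" for C m
  proof
    show "C \<subseteq> (adj I)\<^sup>+ `` {m}" using con that by auto
    have "m' \<in> C" if "(m, m') \<in> (adj I)\<^sup>+" for m'
      using that
    proof (induction rule: trancl_induct)
      case (base y)
      then obtain D where "D \<in> \<C>" "y \<in> D" using un by (auto simp: adj_def)
      then show ?case using dis[of C D m y] base \<open>C \<in> \<C>\<close> \<open>m \<in> C\<close> by (auto simp: adj_def)
    next
      case (step y z)
      then obtain D where "D \<in> \<C>" "z \<in> D" using un by (auto simp: adj_def)
      then show ?case using dis[of C D y z] step \<open>C \<in> \<C>\<close> by (auto simp: adj_def)
    qed
    then show "(adj I)\<^sup>+ `` {m} \<subseteq> C" by auto
  qed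
  show ?thesis
  proof
    show "comps I \<subseteq> \<C>" using cls un by (fastforce simp: comps_def quotient_def)
    show "\<C> \<subseteq> comps I"
    proof
      fix C assume C: "C \<in> \<C>"
      then obtain m where "m \<in> C" using ne by blast
      then have "m \<in> I" "C = (adj I)\<^sup>+ `` {m}" using cls[OF C] C un by blast+
      then show "C \<in> comps I" unfolding comps_def by (simp only: quotientI)
    qed
  qed
qed

lemma comps_props:
  assumes I: "I \<subseteq> mingens prec"
  shows "C \<in> comps I \<Longrightarrow> C \<noteq> {}" "\<Union>(comps I) = I"
    "C \<in> comps I \<Longrightarrow> C' \<in> comps I \<Longrightarrow> m \<in> C \<Longrightarrow> m' \<in> C' \<Longrightarrow> ks m \<inter> ks m' \<noteq> {} \<Longrightarrow> C = C'"
    "C \<in> comps I \<Longrightarrow> m \<in> C \<Longrightarrow> m' \<in> C \<Longrightarrow> (m, m') \<in> (adj I)\<^sup>+"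
    "finite (comps I)"
proof -
  note eq = adj_equiv[OF I]
  show "C \<in> comps I \<Longrightarrow> C \<noteq> {}" using eq in_quotient_imp_non_empty unfolding comps_def by blast
  show un: "\<Union>(comps I) = I" using Union_quotient[OF eq] by (simp add: comps_def)
  show "C \<in> comps I \<Longrightarrow> m \<in> C \<Longrightarrow> m' \<in> C \<Longrightarrow> (m, m') \<in> (adj I)\<^sup>+"
    using in_quotient_imp_in_rel[OF eq] unfolding comps_def by blast
  show "C = C'" if h: "C \<in> comps I" "C' \<in> comps I" "m \<in> C" "m' \<in> C'" "ks m \<inter> ks m' \<noteq> {}"
  proof -
    have "(m, m') \<in> adj I" using h un by (auto simp: adj_def)
    then show ?thesis using quotient_eqI[OF eq, of C C' m m'] h unfolding comps_def by blast
  qed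
  show "finite (comps I)" unfolding comps_def
    by (rule finite_quotient[OF finite_edges[OF I]]) (auto dest: adj_in)
qed

lemma cl_empty [simp]: "cl {} = 0"
  by (simp add: cl_comps comps_def)

lemma cl_pos: "I \<subseteq> mingens prec \<Longrightarrow> I \<noteq> {} \<Longrightarrow> cl I \<ge> 1"
  using comps_props(2,5)[of I] by (fastforce simp: cl_comps Suc_le_eq card_gt_0_iff)

text \<open>No edge of I meets an edge of K, so no class of the union mixes the two.\<close>

lemma cl_Un:
  assumes "I \<subseteq> mingens prec" "K \<subseteq> mingens prec" "support I \<inter> support K = {}"
  shows "cl (I \<union> K) = cl I + cl K"
proof -
  note s = support_eq[OF finite_edges[OF assms(1)]] support_eq[OF finite_edges[OF assms(2)]]
  note pI = comps_props[OF assms(1)] and pK = comps_props[OF assms(2)]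
  have sub: "C \<in> comps I \<Longrightarrow> m \<in> C \<Longrightarrow> m \<in> I" "C \<in> comps K \<Longrightarrow> m \<in> C \<Longrightarrow> m \<in> K" for C m
    using pI(2) pK(2) by auto
  have d: "m \<in> I \<Longrightarrow> m' \<in> K \<Longrightarrow> ks m \<inter> ks m' = {}" for m m' using assms(3) s by blast
  have "comps (I \<union> K) = comps I \<union> comps K"
  proof (rule comps_char)
    fix C C' m m' assume h: "C \<in> comps I \<union> comps K" "C' \<in> comps I \<union> comps K"
      "m \<in> C" "m' \<in> C'" "ks m \<inter> ks m' \<noteq> {}"
    then show "C = C'" using pI(3)[of C C' m m'] pK(3)[of C C' m m'] sub d by blast
  next
    fix C m m' assume h: "C \<in> comps I \<union> comps K" "m \<in> C" "m' \<in> C"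
    then have "(m, m') \<in> (adj I)\<^sup>+ \<or> (m, m') \<in> (adj K)\<^sup>+"
      using pI(4)[of C m m'] pK(4)[of C m m'] by auto
    then show "(m, m') \<in> (adj (I \<union> K))\<^sup>+"
      by (elim disjE) (erule adj_trancl_mono, simp)+
  next
    show "C \<noteq> {}" if "C \<in> comps I \<union> comps K" for C using that pI(1) pK(1) by blast
    show "I \<union> K \<subseteq> mingens prec" using assms by blast
    show "\<Union>(comps I \<union> comps K) = I \<union> K" using pI(2) pK(2) by blast
  qed
  moreover have "comps I \<inter> comps K = {}"
  proof -
    have False if C: "C \<in> comps I" "C \<in> comps K" for C
    proof -
      obtain m where m: "m \<in> C" using pI(1)[OF C(1)] by blast
      then have "ks m = {}" using sub[OF _ m] C d[of m m] by auto
      moreover have "card (ks m) = 2" using sub(1)[OF C(1) m] assms(1) mingens_card by blast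
      ultimately show False by simp
    qed
    then show ?thesis by blast
  qed
  ultimately show ?thesis using pI(5) pK(5) by (simp add: cl_comps card_Un_disjoint)
qed

text \<open>One class against all the others, since distinct classes share no vertex. This is how
  disconnected sets enter the induction on supports.\<close>

lemma cl_split:
  assumes I: "I \<subseteq> mingens prec" and "cl I \<noteq> 1" "I \<noteq> {}"
  obtains A K where "I = A \<union> K" "A \<noteq> {}" "K \<noteq> {}" "A \<inter> K = {}" "support A \<inter> support K = {}"
proof -
  note p = comps_props[OF I]
  obtain m where "m \<in> I" using assms by blast
  then obtain C where C: "C \<in> comps I" "m \<in> C" using p(2) by blast
  have "C \<noteq> I"
  proof
    assume CI: "C = I"
    have "D = C" if D: "D \<in> comps I" for D
    proof -
      obtain m' where m': "m' \<in> D" using p(1)[OF D] by blast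
      then have "m' \<in> C" using p(2) D CI by blast
      moreover have "ks m' \<noteq> {}" using \<open>m' \<in> C\<close> CI I mingens_keys by blast
      ultimately show ?thesis using p(3)[OF D C(1) m', of m'] by auto
    qed
    then have "comps I = {C}" using C by blast
    then show False using assms(2) by (simp add: cl_comps)
  qed
  have sub: "C \<subseteq> I" using p(2) C by blast
  have "support C \<inter> support (I - C) = {}"
  proof -
    have "ks m1 \<inter> ks m2 = {}" if "m1 \<in> C" "m2 \<in> I - C" for m1 m2
    proof -
      have "m2 \<in> \<Union>(comps I)" using that p(2) by simp
      then obtain D where D: "D \<in> comps I" "m2 \<in> D" by (elim UnionE)
      have "C \<noteq> D" using D(2) that by auto
      then show ?thesis using p(3)[OF C(1) D(1) that(1) D(2)] by auto
    qed
    moreover have "finite C" "finite (I - C)" using finite_edges[OF I] sub finite_subset by blast+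
    ultimately show ?thesis using support_eq[of C] support_eq[of "I - C"] by blast
  qed
  then show ?thesis using that[of C "I - C"] sub C \<open>C \<noteq> I\<close> by blast
qed

lemma card_support_insert:
  assumes "I \<subseteq> mingens prec" "e \<in> mingens (prec :: 'n::{finite,linorder} \<Rightarrow> 'n \<Rightarrow> bool)"
  shows "card (support (insert e I)) + card (ks e \<inter> support I) = card (support I) + 2"
proof -
  have "support (insert e I) = support I \<union> ks e" using finite_edges[OF assms(1)] by (auto simp: support_eq)
  then show ?thesis using card_Un_Int[of "support I" "ks e"] mingens_card[OF assms(2)]
    by (simp add: Int_commute)
qed

section \<open>Adding one edge, and the cyclomatic number\<close>

definition touched :: "'n::finite monom \<Rightarrow> 'n monom set \<Rightarrow> 'n monom set set" where
  "touched e I = {C \<in> comps I. \<exists>m\<in>C. ks m \<inter> ks e \<noteq> {}}"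

text \<open>The new edge fuses the classes it touches into a single one and leaves the others alone;
  if it touches none, it forms a class of its own.\<close>

lemma cl_insert:
  assumes I: "I \<subseteq> mingens prec" and e: "e \<in> mingens (prec :: 'n::{finite,linorder} \<Rightarrow> 'n \<Rightarrow> bool)" "e \<notin> I"
  shows "cl (insert e I) + card (touched e I) = cl I + 1"
proof -
  note p = comps_props[OF I]
  \<comment> \<open>The class of e in the enlarged set.\<close>
  let ?D = "insert e (\<Union>(touched e I))"
  have touch: "\<exists>m. m \<in> C \<and> (e, m) \<in> adj (insert e I) \<and> (m, e) \<in> adj (insert e I)" if "C \<in> touched e I" for C
    using that p(2) by (auto simp: touched_def adj_def)
  have reach: "(e, m) \<in> (adj (insert e I))\<^sup>+" if m: "m \<in> ?D" for m
  proof (cases "m = e")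
    case True
    then show ?thesis using mingens_keys[OF e(1)] by (auto simp: adj_def)
  next
    case False
    then obtain C where C: "C \<in> touched e I" "m \<in> C" using m by auto
    then obtain m' where m': "m' \<in> C" "(e, m') \<in> adj (insert e I)" using touch by blast
    have "(m', m) \<in> (adj I)\<^sup>+" using p(4)[of C m' m] C m' by (auto simp: touched_def)
    then show ?thesis using m' adj_trancl_mono[of m' m I "insert e I"] by (meson subset_insertI trancl_into_trancl2)
  qed
  have "comps (insert e I) = insert ?D (comps I - touched e I)"
  proof (rule comps_char)
    have "touched e I \<subseteq> comps I" by (auto simp: touched_def)
    then have "\<Union>(touched e I) \<union> \<Union>(comps I - touched e I) = I" using p(2) by blast
    then show "\<Union>(insert ?D (comps I - touched e I)) = insert e I" by auto
    show "insert e I \<subseteq> mingens prec" using I e by auto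
    show "C \<noteq> {}" if "C \<in> insert ?D (comps I - touched e I)" for C using that p(1) by auto
  next
    fix C m m' assume h: "C \<in> insert ?D (comps I - touched e I)" "m \<in> C" "m' \<in> C"
    show "(m, m') \<in> (adj (insert e I))\<^sup>+"
    proof (cases "C = ?D")
      case True
      then have "(m, e) \<in> (adj (insert e I))\<^sup>+" "(e, m') \<in> (adj (insert e I))\<^sup>+"
        using reach h adj_sym[of "insert e I"] by (auto dest: symD)
      then show ?thesis by (rule trancl_trans)
    next
      case False
      then have "(m, m') \<in> (adj I)\<^sup>+" using h p(4)[of C m m'] by auto
      then show ?thesis by (rule adj_trancl_mono) auto
    qed
  next
    have key: "m' \<in> ?D" if k: "m \<in> ?D" "C' \<in> comps I" "m' \<in> C'" "ks m \<inter> ks m' \<noteq> {}" for m m' C'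
    proof (cases "m = e")
      case True
      then have "C' \<in> touched e I" using k by (auto simp: touched_def)
      then show ?thesis using k by auto
    next
      case False
      then obtain C where C: "C \<in> touched e I" "m \<in> C" using k by auto
      then have "C = C'" using p(3)[of C C' m m'] k by (auto simp: touched_def)
      then show ?thesis using C k by auto
    qed
    have key2: "C' \<in> touched e I" if k: "C' \<in> comps I" "m' \<in> C'" "m' \<in> ?D" for C' m'
    proof -
      have m'I: "m' \<in> I" using k(1,2) p(2) by auto
      then have "m' \<noteq> e" using e(2) by auto
      then obtain C where C: "C \<in> touched e I" "m' \<in> C" using k by auto
      have "ks m' \<noteq> {}" using m'I I mingens_keys by auto
      then have "C = C'" using p(3)[of C C' m' m'] k C by (auto simp: touched_def)
      then show ?thesis using C by simp
    qed
    fix C C' m m'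
    assume h: "C \<in> insert ?D (comps I - touched e I)" "C' \<in> insert ?D (comps I - touched e I)"
      "m \<in> C" "m' \<in> C'" "ks m \<inter> ks m' \<noteq> {}"
    have h': "ks m' \<inter> ks m \<noteq> {}" using h by auto
    consider "C = ?D" "C' = ?D" | "C = ?D" "C' \<in> comps I" "C' \<notin> touched e I"
      | "C' = ?D" "C \<in> comps I" "C \<notin> touched e I" | "C \<in> comps I" "C' \<in> comps I"
      using h(1,2) by auto
    then show "C = C'"
    proof cases
      case 2
      have "m' \<in> ?D" using key[of m C' m'] 2 h by simp
      then have "C' \<in> touched e I" using key2[of C' m'] 2 h by simp
      then show ?thesis using 2 by simp
    next
      case 3
      have "m \<in> ?D" using key[of m' C m] 3 h h' by simp
      then have "C \<in> touched e I" using key2[of C m] 3 h by simp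
      then show ?thesis using 3 by simp
    next
      case 4
      then show ?thesis using p(3)[of C C' m m'] h by simp
    qed simp
  qed
  moreover have "?D \<notin> comps I" using p(2) e(2) by auto
  moreover have t: "touched e I \<subseteq> comps I" by (auto simp: touched_def)
  moreover have "card (comps I - touched e I) = card (comps I) - card (touched e I)"
    using t p(5) by (intro card_Diff_subset) (auto intro: finite_subset)
  moreover have "card (touched e I) \<le> card (comps I)" using t p(5) by (intro card_mono)
  ultimately show ?thesis using p(5) by (simp add: cl_comps)
qed

text \<open>The function f sends a vertex to its class. Since a vertex lies in only one class, the
  touched classes are the images of those ends of e that are already covered; whether f is injective
  on them decides whether e closes a cycle.\<close>

lemma touched_eq_image:
  assumes I: "I \<subseteq> mingens prec"
  obtains f where "\<And>v. v \<in> support I \<Longrightarrow> f v \<in> comps I \<and> v \<in> \<Union>(ks ` f v)"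
    "touched e I = f ` (ks e \<inter> support I)"
proof -
  note p = comps_props[OF I]
  note s = support_eq[OF finite_edges[OF I]]
  have "\<exists>C. C \<in> comps I \<and> v \<in> \<Union>(ks ` C)" if v: "v \<in> support I" for v
  proof -
    obtain m where "m \<in> I" "v \<in> ks m" using v s by auto
    then show ?thesis using p(2) by blast
  qed
  then obtain f where f: "\<And>v. v \<in> support I \<Longrightarrow> f v \<in> comps I \<and> v \<in> \<Union>(ks ` f v)" by metis
  have "touched e I = f ` (ks e \<inter> support I)"
  proof (intro set_eqI iffI)
    fix C assume "C \<in> touched e I"
    then obtain m v where C: "C \<in> comps I" "m \<in> C" "v \<in> ks m" "v \<in> ks e" by (auto simp: touched_def)
    then have v: "v \<in> support I" using s p(2) by blast
    then have "C = f v" using f[OF v] p(3)[of C "f v" m] C by blast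
    then show "C \<in> f ` (ks e \<inter> support I)" using C v by auto
  next
    fix C assume "C \<in> f ` (ks e \<inter> support I)"
    then obtain v where v: "v \<in> ks e" "v \<in> support I" "C = f v" by auto
    then show "C \<in> touched e I" using f[OF v(2)] by (auto simp: touched_def)
  qed
  then show ?thesis using that f by blast
qed

lemma card_touched:
  assumes I: "I \<subseteq> mingens prec"
  shows "card (touched e I) \<le> card (ks e \<inter> support I)"
  by (rule touched_eq_image[OF I, of e]) (metis card_image_le finite_Int finite_keys)

text \<open>cl(I) + |I| - |supp(I)| is the cyclomatic number of the graph with edge set I; its
  vanishing says that the graph is a forest.\<close>

definition excess0 :: "'n::finite monom set \<Rightarrow> bool" where
  "excess0 I \<longleftrightarrow> cl I + card I = card (support I)"

text \<open>Cyclomatic numbers are nonnegative: an edge with r covered ends brings 2 - r new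
  vertices and touches at most r classes.\<close>

lemma card_support_le:
  assumes I: "I \<subseteq> mingens (prec :: 'n::{finite,linorder} \<Rightarrow> 'n \<Rightarrow> bool)"
  shows "card (support I) \<le> cl I + card I"
  using finite_edges[OF I] I
proof (induction I rule: finite_induct)
  case (insert e I)
  then show ?case using card_support_insert[of I prec e] cl_insert[of I prec e] card_touched[of I prec e] by simp
qed simp

text \<open>By \<open>sep\<close> the covered ends of e lie in different classes, so e touches as
  many classes as it has covered ends and closes no cycle.\<close>

lemma excess0_insert:
  assumes I: "I \<subseteq> mingens prec" "excess0 I"
    and e: "e \<in> mingens (prec :: 'n::{finite,linorder} \<Rightarrow> 'n \<Rightarrow> bool)" "e \<notin> I"
    and sep: "\<And>C. C \<in> comps I \<Longrightarrow> \<not> ks e \<subseteq> \<Union>(ks ` C)"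
  shows "excess0 (insert e I)"
proof -
  obtain f where f: "\<And>v. v \<in> support I \<Longrightarrow> f v \<in> comps I \<and> v \<in> \<Union>(ks ` f v)"
    "touched e I = f ` (ks e \<inter> support I)" by (rule touched_eq_image[OF I(1), of e]) blast
  have "inj_on f (ks e \<inter> support I)"
  proof (rule inj_onI)
    fix u v assume h: "u \<in> ks e \<inter> support I" "v \<in> ks e \<inter> support I" "f u = f v"
    show "u = v"
    proof (rule ccontr)
      assume "u \<noteq> v"
      moreover obtain i j where "ks e = {i, j}" using e(1) by (auto elim!: mingensE)
      ultimately have "ks e = {u, v}" using h by auto
      then show False using sep[of "f u"] f(1)[of u] f(1)[of v] h by auto
    qed
  qed
  then have "card (touched e I) = card (ks e \<inter> support I)" using f(2) by (simp add: card_image)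
  then show ?thesis
    using card_support_insert[OF I(1) e(1)] cl_insert[OF I(1) e] I(2) e(2) finite_edges[OF I(1)]
    by (simp add: excess0_def)
qed

lemma excess0_Un:
  assumes "I \<subseteq> mingens prec" "K \<subseteq> mingens (prec :: 'n::{finite,linorder} \<Rightarrow> 'n \<Rightarrow> bool)" "support I \<inter> support K = {}"
    "excess0 I" "excess0 K"
  shows "excess0 (I \<union> K)"
proof -
  have fin: "finite I" "finite K" using assms finite_edges by blast+
  have "I \<inter> K = {}"
  proof -
    have False if "m \<in> I" "m \<in> K" for m
    proof -
      have "ks m \<subseteq> support I \<inter> support K" using that fin by (auto simp: support_eq)
      moreover have "ks m \<noteq> {}" using that assms(1) mingens_keys by blast
      ultimately show False using assms(3) by auto
    qed
    then show ?thesis by blast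
  qed
  then show ?thesis using assms cl_Un[OF assms(1-3)] fin
    by (simp add: excess0_def support_Un card_Un_disjoint)
qed

section \<open>Morse complexes over a commutative ring\<close>

definition lev :: "('c, 'r) based_complex \<Rightarrow> nat \<Rightarrow> 'c set" where
  "lev X n = {c \<in> cells X. cdim X c = n}"

definition complex_ok :: "('c, 'r::comm_ring_1) based_complex \<Rightarrow> bool" where
  "complex_ok X \<longleftrightarrow> finite (cells X) \<and>
     (\<forall>n. \<forall>a\<in>lev X (Suc (Suc n)). \<forall>c\<in>lev X n. (\<Sum>b\<in>lev X (Suc n). bd X a b * bd X b c) = 0)"

definition bnd :: "('c, 'r::comm_ring_1) based_complex \<Rightarrow> nat \<Rightarrow> ('c \<Rightarrow> 'r) \<Rightarrow> 'c \<Rightarrow> 'r" where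
  "bnd X n z b = (\<Sum>a\<in>lev X n. z a * bd X a b)"

text \<open>For n = 0 the cycle condition is empty, so every chain of dimension 0 counts as a cycle:
  the complex is not augmented.\<close>

definition exact_at :: "('c, 'r::comm_ring_1) based_complex \<Rightarrow> nat \<Rightarrow> bool" where
  "exact_at X n \<longleftrightarrow> (\<forall>z. (\<forall>c\<in>cells X. Suc (cdim X c) = n \<longrightarrow> bnd X n z c = 0) \<longrightarrow>
     (\<exists>y. \<forall>a\<in>lev X n. z a = bnd X (Suc n) y a))"

lemma bnd_cong: "(\<And>a. a \<in> lev X n \<Longrightarrow> z a = z' a) \<Longrightarrow> bnd X n z b = bnd X n z' b"
  by (simp add: bnd_def)

lemma bnd_diff: "bnd X n (\<lambda>a. z a - z' a) b = bnd X n z b - bnd X n z' b"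
  by (simp add: bnd_def sum_subtractf algebra_simps)

lemma bnd_bnd:
  assumes "complex_ok X" "c \<in> lev X n"
  shows "bnd X (Suc n) (bnd X (Suc (Suc n)) z) c = 0"
proof -
  have "bnd X (Suc n) (bnd X (Suc (Suc n)) z) c =
      (\<Sum>b\<in>lev X (Suc n). \<Sum>a\<in>lev X (Suc (Suc n)). z a * (bd X a b * bd X b c))"
    by (simp add: bnd_def sum_distrib_right mult.assoc)
  also have "\<dots> = (\<Sum>a\<in>lev X (Suc (Suc n)). z a * (\<Sum>b\<in>lev X (Suc n). bd X a b * bd X b c))"
    by (subst sum.swap) (simp add: sum_distrib_left)
  also have "\<dots> = 0" using assms by (intro sum.neutral) (auto simp: complex_ok_def)
  finally show ?thesis .
qed

lemma unit_inverse_right: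
  fixes u :: "'r::comm_ring_1"
  assumes "u dvd 1"
  shows "u * unit_inverse u = 1"
proof -
  obtain v where v: "u * v = 1" using assms by (auto elim!: dvdE)
  show ?thesis unfolding unit_inverse_def
  proof (rule theI[of _ v])
    fix w assume w: "u * w = 1"
    have "w = (u * v) * w" using v by simp
    also have "\<dots> = v * (u * w)" by (simp add: algebra_simps)
    finally show "w = v" using w by simp
  qed (fact v)
qed

section \<open>Weighted path sums along an acyclic matching\<close>

locale matched_complex =
  fixes X :: "('c, 'r::comm_ring_1) based_complex" and M :: "('c \<times> 'c) set"
  assumes ok: "complex_ok X" and acyc: "acyclic_matching X M"
begin

abbreviation "R \<equiv> reversed_graph X M"
abbreviation "wt \<equiv> step_weight X M"

lemma finite_cells: "finite (cells X)" using ok by (simp add: complex_ok_def)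
lemma finite_lev [simp]: "finite (lev X n)" using finite_cells by (simp add: lev_def)

lemma M_edges: "M \<subseteq> cedges X" using acyc by (simp add: acyclic_matching_def)

lemma M_dest: "(u, l) \<in> M \<Longrightarrow> u \<in> cells X \<and> l \<in> cells X \<and> cdim X u = Suc (cdim X l)"
  using M_edges by (auto simp: cedges_def)

lemma M_disj: "e \<in> M \<Longrightarrow> e' \<in> M \<Longrightarrow> e \<noteq> e' \<Longrightarrow> {fst e, snd e} \<inter> {fst e', snd e'} = {}"
  using acyc unfolding acyclic_matching_def by blast

lemma M_inj: "(u, l) \<in> M \<Longrightarrow> (u', l) \<in> M \<Longrightarrow> u = u'" "(u, l) \<in> M \<Longrightarrow> (u, l') \<in> M \<Longrightarrow> l = l'"
  using M_disj by fastforce+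

lemma Domain_Range: "c \<in> Domain M \<Longrightarrow> c \<in> Range M \<Longrightarrow> False"
  using M_disj M_dest by fastforce

lemma M_unit: "(u, l) \<in> M \<Longrightarrow> bd X u l * unit_inverse (bd X u l) = 1"
  using acyc by (intro unit_inverse_right) (auto simp: acyclic_matching_def)

lemma acyclic_R: "(x, x) \<notin> R\<^sup>+"
  using acyc by (simp add: acyclic_matching_def acyclic_def)

lemma R_cells: "R \<subseteq> cells X \<times> cells X"
  using M_dest by (auto simp: reversed_graph_def cedges_def)

lemma R_cases:
  assumes "(a, b) \<in> R"
  obtains "(a, b) \<in> cedges X" "(a, b) \<notin> M" "cdim X a = Suc (cdim X b)" "(b, a) \<notin> M"
  | "(b, a) \<in> M" "cdim X b = Suc (cdim X a)"
proof -
  have "cdim X b = Suc (cdim X a)" if "(b, a) \<in> M" using M_dest that by auto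
  then show ?thesis using assms that unfolding reversed_graph_def cedges_def by fastforce
qed

lemma successively_rtrancl:
  "successively (\<lambda>a b. (a, b) \<in> R) p \<Longrightarrow> y \<in> set p \<Longrightarrow> (y, last p) \<in> R\<^sup>*"
proof (induction p arbitrary: y rule: induct_list012)
  case (3 a b p)
  have b: "(b, last (b # p)) \<in> R\<^sup>*" using 3(2)[of b] 3(3) by simp
  show ?case
  proof (cases "y = a")
    case True
    then show ?thesis using b 3(3) by (auto intro: converse_rtrancl_into_rtrancl)
  next
    case False
    then show ?thesis using 3(2)[of y] 3(3,4) by simp
  qed
qed auto

lemma finite_paths: "finite (graph_paths X M c x)"
proof -
  have "graph_paths X M c x \<subseteq> {p. set p \<subseteq> insert c (cells X) \<and> distinct p}"
  proof
    fix p assume p: "p \<in> graph_paths X M c x"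
    have "set p \<subseteq> insert (hd p) (cells X)" if "successively (\<lambda>a b. (a, b) \<in> R) p"
      using that
    proof (induction p rule: induct_list012)
      case (3 a b p)
      then show ?case using R_cells by auto
    qed auto
    then show "p \<in> {p. set p \<subseteq> insert c (cells X) \<and> distinct p}"
      using p by (auto simp: graph_paths_def)
  qed
  then show ?thesis using finite_subset_distinct[of "insert c (cells X)"] finite_cells finite_subset by blast
qed

definition pw :: "'c list \<Rightarrow> 'r" where
  "pw p = (\<Prod>i<length p - 1. wt (p ! i) (p ! Suc i))"

text \<open>For fixed critical c, viewed as a chain in x, this is c completed by its gradient
  flow.\<close>

definition P :: "'c \<Rightarrow> 'c \<Rightarrow> 'r" where
  "P c x = (\<Sum>p\<in>graph_paths X M c x. pw p)"

lemma pw_snoc: "q \<noteq> [] \<Longrightarrow> pw (q @ [x]) = pw q * wt (last q) x"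
proof -
  assume q: "q \<noteq> []"
  then obtain n where n: "length q = Suc n" by (cases q) auto
  have "pw (q @ [x]) = (\<Prod>i<Suc n. wt ((q @ [x]) ! i) ((q @ [x]) ! Suc i))"
    by (simp add: pw_def n)
  also have "\<dots> = (\<Prod>i<n. wt (q ! i) (q ! Suc i)) * wt (q ! n) x"
    using n by (simp add: nth_append)
  also have "\<dots> = pw q * wt (last q) x" using n q by (simp add: pw_def last_conv_nth)
  finally show ?thesis .
qed

text \<open>Splits off the last step. The extended path is again distinct by acyclicity: a repeated
  end point would close a directed cycle.\<close>

lemma graph_paths_rec:
  "graph_paths X M c x = (if c = x then {[c]} else {}) \<union>
     (\<Union>y\<in>{y \<in> cells X. (y, x) \<in> R}. (\<lambda>q. q @ [x]) ` graph_paths X M c y)" (is "?l = ?a \<union> ?b")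
proof (intro set_eqI iffI)
  fix p assume p: "p \<in> ?l"
  then have "p \<noteq> []" "last p = x" by (auto simp: graph_paths_def)
  then obtain q where q: "p = q @ [x]" by (metis append_butlast_last_id)
  show "p \<in> ?a \<union> ?b"
  proof (cases "q = []")
    case True
    then show ?thesis using p q by (auto simp: graph_paths_def)
  next
    case False
    then have "q \<in> graph_paths X M c (last q)" "(last q, x) \<in> R"
      using p q by (auto simp: graph_paths_def successively_append_iff)
    then show ?thesis using q R_cells by blast
  qed
next
  fix p assume p: "p \<in> ?a \<union> ?b"
  show "p \<in> ?l"
  proof (cases "p \<in> ?b")
    case False
    then show ?thesis using p by (auto simp: graph_paths_def split: if_splits)
  next
    case True
    then obtain y q where y: "(y, x) \<in> R" "q \<in> graph_paths X M c y" "p = q @ [x]" by auto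
    then have q: "successively (\<lambda>a b. (a, b) \<in> R) q" "q \<noteq> []" "last q = y"
      by (auto simp: graph_paths_def)
    have "x \<notin> set q"
    proof
      assume "x \<in> set q"
      then have "(x, y) \<in> R\<^sup>*" using successively_rtrancl[OF q(1)] q by auto
      then show False using y acyclic_R by (meson rtrancl_into_trancl1)
    qed
    then show ?thesis using y q by (auto simp: graph_paths_def successively_append_iff)
  qed
qed

lemma P_rec: "P c x = (if c = x then 1 else 0) + (\<Sum>y\<in>{y \<in> cells X. (y, x) \<in> R}. P c y * wt y x)"
proof -
  let ?B = "\<Union>y\<in>{y \<in> cells X. (y, x) \<in> R}. (\<lambda>q. q @ [x]) ` graph_paths X M c y"
  have ne: "q \<noteq> []" if "q \<in> graph_paths X M c y" for q y using that by (auto simp: graph_paths_def)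
  have "P c x = sum pw (if c = x then {[c]} else {}) + sum pw ?B"
    unfolding P_def by (subst graph_paths_rec, rule sum.union_disjoint)
      (use ne in \<open>force simp: finite_paths finite_cells\<close>)+
  also have "sum pw (if c = x then {[c]} else {}) = (if c = x then 1 else 0)"
    by (simp add: pw_def)
  also have "sum pw ?B = (\<Sum>y\<in>{y \<in> cells X. (y, x) \<in> R}. sum pw ((\<lambda>q. q @ [x]) ` graph_paths X M c y))"
    by (rule sum.UNION_disjoint)
      (use finite_paths finite_cells in auto, auto simp: graph_paths_def)
  also have "\<dots> = (\<Sum>y\<in>{y \<in> cells X. (y, x) \<in> R}. P c y * wt y x)"
  proof (rule sum.cong[OF refl])
    fix y
    have "sum pw ((\<lambda>q. q @ [x]) ` graph_paths X M c y) = (\<Sum>q\<in>graph_paths X M c y. pw (q @ [x]))"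
      by (subst sum.reindex) (auto simp: inj_on_def)
    also have "\<dots> = (\<Sum>q\<in>graph_paths X M c y. pw q * wt y x)"
    proof (rule sum.cong[OF refl])
      fix q assume q: "q \<in> graph_paths X M c y"
      then show "pw (q @ [x]) = pw q * wt y x"
        using pw_snoc[OF ne[OF q]] by (auto simp: graph_paths_def)
    qed
    finally show "sum pw ((\<lambda>q. q @ [x]) ` graph_paths X M c y) = P c y * wt y x"
      by (simp add: P_def sum_distrib_right)
  qed
  finally show ?thesis .
qed

lemma P_nonzero: "P c x \<noteq> 0 \<Longrightarrow> (c, x) \<in> R\<^sup>*"
proof -
  assume "P c x \<noteq> 0"
  then obtain p where "p \<in> graph_paths X M c x" by (metis P_def all_not_in_conv sum.empty)
  then show ?thesis using successively_rtrancl[of p c] by (auto simp: graph_paths_def)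
qed

lemma P_self: "P c c = 1"
proof -
  have "P c y * wt y c = 0" if "(y, c) \<in> R" for y
    using P_nonzero[of c y] that acyclic_R by (metis mult_zero_left rtrancl_into_trancl1)
  then have "(\<Sum>y\<in>{y \<in> cells X. (y, c) \<in> R}. P c y * wt y c) = 0" by (intro sum.neutral) auto
  then show ?thesis using P_rec[of c c] by simp
qed

text \<open>The highest dimension that paths from c can reach: only a lower end of a matched edge
  can begin with an upward step.\<close>

definition top :: "'c \<Rightarrow> nat" where
  "top c = (if c \<in> Range M then Suc (cdim X c) else cdim X c)"

text \<open>An upward step ends in the upper end of a matched edge, which is never a lower end, so
  upward steps do not follow each other. A cell on the top level other than c is entered by an
  upward step and hence is an upper end.\<close>

lemma path_inv:
  assumes "(c, x) \<in> R\<^sup>*" "c \<notin> Domain M"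
  shows "cdim X x \<le> top c \<and> (cdim X x = top c \<longrightarrow> x = c \<or> x \<in> Domain M)"
  using assms
proof (induction rule: rtrancl_induct)
  case base
  then show ?case by (auto simp: top_def)
next
  case (step a b)
  from step(2) show ?case
  proof (cases rule: R_cases)
    case 1
    then show ?thesis using step by auto
  next
    case 2
    then have "a \<in> Range M" "b \<in> Domain M" by auto
    moreover have "cdim X a \<noteq> top c"
    proof
      assume "cdim X a = top c"
      then have "a = c" using step Domain_Range[of a] \<open>a \<in> Range M\<close> by auto
      then show False using \<open>cdim X a = top c\<close> \<open>a \<in> Range M\<close> by (auto simp: top_def)
    qed
    ultimately show ?thesis using step 2 by auto
  qed
qed

lemma P_zero:
  assumes "c \<notin> Domain M" "cdim X x > top c \<or> cdim X x = top c \<and> x \<noteq> c \<and> x \<notin> Domain M"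
  shows "P c x = 0"
  using path_inv[of c x] P_nonzero[of c x] assms by fastforce

lemma bd_nonedge: "c \<in> cells X \<Longrightarrow> c' \<in> cells X \<Longrightarrow> cdim X c = Suc (cdim X c') \<Longrightarrow> (c, c') \<notin> cedges X \<Longrightarrow> bd X c c' = 0"
  by (auto simp: cedges_def)

text \<open>Into a cell that is not the upper end of a matched edge, paths only descend.\<close>

lemma P_rec_down:
  assumes "x \<in> cells X" "x \<notin> Domain M"
  shows "P c x = (if c = x then 1 else 0) +
    (\<Sum>y\<in>{y \<in> lev X (Suc (cdim X x)). (y, x) \<notin> M}. P c y * bd X y x)"
proof -
  have "(\<Sum>y\<in>{y \<in> cells X. (y, x) \<in> R}. P c y * wt y x) =
     (\<Sum>y\<in>{y \<in> lev X (Suc (cdim X x)). (y, x) \<notin> M}. P c y * bd X y x)"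
  proof (rule sum.mono_neutral_cong_left)
    show "finite {y \<in> lev X (Suc (cdim X x)). (y, x) \<notin> M}" by simp
    show "{y \<in> cells X. (y, x) \<in> R} \<subseteq> {y \<in> lev X (Suc (cdim X x)). (y, x) \<notin> M}"
      using assms by (auto simp: lev_def elim!: R_cases)
    show "\<forall>i\<in>{y \<in> lev X (Suc (cdim X x)). (y, x) \<notin> M} - {y \<in> cells X. (y, x) \<in> R}. P c i * bd X i x = 0"
    proof
      fix y assume y: "y \<in> {y \<in> lev X (Suc (cdim X x)). (y, x) \<notin> M} - {y \<in> cells X. (y, x) \<in> R}"
      then have "(y, x) \<notin> cedges X" by (auto simp: reversed_graph_def lev_def)
      then have "bd X y x = 0" using y assms by (intro bd_nonedge) (auto simp: lev_def)
      then show "P c y * bd X y x = 0" by simp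
    qed
    fix y assume "y \<in> {y \<in> cells X. (y, x) \<in> R}"
    then show "P c y * wt y x = P c y * bd X y x"
      using assms by (auto simp: step_weight_def)
  qed
  then show ?thesis using P_rec[of c x] by simp
qed

text \<open>Every other edge into u starts one dimension higher, above the top level, where path
  sums vanish; only the reversed edge from l is left.\<close>

lemma P_upper:
  assumes "c \<notin> Domain M" "(u, l) \<in> M" "cdim X u = top c"
  shows "P c u = - P c l * unit_inverse (bd X u l)"
proof -
  have "(\<Sum>y\<in>{y \<in> cells X. (y, u) \<in> R}. P c y * wt y u) = (\<Sum>y\<in>{l}. P c y * wt y u)"
  proof (rule sum.mono_neutral_right)
    show "{l} \<subseteq> {y \<in> cells X. (y, u) \<in> R}" using M_dest assms by (auto simp: reversed_graph_def)
    show "\<forall>i\<in>{y \<in> cells X. (y, u) \<in> R} - {l}. P c i * wt i u = 0"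
    proof
      fix y assume y: "y \<in> {y \<in> cells X. (y, u) \<in> R} - {l}"
      then have "(y, u) \<in> R" "(u, y) \<notin> M" using M_inj(2)[OF assms(2), of y] by auto
      then have "cdim X y > top c" using assms(3) by (auto elim!: R_cases)
      then show "P c y * wt y u = 0" using P_zero[OF assms(1), of y] by simp
    qed
  qed (use finite_cells in auto)
  moreover have "c \<noteq> u" using assms by auto
  ultimately show ?thesis using P_rec[of c u] assms by (simp add: step_weight_def)
qed

text \<open>The partner u of l carries minus the path sum of l divided by the matched coefficient,
  so its contribution cancels those of all other cofaces of l. Only the trivial path remains, when l
  = c.\<close>

lemma bnd_P_lower:
  assumes "c \<notin> Domain M" "l \<in> Range M" "Suc (cdim X l) = top c"
  shows "bnd X (top c) (P c) l = - (if c = l then 1 else 0)"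
proof -
  obtain u where u: "(u, l) \<in> M" using assms by auto
  have d: "u \<in> lev X (top c)" "l \<in> cells X" using M_dest[OF u] assms by (auto simp: lev_def)
  have l: "l \<notin> Domain M" using assms Domain_Range by auto
  have s: "{y \<in> lev X (top c). (y, l) \<notin> M} = lev X (top c) - {u}" using u M_inj(1) by auto
  have "bnd X (top c) (P c) l = P c u * bd X u l + (\<Sum>y\<in>lev X (top c) - {u}. P c y * bd X y l)"
    unfolding bnd_def using d by (simp add: sum.remove)
  also have "P c u * bd X u l = - P c l * (bd X u l * unit_inverse (bd X u l))"
    using P_upper[OF assms(1) u] d by (simp add: lev_def algebra_simps)
  also have "\<dots> = - P c l" using M_unit[OF u] by simp
  also have "P c l = (if c = l then 1 else 0) + (\<Sum>y\<in>lev X (top c) - {u}. P c y * bd X y l)"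
    using P_rec_down[OF d(2) l, of c] s assms(3) by simp
  finally show ?thesis by simp
qed

section \<open>The Morse complex on the critical cells\<close>

definition crit :: "nat \<Rightarrow> 'c set" where "crit n = lev X n - Field M"

lemma critD: "c \<in> crit n \<Longrightarrow> c \<in> cells X \<and> cdim X c = n \<and> c \<notin> Domain M \<and> c \<notin> Range M \<and> top c = n"
  by (auto simp: crit_def lev_def Field_def top_def)

lemma finite_crit [simp]: "finite (crit n)" by (simp add: crit_def)

lemma lev_cases:
  assumes "a \<in> lev X n"
  obtains "a \<in> crit n" | "a \<in> Domain M" "a \<notin> Range M" | "a \<in> Range M" "a \<notin> Domain M"
  using assms Domain_Range by (auto simp: crit_def Field_def)

abbreviation "Y \<equiv> morse_complex X M"

lemma lev_morse: "lev Y n = crit n"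
  by (auto simp: lev_def crit_def morse_complex_def)

text \<open>A critical cell is entered by ordinary edges only, so the path sum into it is a
  coefficient of the boundary of the flow chain.\<close>

lemma bd_morse:
  assumes "c \<in> crit (Suc n)" "c' \<in> crit n"
  shows "bd Y c c' = bnd X (Suc n) (P c) c'"
proof -
  have c: "cdim X c = Suc n" "cdim X c' = n" using assms critD by auto
  then have "c \<noteq> c'" by auto
  have "bd Y c c' = P c c'"
    using c by (simp add: morse_complex_def P_def pw_def)
  also have "\<dots> = (\<Sum>y\<in>{y \<in> lev X (Suc n). (y, c') \<notin> M}. P c y * bd X y c')"
    using P_rec_down[of c' c] critD[OF assms(2)] c \<open>c \<noteq> c'\<close> by simp
  also have "{y \<in> lev X (Suc n). (y, c') \<notin> M} = lev X (Suc n)" using critD[OF assms(2)] by auto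
  finally show ?thesis by (simp add: bnd_def)
qed

text \<open>Embeds the Morse complex into X by completing every critical cell with its gradient
  flow.\<close>

definition phi :: "nat \<Rightarrow> ('c \<Rightarrow> 'r) \<Rightarrow> 'c \<Rightarrow> 'r" where
  "phi n z x = (\<Sum>c\<in>crit n. z c * P c x)"

lemma bnd_phi: "bnd X n (phi n z) b = (\<Sum>c\<in>crit n. z c * bnd X n (P c) b)"
  unfolding bnd_def phi_def sum_distrib_right sum_distrib_left
  by (subst sum.swap) (simp add: algebra_simps)

lemma phi_crit: assumes "c \<in> crit n" shows "phi n z c = z c"
proof -
  have "phi n z c = (\<Sum>a\<in>crit n. if a = c then z a else 0)"
    unfolding phi_def
  proof (rule sum.cong[OF refl])
    fix a assume a: "a \<in> crit n"
    show "z a * P a c = (if a = c then z a else 0)"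
      using P_zero[of a c] P_self critD[OF a] critD[OF assms] by auto
  qed
  then show ?thesis using assms by simp
qed

lemma phi_lower: assumes "l \<in> lev X n" "l \<in> Range M" shows "phi n z l = 0"
  unfolding phi_def
proof (rule sum.neutral, rule ballI)
  fix a assume a: "a \<in> crit n"
  have "l \<noteq> a" "l \<notin> Domain M" using critD[OF a] assms Domain_Range by auto
  then show "z a * P a l = 0"
    using P_zero[of a l] critD[OF a] assms by (auto simp: lev_def)
qed

lemma bnd_phi_lower: assumes "l \<in> Range M" "Suc (cdim X l) = n" shows "bnd X n (phi n z) l = 0"
  unfolding bnd_phi
proof (rule sum.neutral, rule ballI)
  fix a assume a: "a \<in> crit n"
  have "l \<noteq> a" using critD[OF a] assms by auto
  then show "z a * bnd X n (P a) l = 0"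
    using bnd_P_lower[of a l] critD[OF a] assms by auto
qed

lemma bnd_phi_crit: assumes "c \<in> crit n" shows "bnd X (Suc n) (phi (Suc n) z) c = bnd Y (Suc n) z c"
  unfolding bnd_phi using assms by (simp add: bnd_def[of Y] lev_morse bd_morse)

text \<open>The matched coefficients are the diagonal of a triangular matrix: if u has no
  predecessor in the support of w, then no other cell of the support has the partner of u in its
  boundary. It follows that chains of the form \<open>phi\<close> are determined by their critical
  coefficients.\<close>

lemma upper_unique:
  assumes w: "\<And>x. x \<in> lev X n \<Longrightarrow> x \<notin> Domain M \<Longrightarrow> w x = 0"
    and b: "\<And>l. l \<in> Range M \<Longrightarrow> Suc (cdim X l) = n \<Longrightarrow> bnd X n w l = 0"
    and "x \<in> lev X n"
  shows "w x = 0"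
proof (rule ccontr)
  assume "w x \<noteq> 0"
  define S where "S = {x \<in> lev X n. w x \<noteq> 0}"
  have "x \<in> S" using \<open>w x \<noteq> 0\<close> assms by (simp add: S_def)
  have "finite R" using R_cells finite_cells by (meson finite_SigmaI finite_subset)
  then have "wf (R\<^sup>+)"
    using acyclic_R by (intro wf_trancl finite_acyclic_wf) (auto simp: acyclic_def)
  then obtain u where u: "u \<in> S" "\<And>u'. (u', u) \<in> R\<^sup>+ \<Longrightarrow> u' \<notin> S"
    using \<open>x \<in> S\<close> by (metis wfE_min)
  then obtain l where l: "(u, l) \<in> M" using w by (auto simp: S_def)
  then have ul: "Suc (cdim X l) = n" "l \<in> cells X" using M_dest[OF l] u by (auto simp: S_def lev_def)
  have "bnd X n w l = (\<Sum>y\<in>{u}. w y * bd X y l)"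
    unfolding bnd_def
  proof (rule sum.mono_neutral_right)
    show "\<forall>y\<in>lev X n - {u}. w y * bd X y l = 0"
    proof
      fix y assume y: "y \<in> lev X n - {u}"
      show "w y * bd X y l = 0"
      proof (rule ccontr)
        assume nz: "w y * bd X y l \<noteq> 0"
        then have "y \<in> S" using y by (auto simp: S_def)
        moreover have "(y, l) \<in> R"
        proof -
          have "bd X y l \<noteq> 0" using nz by auto
          then have "(y, l) \<in> cedges X" using y ul by (auto simp: cedges_def lev_def)
          moreover have "(y, l) \<notin> M" using y M_inj(1)[OF l, of y] by auto
          ultimately show ?thesis by (simp add: reversed_graph_def)
        qed
        moreover have "(l, u) \<in> R" using l by (simp add: reversed_graph_def)
        ultimately show False using u(2)[of y] by (meson trancl.simps)
      qed
    qed
  qed (use u in \<open>auto simp: S_def\<close>)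
  moreover have "bnd X n w l = 0" using b l ul by auto
  ultimately have "w u * (bd X u l * unit_inverse (bd X u l)) = 0"
    by (simp add: mult.assoc[symmetric])
  then show False using M_unit[OF l] u by (simp add: S_def)
qed

text \<open>The boundary of a flow chain is again of the form \<open>phi\<close>: the two agree off
  the upper ends and have zero boundary at lower ends, so \<open>upper_unique\<close> applies. The
  square of the Morse differential is thereby computed inside X.\<close>

lemma complex_ok_morse: "complex_ok Y"
  unfolding complex_ok_def
proof (intro conjI allI ballI)
  show "finite (cells Y)" using finite_cells by (simp add: morse_complex_def)
  fix n a c assume a: "a \<in> lev Y (Suc (Suc n))" and c: "c \<in> lev Y n"
  then have a': "a \<in> crit (Suc (Suc n))" and c': "c \<in> crit n" by (auto simp: lev_morse)
  define v where "v = bnd X (Suc (Suc n)) (P a)"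
  define w where "w = phi (Suc n) v"
  have vl: "v l = 0" if "l \<in> lev X (Suc n)" "l \<in> Range M" for l
    using bnd_P_lower[of a l] critD[OF a'] that by (auto simp: v_def lev_def)
  have eq: "v x = w x" if "x \<in> lev X (Suc n)" for x
  proof -
    have "v x - w x = 0"
    proof (rule upper_unique[where w = "\<lambda>x. v x - w x" and n = "Suc n"])
      fix x assume x: "x \<in> lev X (Suc n)" "x \<notin> Domain M"
      then show "v x - w x = 0"
        by (cases rule: lev_cases[OF x(1)]) (auto simp: w_def phi_crit phi_lower vl)
    next
      fix l assume l: "l \<in> Range M" "Suc (cdim X l) = Suc n"
      then have "l \<in> lev X n" using M_dest by (auto simp: lev_def)
      then have "bnd X (Suc n) v l = 0" unfolding v_def by (intro bnd_bnd[OF ok])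
      then show "bnd X (Suc n) (\<lambda>x. v x - w x) l = 0"
        using bnd_phi_lower[OF l] by (simp add: bnd_diff w_def)
    qed (use that in auto)
    then show ?thesis by simp
  qed
  have "c \<in> lev X n" using c' by (simp add: crit_def)
  then have "0 = bnd X (Suc n) v c" unfolding v_def by (simp add: bnd_bnd[OF ok])
  also have "\<dots> = bnd X (Suc n) w c" using eq by (rule bnd_cong)
  also have "\<dots> = bnd Y (Suc n) v c" unfolding w_def by (rule bnd_phi_crit[OF c'])
  also have "\<dots> = (\<Sum>b\<in>lev Y (Suc n). bd Y a b * bd Y b c)"
    unfolding bnd_def[of Y] using a' by (intro sum.cong refl) (simp add: v_def bd_morse lev_morse)
  finally show "(\<Sum>b\<in>lev Y (Suc n). bd Y a b * bd Y b c) = 0" by simp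
qed

text \<open>The image of a cycle under \<open>phi\<close> bounds some y in X. Since y need not be of
  the form \<open>phi\<close>, it is first changed by a boundary until its coefficients at lower
  ends vanish; then it is determined by its critical part.\<close>

lemma exact_at_morse:
  assumes ex: "exact_at X n"
  shows "exact_at Y n"
  unfolding exact_at_def
proof (intro allI impI)
  fix z assume z: "\<forall>c\<in>cells Y. Suc (cdim Y c) = n \<longrightarrow> bnd Y n z c = 0"
  define z' where "z' = phi n z"
  define w where "w = bnd X n z'"
  have wl: "w l = 0" if "l \<in> Range M" "Suc (cdim X l) = n" for l
    using bnd_phi_lower[OF that] by (simp add: w_def z'_def)
  \<comment> \<open>Critical coefficients vanish because z is a cycle, lower ones by the flow, and
    upper ones by \<open>upper_unique\<close>.\<close>
  have w0: "w c = 0" if c: "c \<in> cells X" "Suc (cdim X c) = n" for c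
  proof -
    obtain m where m: "n = Suc m" "cdim X c = m" using c by auto
    show ?thesis
    proof (rule upper_unique[where n = m])
      fix x assume x: "x \<in> lev X m" "x \<notin> Domain M"
      then show "w x = 0"
      proof (cases rule: lev_cases[OF x(1)])
        case 1
        then have "x \<in> cells Y" "cdim Y x = m" by (auto simp: crit_def lev_def morse_complex_def)
        then have "bnd Y n z x = 0" using z m by auto
        then show ?thesis using bnd_phi_crit[OF 1] by (simp add: w_def z'_def m)
      qed (use x wl m in \<open>auto simp: lev_def\<close>)
    next
      fix l assume l: "l \<in> Range M" "Suc (cdim X l) = m"
      then show "bnd X m w l = 0"
        using bnd_bnd[OF ok, of l "cdim X l" z'] M_dest by (auto simp: w_def m lev_def)
    qed (use c m in \<open>auto simp: lev_def\<close>)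
  qed
  then obtain y where y: "\<And>a. a \<in> lev X n \<Longrightarrow> z' a = bnd X (Suc n) y a"
    using ex unfolding exact_at_def w_def by blast
  \<comment> \<open>The flow chain of a lower end l has boundary -1 at l and 0 at the other lower
    ends of this level, so the boundary of u agrees with y at all of them.\<close>
  define u where "u x = - (\<Sum>l\<in>lev X (Suc n) \<inter> Range M. y l * P l x)" for x
  have ub: "bnd X (Suc (Suc n)) u l = y l" if l: "l \<in> lev X (Suc n)" "l \<in> Range M" for l
  proof -
    have "bnd X (Suc (Suc n)) u l =
        - (\<Sum>k\<in>lev X (Suc n) \<inter> Range M. y k * bnd X (Suc (Suc n)) (P k) l)"
      unfolding bnd_def u_def sum_distrib_right sum_distrib_left sum_negf
      by (subst sum.swap) (simp add: algebra_simps sum_negf sum_distrib_left)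
    also have "(\<Sum>k\<in>lev X (Suc n) \<inter> Range M. y k * bnd X (Suc (Suc n)) (P k) l) =
        (\<Sum>k\<in>lev X (Suc n) \<inter> Range M. if k = l then - y k else 0)"
    proof (rule sum.cong[OF refl])
      fix k assume k: "k \<in> lev X (Suc n) \<inter> Range M"
      then have "k \<notin> Domain M" "top k = Suc (Suc n)" using Domain_Range by (auto simp: top_def lev_def)
      then show "y k * bnd X (Suc (Suc n)) (P k) l = (if k = l then - y k else 0)"
        using bnd_P_lower[of k l] l by (auto simp: lev_def)
    qed
    also have "\<dots> = - y l" using l by simp
    finally show ?thesis by simp
  qed
  define y1 where "y1 x = y x - bnd X (Suc (Suc n)) u x" for x
  have y1: "bnd X (Suc n) y1 a = z' a" if "a \<in> lev X n" for a
    unfolding y1_def bnd_diff using bnd_bnd[OF ok that] y that by simp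
  define y2 where "y2 = phi (Suc n) y1"
  have eq: "y1 x = y2 x" if "x \<in> lev X (Suc n)" for x
  proof -
    have "y1 x - y2 x = 0"
    proof (rule upper_unique[where w = "\<lambda>x. y1 x - y2 x" and n = "Suc n"])
      fix x assume x: "x \<in> lev X (Suc n)" "x \<notin> Domain M"
      then show "y1 x - y2 x = 0"
        by (cases rule: lev_cases[OF x(1)]) (auto simp: y2_def phi_crit phi_lower ub y1_def)
    next
      fix l assume l: "l \<in> Range M" "Suc (cdim X l) = Suc n"
      then have "l \<in> lev X n" using M_dest by (auto simp: lev_def)
      then show "bnd X (Suc n) (\<lambda>x. y1 x - y2 x) l = 0"
        using bnd_phi_lower[OF l] y1[of l] phi_lower[of l n z] l
        by (simp add: bnd_diff y2_def z'_def)
    qed (use that in auto)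
    then show ?thesis by simp
  qed
  show "\<exists>y. \<forall>a\<in>lev Y n. z a = bnd Y (Suc n) y a"
  proof (rule exI[of _ y1], rule ballI)
    fix a assume "a \<in> lev Y n"
    then have a: "a \<in> crit n" by (simp add: lev_morse)
    then have "a \<in> lev X n" by (simp add: crit_def)
    have "z a = z' a" using a by (simp add: z'_def phi_crit)
    also have "\<dots> = bnd X (Suc n) y2 a" using y1[OF \<open>a \<in> lev X n\<close>] eq bnd_cong[of X "Suc n" y1 y2 a] by simp
    also have "\<dots> = bnd Y (Suc n) y1 a" unfolding y2_def by (rule bnd_phi_crit[OF a])
    finally show "z a = bnd Y (Suc n) y1 a" .
  qed
qed

end

section \<open>Edge sets covering given vertices\<close>

definition esign :: "'e::linorder \<Rightarrow> 'e set \<Rightarrow> 'r::comm_ring_1" where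
  "esign g I = (- 1) ^ (card {h \<in> I. h \<le> g} + 1)"

text \<open>The subsets of E that cover T form the simplex on E modulo its non-covering faces; this
  is exactness at cardinality i. With E the edges inside V and T = V it is the strand of the Taylor
  resolution in multidegree V.\<close>

definition cover_exact ::
    "'r::comm_ring_1 itself \<Rightarrow> ('e::linorder \<Rightarrow> 'v set) \<Rightarrow> 'v set \<Rightarrow> 'e set \<Rightarrow> nat \<Rightarrow> bool" where
  "cover_exact _ vs T E i \<longleftrightarrow> (\<forall>z :: 'e set \<Rightarrow> 'r.
     (\<forall>J\<subseteq>E. T \<subseteq> \<Union>(vs ` J) \<and> Suc (card J) = i \<longrightarrow>
        (\<Sum>g\<in>E - J. esign g (insert g J) * z (insert g J)) = 0) \<longrightarrow>
     (\<exists>y. \<forall>I\<subseteq>E. T \<subseteq> \<Union>(vs ` I) \<and> card I = i \<longrightarrow>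
        z I = (\<Sum>g\<in>E - I. esign g (insert g I) * y (insert g I))))"

lemma cover_exactE:
  fixes z :: "'e::linorder set \<Rightarrow> 'r::comm_ring_1"
  assumes "cover_exact TYPE('r) vs T E i"
    and "\<forall>J\<subseteq>E. T \<subseteq> \<Union>(vs ` J) \<and> Suc (card J) = i \<longrightarrow>
        (\<Sum>g\<in>E - J. esign g (insert g J) * z (insert g J)) = 0"
  obtains y where "\<And>I. I \<subseteq> E \<Longrightarrow> T \<subseteq> \<Union>(vs ` I) \<Longrightarrow> card I = i \<Longrightarrow>
      z I = (\<Sum>g\<in>E - I. esign g (insert g I) * y (insert g I))"
proof -
  have "\<exists>y. \<forall>I\<subseteq>E. T \<subseteq> \<Union>(vs ` I) \<and> card I = i \<longrightarrow>
      z I = (\<Sum>g\<in>E - I. esign g (insert g I) * y (insert g I))"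
    using assms(1) unfolding cover_exact_def by (rule allE[of _ z]) (erule mp, rule assms(2))
  then show ?thesis by (elim exE, intro that) simp
qed

lemma esign_insert_max:
  assumes "\<forall>h\<in>E. h < e" "g \<in> E"
  shows "esign g (insert g (insert e J)) = esign g (insert g J)"
proof -
  have "g < e" using assms by auto
  then have "{h \<in> insert g (insert e J). h \<le> g} = {h \<in> insert g J. h \<le> g}" by auto
  then show ?thesis by (simp add: esign_def)
qed

lemma esign_max:
  assumes "finite E" "\<forall>h\<in>E. h < e" "J \<subseteq> E"
  shows "esign e (insert e J) = (- 1) ^ card J"
proof -
  have "{h \<in> insert e J. h \<le> e} = insert e J" using assms by fastforce
  moreover have "e \<notin> J" "finite J" using assms finite_subset by blast+
  ultimately show ?thesis by (simp add: esign_def)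
qed

lemma sum_insert_max:
  assumes "finite E" "\<forall>h\<in>E. h < e" "J \<subseteq> E"
  shows "(\<Sum>g\<in>insert e E - J. esign g (insert g J) * z (insert g J)) =
    (- 1) ^ card J * z (insert e J) + (\<Sum>g\<in>E - J. esign g (insert g J) * z (insert g J))"
proof -
  have e: "e \<notin> E" "e \<notin> J" using assms by auto
  then have "insert e E - J = insert e (E - J)" by auto
  then show ?thesis using assms e by (simp add: esign_max)
qed

lemma sum_insert_max':
  assumes "finite E" "\<forall>h\<in>E. h < e" "J \<subseteq> E"
  shows "(\<Sum>g\<in>insert e E - insert e J. esign g (insert g (insert e J)) * z (insert g (insert e J))) =
    (\<Sum>g\<in>E - J. esign g (insert g J) * z (insert e (insert g J)))"
proof -
  have "e \<notin> E" using assms by auto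
  then have "insert e E - insert e J = E - J" by auto
  then show ?thesis using assms by (auto intro!: sum.cong simp: esign_insert_max insert_commute)
qed

text \<open>Sets without e form a subcomplex. In the quotient, a set containing e only needs the
  rest to cover the vertices of T outside e, with one element fewer. Exactness in the middle follows
  from exactness of both. Taking e largest keeps the signs of the other elements unchanged.\<close>

lemma cover_exact_insert:
  fixes vs :: "'e::linorder \<Rightarrow> 'v set"
  assumes E: "finite E" "\<forall>h\<in>E. h < e" and i: "i \<ge> 1"
    and ex: "cover_exact TYPE('r::comm_ring_1) vs T E i"
      "cover_exact TYPE('r) vs (T - vs e) E (i - 1)"
  shows "cover_exact TYPE('r) vs T (insert e E) i"
  unfolding cover_exact_def
proof (intro allI impI)
  fix z :: "'e set \<Rightarrow> 'r"
  assume z: "\<forall>J\<subseteq>insert e E. T \<subseteq> \<Union>(vs ` J) \<and> Suc (card J) = i \<longrightarrow>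
        (\<Sum>g\<in>insert e E - J. esign g (insert g J) * z (insert g J)) = 0"
  have e: "e \<notin> E" using E by auto
  have fin: "finite J" if "J \<subseteq> E" for J using that E(1) finite_subset by blast
  define z1 where "z1 I = z (insert e I)" for I
  have "\<forall>J\<subseteq>E. T - vs e \<subseteq> \<Union>(vs ` J) \<and> Suc (card J) = i - 1 \<longrightarrow>
      (\<Sum>g\<in>E - J. esign g (insert g J) * z1 (insert g J)) = 0"
  proof (intro allI impI)
    fix J assume J: "J \<subseteq> E" "T - vs e \<subseteq> \<Union>(vs ` J) \<and> Suc (card J) = i - 1"
    then have "card (insert e J) = Suc (card J)" using e fin[OF J(1)] by (metis card_insert_disjoint subsetD)
    then have "(\<Sum>g\<in>insert e E - insert e J. esign g (insert g (insert e J)) * z (insert g (insert e J))) = 0"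
      using J i by (intro z[rule_format]) auto
    then show "(\<Sum>g\<in>E - J. esign g (insert g J) * z1 (insert g J)) = 0"
      using sum_insert_max'[OF E J(1), of z] by (simp add: z1_def)
  qed
  then obtain y1 where y1: "\<And>I. I \<subseteq> E \<Longrightarrow> T - vs e \<subseteq> \<Union>(vs ` I) \<Longrightarrow> card I = i - 1 \<Longrightarrow>
      z1 I = (\<Sum>g\<in>E - I. esign g (insert g I) * y1 (insert g I))"
    by (rule cover_exactE[OF ex(2)]) (rule that)
  \<comment> \<open>Subtracts the part of the boundary of the lifted y1 that falls on sets without
    e; removing the largest of i + 1 elements has sign (-1)^i.\<close>
  define z0 where "z0 I = z I + (- 1) ^ (i - 1) * y1 I" for I
  have "\<forall>J\<subseteq>E. T \<subseteq> \<Union>(vs ` J) \<and> Suc (card J) = i \<longrightarrow>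
      (\<Sum>g\<in>E - J. esign g (insert g J) * z0 (insert g J)) = 0"
  proof (intro allI impI)
    fix J assume J: "J \<subseteq> E" "T \<subseteq> \<Union>(vs ` J) \<and> Suc (card J) = i"
    have "(\<Sum>g\<in>insert e E - J. esign g (insert g J) * z (insert g J)) = 0"
      using J by (intro z[rule_format]) auto
    then have "(- 1) ^ (i - 1) * z1 J + (\<Sum>g\<in>E - J. esign g (insert g J) * z (insert g J)) = 0"
      using J by (subst (asm) sum_insert_max[OF E J(1)]) (auto simp: z1_def)
    moreover have "z1 J = (\<Sum>g\<in>E - J. esign g (insert g J) * y1 (insert g J))"
      using J by (intro y1) auto
    ultimately show "(\<Sum>g\<in>E - J. esign g (insert g J) * z0 (insert g J)) = 0"
      by (simp add: z0_def algebra_simps sum.distrib sum_distrib_left)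
  qed
  then obtain y0 where y0: "\<And>I. I \<subseteq> E \<Longrightarrow> T \<subseteq> \<Union>(vs ` I) \<Longrightarrow> card I = i \<Longrightarrow>
      z0 I = (\<Sum>g\<in>E - I. esign g (insert g I) * y0 (insert g I))"
    by (rule cover_exactE[OF ex(1)]) (rule that)
  define y where "y I = (if e \<in> I then y1 (I - {e}) else y0 I)" for I
  have yE: "y I = y0 I" if "I \<subseteq> E" for I using that e by (auto simp: y_def)
  have yI: "y (insert e I) = y1 I" if "I \<subseteq> E" for I
  proof -
    have "insert e I - {e} = I" using that e by auto
    then show ?thesis by (simp add: y_def)
  qed
  show "\<exists>y. \<forall>I\<subseteq>insert e E. T \<subseteq> \<Union>(vs ` I) \<and> card I = i \<longrightarrow>
        z I = (\<Sum>g\<in>insert e E - I. esign g (insert g I) * y (insert g I))"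
  proof (rule exI[of _ y], intro allI impI)
    fix I assume I: "I \<subseteq> insert e E" "T \<subseteq> \<Union>(vs ` I) \<and> card I = i"
    show "z I = (\<Sum>g\<in>insert e E - I. esign g (insert g I) * y (insert g I))"
    proof (cases "e \<in> I")
      case True
      define J where "J = I - {e}"
      have J: "J \<subseteq> E" "I = insert e J" "e \<notin> J" using I True by (auto simp: J_def)
      then have c: "card J = i - 1" using I fin[OF J(1)] by auto
      have "z I = z1 J" by (simp add: z1_def J)
      also have "\<dots> = (\<Sum>g\<in>E - J. esign g (insert g J) * y1 (insert g J))"
        using I J c by (intro y1) auto
      also have "\<dots> = (\<Sum>g\<in>E - J. esign g (insert g J) * y (insert e (insert g J)))"
        using J by (intro sum.cong refl) (auto simp: yI)
      finally show ?thesis unfolding J(2) sum_insert_max'[OF E J(1)] .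
    next
      case False
      then have J: "I \<subseteq> E" using I by auto
      have "z I + (- 1) ^ (i - 1) * y1 I = (\<Sum>g\<in>E - I. esign g (insert g I) * y0 (insert g I))"
        using y0[of I] I J by (simp add: z0_def)
      also have "\<dots> = (\<Sum>g\<in>E - I. esign g (insert g I) * y (insert g I))"
        using J by (intro sum.cong refl) (auto simp: yE)
      moreover have "(- 1) ^ card I = - ((- 1) ^ (i - 1) :: 'r)"
        using I i by (cases i) auto
      ultimately show ?thesis unfolding sum_insert_max[OF E J] using yI[OF J]
        by (simp add: algebra_simps)
    qed
  qed
qed

text \<open>Adding or removing e does not affect covering, so adding e is a contracting
  homotopy.\<close>

lemma cover_exact_cone:
  fixes vs :: "'e::linorder \<Rightarrow> 'v set"
  assumes E: "finite E" "\<forall>h\<in>E. h < e" and i: "i \<ge> 1" and disj: "vs e \<inter> T = {}"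
  shows "cover_exact TYPE('r::comm_ring_1) vs T (insert e E) i"
  unfolding cover_exact_def
proof (intro allI impI)
  fix z :: "'e set \<Rightarrow> 'r"
  assume z: "\<forall>J\<subseteq>insert e E. T \<subseteq> \<Union>(vs ` J) \<and> Suc (card J) = i \<longrightarrow>
        (\<Sum>g\<in>insert e E - J. esign g (insert g J) * z (insert g J)) = 0"
  have e: "e \<notin> E" using E by auto
  have fin: "finite J" if "J \<subseteq> E" for J using that E(1) finite_subset by blast
  define y where "y I = (if e \<in> I then (- 1) ^ i * z (I - {e}) else 0)" for I
  have yE: "y I = 0" if "I \<subseteq> E" for I using that e by (auto simp: y_def)
  have yI: "y (insert e I) = (- 1) ^ i * z I" if "I \<subseteq> E" for I
  proof -
    have "insert e I - {e} = I" using that e by auto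
    then show ?thesis by (simp add: y_def)
  qed
  have sq: "(- 1) ^ i * ((- 1) ^ i * x) = (x::'r)" for x
    by (simp add: mult.assoc[symmetric] power_mult_distrib[symmetric])
  show "\<exists>y. \<forall>I\<subseteq>insert e E. T \<subseteq> \<Union>(vs ` I) \<and> card I = i \<longrightarrow>
        z I = (\<Sum>g\<in>insert e E - I. esign g (insert g I) * y (insert g I))"
  proof (rule exI[of _ y], intro allI impI)
    fix I assume I: "I \<subseteq> insert e E" "T \<subseteq> \<Union>(vs ` I) \<and> card I = i"
    show "z I = (\<Sum>g\<in>insert e E - I. esign g (insert g I) * y (insert g I))"
    proof (cases "e \<in> I")
      case True
      define J where "J = I - {e}"
      have J: "J \<subseteq> E" "I = insert e J" "e \<notin> J" using I True by (auto simp: J_def)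
      then have c: "Suc (card J) = i" using I fin[OF J(1)] by auto
      have cov: "T \<subseteq> \<Union>(vs ` J)" using I disj J by auto
      have "(\<Sum>g\<in>insert e E - J. esign g (insert g J) * z (insert g J)) = 0"
        using J c cov by (intro z[rule_format]) auto
      then have "(- 1) ^ card J * z I + (\<Sum>g\<in>E - J. esign g (insert g J) * z (insert g J)) = 0"
        using J by (subst (asm) sum_insert_max[OF E J(1)]) auto
      then have "(- 1) ^ i * z I = (\<Sum>g\<in>E - J. esign g (insert g J) * z (insert g J))"
        using c minus_unique by fastforce
      then have "z I = (- 1) ^ i * (\<Sum>g\<in>E - J. esign g (insert g J) * z (insert g J))"
        using sq[of "z I"] by simp
      also have "\<dots> = (\<Sum>g\<in>E - J. esign g (insert g J) * ((- 1) ^ i * z (insert g J)))"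
        by (simp add: sum_distrib_left algebra_simps)
      also have "\<dots> = (\<Sum>g\<in>E - J. esign g (insert g J) * y (insert e (insert g J)))"
        using J by (intro sum.cong refl) (auto simp: yI)
      finally show ?thesis unfolding J(2) sum_insert_max'[OF E J(1)] .
    next
      case False
      then have J: "I \<subseteq> E" using I by auto
      have "(\<Sum>g\<in>E - I. esign g (insert g I) * y (insert g I)) = 0"
        using J by (intro sum.neutral) (auto simp: yE)
      then show ?thesis unfolding sum_insert_max[OF E J] using yI[OF J] I sq
        by simp
    qed
  qed
qed

text \<open>Induction on the largest edge: an edge meeting T lowers i by one and |T| by at least
  one, which keeps the inequality; an edge missing T makes the complex a cone.\<close>

lemma cover_exact_weak:
  assumes "finite E" "finite T" "card T < i"
  shows "cover_exact TYPE('r::comm_ring_1) vs T E i"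
  using assms
proof (induction E arbitrary: T i rule: finite_linorder_max_induct)
  case empty
  then show ?case by (auto simp: cover_exact_def)
next
  case (insert e E)
  show ?case
  proof (cases "vs e \<inter> T = {}")
    case True
    then show ?thesis using insert by (intro cover_exact_cone) auto
  next
    case False
    then have "T - vs e \<subset> T" by auto
    then have "card (T - vs e) < card T" using insert.prems psubset_card_mono by blast
    then show ?thesis using insert by (intro cover_exact_insert) auto
  qed
qed

text \<open>Every edge now takes two vertices from T but only one from the cardinality, so the
  quotient falls under the weak bound even for i = |T|. Without edges nothing covers a nonempty
  T.\<close>

lemma cover_exact_strong:
  assumes "finite E" "finite T" "T \<noteq> {}" "card T \<le> i" "\<forall>e\<in>E. vs e \<subseteq> T \<and> card (vs e) = 2"
  shows "cover_exact TYPE('r::comm_ring_1) vs T E i"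
  using assms
proof (induction E rule: finite_linorder_max_induct)
  case empty
  then show ?case by (auto simp: cover_exact_def)
next
  case (insert e E)
  have "card T > 0" using insert by (simp add: card_gt_0_iff)
  moreover have "card (T - vs e) = card T - 2" "card T \<ge> 2"
    using insert.prems card_mono[of T "vs e"] by (auto simp: card_Diff_subset finite_subset)
  ultimately have "cover_exact TYPE('r) vs (T - vs e) E (i - 1)"
    using insert.prems insert.hyps by (intro cover_exact_weak) auto
  moreover have "cover_exact TYPE('r) vs T E i" using insert by auto
  ultimately show ?case using insert.hyps insert.prems \<open>card T > 0\<close> by (intro cover_exact_insert) auto
qed

section \<open>Matchings restricted to a multidegree\<close>

definition gradedby :: "('c \<Rightarrow> 'v set) \<Rightarrow> ('c, 'r::comm_ring_1) based_complex \<Rightarrow> bool" where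
  "gradedby s X \<longleftrightarrow> (\<forall>(c, c')\<in>cedges X. s c' \<subseteq> s c)"

text \<open>For the Taylor resolution, entries between cells of equal multidegree are those free of
  variables, so the strands are what remains after setting all variables to 0.\<close>

definition strand :: "('c \<Rightarrow> 'v set) \<Rightarrow> 'v set \<Rightarrow> ('c, 'r) based_complex \<Rightarrow> ('c, 'r) based_complex" where
  "strand s V X = X\<lparr>cells := {c \<in> cells X. s c = V}\<rparr>"

lemma strand_simps [simp]:
  "cells (strand s V X) = {c \<in> cells X. s c = V}" "cdim (strand s V X) = cdim X" "bd (strand s V X) = bd X"
  by (simp_all add: strand_def)

lemma cedges_strand: "cedges (strand s V X) = {(c, c') \<in> cedges X. s c = V \<and> s c' = V}"
  by (auto simp: cedges_def)

definition mstrand :: "('c \<Rightarrow> 'v set) \<Rightarrow> 'v set \<Rightarrow> ('c \<times> 'c) set \<Rightarrow> ('c \<times> 'c) set" where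
  "mstrand s V M = {(c, c') \<in> M. s c = V}"

definition preserves :: "('c \<Rightarrow> 'v set) \<Rightarrow> ('c \<times> 'c) set \<Rightarrow> bool" where
  "preserves s M \<longleftrightarrow> (\<forall>(c, c')\<in>M. s c = s c')"

lemma reversed_strand:
  assumes "preserves s M"
  shows "reversed_graph (strand s V X) (mstrand s V M) = {(a, b) \<in> reversed_graph X M. s a = V \<and> s b = V}"
  using assms by (auto simp: reversed_graph_def cedges_strand mstrand_def preserves_def)

lemma acyclic_matching_strand:
  assumes "acyclic_matching X M" "preserves s M"
  shows "acyclic_matching (strand s V X) (mstrand s V M)"
  unfolding acyclic_matching_def
proof (intro conjI)
  show "mstrand s V M \<subseteq> cedges (strand s V X)"
    using assms by (auto simp: acyclic_matching_def cedges_strand mstrand_def preserves_def)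
  show "\<forall>e\<in>mstrand s V M. \<forall>e'\<in>mstrand s V M. e \<noteq> e' \<longrightarrow> {fst e, snd e} \<inter> {fst e', snd e'} = {}"
    using assms(1) unfolding acyclic_matching_def mstrand_def by blast
  show "\<forall>(c, c')\<in>mstrand s V M. bd (strand s V X) c c' dvd 1"
    using assms(1) by (auto simp: acyclic_matching_def mstrand_def)
  have "reversed_graph (strand s V X) (mstrand s V M) \<subseteq> reversed_graph X M"
    unfolding reversed_strand[OF assms(2)] by auto
  then show "acyclic (reversed_graph (strand s V X) (mstrand s V M))"
    using assms(1) by (auto simp: acyclic_matching_def intro: acyclic_subset)
qed

lemma reversed_le:
  assumes "gradedby s X" "preserves s M" "(a, b) \<in> reversed_graph X M"
  shows "s b \<subseteq> s a"
  using assms by (auto simp: gradedby_def preserves_def reversed_graph_def)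

lemma reversed_rtrancl_le:
  assumes "gradedby s X" "preserves s M" "(a, b) \<in> (reversed_graph X M)\<^sup>*"
  shows "s b \<subseteq> s a"
  using assms(3) by (induction rule: rtrancl_induct) (use reversed_le[OF assms(1,2)] in auto)

lemma successively_rtrancl_both:
  "successively (\<lambda>a b. (a, b) \<in> R) p \<Longrightarrow> y \<in> set p \<Longrightarrow> (hd p, y) \<in> R\<^sup>* \<and> (y, last p) \<in> R\<^sup>*"
proof (induction p arbitrary: y rule: induct_list012)
  case (3 a b p)
  have b: "(b, last (b # p)) \<in> R\<^sup>*" using 3(2)[of b] 3(3) by simp
  have ab: "(a, b) \<in> R" using 3(3) by simp
  show ?case
  proof (cases "y = a")
    case True
    then show ?thesis using b ab by (auto intro: converse_rtrancl_into_rtrancl)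
  next
    case False
    then have "(b, y) \<in> R\<^sup>* \<and> (y, last (b # p)) \<in> R\<^sup>*" using 3(2)[of y] 3(3,4) by simp
    then show ?thesis using ab by (auto intro: converse_rtrancl_into_rtrancl)
  qed
qed auto

lemma gradedby_morse:
  assumes "gradedby s X" "preserves s M"
  shows "gradedby s (morse_complex X M)"
  unfolding gradedby_def
proof safe
  fix c c' x assume e: "(c, c') \<in> cedges (morse_complex X M)" "x \<in> s c'"
  then have "(\<Sum>p\<in>graph_paths X M c c'. \<Prod>i<length p - 1. step_weight X M (p ! i) (p ! Suc i)) \<noteq> 0"
    by (auto simp: cedges_def morse_complex_def)
  then have "graph_paths X M c c' \<noteq> {}" by auto
  then obtain p where "p \<in> graph_paths X M c c'" by blast
  then have "(c, c') \<in> (reversed_graph X M)\<^sup>*"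
    using successively_rtrancl_both[of "reversed_graph X M" p c] by (auto simp: graph_paths_def)
  then show "x \<in> s c" using reversed_rtrancl_le[OF assms] e by auto
qed

text \<open>Degrees never grow along the reversed graph, so a path between two cells of degree V
  cannot leave degree V. Hence Morse complexes and strands commute.\<close>

lemma graph_paths_strand:
  assumes "gradedby s X" "preserves s M" "s c = V" "s c' = V"
  shows "graph_paths (strand s V X) (mstrand s V M) c c' = graph_paths X M c c'"
    and "p \<in> graph_paths X M c c' \<Longrightarrow> y \<in> set p \<Longrightarrow> s y = V"
proof -
  have V: "s y = V" if "p \<in> graph_paths X M c c'" "y \<in> set p" for p y
  proof -
    have "(c, y) \<in> (reversed_graph X M)\<^sup>*" "(y, c') \<in> (reversed_graph X M)\<^sup>*"
      using successively_rtrancl_both[of "reversed_graph X M" p y] that by (auto simp: graph_paths_def)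
    then show ?thesis using reversed_rtrancl_le[OF assms(1,2)] assms(3,4) by blast
  qed
  then show "p \<in> graph_paths X M c c' \<Longrightarrow> y \<in> set p \<Longrightarrow> s y = V" by blast
  show "graph_paths (strand s V X) (mstrand s V M) c c' = graph_paths X M c c'"
  proof (intro set_eqI iffI)
    fix p assume "p \<in> graph_paths (strand s V X) (mstrand s V M) c c'"
    then show "p \<in> graph_paths X M c c'"
      unfolding graph_paths_def reversed_strand[OF assms(2)] by (auto simp: successively_conv_nth)
  next
    fix p assume p: "p \<in> graph_paths X M c c'"
    then show "p \<in> graph_paths (strand s V X) (mstrand s V M) c c'"
      using V[OF p] unfolding graph_paths_def reversed_strand[OF assms(2)]
      by (auto simp: successively_conv_nth)
  qed
qed

lemma bd_morse_strand:
  assumes "gradedby s X" "preserves s M" "s c = V" "s c' = V"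
  shows "bd (morse_complex (strand s V X) (mstrand s V M)) c c' = bd (morse_complex X M) c c'"
proof -
  have "(\<Prod>i<length p - 1. step_weight (strand s V X) (mstrand s V M) (p ! i) (p ! Suc i)) =
      (\<Prod>i<length p - 1. step_weight X M (p ! i) (p ! Suc i))" if p: "p \<in> graph_paths X M c c'" for p
  proof (rule prod.cong[OF refl])
    fix i assume "i \<in> {..<length p - 1}"
    then have "s (p ! i) = V" "s (p ! Suc i) = V"
      using graph_paths_strand(2)[OF assms p] nth_mem[of i p] nth_mem[of "Suc i" p] by auto
    then show "step_weight (strand s V X) (mstrand s V M) (p ! i) (p ! Suc i) = step_weight X M (p ! i) (p ! Suc i)"
      by (auto simp: step_weight_def mstrand_def)
  qed
  then show ?thesis unfolding morse_complex_def by (simp add: graph_paths_strand(1)[OF assms])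
qed

lemma exact_at_cong:
  assumes "cells X = cells Y" "cdim X = cdim Y"
    "\<And>c c'. c \<in> cells X \<Longrightarrow> c' \<in> cells X \<Longrightarrow> bd X c c' = bd Y c c'"
  shows "exact_at X n = exact_at Y n" "complex_ok X = complex_ok Y"
proof -
  have lev: "lev X = lev Y" using assms(1,2) by (simp add: lev_def fun_eq_iff)
  have lc: "a \<in> lev Y m \<Longrightarrow> a \<in> cells X" for a m using assms(1) by (simp add: lev_def)
  have bnd: "bnd X m z c = bnd Y m z c" if "c \<in> cells X" for m z c
    unfolding bnd_def lev using assms(3) that lc by (intro sum.cong refl) simp
  have "(\<forall>c\<in>cells X. Suc (cdim X c) = n \<longrightarrow> bnd X n z c = 0) =
      (\<forall>c\<in>cells Y. Suc (cdim Y c) = n \<longrightarrow> bnd Y n z c = 0)" for z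
    using assms(1,2) bnd by auto
  moreover have "(\<forall>a\<in>lev X n. z a = bnd X (Suc n) y a) = (\<forall>a\<in>lev Y n. z a = bnd Y (Suc n) y a)" for z y
    using lev lc bnd by auto
  ultimately show "exact_at X n = exact_at Y n" by (simp add: exact_at_def)
  have "(\<Sum>b\<in>lev X (Suc m). bd X a b * bd X b c) = (\<Sum>b\<in>lev Y (Suc m). bd Y a b * bd Y b c)"
    if "a \<in> lev Y (Suc (Suc m))" "c \<in> lev Y m" for a c m
    unfolding lev using lc that assms(3) by (intro sum.cong refl) metis
  then show "complex_ok X = complex_ok Y" using assms(1) by (simp add: complex_ok_def lev)
qed

text \<open>The general Morse theorem is applied to the strand itself, whose Morse complex is the
  strand of the Morse complex.\<close>

lemma strand_morse_exact:
  assumes "gradedby s X" "preserves s M" "acyclic_matching X M" "complex_ok (strand s V X)"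
  shows "complex_ok (strand s V (morse_complex X M))"
    and "exact_at (strand s V X) n \<Longrightarrow> exact_at (strand s V (morse_complex X M)) n"
proof -
  interpret matched_complex "strand s V X" "mstrand s V M"
    by (rule matched_complex.intro[OF assms(4) acyclic_matching_strand[OF assms(3,2)]])
  let ?Y = "morse_complex (strand s V X) (mstrand s V M)"
  have cells: "cells (strand s V (morse_complex X M)) = cells ?Y"
    using assms(2) by (fastforce simp: morse_complex_def mstrand_def preserves_def Field_def)
  have cdim: "cdim (strand s V (morse_complex X M)) = cdim ?Y" by (simp add: morse_complex_def)
  have bd: "bd (strand s V (morse_complex X M)) c c' = bd ?Y c c'"
    if "c \<in> cells (strand s V (morse_complex X M))" "c' \<in> cells (strand s V (morse_complex X M))" for c c'
    using bd_morse_strand[OF assms(1,2), of c V c'] that by simp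
  note cong = exact_at_cong[OF cells cdim bd]
  show "complex_ok (strand s V (morse_complex X M))" using cong(2) complex_ok_morse by simp
  show "exact_at (strand s V X) n \<Longrightarrow> exact_at (strand s V (morse_complex X M)) n"
    using cong(1) exact_at_morse by simp
qed

lemma strand_sequence_exact:
  assumes "matching_sequence X Ms" "\<forall>M\<in>set Ms. preserves s M" "gradedby s X"
    "complex_ok (strand s V X)" "exact_at (strand s V X) n"
  shows "exact_at (strand s V (foldl morse_complex X Ms)) n"
  using assms
proof (induction Ms arbitrary: X)
  case (Cons M Ms)
  then show ?case using strand_morse_exact[of s X M V] gradedby_morse[of s X M] by simp
qed simp

lemma cells_sequence:
  "cells (foldl morse_complex X Ms) = cells X - Field (\<Union>(set Ms))"
  "cdim (foldl morse_complex X Ms) = cdim X"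
  by (induction Ms arbitrary: X) (auto simp: morse_complex_def Field_def)

lemma matching_sequence_append:
  "matching_sequence X (Ms @ Ns) \<longleftrightarrow> matching_sequence X Ms \<and> matching_sequence (foldl morse_complex X Ms) Ns"
  by (induction Ms arbitrary: X) auto

lemma matching_sequence_cells:
  "matching_sequence X Ms \<Longrightarrow> Field (\<Union>(set Ms)) \<subseteq> cells X"
proof (induction Ms arbitrary: X)
  case (Cons M Ms)
  have "Field M \<subseteq> cells X"
    using Cons.prems by (auto simp: acyclic_matching_def cedges_def Field_def)
  moreover have "Field (\<Union>(set Ms)) \<subseteq> cells X"
    using Cons.IH[of "morse_complex X M"] Cons.prems by (auto simp: morse_complex_def)
  ultimately show ?case by (simp add: Field_Un)
qed (auto simp: Field_def)

text \<open>The differential of this strand is 0, so the indicator of c is a cycle; were it a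
  boundary, it would be 0.\<close>

lemma no_cell_if_exact:
  assumes "exact_at (strand s V Y) n" "\<forall>(c, c')\<in>cedges Y. s c \<noteq> s c'" "finite (cells Y)"
    "c \<in> cells Y" "s c = V" "cdim Y c = n"
  shows False
proof -
  define z where "z = (\<lambda>a. if a = c then 1 else 0 :: 'b)"
  have bd0: "bd Y a b = 0" if "a \<in> cells Y" "b \<in> cells Y" "s a = V" "s b = V" "cdim Y a = Suc (cdim Y b)" for a b
    using assms(2) that by (auto simp: cedges_def)
  let ?S = "strand s V Y"
  have fin: "finite (lev ?S m)" for m using assms(3) by (simp add: lev_def)
  have "bnd ?S n z b = 0" if "b \<in> cells ?S" "Suc (cdim ?S b) = n" for b
    unfolding bnd_def using that bd0 by (intro sum.neutral) (auto simp: z_def lev_def)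
  then obtain y where y: "\<And>a. a \<in> lev ?S n \<Longrightarrow> z a = bnd ?S (Suc n) y a"
    using assms(1) unfolding exact_at_def by blast
  have "c \<in> lev ?S n" using assms by (simp add: lev_def)
  then have "1 = bnd ?S (Suc n) y c" using y[of c] by (simp add: z_def)
  also have "\<dots> = 0" unfolding bnd_def using assms(4-6) bd0
    by (intro sum.neutral) (auto simp: lev_def)
  finally show False by simp
qed

section \<open>Alternating sums under matchings\<close>

lemma euler_matching:
  fixes w :: "'c \<Rightarrow> int"
  assumes "acyclic_matching X M" "finite (cells X)" "preserves s M" "\<forall>(c, c')\<in>M. w c = - w c'"
  shows "(\<Sum>c\<in>{c \<in> cells X - Field M. s c = V}. w c) = (\<Sum>c\<in>{c \<in> cells X. s c = V}. w c)"
proof -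
  let ?M = "mstrand s V M"
  have Msub: "M \<subseteq> cedges X" and dis: "\<And>e e'. e \<in> M \<Longrightarrow> e' \<in> M \<Longrightarrow> e \<noteq> e' \<Longrightarrow> {fst e, snd e} \<inter> {fst e', snd e'} = {}"
    using assms(1) unfolding acyclic_matching_def by blast+
  have fin: "finite M"
    using Msub assms(2) by (rule_tac finite_subset[of _ "cells X \<times> cells X"]) (auto simp: cedges_def)
  have injf: "inj_on fst ?M" and injs: "inj_on snd ?M"
    using dis by (force simp: inj_on_def mstrand_def)+
  have "fst ` ?M \<inter> snd ` ?M = {}"
  proof -
    have False if "e \<in> ?M" "e' \<in> ?M" "fst e = snd e'" for e e'
    proof -
      have e: "e \<in> M" "e' \<in> M" using that by (auto simp: mstrand_def)
      have "cdim X (fst e) = Suc (cdim X (snd e))" using e(1) Msub by (auto simp: cedges_def)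
      then have "e \<noteq> e'" using that(3) by auto
      then show False using dis[OF e] that(3) by auto
    qed
    then show ?thesis by blast
  qed
  moreover have S: "{c \<in> cells X. s c = V} = {c \<in> cells X - Field M. s c = V} \<union> (fst ` ?M \<union> snd ` ?M)"
    using Msub assms(3) by (fastforce simp: mstrand_def preserves_def cedges_def Field_def image_iff)
  moreover have "{c \<in> cells X - Field M. s c = V} \<inter> (fst ` ?M \<union> snd ` ?M) = {}"
  proof -
    have "fst ` ?M \<union> snd ` ?M \<subseteq> Field M"
      by (auto simp: mstrand_def intro: FieldI1 FieldI2)
    then show ?thesis by auto
  qed
  moreover have finM: "finite ?M" using fin by (auto simp: mstrand_def intro: finite_subset)
  moreover have "sum w (fst ` ?M) + sum w (snd ` ?M) = 0"
  proof -
    have "sum w (fst ` ?M) + sum w (snd ` ?M) = (\<Sum>e\<in>?M. w (fst e) + w (snd e))"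
      using injf injs by (simp add: sum.reindex sum.distrib)
    also have "\<dots> = 0" using assms(4) by (intro sum.neutral) (auto simp: mstrand_def)
    finally show ?thesis .
  qed
  ultimately show ?thesis
    using assms(2) by (simp add: S sum.union_disjoint del: Un_iff)
qed

lemma euler_sequence:
  fixes w :: "'c \<Rightarrow> int"
  assumes "matching_sequence X Ms" "finite (cells X)" "\<forall>M\<in>set Ms. preserves s M \<and> (\<forall>(c, c')\<in>M. w c = - w c')"
  shows "(\<Sum>c\<in>{c \<in> cells X - Field (\<Union>(set Ms)). s c = V}. w c) = (\<Sum>c\<in>{c \<in> cells X. s c = V}. w c)"
  using assms
proof (induction Ms arbitrary: X)
  case (Cons M Ms)
  have "{c \<in> cells X - Field (\<Union>(set (M # Ms))). s c = V} =
      {c \<in> cells (morse_complex X M) - Field (\<Union>(set Ms)). s c = V}"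
    by (auto simp: morse_complex_def Field_def)
  then have "(\<Sum>c\<in>{c \<in> cells X - Field (\<Union>(set (M # Ms))). s c = V}. w c) =
      (\<Sum>c\<in>{c \<in> cells (morse_complex X M). s c = V}. w c)"
    using Cons.IH[of "morse_complex X M"] Cons.prems by (simp add: morse_complex_def)
  also have "\<dots> = (\<Sum>c\<in>{c \<in> cells X. s c = V}. w c)"
    using euler_matching[of X M s w V] Cons.prems by (simp add: morse_complex_def)
  finally show ?case .
qed (simp add: Field_def)

section \<open>The strands of the Taylor resolution\<close>

definition edges_in :: "('n::{finite,linorder} \<Rightarrow> 'n \<Rightarrow> bool) \<Rightarrow> 'n set \<Rightarrow> 'n monom set" where
  "edges_in prec V = {g \<in> mingens prec. ks g \<subseteq> V}"

lemma finite_edges_in [simp]: "finite (edges_in prec V)"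
  by (simp add: edges_in_def)

lemma edges_in_iff:
  "I \<subseteq> edges_in prec V \<and> V \<subseteq> \<Union>(ks ` I) \<longleftrightarrow> I \<subseteq> mingens prec \<and> support I = V"
proof
  assume h: "I \<subseteq> edges_in prec V \<and> V \<subseteq> \<Union>(ks ` I)"
  then have "I \<subseteq> mingens prec" by (auto simp: edges_in_def)
  moreover have "\<Union>(ks ` I) = V" using h by (auto simp: edges_in_def)
  ultimately show "I \<subseteq> mingens prec \<and> support I = V" using finite_edges support_eq by metis
next
  assume h: "I \<subseteq> mingens prec \<and> support I = V"
  then have "\<Union>(ks ` I) = V" using finite_edges[of I prec] support_eq[of I] by simp
  then show "I \<subseteq> edges_in prec V \<and> V \<subseteq> \<Union>(ks ` I)" using h by (auto simp: edges_in_def)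
qed

lemma cells_taylor: "cells (taylor prec) = {I. I \<noteq> {} \<and> I \<subseteq> mingens prec}"
  and cdim_taylor: "cdim (taylor prec) = (\<lambda>I. card I - 1)"
  by (simp_all add: taylor_def)

lemma finite_cells_taylor: "finite (cells (taylor prec))"
  unfolding cells_taylor by (rule finite_subset[of _ "Pow (mingens prec)"]) auto

text \<open>Equal supports mean equal lcms, so the monomial factor is 1 and only the sign
  survives.\<close>

lemma bd_taylor:
  assumes "I \<subseteq> mingens prec" "J \<subseteq> mingens prec" "support I = support J" "J \<noteq> {}"
  shows "g \<in> I \<Longrightarrow> J = I - {g} \<Longrightarrow> bd (taylor prec) I J = (esign g I :: ('n::{finite,linorder}, 'k::field) mpoly)"
    and "(\<And>g. g \<in> I \<Longrightarrow> J \<noteq> I - {g}) \<Longrightarrow> bd (taylor prec) I J = (0 :: ('n, 'k) mpoly)"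
proof -
  have m: "mlcm I = mlcm J" using assms(3) mlcm_sqf[OF assms(1)] mlcm_sqf[OF assms(2)] by simp
  let ?T = "taylor prec :: ('n monom set, ('n, 'k) mpoly) based_complex"
  have bd: "bd ?T I J = (\<Sum>g\<in>I. if J = I - {g} then esign g I else 0 :: ('n, 'k) mpoly)"
    using assms(4) m by (simp add: taylor_def esign_def pmonom_def cong: if_cong)
  show "bd ?T I J = esign g I" if g: "g \<in> I" "J = I - {g}"
  proof -
    have eq: "(J = I - {h}) = (h = g)" if "h \<in> I" for h using that g by blast
    have "bd ?T I J = (\<Sum>h\<in>I. if h = g then esign g I else 0)"
      unfolding bd by (intro sum.cong refl) (use eq in auto)
    then show ?thesis using g finite_edges[OF assms(1)] by simp
  qed
  show "bd ?T I J = 0" if "\<And>g. g \<in> I \<Longrightarrow> J \<noteq> I - {g}"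
    unfolding bd using that by (intro sum.neutral) auto
qed

text \<open>Identifies the strand with the covering complex. A set of i edges has dimension i - 1,
  so the boundary onto J is taken from level \<open>card J\<close>.\<close>

lemma bnd_taylor_strand:
  fixes z :: "'n::{finite,linorder} monom set \<Rightarrow> ('n, 'k::field) mpoly"
  assumes J: "J \<subseteq> mingens prec" "support J = V" "J \<noteq> {}"
  shows "bnd (strand support V (taylor prec)) (card J) z J =
    (\<Sum>g\<in>edges_in prec V - J. esign g (insert g J) * z (insert g J))"
proof -
  let ?T = "taylor prec :: ('n monom set, ('n, 'k) mpoly) based_complex"
  let ?L = "lev (strand support V ?T) (card J)"
  have fin: "finite J" using finite_edges[OF J(1)] .
  have cJ: "card J > 0" using fin J(3) by (simp add: card_gt_0_iff)
  have V: "support (insert g J) = V" if "g \<in> edges_in prec V" for g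
    using that J(2) fin by (auto simp: support_eq edges_in_def)
  have sub: "(\<lambda>g. insert g J) ` (edges_in prec V - J) \<subseteq> ?L"
    using J V fin by (auto simp: lev_def cells_taylor cdim_taylor edges_in_def)
  have "bnd (strand support V ?T) (card J) z J = (\<Sum>I\<in>?L. z I * bd ?T I J)"
    by (simp add: bnd_def)
  also have "\<dots> = (\<Sum>I\<in>(\<lambda>g. insert g J) ` (edges_in prec V - J). z I * bd ?T I J)"
  proof (rule sum.mono_neutral_right)
    show "finite ?L" by (rule finite_subset[OF _ finite_cells_taylor]) (auto simp: lev_def)
    show "\<forall>I\<in>?L - (\<lambda>g. insert g J) ` (edges_in prec V - J). z I * bd ?T I J = 0"
    proof
      fix I assume I: "I \<in> ?L - (\<lambda>g. insert g J) ` (edges_in prec V - J)"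
      then have I': "I \<subseteq> mingens prec" "support I = V" by (auto simp: lev_def cells_taylor)
      then have IE: "I \<subseteq> edges_in prec V" using edges_in_iff[of I prec V] by simp
      have "J \<noteq> I - {g}" if "g \<in> I" for g
      proof
        assume "J = I - {g}"
        then have "I = insert g J" "g \<in> edges_in prec V - J" using that IE by auto
        then show False using I by blast
      qed
      then have "bd ?T I J = 0" using I' J by (intro bd_taylor(2)) auto
      then show "z I * bd ?T I J = 0" by simp
    qed
  qed (rule sub)
  also have "\<dots> = (\<Sum>g\<in>edges_in prec V - J. z (insert g J) * bd ?T (insert g J) J)"
    by (subst sum.reindex) (auto simp: inj_on_def)
  also have "\<dots> = (\<Sum>g\<in>edges_in prec V - J. esign g (insert g J) * z (insert g J))"
  proof (rule sum.cong[OF refl])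
    fix g assume g: "g \<in> edges_in prec V - J"
    then have "bd ?T (insert g J) J = esign g (insert g J)"
      using J V[of g] by (intro bd_taylor(1)) (auto simp: edges_in_def)
    then show "z (insert g J) * bd ?T (insert g J) J = esign g (insert g J) * z (insert g J)"
      by (simp add: mult.commute)
  qed
  finally show ?thesis .
qed

text \<open>Only the larger element h notices whether g is present, so the two orders of removal
  differ by one sign.\<close>

lemma esign_swap:
  fixes g h :: "'e::linorder"
  assumes "finite c" "g \<notin> c" "h \<notin> c" "g < h"
  shows "esign g (insert g c) * esign h (insert h (insert g c)) +
    esign h (insert h c) * esign g (insert g (insert h c)) = (0::'r::comm_ring_1)"
proof -
  have 1: "{x \<in> insert g (insert h c). x \<le> g} = {x \<in> insert g c. x \<le> g}" using assms by auto
  have 2: "{x \<in> insert h (insert g c). x \<le> h} = insert g {x \<in> insert h c. x \<le> h}" using assms by auto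
  have "g \<notin> {x \<in> insert h c. x \<le> h}" using assms by auto
  then have 3: "card {x \<in> insert h (insert g c). x \<le> h} = Suc (card {x \<in> insert h c. x \<le> h})"
    unfolding 2 using assms(1) by (subst card_insert_disjoint) auto
  show ?thesis unfolding esign_def 3 1 by (simp add: algebra_simps)
qed

lemma complex_ok_taylor_strand:
  "complex_ok (strand support V (taylor prec :: ('n::{finite,linorder} monom set, ('n, 'k::field) mpoly) based_complex))"
proof -
  let ?T = "taylor prec :: ('n monom set, ('n, 'k) mpoly) based_complex"
  let ?S = "strand support V ?T"
  have "(\<Sum>b\<in>lev ?S (Suc n). bd ?S a b * bd ?S b c) = 0"
    if a: "a \<in> lev ?S (Suc (Suc n))" and c: "c \<in> lev ?S n" for n a c
  proof -
    have c0: "c \<noteq> {}" "c \<subseteq> mingens prec" "support c = V" "card c - 1 = n"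
      using c by (auto simp: lev_def cells_taylor cdim_taylor)
    then have "card c > 0" using finite_edges[of c prec] by (simp add: card_gt_0_iff)
    then have c': "c \<noteq> {}" "c \<subseteq> mingens prec" "support c = V" "card c = Suc n" using c0 by auto
    have a': "a \<noteq> {}" "a \<subseteq> mingens prec" "support a = V" "card a = Suc (Suc (Suc n))"
      using a by (auto simp: lev_def cells_taylor cdim_taylor)
    have fc: "finite c" and fa: "finite a" using c'(2) a'(2) finite_edges by blast+
    have "(\<Sum>b\<in>lev ?S (Suc n). bd ?S a b * bd ?S b c) = bnd ?S (card c) (bd ?T a) c"
      by (simp add: bnd_def c')
    also have "\<dots> = (\<Sum>g\<in>edges_in prec V - c. esign g (insert g c) * bd ?T a (insert g c))"
      using c' by (intro bnd_taylor_strand) auto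
    also have "\<dots> = (\<Sum>g\<in>a - c. if c \<subseteq> a then esign g (insert g c) * bd ?T a (insert g c) else 0)"
    proof (rule sum.mono_neutral_cong_right)
      show "a - c \<subseteq> edges_in prec V - c" using a' edges_in_iff[of a prec V] by auto
      have z: "bd ?T a (insert g c) = 0" if g: "g \<in> edges_in prec V" "\<not> insert g c \<subseteq> a" for g
      proof (rule bd_taylor(2))
        show "support a = support (insert g c)" using g c' a' fc by (auto simp: support_eq edges_in_def)
        show "insert g c \<subseteq> mingens prec" using g c' by (auto simp: edges_in_def)
        show "insert g c \<noteq> a - {h}" if "h \<in> a" for h using g(2) that by blast
      qed (use a' in auto)
      show "\<forall>g\<in>edges_in prec V - c - (a - c). esign g (insert g c) * bd ?T a (insert g c) = 0"
        using z by auto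
      fix g assume "g \<in> a - c"
      then show "esign g (insert g c) * bd ?T a (insert g c) =
          (if c \<subseteq> a then esign g (insert g c) * bd ?T a (insert g c) else 0)"
        using z[of g] a' edges_in_iff[of a prec V] by auto
    qed auto
    also have "\<dots> = 0"
    proof (cases "c \<subseteq> a")
      case True
      \<comment> \<open>Exactly two sets lie strictly between c and a, and their contributions
        cancel.\<close>
      then have "card (a - c) = 2" using a' c' fc by (simp add: card_Diff_subset)
      then obtain g h where gh: "a - c = {g, h}" "g < h"
        by (metis card_2_iff insert_commute linorder_neqE)
      have ne: "g \<notin> c" "h \<notin> c" "g \<noteq> h" using gh by auto
      have a: "a = insert h (insert g c)" "a = insert g (insert h c)" using gh True by auto
      have "bd ?T a (insert g c) = esign h a"
      proof (rule bd_taylor(1))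
        show "support a = support (insert g c)" using a'(3) c'(3) fc fa a by (auto simp: support_eq)
      qed (use a' c' a ne in auto)
      moreover have "bd ?T a (insert h c) = esign g a"
      proof (rule bd_taylor(1))
        show "support a = support (insert h c)" using a'(3) c'(3) fc fa a by (auto simp: support_eq)
      qed (use a' c' a ne in auto)
      ultimately have "(\<Sum>x\<in>a - c. if c \<subseteq> a then esign x (insert x c) * bd ?T a (insert x c) else 0) =
          esign g (insert g c) * esign h a + esign h (insert h c) * esign g a"
        using True ne(3) by (simp add: gh(1))
      moreover have "esign h a = (esign h (insert h (insert g c)) :: ('n, 'k) mpoly)"
        "esign g a = (esign g (insert g (insert h c)) :: ('n, 'k) mpoly)" using a by simp_all
      ultimately show ?thesis
        using esign_swap[OF fc ne(1,2) gh(2), where 'r = "('n, 'k) mpoly"] by simp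
    qed simp
    finally show ?thesis .
  qed
  moreover have "finite (cells ?S)" by (rule finite_subset[OF _ finite_cells_taylor[of prec]]) auto
  ultimately show ?thesis by (auto simp: complex_ok_def)
qed

text \<open>Dimension n is cardinality n + 1. As V is nonempty, no covering set is empty, so the
  strand has all cells of the covering complex.\<close>

lemma taylor_strand_exact:
  assumes "V \<noteq> {}" "card V \<le> Suc n"
  shows "exact_at (strand support V (taylor prec :: ('n::{finite,linorder} monom set, ('n, 'k::field) mpoly) based_complex)) n"
  unfolding exact_at_def
proof (intro allI impI)
  let ?T = "taylor prec :: ('n monom set, ('n, 'k) mpoly) based_complex"
  let ?S = "strand support V ?T"
  fix z assume z: "\<forall>c\<in>cells ?S. Suc (cdim ?S c) = n \<longrightarrow> bnd ?S n z c = 0"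
  have "cover_exact TYPE(('n, 'k) mpoly) ks V (edges_in prec V) (Suc n)"
    using assms by (intro cover_exact_strong) (auto simp: edges_in_def mingens_card)
  moreover have "\<forall>J\<subseteq>edges_in prec V. V \<subseteq> \<Union>(ks ` J) \<and> Suc (card J) = Suc n \<longrightarrow>
      (\<Sum>g\<in>edges_in prec V - J. esign g (insert g J) * z (insert g J)) = 0"
  proof (intro allI impI)
    fix J assume J: "J \<subseteq> edges_in prec V" "V \<subseteq> \<Union>(ks ` J) \<and> Suc (card J) = Suc n"
    then have J': "J \<subseteq> mingens prec" "support J = V" "J \<noteq> {}" "card J = n"
      using edges_in_iff[of J prec V] assms(1) by auto
    have "card J > 0" using finite_edges[OF J'(1)] J'(3) card_gt_0_iff by blast
    then have "bnd ?S n z J = 0" using J' by (intro z[rule_format]) (auto simp: cells_taylor cdim_taylor)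
    then show "(\<Sum>g\<in>edges_in prec V - J. esign g (insert g J) * z (insert g J)) = 0"
      using bnd_taylor_strand[OF J'(1-3), of z] J'(4) by simp
  qed
  ultimately obtain y where y: "\<And>I. I \<subseteq> edges_in prec V \<Longrightarrow> V \<subseteq> \<Union>(ks ` I) \<Longrightarrow> card I = Suc n \<Longrightarrow>
      z I = (\<Sum>g\<in>edges_in prec V - I. esign g (insert g I) * y (insert g I))"
    by (rule cover_exactE) (rule that)
  show "\<exists>y. \<forall>a\<in>lev ?S n. z a = bnd ?S (Suc n) y a"
  proof (rule exI[of _ y], rule ballI)
    fix a assume a: "a \<in> lev ?S n"
    then have a': "a \<noteq> {}" "a \<subseteq> mingens prec" "support a = V" "card a - 1 = n"
      by (auto simp: lev_def cells_taylor cdim_taylor)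
    have "card a > 0" using finite_edges[OF a'(2)] a'(1) card_gt_0_iff by blast
    then have "card a = Suc n" using a'(4) by simp
    then show "z a = bnd ?S (Suc n) y a"
      using y[of a] edges_in_iff[of a prec V] bnd_taylor_strand[OF a'(2,3,1), of y] a' by simp
  qed
qed

lemma bd_taylor_nonzero:
  assumes "I \<subseteq> mingens prec" "bd (taylor prec) I J \<noteq> (0 :: ('n::{finite,linorder}, 'k::field) mpoly)"
  shows "J \<subseteq> I"
proof (rule ccontr)
  assume "\<not> J \<subseteq> I"
  then have "bd (taylor prec) I J = (0 :: ('n, 'k) mpoly)"
    unfolding taylor_def by (auto intro!: sum.neutral)
  then show False using assms by simp
qed

lemma gradedby_taylor:
  "gradedby support (taylor prec :: ('n::{finite,linorder} monom set, ('n, 'k::field) mpoly) based_complex)"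
proof -
  have "support c' \<subseteq> support c" if "(c, c') \<in> cedges (taylor prec :: ('n monom set, ('n, 'k) mpoly) based_complex)" for c c'
  proof -
    have c: "c \<subseteq> mingens prec" "c' \<subseteq> c"
      using that bd_taylor_nonzero by (auto simp: cedges_def cells_taylor)
    then have "finite c" "finite c'" using finite_edges finite_subset by blast+
    then show ?thesis using c by (auto simp: support_eq)
  qed
  then show ?thesis by (auto simp: gradedby_def)
qed

section \<open>Standard matchings\<close>

text \<open>Both ends of an edge of B have the same support, contained in that of L; so K is coprime
  to it, and K0 and K together extend the same edge.\<close>

lemma Field_coprime_extensions:
  assumes pres: "preserves support B" and cells: "Field B \<subseteq> {I. I \<noteq> {} \<and> I \<subseteq> mingens prec}"
    and L: "L \<in> Field (coprime_extensions prec B)" "K \<subseteq> mingens prec" "support L \<inter> support K = {}"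
  shows "L \<union> K \<in> Field (coprime_extensions prec B)"
proof -
  obtain I J K0 where IJ: "(I, J) \<in> B" "K0 \<subseteq> mingens prec" "mgcd (mlcm I) (mlcm K0) = 0"
    "L = I \<union> K0 \<or> L = J \<union> K0"
    using L(1) by (auto simp: coprime_extensions_def Field_def)
  have c: "I \<subseteq> mingens prec" "J \<subseteq> mingens prec" using IJ(1) cells by (auto simp: Field_def)
  have fin: "finite I" "finite J" "finite K0" "finite K" using c IJ(2) L(2) finite_edges by blast+
  have "support I = support J" using pres IJ(1) by (auto simp: preserves_def)
  then have "support I \<subseteq> support L" using IJ(4) fin by (auto simp: support_Un)
  then have "support I \<inter> support (K0 \<union> K) = {}"
    using L(3) IJ(3) fin by (auto simp: support_Un mgcd_mlcm)
  then have "(I \<union> (K0 \<union> K), J \<union> (K0 \<union> K)) \<in> coprime_extensions prec B"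
    unfolding coprime_extensions_def mgcd_mlcm using IJ(1,2) L(2)
    by (intro CollectI exI[of _ I] exI[of _ J] exI[of _ "K0 \<union> K"]) auto
  moreover have "L \<union> K = I \<union> (K0 \<union> K) \<or> L \<union> K = J \<union> (K0 \<union> K)" using IJ(4) by auto
  ultimately show ?thesis by (auto simp: Field_def)
qed

lemma B_subset_coprime_extensions: "B \<subseteq> coprime_extensions prec B"
proof
  fix e assume "e \<in> B"
  moreover have "mgcd (mlcm (fst e)) (mlcm {}) = 0" by (simp add: mgcd_mlcm)
  ultimately show "e \<in> coprime_extensions prec B"
    unfolding coprime_extensions_def
    by (intro CollectI exI[of _ "fst e"] exI[of _ "snd e"] exI[of _ "{}"]) simp
qed

locale two_step_matching =
  fixes prec :: "'n::{finite,linorder} \<Rightarrow> 'n \<Rightarrow> bool" and K :: "'k::field itself"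
    and N1 N2 :: "('n monom set \<times> 'n monom set) set list"
  assumes std: "standard_matching TYPE('k) prec [N1, N2]"
begin

abbreviation "T \<equiv> (taylor prec :: ('n monom set, ('n, 'k) mpoly) based_complex)"
abbreviation "U1 \<equiv> \<Union>(set N1)"
abbreviation "U2 \<equiv> \<Union>(set N2)"

lemma std_parts:
  "matching_sequence T (concat [N1, N2])"
  "\<forall>i<length [N1, N2]. \<forall>(I, J)\<in>\<Union>(set ([N1, N2] ! i)).
     mlcm I = mlcm J \<and> card I = card J + 1 \<and> cl J = cl I + i"
  "\<forall>(I, J)\<in>cedges (foldl morse_complex T (concat [N1, N2])). mlcm I \<noteq> mlcm J"
  "\<forall>i<length [N1, N2]. \<exists>B.
     generated_by prec (\<Union>(set (concat (take i [N1, N2])))) (\<Union>(set ([N1, N2] ! i))) B \<and>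
     (\<forall>(I, J)\<in>B. cl I = 1 \<and> cl J = i + 1)"
  using std unfolding standard_matching_def Let_def by blast+

lemma whole_sequence: "matching_sequence T (N1 @ N2)"
  using std_parts(1) by simp

lemma edge1: "(I, J) \<in> U1 \<Longrightarrow> mlcm I = mlcm J \<and> card I = card J + 1 \<and> cl J = cl I"
  using std_parts(2)[rule_format, of 0] by force

lemma edge2: "(I, J) \<in> U2 \<Longrightarrow> mlcm I = mlcm J \<and> card I = card J + 1 \<and> cl J = cl I + 1"
  using std_parts(2)[rule_format, of 1] by force

lemma final: "(I, J) \<in> cedges (foldl morse_complex T (N1 @ N2)) \<Longrightarrow> mlcm I \<noteq> mlcm J"
  using std_parts(3) by auto

lemma generated: "\<exists>B. generated_by prec {} U1 B \<and> (\<forall>(I, J)\<in>B. cl I = 1 \<and> cl J = 1)"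
  using std_parts(4)[rule_format, of 0] by simp

lemma first_sequence: "matching_sequence T N1" and second_sequence: "matching_sequence (foldl morse_complex T N1) N2"
  using whole_sequence by (auto simp: matching_sequence_append)

lemma cells1: "Field U1 \<subseteq> cells T" using matching_sequence_cells[OF first_sequence] .

lemma cells2: "Field U2 \<subseteq> cells T - Field U1"
  using matching_sequence_cells[OF second_sequence] by (simp add: cells_sequence)

lemma Field_cells: "I \<in> Field U1 \<or> I \<in> Field U2 \<Longrightarrow> I \<noteq> {} \<and> I \<subseteq> mingens prec"
  using cells1 cells2 by (auto simp: cells_taylor)

lemma preserves_all: "M \<in> set (N1 @ N2) \<Longrightarrow> preserves support M"
  using edge1 edge2 by (fastforce simp: preserves_def support_def)

lemma preserves_U1: "preserves support U1"
  using edge1 by (fastforce simp: preserves_def support_def)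

text \<open>Nothing is matched before the first matching, so the ends of all coprime extensions are
  matched by it. The contrapositive passes unmatchedness on to the parts of a disconnected
  set.\<close>

lemma U1_closed:
  assumes "L \<in> Field U1" "A \<subseteq> mingens prec" "support L \<inter> support A = {}"
  shows "L \<union> A \<in> Field U1"
proof -
  obtain B where B: "B \<subseteq> U1" "U1 \<subseteq> B \<union> coprime_extensions prec B"
    "Field (coprime_extensions prec B) \<subseteq> Field U1"
    using generated by (auto simp: generated_by_def)
  have "Field U1 \<subseteq> Field (coprime_extensions prec B)"
    using B(2) B_subset_coprime_extensions[of B prec] by (intro mono_Field) auto
  moreover have "Field B \<subseteq> {I. I \<noteq> {} \<and> I \<subseteq> mingens prec}"
    using mono_Field[OF B(1)] cells1 by (auto simp: cells_taylor)
  moreover have "preserves support B" using preserves_U1 B(1) unfolding preserves_def by blast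
  ultimately show ?thesis
    using Field_coprime_extensions[of B prec L A] assms B(3) by blast
qed

text \<open>Both parts of L are unmatched by \<open>U1_closed\<close> and have smaller supports. The
  induction hypothesis appears as a parameter because the lemma is also applied to a partner having
  the same support as the set under induction.\<close>

lemma unmatched1_split:
  assumes L: "L \<subseteq> mingens prec" "L \<noteq> {}" "L \<notin> Field U1" "cl L \<noteq> 1"
    and IH: "\<And>A. card (support A) < card (support L) \<Longrightarrow> A \<subseteq> mingens prec \<Longrightarrow> A \<noteq> {} \<Longrightarrow>
      A \<notin> Field U1 \<Longrightarrow> excess0 A"
  shows "excess0 L"
proof -
  obtain A C where AC: "L = A \<union> C" "A \<noteq> {}" "C \<noteq> {}" "support A \<inter> support C = {}"
    by (rule cl_split[OF L(1,4,2)])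
  have sub: "A \<subseteq> mingens prec" "C \<subseteq> mingens prec" using L(1) AC by auto
  have fin: "finite A" "finite C" using sub finite_edges by blast+
  have "support A \<noteq> {}" "support C \<noteq> {}" using support_nonempty sub AC by blast+
  then have "card (support A) > 0" "card (support C) > 0" by (simp_all add: card_gt_0_iff support_def)
  moreover have "card (support L) = card (support A) + card (support C)"
    unfolding AC(1) support_Un[OF fin] using AC(4) by (intro card_Un_disjoint) (auto simp: support_def)
  moreover have "A \<notin> Field U1" using U1_closed[of A C] L(3) AC sub by auto
  moreover have "C \<notin> Field U1" using U1_closed[of C A] L(3) AC sub by (auto simp: Un_commute)
  ultimately have "excess0 A" "excess0 C" using IH sub AC by auto
  then show ?thesis unfolding AC(1) by (intro excess0_Un[OF sub AC(4)])
qed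

text \<open>From |supp(L)| edges on, the Taylor strand is exact and so is that of the final Morse
  complex. The latter has no edges within a multidegree, hence no cells there.\<close>

lemma final_cell_small:
  assumes L: "L \<subseteq> mingens prec" "L \<noteq> {}" "L \<notin> Field U1" "L \<notin> Field U2"
  shows "card L < card (support L)"
proof (rule ccontr)
  assume n: "\<not> card L < card (support L)"
  let ?Y = "foldl morse_complex T (N1 @ N2)"
  let ?V = "support L"
  have cY: "cells ?Y = cells T - Field (U1 \<union> U2)" "cdim ?Y = cdim T"
    using cells_sequence[of T "N1 @ N2"] by simp_all
  have V: "?V \<noteq> {}" using support_nonempty L by blast
  have "card L > 0" using finite_edges[OF L(1)] L(2) by (simp add: card_gt_0_iff)
  then have "card ?V \<le> Suc (card L - 1)" using n by simp
  then have "exact_at (strand support ?V T) (card L - 1)" by (intro taylor_strand_exact V)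
  then have "exact_at (strand support ?V ?Y) (card L - 1)"
    using strand_sequence_exact[OF whole_sequence _ gradedby_taylor complex_ok_taylor_strand] preserves_all by blast
  moreover have "\<forall>(c, c')\<in>cedges ?Y. support c \<noteq> support c'"
  proof safe
    fix c c' assume e: "(c, c') \<in> cedges ?Y" "support c = support c'"
    then have "c \<subseteq> mingens prec" "c' \<subseteq> mingens prec" using cY by (auto simp: cedges_def cells_taylor)
    then have "mlcm c = mlcm c'" using e(2) mlcm_eq_iff by blast
    then show False using final[OF e(1)] by simp
  qed
  moreover have "finite (cells ?Y)" unfolding cY using finite_cells_taylor by blast
  moreover have "L \<in> cells ?Y" unfolding cY using L by (simp add: cells_taylor Field_Un)
  moreover have "cdim ?Y L = card L - 1" unfolding cY cdim_taylor ..
  ultimately show False by (intro no_cell_if_exact[where s = support and Y = ?Y and c = L]) auto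
qed

lemma unmatched1_excess0:
  assumes "L \<subseteq> mingens prec" "L \<noteq> {}" "L \<notin> Field U1"
  shows "excess0 L"
  using assms
proof (induction "card (support L)" arbitrary: L rule: less_induct)
  case less
  show ?case
  proof (cases "cl L = 1")
    case False
    then show ?thesis using unmatched1_split[of L] less by blast
  next
    case True
    consider "L \<notin> Field U2" | J where "(L, J) \<in> U2" | I where "(I, L) \<in> U2"
      by (auto simp: Field_def)
    then show ?thesis
    proof cases
      case 1
      \<comment> \<open>A connected set has at least |supp(L)| - 1 edges, so this bound leaves only
        the forest.\<close>
      then have "card L < card (support L)" using final_cell_small less by blast
      then show ?thesis using True card_support_le[OF less.prems(1)] by (simp add: excess0_def)
    next
      case 2
      note e = edge2[OF 2]
      have "J \<in> Field U2" using 2 by (auto simp: Field_def)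
      then have J: "J \<subseteq> mingens prec" "J \<noteq> {}" "J \<notin> Field U1" using cells2 by (auto simp: cells_taylor)
      have s: "support J = support L" using e by (simp add: support_def)
      \<comment> \<open>J has two classes and the same support as L, so the induction hypothesis
        applies to its parts but not to J itself.\<close>
      have "excess0 J"
      proof (rule unmatched1_split[OF J(1,2,3)])
        show "cl J \<noteq> 1" using e True by simp
        show "excess0 A" if "card (support A) < card (support J)" "A \<subseteq> mingens prec" "A \<noteq> {}"
          "A \<notin> Field U1" for A using less.hyps[of A] s that by simp
      qed
      \<comment> \<open>L has one edge more and one class fewer than J.\<close>
      then show ?thesis using e s by (simp add: excess0_def)
    next
      case 3
      \<comment> \<open>A lower end in the second matching has at least two classes, so this case
        cannot occur.\<close>
      have "I \<in> Field U2" using 3 by (auto simp: Field_def)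
      then have "cl I \<ge> 1" using Field_cells cl_pos by blast
      then show ?thesis using edge2[OF 3] True by simp
    qed
  qed
qed

lemma unmatched_euler:
  shows "(\<Sum>I\<in>{I \<in> unmatched prec (U1 \<union> U2). support I = V}. (- 1) ^ card I :: int) =
      (\<Sum>I\<in>{I. I \<noteq> {} \<and> I \<subseteq> mingens prec \<and> support I = V}. (- 1) ^ card I)"
    and "(\<Sum>I\<in>{I \<in> unmatched prec U1. support I = V}. (- 1) ^ card I :: int) =
      (\<Sum>I\<in>{I. I \<noteq> {} \<and> I \<subseteq> mingens prec \<and> support I = V}. (- 1) ^ card I)"
proof -
  have s: "preserves support M \<and> (\<forall>(c, c')\<in>M. (- 1) ^ card c = - ((- 1) ^ card c' :: int))"
    if M: "M \<in> set (N1 @ N2)" for M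
  proof -
    have "card c = card c' + 1" if "(c, c') \<in> M" for c c'
      using M that edge1[of c c'] edge2[of c c'] by auto
    then show ?thesis using preserves_all[OF M] by fastforce
  qed
  have a: "{c \<in> cells T. support c = V} = {I. I \<noteq> {} \<and> I \<subseteq> mingens prec \<and> support I = V}"
    by (auto simp: cells_taylor)
  have b: "{c \<in> cells T - Field M. support c = V} = {I \<in> unmatched prec M. support I = V}" for M
    by (auto simp: cells_taylor unmatched_def)
  show "(\<Sum>I\<in>{I \<in> unmatched prec (U1 \<union> U2). support I = V}. (- 1) ^ card I :: int) =
      (\<Sum>I\<in>{I. I \<noteq> {} \<and> I \<subseteq> mingens prec \<and> support I = V}. (- 1) ^ card I)"
    using euler_sequence[OF whole_sequence finite_cells_taylor, of support "\<lambda>I. (- 1) ^ card I" V] s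
    unfolding a b set_append Union_Un_distrib by blast
  show "(\<Sum>I\<in>{I \<in> unmatched prec U1. support I = V}. (- 1) ^ card I :: int) =
      (\<Sum>I\<in>{I. I \<noteq> {} \<and> I \<subseteq> mingens prec \<and> support I = V}. (- 1) ^ card I)"
    using euler_sequence[OF first_sequence finite_cells_taylor, of support "\<lambda>I. (- 1) ^ card I" V] s
    unfolding a b set_append by blast
qed

end

section \<open>Dimensions of homology and long exact sequences\<close>

lemma lookup_pscale [simp]: "lk (pscale c v) k = c * lk v k"
  by (simp add: pscale_def Poly_Mapping.map.rep_eq when_def)

global_interpretation pm: vector_space "pscale :: 'k::field \<Rightarrow> ('b \<Rightarrow>\<^sub>0 'k) \<Rightarrow> 'b \<Rightarrow>\<^sub>0 'k"
  by unfold_locales (auto intro!: poly_mapping_eqI simp: lookup_add algebra_simps)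

text \<open>A relational counterpart of \<open>quot_dim\<close> with an indexed family of
  representatives, so that bases can be concatenated along exact sequences.\<close>

definition has_quot_dim :: "('b \<Rightarrow>\<^sub>0 'k::field) set \<Rightarrow> ('b \<Rightarrow>\<^sub>0 'k) set \<Rightarrow> nat \<Rightarrow> bool" where
  "has_quot_dim V U n \<longleftrightarrow> (\<exists>b :: nat \<Rightarrow> ('b \<Rightarrow>\<^sub>0 'k). (\<forall>i<n. b i \<in> V) \<and>
     (\<forall>v\<in>V. \<exists>c. v - (\<Sum>i<n. pscale (c i) (b i)) \<in> U) \<and>
     (\<forall>c. (\<Sum>i<n. pscale (c i) (b i)) \<in> U \<longrightarrow> (\<forall>i<n. c i = 0)))"

lemma has_quot_dim_0_iff: "has_quot_dim V U 0 \<longleftrightarrow> V \<subseteq> U"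
  by (auto simp: has_quot_dim_def)

text \<open>Exchange modulo U: every element of B2 is congruent to an element of the span of B1. As
  the span of B2 meets U only in 0, this replacement is injective and preserves
  independence.\<close>

lemma independent_mod_le:
  fixes U :: "('b \<Rightarrow>\<^sub>0 'k::field) set"
  assumes U: "pm.subspace U" and B1: "finite B1" "V \<subseteq> pm.span (B1 \<union> U)"
    and B2: "B2 \<subseteq> V" "pm.independent B2" "pm.span B2 \<inter> U = {0}"
  shows "finite B2 \<and> card B2 \<le> card B1"
proof -
  have "\<exists>y. y \<in> pm.span B1 \<and> x - y \<in> U" if "x \<in> B2" for x
  proof -
    have "x \<in> pm.span (B1 \<union> U)" using that B1 B2 by auto
    then obtain a b where "a \<in> pm.span B1" "b \<in> pm.span U" "x = a + b" by (auto simp: pm.span_Un)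
    then show ?thesis using pm.span_eq_iff[THEN iffD2, OF U] by (intro exI[of _ a]) auto
  qed
  then obtain p where p: "\<And>x. x \<in> B2 \<Longrightarrow> p x \<in> pm.span B1 \<and> x - p x \<in> U" by metis
  have in0: "x = 0" if "x \<in> pm.span B2" "x \<in> U" for x using B2(3) that by auto
  have inj: "inj_on p B2"
  proof (rule inj_onI)
    fix x y assume xy: "x \<in> B2" "y \<in> B2" "p x = p y"
    have "x - p x \<in> U" "y - p y \<in> U" using p[OF xy(1)] p[OF xy(2)] by auto
    then have "(x - p x) - (y - p y) \<in> U" by (rule pm.subspace_diff[OF U])
    then have "x - y \<in> U" using xy by simp
    moreover have "x - y \<in> pm.span B2" using xy by (intro pm.span_diff pm.span_base)
    ultimately show "x = y" using in0 by fastforce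
  qed
  have "pm.independent (p ` B2)"
    unfolding pm.independent_explicit_finite_subsets
  proof (intro allI impI ballI)
    fix S u v assume S: "S \<subseteq> p ` B2" "finite S" "(\<Sum>v\<in>S. pscale (u v) v) = 0" "v \<in> S"
    define S' where "S' = B2 \<inter> p -` S"
    have S': "S = p ` S'" "S' \<subseteq> B2" using S(1) by (auto simp: S'_def)
    have injS: "inj_on p S'" using inj S'(2) inj_on_subset by blast
    have fin: "finite S'" using finite_imageD[OF _ injS] S(2) S'(1) by simp
    have "(\<Sum>x\<in>S'. pscale (u (p x)) (p x)) = 0" using S(3) S'(1) injS by (simp add: sum.reindex)
    moreover have "(\<Sum>x\<in>S'. pscale (u (p x)) (x - p x)) \<in> U"
      using p S'(2) U by (intro pm.subspace_sum pm.subspace_scale) auto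
    ultimately have "(\<Sum>x\<in>S'. pscale (u (p x)) x) \<in> U"
      by (simp add: pm.scale_right_diff_distrib sum_subtractf)
    moreover have "(\<Sum>x\<in>S'. pscale (u (p x)) x) \<in> pm.span B2"
      using S'(2) by (intro pm.span_sum pm.span_scale pm.span_base) auto
    ultimately have "(\<Sum>x\<in>S'. pscale (u (p x)) x) = 0" by (rule in0[rotated])
    then have "\<forall>x\<in>S'. u (p x) = 0"
      using B2(2)[unfolded pm.independent_explicit_finite_subsets, rule_format, of S' "\<lambda>x. u (p x)"] S'(2) fin by auto
    then show "u v = 0" using S(4) S'(1) by auto
  qed
  then have "finite (p ` B2) \<and> card (p ` B2) \<le> card B1"
    using p by (intro pm.independent_span_bound[OF B1(1)]) auto
  then show ?thesis using finite_imageD[OF _ inj] card_image[OF inj] by auto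
qed

lemma quot_dim_eq:
  fixes U V :: "('b \<Rightarrow>\<^sub>0 'k::field) set"
  assumes U: "pm.subspace U" and "has_quot_dim V U n"
  shows "quot_dim V U = n"
proof -
  obtain b :: "nat \<Rightarrow> ('b \<Rightarrow>\<^sub>0 'k)" where b: "\<And>i. i < n \<Longrightarrow> b i \<in> V"
    "\<And>v. v \<in> V \<Longrightarrow> \<exists>c. v - (\<Sum>i<n. pscale (c i) (b i)) \<in> U"
    "\<And>c. (\<Sum>i<n. pscale (c i) (b i)) \<in> U \<Longrightarrow> (\<forall>i<n. c i = 0)"
    using assms(2) unfolding has_quot_dim_def by blast
  have inj: "inj_on b {..<n}"
  proof (rule inj_onI, rule ccontr)
    fix i j assume ij: "i \<in> {..<n}" "j \<in> {..<n}" "b i = b j" "i \<noteq> j"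
    \<comment> \<open>Two equal members of the family would satisfy a nontrivial relation, their
      difference.\<close>
    define c where "c k = (if k = i then 1 else 0) - (if k = j then 1 else (0::'k))" for k
    have "(\<Sum>k<n. pscale (c k) (b k)) =
        (\<Sum>k<n. if k = i then b k else 0) - (\<Sum>k<n. if k = j then b k else 0)"
      unfolding sum_subtractf[symmetric] by (intro sum.cong refl) (auto simp: c_def)
    also have "\<dots> = 0" using ij by simp
    finally have "c i = 0" using b(3)[of c] ij U pm.subspace_0 by auto
    then show False using ij by (simp add: c_def)
  qed
  define B where "B = b ` {..<n}"
  have fin: "finite B" and card: "card B = n" using card_image[OF inj] by (auto simp: B_def)
  have sumB: "(\<Sum>v\<in>B. pscale (u v) v) = (\<Sum>i<n. pscale (u (b i)) (b i))" for u
    unfolding B_def by (simp add: sum.reindex[OF inj])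
  have ind: "pm.independent B"
    unfolding pm.independent_explicit_finite_subsets
  proof (intro allI impI ballI)
    fix S u v assume S: "S \<subseteq> B" "finite S" "(\<Sum>v\<in>S. pscale (u v) v) = 0" "v \<in> S"
    define u' where "u' x = (if x \<in> S then u x else 0)" for x
    have "(\<Sum>v\<in>B. pscale (u' v) v) = (\<Sum>v\<in>S. pscale (u v) v)"
      using S fin by (intro sum.mono_neutral_cong_right) (auto simp: u'_def)
    then have "(\<Sum>i<n. pscale (u' (b i)) (b i)) \<in> U" using S(3) sumB[of u'] U pm.subspace_0 by auto
    then have "\<forall>i<n. u' (b i) = 0" by (rule b(3))
    moreover obtain i where "i < n" "v = b i" using S by (auto simp: B_def)
    ultimately show "u v = 0" using S(4) by (auto simp: u'_def)
  qed
  have spanB: "pm.span B \<inter> U = {0}"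
  proof -
    have "x = 0" if xB: "x \<in> pm.span B" "x \<in> U" for x
    proof -
      obtain u where "x = (\<Sum>v\<in>B. pscale (u v) v)" using xB(1) unfolding pm.span_finite[OF fin] by blast
      then have x: "x = (\<Sum>i<n. pscale (u (b i)) (b i))" using sumB by simp
      then have "\<forall>i<n. u (b i) = 0" using xB(2) by (intro b(3)) simp
      then show ?thesis unfolding x by (intro sum.neutral) simp
    qed
    then show ?thesis using pm.span_zero pm.subspace_0[OF U] by auto
  qed
  have sup: "V \<subseteq> pm.span (B \<union> U)"
  proof
    fix v assume "v \<in> V"
    then obtain c where c: "v - (\<Sum>i<n. pscale (c i) (b i)) \<in> U" using b(2) by blast
    have "(\<Sum>i<n. pscale (c i) (b i)) \<in> pm.span (B \<union> U)"
      by (intro pm.span_sum pm.span_scale pm.span_base) (auto simp: B_def)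
    moreover have "v - (\<Sum>i<n. pscale (c i) (b i)) \<in> pm.span (B \<union> U)" using c by (intro pm.span_base) auto
    ultimately have "(v - (\<Sum>i<n. pscale (c i) (b i))) + (\<Sum>i<n. pscale (c i) (b i)) \<in> pm.span (B \<union> U)"
      by (rule pm.span_add[rotated])
    then show "v \<in> pm.span (B \<union> U)" by simp
  qed
  let ?Q = "\<lambda>B. B \<subseteq> V \<and> pm.independent B \<and> pm.span B \<inter> U = {0} \<and> V \<subseteq> pm.span (B \<union> U)"
  have QB: "?Q B" using b(1) ind spanB sup by (auto simp: B_def)
  then have Q: "?Q (SOME B. ?Q B)" by (rule someI[of ?Q])
  let ?B = "SOME B. ?Q B"
  have 1: "finite ?B \<and> card ?B \<le> card B"
    using Q by (intro independent_mod_le[OF U fin sup]) auto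
  then have "card B \<le> card ?B"
    using Q QB independent_mod_le[OF U, of ?B V B] by auto
  then show ?thesis using 1 card by (simp add: quot_dim_def)
qed

definition lin :: "(('b \<Rightarrow>\<^sub>0 'k::field) \<Rightarrow> ('c \<Rightarrow>\<^sub>0 'k)) \<Rightarrow> bool" where
  "lin f \<longleftrightarrow> (\<forall>x y. f (x + y) = f x + f y) \<and> (\<forall>c x. f (pscale c x) = pscale c (f x))"

lemma linD:
  assumes "lin f"
  shows "f (x + y) = f x + f y" "f (pscale c x) = pscale c (f x)" "f 0 = 0" "f (- x) = - f x"
    "f (x - y) = f x - f y" "f (sum h S) = (\<Sum>i\<in>S. f (h i))"
proof -
  show a: "f (x + y) = f x + f y" "f (pscale c x) = pscale c (f x)" for x y c using assms by (auto simp: lin_def)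
  show 0: "f 0 = 0" using a(1)[of 0 0] by simp
  show m: "f (- x) = - f x" for x using a(1)[of x "- x"] 0 by (simp add: eq_neg_iff_add_eq_0 add.commute)
  show "f (x - y) = f x - f y" using a(1)[of x "- y"] m by simp
  show "f (sum h S) = (\<Sum>i\<in>S. f (h i))"
    by (induction S rule: infinite_finite_induct) (auto simp: 0 a)
qed

lemma sum_lessThan_add: "sum F {..<n + m} = sum F {..<n} + (\<Sum>j<m. F (n + j))" for F :: "nat \<Rightarrow> 'a::comm_monoid_add"
  by (induction m) (auto simp: add.assoc)

text \<open>The sequence 0 -> V/U -> V'/U' -> V''/U'' -> 0 is given on representatives, so exactness
  becomes a set of congruences. Images of the first family and lifts of the last one form the middle
  family.\<close>

lemma has_quot_dim_ses:
  fixes g :: "('b \<Rightarrow>\<^sub>0 'k::field) \<Rightarrow> ('c \<Rightarrow>\<^sub>0 'k)" and f :: "('c \<Rightarrow>\<^sub>0 'k) \<Rightarrow> ('d \<Rightarrow>\<^sub>0 'k)"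
  assumes lg: "lin g" and lf: "lin f"
    and sU': "pm.subspace U'" and sU'': "pm.subspace U''" and sV: "pm.subspace V" and sV': "pm.subspace V'"
    and g: "\<And>v. v \<in> V \<Longrightarrow> g v \<in> V'" "\<And>v. v \<in> U \<Longrightarrow> g v \<in> U'" "\<And>v. v \<in> V \<Longrightarrow> g v \<in> U' \<Longrightarrow> v \<in> U"
    and f: "\<And>v. v \<in> V' \<Longrightarrow> f v \<in> V''" "\<And>v. v \<in> U' \<Longrightarrow> f v \<in> U''" "\<And>v. v \<in> V \<Longrightarrow> f (g v) \<in> U''"
      "\<And>w. w \<in> V'' \<Longrightarrow> \<exists>v\<in>V'. f v - w \<in> U''" "\<And>v. v \<in> V' \<Longrightarrow> f v \<in> U'' \<Longrightarrow> \<exists>w\<in>V. v - g w \<in> U'"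
    and n: "has_quot_dim V U n" and m: "has_quot_dim V'' U'' m"
  shows "has_quot_dim V' U' (n + m)"
proof -
  obtain b where b: "\<And>i. i < n \<Longrightarrow> b i \<in> V"
    "\<And>v. v \<in> V \<Longrightarrow> \<exists>c. v - (\<Sum>i<n. pscale (c i) (b i)) \<in> U"
    "\<And>c. (\<Sum>i<n. pscale (c i) (b i)) \<in> U \<Longrightarrow> (\<forall>i<n. c i = 0)"
    using n unfolding has_quot_dim_def by blast
  obtain b2 where b2: "\<And>i. i < m \<Longrightarrow> b2 i \<in> V''"
    "\<And>v. v \<in> V'' \<Longrightarrow> \<exists>c. v - (\<Sum>i<m. pscale (c i) (b2 i)) \<in> U''"
    "\<And>c. (\<Sum>i<m. pscale (c i) (b2 i)) \<in> U'' \<Longrightarrow> (\<forall>i<m. c i = 0)"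
    using m unfolding has_quot_dim_def by blast
  have "\<exists>v. i < m \<longrightarrow> v \<in> V' \<and> f v - b2 i \<in> U''" for i using f(4) b2(1) by blast
  then obtain l where l: "\<And>i. i < m \<Longrightarrow> l i \<in> V' \<and> f (l i) - b2 i \<in> U''" by metis
  define b' where "b' i = (if i < n then g (b i) else l (i - n))" for i
  have split: "(\<Sum>i<n + m. pscale (c i) (b' i)) =
      g (\<Sum>i<n. pscale (c i) (b i)) + (\<Sum>j<m. pscale (c (n + j)) (l j))" for c
    unfolding sum_lessThan_add linD(6)[OF lg] by (simp add: b'_def linD(2)[OF lg])
  have bV: "(\<Sum>i<n. pscale (c i) (b i)) \<in> V" for c
    using b(1) sV by (intro pm.subspace_sum pm.subspace_scale) auto
  have lV: "(\<Sum>j<m. pscale (c j) (l j)) \<in> V'" for c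
    using l sV' by (intro pm.subspace_sum pm.subspace_scale) auto
  have fl: "f (\<Sum>j<m. pscale (c j) (l j)) - (\<Sum>j<m. pscale (c j) (b2 j)) \<in> U''" for c
  proof -
    have "(\<Sum>j<m. pscale (c j) (f (l j) - b2 j)) \<in> U''"
      using l sU'' by (intro pm.subspace_sum pm.subspace_scale) auto
    then show ?thesis by (simp add: linD[OF lf] pm.scale_right_diff_distrib sum_subtractf)
  qed
  have 1: "\<forall>i<n + m. b' i \<in> V'" using b(1) l g(1) by (auto simp: b'_def)
  have 2: "\<exists>c. v - (\<Sum>i<n + m. pscale (c i) (b' i)) \<in> U'" if v: "v \<in> V'" for v
  proof -
    obtain c2 where c2: "f v - (\<Sum>i<m. pscale (c2 i) (b2 i)) \<in> U''" using b2(2) f(1) v by blast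
    define v1 where "v1 = v - (\<Sum>j<m. pscale (c2 j) (l j))"
    have "v1 \<in> V'" using v lV sV' by (simp add: v1_def pm.subspace_diff)
    moreover have "f v1 \<in> U''"
      using pm.subspace_diff[OF sU'' c2 fl[of c2]] by (simp add: v1_def linD[OF lf])
    ultimately obtain w where w: "w \<in> V" "v1 - g w \<in> U'" using f(5) by blast
    obtain c where c: "w - (\<Sum>i<n. pscale (c i) (b i)) \<in> U" using b(2) w by blast
    have "g (w - (\<Sum>i<n. pscale (c i) (b i))) \<in> U'" using c g(2) by blast
    then have "v1 - g w + (g w - g (\<Sum>i<n. pscale (c i) (b i))) \<in> U'"
      using w(2) sU' pm.subspace_add linD(5)[OF lg] by metis
    then have "v - (\<Sum>i<n + m. pscale ((\<lambda>i. if i < n then c i else c2 (i - n)) i) (b' i)) \<in> U'"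
      unfolding split by (simp add: v1_def algebra_simps)
    then show ?thesis by (rule exI[of _ "\<lambda>i. if i < n then c i else c2 (i - n)"])
  qed
  have 3: "\<forall>i<n + m. c i = 0" if c: "(\<Sum>i<n + m. pscale (c i) (b' i)) \<in> U'" for c
  proof -
    have "f (\<Sum>i<n + m. pscale (c i) (b' i)) \<in> U''" using c f(2) by blast
    then have "f (\<Sum>j<m. pscale (c (n + j)) (l j)) \<in> U''"
      using pm.subspace_diff[OF sU'' _ f(3)[OF bV[of c]]] unfolding split linD(1)[OF lf]
      by (metis add_diff_cancel_left')
    then have "(\<Sum>j<m. pscale (c (n + j)) (b2 j)) \<in> U''"
      using pm.subspace_diff[OF sU'' _ fl[of "\<lambda>j. c (n + j)"]] by fastforce
    then have cm: "\<forall>j<m. c (n + j) = 0" by (rule b2(3))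
    then have "g (\<Sum>i<n. pscale (c i) (b i)) \<in> U'" using c unfolding split by simp
    then have "(\<Sum>i<n. pscale (c i) (b i)) \<in> U" using g(3) bV by blast
    then have "\<forall>i<n. c i = 0" by (rule b(3))
    then show ?thesis using cm by (metis le_add_diff_inverse nat_add_left_cancel_less not_less)
  qed
  show ?thesis unfolding has_quot_dim_def using 1 2 3 by blast
qed

section \<open>Complexes cut out of a family of linear maps by sets of labels\<close>

definition restr :: "'b set \<Rightarrow> ('b \<Rightarrow>\<^sub>0 'k::zero) \<Rightarrow> 'b \<Rightarrow>\<^sub>0 'k" where
  "restr Y x = Poly_Mapping.mapp (\<lambda>b a. if b \<in> Y then a else 0) x"

lemma lookup_restr [simp]: "lk (restr Y x) b = (if b \<in> Y then lk x b else 0)"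
  by (simp add: restr_def lookup_mapp when_def in_keys_iff)

lemma keys_restr [simp]: "ks (restr Y x) = ks x \<inter> Y"
  by (auto simp: in_keys_iff split: if_splits)

lemma lin_restr: "lin (restr Y)"
  by (auto simp: lin_def lookup_add intro!: poly_mapping_eqI)

lemma restr_id: "ks x \<subseteq> Y \<Longrightarrow> restr Y x = x"
  by (rule poly_mapping_eqI) (auto simp: in_keys_iff)

definition span_on :: "'b set \<Rightarrow> ('b \<Rightarrow>\<^sub>0 'k::zero) set" where "span_on Y = {x. ks x \<subseteq> Y}"

lemma restr_span_on [simp]: "restr Y x \<in> span_on Y" by (simp add: span_on_def)

lemma span_on_iff: "x \<in> span_on Y \<longleftrightarrow> (\<forall>k. k \<notin> Y \<longrightarrow> lk x k = 0)"
  by (auto simp: span_on_def in_keys_iff)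

lemma subspace_span_on: "pm.subspace (span_on Y)"
  unfolding pm.subspace_def by (auto simp: span_on_iff lookup_add)

text \<open>A sequence of linear maps and a choice of basis labels in each degree give a complex
  once the maps are followed by the projection to the span of the labels.\<close>

definition res_diff :: "(nat \<Rightarrow> ('b \<Rightarrow>\<^sub>0 'k::field) \<Rightarrow> ('b \<Rightarrow>\<^sub>0 'k)) \<Rightarrow> (nat \<Rightarrow> 'b set) \<Rightarrow> nat \<Rightarrow> ('b \<Rightarrow>\<^sub>0 'k) \<Rightarrow> ('b \<Rightarrow>\<^sub>0 'k)" where
  "res_diff D Y i x = (case i of 0 \<Rightarrow> 0 | Suc j \<Rightarrow> restr (Y j) (D i x))"

lemma res_diff_simps [simp]: "res_diff D Y 0 x = 0" "res_diff D Y (Suc j) x = restr (Y j) (D (Suc j) x)"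
  by (simp_all add: res_diff_def)

definition cycles where "cycles D Y i = {x \<in> span_on (Y i). res_diff D Y i x = 0}"
definition boundaries where "boundaries D Y i = res_diff D Y (Suc i) ` span_on (Y (Suc i))"

lemma lin_res_diff: "(\<And>i. lin (D i)) \<Longrightarrow> lin (res_diff D Y i)"
  by (cases i) (auto simp: lin_def res_diff_def linD[OF lin_restr])

lemma subspace_cycles: "(\<And>i. lin (D i)) \<Longrightarrow> pm.subspace (cycles D Y i)"
  using subspace_span_on[of "Y i"] linD(1,2,3)[OF lin_res_diff[of D Y i]] unfolding pm.subspace_def cycles_def
  by (auto simp del: res_diff_simps)

lemma subspace_boundaries: "(\<And>i. lin (D i)) \<Longrightarrow> pm.subspace (boundaries D Y i)"
  unfolding pm.subspace_def boundaries_def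
proof (intro conjI allI ballI)
  assume l: "\<And>i. lin (D i)"
  note s = subspace_span_on[of "Y (Suc i)", unfolded pm.subspace_def] and r = linD[OF lin_res_diff[OF l], symmetric]
  show "0 \<in> res_diff D Y (Suc i) ` span_on (Y (Suc i))"
    by (rule image_eqI[of _ _ 0]) (use s linD(3)[OF lin_res_diff[OF l]] in auto)
  show "x + y \<in> res_diff D Y (Suc i) ` span_on (Y (Suc i))"
    if "x \<in> res_diff D Y (Suc i) ` span_on (Y (Suc i))" "y \<in> res_diff D Y (Suc i) ` span_on (Y (Suc i))" for x y
    using that s r(1) by (auto simp del: res_diff_simps)
  show "pscale c x \<in> res_diff D Y (Suc i) ` span_on (Y (Suc i))" if "x \<in> res_diff D Y (Suc i) ` span_on (Y (Suc i))" for c x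
    using that s r(2) by (auto simp del: res_diff_simps)
qed

text \<open>By \<open>tri\<close> the labels Y2 span a subcomplex, and Y1 stands for the quotient;
  all three complexes use the same maps followed by different projections.\<close>

locale subcomplex =
  fixes D :: "nat \<Rightarrow> ('b \<Rightarrow>\<^sub>0 'k::field) \<Rightarrow> ('b \<Rightarrow>\<^sub>0 'k)" and Y Y1 Y2 :: "nat \<Rightarrow> 'b set"
  assumes lD: "\<And>i. lin (D i)"
    and Y: "\<And>i. Y i = Y1 i \<union> Y2 i" and disj: "\<And>i. Y1 i \<inter> Y2 i = {}"
    and tri: "\<And>i x. x \<in> span_on (Y2 (Suc i)) \<Longrightarrow> restr (Y1 i) (D (Suc i) x) = 0"
    and dd: "\<And>i x. x \<in> span_on (Y (Suc i)) \<Longrightarrow> res_diff D Y i (res_diff D Y (Suc i) x) = 0"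
begin

lemma span_on_sub: "x \<in> span_on (Y1 i) \<Longrightarrow> x \<in> span_on (Y i)" "x \<in> span_on (Y2 i) \<Longrightarrow> x \<in> span_on (Y i)"
  using Y by (auto simp: span_on_def)

lemma split: "x \<in> span_on (Y i) \<Longrightarrow> x = restr (Y1 i) x + restr (Y2 i) x"
  using Y[of i] disj[of i] by (intro poly_mapping_eqI) (auto simp: lookup_add span_on_iff)

lemma restricted_diff_quotient: "x \<in> span_on (Y i) \<Longrightarrow> res_diff D Y1 i (restr (Y1 i) x) = restr (Y1 (i - 1)) (res_diff D Y i x)"
proof (cases i)
  case (Suc j)
  assume x: "x \<in> span_on (Y i)"
  have "D i x = D i (restr (Y1 i) x) + D i (restr (Y2 i) x)"
    using split[OF x] linD(1)[OF lD[of i]] by metis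
  then have "restr (Y1 j) (D i x) = restr (Y1 j) (D i (restr (Y1 i) x))"
    using tri[of "restr (Y2 i) x" j] Suc by (simp add: linD[OF lin_restr])
  moreover have "restr (Y1 j) (restr (Y j) v) = restr (Y1 j) v" for v :: "'b \<Rightarrow>\<^sub>0 'k"
    using Y by (intro poly_mapping_eqI) auto
  ultimately show ?thesis by (simp add: Suc)
qed (simp add: linD[OF lin_restr])

lemma restricted_diff_sub: "x \<in> span_on (Y2 i) \<Longrightarrow> res_diff D Y2 i x = res_diff D Y i x"
proof (cases i)
  case (Suc j)
  assume "x \<in> span_on (Y2 i)"
  then have "restr (Y1 j) (D i x) = 0" using tri Suc by simp
  then have "lk (restr (Y1 j) (D i x)) b = 0" for b by (simp only: lookup_zero)
  then have "lk (D i x) b = 0" if "b \<in> Y1 j" for b using that by (metis lookup_restr)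
  then show ?thesis using Y[of j] Suc by (intro poly_mapping_eqI) auto
qed simp

lemma res_diff_span_on: "res_diff D Y (Suc i) x \<in> span_on (Y i)" by simp

lemma cycles_if: "(x :: 'b \<Rightarrow>\<^sub>0 'k) \<in> span_on (Y i) \<Longrightarrow> restr (Y1 i) x = 0 \<Longrightarrow> x \<in> span_on (Y2 i)"
  using split[of x i] restr_span_on[of "Y2 i" x] by simp

text \<open>The portion H_i(Y) -> H_i(Y1) -> H_(i-1)(Y2) of the long exact sequence, the last term
  being 0 for i = 0.\<close>

lemma les_vanish:
  assumes "cycles D Y i \<subseteq> boundaries D Y i" "\<And>j. i = Suc j \<Longrightarrow> cycles D Y2 j \<subseteq> boundaries D Y2 j"
  shows "cycles D Y1 i \<subseteq> boundaries D Y1 i"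
proof
  fix x assume x: "x \<in> cycles D Y1 i"
  then have xY: "x \<in> span_on (Y i)" "x \<in> span_on (Y1 i)" "res_diff D Y1 i x = 0" using span_on_sub by (auto simp: cycles_def)
  have rx: "restr (Y1 i) x = x" using xY(2) by (intro restr_id) (simp add: span_on_def)
  have "\<exists>y\<in>span_on (Y2 i). res_diff D Y i x = res_diff D Y i y"
  proof (cases i)
    case 0
    then show ?thesis by (intro bexI[of _ 0]) (auto simp: span_on_def)
  next
    case (Suc j)
    have "restr (Y1 j) (res_diff D Y i x) = 0" using restricted_diff_quotient[OF xY(1)] xY(3) rx Suc by simp
    then have "res_diff D Y i x \<in> span_on (Y2 j)" using cycles_if[of "res_diff D Y i x" j] res_diff_span_on Suc by blast
    moreover have "res_diff D Y j (res_diff D Y i x) = 0" using dd xY Suc by blast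
    ultimately have "res_diff D Y i x \<in> cycles D Y2 j" using restricted_diff_sub by (simp add: cycles_def)
    then obtain y where "y \<in> span_on (Y2 i)" "res_diff D Y i x = res_diff D Y2 i y" using assms(2)[OF Suc] Suc by (auto simp: boundaries_def)
    then show ?thesis using restricted_diff_sub[of y i] by auto
  qed
  then obtain y where y: "y \<in> span_on (Y2 i)" "res_diff D Y i x = res_diff D Y i y" by blast
  have "x - y \<in> span_on (Y i)" using xY(1) span_on_sub(2)[OF y(1)] subspace_span_on pm.subspace_diff by blast
  moreover have "res_diff D Y i (x - y) = 0" using y by (simp add: linD[OF lin_res_diff[OF lD]])
  ultimately have "x - y \<in> cycles D Y i" by (simp add: cycles_def)
  then obtain w where w: "w \<in> span_on (Y (Suc i))" "x - y = res_diff D Y (Suc i) w" using assms(1) by (auto simp: boundaries_def)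
  have "restr (Y1 i) y = 0" using y(1) disj[of i] by (intro poly_mapping_eqI) (auto simp: span_on_iff)
  then have "x = restr (Y1 i) (x - y)" using rx by (simp add: linD[OF lin_restr])
  also have "\<dots> = res_diff D Y1 (Suc i) (restr (Y1 (Suc i)) w)" using restricted_diff_quotient[OF w(1)] w(2) by simp
  finally show "x \<in> boundaries D Y1 i" unfolding boundaries_def by (rule image_eqI) simp
qed

text \<open>The portion H_(j+1)(Y2) -> H_(j+1)(Y) -> H_(j+1)(Y1) -> H_j(Y2) -> H_j(Y), with both
  outer terms 0. The connecting map is the differential of Y on a representative from the
  quotient.\<close>

lemma les_dim:
  assumes van2: "cycles D Y2 (Suc j) \<subseteq> boundaries D Y2 (Suc j)" and van: "cycles D Y j \<subseteq> boundaries D Y j"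
    and n: "has_quot_dim (cycles D Y (Suc j)) (boundaries D Y (Suc j)) n" and m: "has_quot_dim (cycles D Y2 j) (boundaries D Y2 j) m"
  shows "has_quot_dim (cycles D Y1 (Suc j)) (boundaries D Y1 (Suc j)) (n + m)"
proof -
  let ?i = "Suc j"
  let ?g = "restr (Y1 ?i)" and ?f = "res_diff D Y ?i"
  note r = linD[OF lin_res_diff[OF lD]] and lr = linD[OF lin_restr]
  note rY = linD[OF lin_res_diff[of D Y ?i, OF lD]] and rY2 = linD[OF lin_res_diff[of D Y2 ?i, OF lD]]
  have r1: "restr (Y1 i) x = x" if "x \<in> span_on (Y1 i)" for i and x :: "'b \<Rightarrow>\<^sub>0 'k"
    using that by (intro restr_id) (simp add: span_on_def)
  have r12: "restr (Y1 i) x = 0" if "x \<in> span_on (Y2 i)" for i and x :: "'b \<Rightarrow>\<^sub>0 'k"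
    using that disj[of i] by (intro poly_mapping_eqI) (auto simp: span_on_iff)
  have fcyc: "?f x \<in> cycles D Y2 j" if "x \<in> span_on (Y ?i)" "res_diff D Y1 ?i (restr (Y1 ?i) x) = 0" for x
  proof -
    have "restr (Y1 j) (?f x) = 0" using restricted_diff_quotient[OF that(1)] that(2) by simp
    then have "?f x \<in> span_on (Y2 j)" using cycles_if[OF res_diff_span_on] by blast
    then show ?thesis using dd[OF that(1)] restricted_diff_sub by (simp add: cycles_def)
  qed
  have diffch: "x - y \<in> span_on (Y i)" if "x \<in> span_on (Y i)" "y \<in> span_on (Y i)" for x y :: "'b \<Rightarrow>\<^sub>0 'k" and i
    using that subspace_span_on pm.subspace_diff by blast
  show ?thesis
  proof (rule has_quot_dim_ses[OF lin_restr lin_res_diff[OF lD] subspace_boundaries[OF lD] subspace_boundaries[OF lD]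
        subspace_cycles[OF lD] subspace_cycles[OF lD] _ _ _ _ _ _ _ _ n m])
    fix v assume v: "v \<in> cycles D Y ?i"
    then have vc: "v \<in> span_on (Y ?i)" "?f v = 0" by (simp_all add: cycles_def del: res_diff_simps)
    then show "?g v \<in> cycles D Y1 ?i" using restricted_diff_quotient[OF vc(1)] by (simp add: cycles_def lr del: res_diff_simps)
    \<comment> \<open>As v is a cycle, the differential of its quotient part is minus that of its
      part in Y2, hence a boundary there.\<close>
    have "?f (?g v) = - ?f (restr (Y2 ?i) v)"
      using arg_cong[OF split[OF vc(1)], of ?f] vc(2) unfolding r(1) by (simp add: eq_neg_iff_add_eq_0 del: res_diff_simps)
    also have "\<dots> = res_diff D Y2 ?i (- restr (Y2 ?i) v)"
      using restricted_diff_sub[of "restr (Y2 ?i) v" ?i] rY2(4) by (simp del: res_diff_simps)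
    finally show "?f (?g v) \<in> boundaries D Y2 j" unfolding boundaries_def
      by (rule image_eqI) (auto simp: span_on_def)
    show "v \<in> boundaries D Y ?i" if gv: "?g v \<in> boundaries D Y1 ?i"
    proof -
      obtain w where w: "w \<in> span_on (Y1 (Suc ?i))" "?g v = res_diff D Y1 (Suc ?i) w" using gv by (auto simp: boundaries_def simp del: res_diff_simps)
      have wY: "w \<in> span_on (Y (Suc ?i))" using w span_on_sub by blast
      \<comment> \<open>What remains of v is a cycle of the subcomplex, whose homology vanishes in
        this degree.\<close>
      let ?u = "v - res_diff D Y (Suc ?i) w"
      have u: "?u \<in> span_on (Y ?i)" by (rule diffch[OF vc(1) res_diff_span_on])
      have "restr (Y1 ?i) ?u = 0" using restricted_diff_quotient[OF wY] w r1[OF w(1)] by (simp add: lr del: res_diff_simps)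
      then have u2: "?u \<in> span_on (Y2 ?i)" using cycles_if[OF u] by blast
      have "?f ?u = 0" using vc(2) dd[OF wY] by (simp add: r del: res_diff_simps)
      then have "?u \<in> cycles D Y2 ?i" using u2 restricted_diff_sub[OF u2] by (simp add: cycles_def del: res_diff_simps)
      then obtain t where t: "t \<in> span_on (Y2 (Suc ?i))" "?u = res_diff D Y2 (Suc ?i) t" using van2 by (auto simp: boundaries_def simp del: res_diff_simps)
      then have "v = res_diff D Y (Suc ?i) (t + w)" using restricted_diff_sub[OF t(1)] by (simp add: r algebra_simps del: res_diff_simps)
      moreover have "t + w \<in> span_on (Y (Suc ?i))" using wY span_on_sub(2)[OF t(1)] subspace_span_on pm.subspace_add by blast
      ultimately show ?thesis unfolding boundaries_def by (rule image_eqI)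
    qed
  next
    fix v assume "v \<in> boundaries D Y ?i"
    then obtain w where w: "w \<in> span_on (Y (Suc ?i))" "v = res_diff D Y (Suc ?i) w" by (auto simp: boundaries_def simp del: res_diff_simps)
    then have "?g v = res_diff D Y1 (Suc ?i) (restr (Y1 (Suc ?i)) w)" using restricted_diff_quotient[OF w(1)] by (simp del: res_diff_simps)
    then show "?g v \<in> boundaries D Y1 ?i" unfolding boundaries_def by (rule image_eqI) simp
  next
    fix v assume v: "v \<in> cycles D Y1 ?i"
    then have vc: "v \<in> span_on (Y ?i)" "v \<in> span_on (Y1 ?i)" "res_diff D Y1 ?i v = 0" using span_on_sub by (auto simp: cycles_def simp del: res_diff_simps)
    show "?f v \<in> cycles D Y2 j" using fcyc[OF vc(1)] r1[OF vc(2)] vc(3) by simp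
    show "\<exists>w\<in>cycles D Y ?i. v - ?g w \<in> boundaries D Y1 ?i" if fv: "?f v \<in> boundaries D Y2 j"
    proof -
      obtain w where w: "w \<in> span_on (Y2 ?i)" "?f v = res_diff D Y2 ?i w" using fv by (auto simp: boundaries_def simp del: res_diff_simps)
      have "v - w \<in> cycles D Y ?i"
        using w restricted_diff_sub[OF w(1)] diffch[OF vc(1) span_on_sub(2)[OF w(1)]] by (simp add: cycles_def r del: res_diff_simps)
      moreover
      have "v - ?g (v - w) = 0" using r1[OF vc(2)] r12[OF w(1)] by (simp add: lr)
      then have "v - ?g (v - w) \<in> boundaries D Y1 ?i" using pm.subspace_0[OF subspace_boundaries[OF lD]] by simp
      ultimately show ?thesis by (intro bexI[of _ "v - w"])
    qed
  next
    fix v assume "v \<in> boundaries D Y1 ?i"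
    then obtain w where w: "w \<in> span_on (Y1 (Suc ?i))" "v = res_diff D Y1 (Suc ?i) w" by (auto simp: boundaries_def simp del: res_diff_simps)
    have wY: "w \<in> span_on (Y (Suc ?i))" using w span_on_sub by blast
    let ?x = "res_diff D Y (Suc ?i) w"
    have x: "?x = v + restr (Y2 ?i) ?x"
      using split[OF res_diff_span_on, of ?i w] restricted_diff_quotient[OF wY] r1[OF w(1)] w(2) by (simp del: res_diff_simps)
    have "?f ?x = ?f (v + restr (Y2 ?i) ?x)" by (rule arg_cong[OF x])
    then have "0 = ?f v + ?f (restr (Y2 ?i) ?x)" unfolding rY(1) dd[OF wY] .
    then have "?f v = - ?f (restr (Y2 ?i) ?x)" by (simp only: eq_neg_iff_add_eq_0)
    also have "\<dots> = res_diff D Y2 ?i (- restr (Y2 ?i) ?x)"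
      unfolding rY2(4) restricted_diff_sub[OF restr_span_on] ..
    finally have "?f v = res_diff D Y2 ?i (- restr (Y2 ?i) ?x)" .
    then show "?f v \<in> boundaries D Y2 j" unfolding boundaries_def by (rule image_eqI) (auto simp: span_on_def)
  next
    fix w assume w: "w \<in> cycles D Y2 j"
    then have wc: "w \<in> span_on (Y2 j)" "res_diff D Y2 j w = 0" by (simp_all add: cycles_def)
    then have "w \<in> cycles D Y j" using span_on_sub(2) restricted_diff_sub by (simp add: cycles_def)
    then obtain y where y: "y \<in> span_on (Y ?i)" "w = ?f y" using van by (auto simp: boundaries_def simp del: res_diff_simps)
    have y0: "res_diff D Y1 ?i (?g y) = 0" using restricted_diff_quotient[OF y(1)] y(2) r12[OF wc(1)] by (simp del: res_diff_simps)
    have "?f y = ?f (?g y + restr (Y2 ?i) y)" by (rule arg_cong[OF split[OF y(1)]])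
    then have "w = ?f (?g y) + ?f (restr (Y2 ?i) y)" unfolding rY(1) y(2)[symmetric] .
    then have "?f (?g y) - w = - ?f (restr (Y2 ?i) y)" by (simp del: res_diff_simps)
    also have "\<dots> = res_diff D Y2 ?i (- restr (Y2 ?i) y)"
      using restricted_diff_sub[of "restr (Y2 ?i) y" ?i] rY2(4) by (simp del: res_diff_simps)
    finally have "?f (?g y) - w \<in> boundaries D Y2 j" unfolding boundaries_def by (rule image_eqI) (auto simp: span_on_def)
    then show "\<exists>v\<in>cycles D Y1 ?i. ?f v - w \<in> boundaries D Y2 j"
      using y0 by (intro bexI[of _ "?g y"]) (auto simp: cycles_def simp del: res_diff_simps)
  qed
qed

end

section \<open>Resolutions in a fixed multidegree\<close>

text \<open>The standard monomials, whose support is a chain; their classes form a k-basis of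
  A.\<close>

definition std :: "('n::linorder \<Rightarrow> 'n \<Rightarrow> bool) \<Rightarrow> 'n monom \<Rightarrow> bool" where
  "std prec m \<longleftrightarrow> (\<forall>i\<in>ks m. \<forall>j\<in>ks m. i < j \<longrightarrow> prec i j)"

lemma keys_plus_nat: "ks (a + b) = ks a \<union> ks (b :: 'n monom)"
  by (auto simp: in_keys_iff lookup_add)

lemma std_add: "std prec (a + b) \<Longrightarrow> std prec a" "std prec (a + b) \<Longrightarrow> std prec b"
  by (auto simp: std_def keys_plus_nat)

lemma std_0 [simp]: "std prec 0" by (simp add: std_def)

lemma monom_diff: "lk m i > 0 \<Longrightarrow> (m - Poly_Mapping.single i 1) + Poly_Mapping.single i 1 = (m :: 'n monom)"
  by (rule poly_mapping_eqI) (auto simp: lookup_add lookup_minus lookup_single when_def)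

lemma not_std_iff: "\<not> std prec m \<longleftrightarrow> (\<exists>g\<in>mingens prec. \<exists>a. m = a + g)"
proof
  assume "\<not> std prec m"
  then obtain i j where ij: "i \<in> ks m" "j \<in> ks m" "i < j" "\<not> prec i j" by (auto simp: std_def)
  define m1 where "m1 = m - Poly_Mapping.single i 1"
  have m: "m = m1 + Poly_Mapping.single i 1" using monom_diff[of m i] ij by (simp add: m1_def in_keys_iff)
  have "lk m1 j = lk m j" using ij by (simp add: m1_def lookup_minus lookup_single)
  then have m1: "m1 = (m1 - Poly_Mapping.single j 1) + Poly_Mapping.single j 1"
    using monom_diff[of m1 j] ij by (simp add: in_keys_iff)
  have "m = (m1 - Poly_Mapping.single j 1) + edge_monom i j"
    unfolding edge_monom_def by (subst m, subst (1) m1) (simp only: ac_simps)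
  moreover have "edge_monom i j \<in> mingens prec" using ij by (auto simp: mingens_def)
  ultimately show "\<exists>g\<in>mingens prec. \<exists>a. m = a + g" by blast
next
  assume "\<exists>g\<in>mingens prec. \<exists>a. m = a + g"
  then obtain i j a where "i < j" "\<not> prec i j" "m = a + edge_monom i j" by (auto simp: mingens_def)
  then have "i \<in> ks m" "j \<in> ks m" "i < j" "\<not> prec i j"
    by (auto simp: in_keys_iff lookup_add edge_monom_def)
  then show "\<not> std prec m" by (auto simp: std_def)
qed

lemma poly_mapping_sum_singles: "(\<Sum>m\<in>ks p. Poly_Mapping.single m (lk p m)) = p"
proof (rule poly_mapping_eqI)
  fix k
  have "lk (\<Sum>m\<in>ks p. Poly_Mapping.single m (lk p m)) k = (\<Sum>m\<in>ks p. if m = k then lk p m else 0)"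
    unfolding lookup_sum by (intro sum.cong refl) (auto simp: lookup_single when_def)
  then show "lk (\<Sum>m\<in>ks p. Poly_Mapping.single m (lk p m)) k = lk p k"
    by (simp add: in_keys_iff)
qed

text \<open>Membership in a monomial ideal is decided term by term. For the converse, each
  nonstandard term chooses a generator dividing it, and the cofactors belonging to one generator are
  collected in s.\<close>

lemma ideal_iff:
  fixes prec :: "'n::{finite,linorder} \<Rightarrow> 'n \<Rightarrow> bool" and p :: "('n, 'k::field) mpoly"
  shows "p \<in> ideal_a prec \<longleftrightarrow> (\<forall>m\<in>ks p. \<not> std prec m)"
proof
  assume "p \<in> ideal_a prec"
  then obtain s where p: "p = (\<Sum>g\<in>mingens prec. s g * pmonom g)" by (auto simp: ideal_a_def)
  show "\<forall>m\<in>ks p. \<not> std prec m"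
  proof
    fix m assume "m \<in> ks p"
    moreover have "ks p \<subseteq> (\<Union>g\<in>mingens prec. ks (s g * pmonom g))" unfolding p by (rule keys_sum)
    ultimately have "m \<in> (\<Union>g\<in>mingens prec. ks (s g * pmonom g))" by (rule rev_subsetD)
    then obtain g where g: "g \<in> mingens prec" "m \<in> ks (s g * pmonom g)" by blast
    have "m \<in> {a + b |a b. a \<in> ks (s g) \<and> b \<in> ks (pmonom g :: ('n, 'k) mpoly)}"
      using g(2) keys_mult[of "s g" "pmonom g"] by (rule rev_subsetD)
    moreover have "ks (pmonom g :: ('n, 'k) mpoly) = {g}" by (simp add: pmonom_def)
    ultimately obtain a where "m = a + g" by auto
    then show "\<not> std prec m" using g not_std_iff by blast
  qed
next
  assume ns: "\<forall>m\<in>ks p. \<not> std prec m"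
  then have "\<forall>m\<in>ks p. \<exists>g a. g \<in> mingens prec \<and> m = a + g" using not_std_iff by metis
  then obtain g a where ga: "\<And>m. m \<in> ks p \<Longrightarrow> g m \<in> mingens prec \<and> m = a m + g m" by metis
  define s where "s h = (\<Sum>m\<in>{m \<in> ks p. g m = h}. Poly_Mapping.single (a m) (lk p m))" for h
  have "(\<Sum>h\<in>mingens prec. s h * pmonom h) =
      (\<Sum>h\<in>mingens prec. \<Sum>m\<in>{m \<in> ks p. g m = h}. Poly_Mapping.single m (lk p m))"
  proof (rule sum.cong[OF refl])
    fix h
    have "s h * pmonom h = (\<Sum>m\<in>{m \<in> ks p. g m = h}. Poly_Mapping.single (a m) (lk p m) * pmonom h)"
      unfolding s_def by (rule sum_distrib_right)
    also have "\<dots> = (\<Sum>m\<in>{m \<in> ks p. g m = h}. Poly_Mapping.single m (lk p m))"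
    proof (rule sum.cong[OF refl])
      fix m assume "m \<in> {m \<in> ks p. g m = h}"
      then have "m = a m + h" using ga by auto
      then show "Poly_Mapping.single (a m) (lk p m) * pmonom h = Poly_Mapping.single m (lk p m)"
        by (simp add: pmonom_def mult_single)
    qed
    finally show "s h * pmonom h = (\<Sum>m\<in>{m \<in> ks p. g m = h}. Poly_Mapping.single m (lk p m))" .
  qed
  also have "\<dots> = (\<Sum>m\<in>ks p. Poly_Mapping.single m (lk p m))"
    using ga by (intro sum.group) auto
  also have "\<dots> = p" by (rule poly_mapping_sum_singles)
  finally show "p \<in> ideal_a prec" by (auto simp: ideal_a_def)
qed

lemma fzero_iff:
  fixes prec :: "'n::{finite,linorder} \<Rightarrow> 'n \<Rightarrow> bool" and v :: "'b \<Rightarrow>\<^sub>0 ('n, 'k::field) mpoly"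
  shows "fzero prec v \<longleftrightarrow> (\<forall>b m. std prec m \<longrightarrow> lk (lk v b) m = 0)"
  unfolding fzero_def ideal_iff Ball_def in_keys_iff by blast

section \<open>Scalar matrices of multigraded maps\<close>

definition linext :: "('b \<Rightarrow> ('c \<Rightarrow>\<^sub>0 'r)) \<Rightarrow> ('b \<Rightarrow>\<^sub>0 'r::comm_ring_1) \<Rightarrow> ('c \<Rightarrow>\<^sub>0 'r)" where
  "linext f x = (\<Sum>b\<in>ks x. pscale (lk x b) (f b))"

lemma lookup_linext: "lk (linext f x) c = (\<Sum>b\<in>ks x. lk x b * lk (f b) c)"
  by (simp add: linext_def lookup_sum)

lemma lookup_linext_superset:
  "finite S \<Longrightarrow> ks x \<subseteq> S \<Longrightarrow> lk (linext f x) c = (\<Sum>b\<in>S. lk x b * lk (f b) c)"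
  unfolding lookup_linext by (intro sum.mono_neutral_left) (auto simp: in_keys_iff)

lemma linext_add: "linext f (x + y) = linext f x + linext f y"
proof (rule poly_mapping_eqI)
  fix c
  let ?S = "ks x \<union> ks y"
  have "ks (x + y) \<subseteq> ?S" by (rule keys_add)
  then show "lk (linext f (x + y)) c = lk (linext f x + linext f y) c"
    using lookup_linext_superset[of ?S "x + y" f c] lookup_linext_superset[of ?S x f c]
      lookup_linext_superset[of ?S y f c]
    by (simp add: lookup_add distrib_right sum.distrib)
qed

lemma lin_linext: "lin (linext f)"
proof -
  have "linext f (pscale c x) = pscale c (linext f x)" for c x
  proof (rule poly_mapping_eqI)
    fix d
    have "ks (pscale c x) \<subseteq> ks x" by (auto simp: in_keys_iff)
    then show "lk (linext f (pscale c x)) d = lk (pscale c (linext f x)) d"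
      using lookup_linext_superset[of "ks x" "pscale c x" f d]
      by (simp add: lookup_linext sum_distrib_left mult.assoc)
  qed
  then show ?thesis by (simp add: lin_def linext_add)
qed

lemma linext_single: "linext f (Poly_Mapping.single b c) = pscale c (f b)"
  by (cases "c = 0") (auto simp: linext_def pscale_def poly_mapping_eq_iff fun_eq_iff Poly_Mapping.map.rep_eq)

lemma fd_linext: "fd F i v = linext (fdiff F i) v"
  by (simp add: fd_def linext_def)

definition graded :: "('b, 'n::linorder, 'k::field) gfree \<Rightarrow> bool" where
  "graded F \<longleftrightarrow> (\<forall>i. \<forall>b\<in>fbasis F (Suc i). fdiff F (Suc i) b \<in> fcarrier F i \<and>
        (\<forall>b'. \<forall>m\<in>ks (lk (fdiff F (Suc i) b) b'). m + fdeg F i b' = fdeg F (Suc i) b))"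

text \<open>A k-basis of the degree-\<alpha> part of F_i tensored with A_W: the label b stands for b
  times the monomial \<gamma>, which is determined by \<alpha> and b. All variables give F itself,
  and W = {} gives the tensor product with k.\<close>

definition part_basis :: "('n::linorder \<Rightarrow> 'n \<Rightarrow> bool) \<Rightarrow> ('b, 'n, 'k::field) gfree \<Rightarrow> 'n set \<Rightarrow> 'n monom \<Rightarrow> nat \<Rightarrow> 'b set" where
  "part_basis prec F W \<alpha> i = {b \<in> fbasis F i. \<exists>\<gamma>. \<alpha> = \<gamma> + fdeg F i b \<and> std prec \<gamma> \<and> ks \<gamma> \<subseteq> W}"

text \<open>By homogeneity each entry of the differential is a scalar times one monomial. Only the
  scalar is kept, so one matrix serves all multidegrees and all W. Labels outside the basis get a
  zero column because their differential is unrestricted.\<close>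

definition cdiff_column :: "('b, 'n::linorder, 'k::field) gfree \<Rightarrow> nat \<Rightarrow> 'b \<Rightarrow> ('b \<Rightarrow>\<^sub>0 'k)" where
  "cdiff_column F i b = (if b \<in> fbasis F i
     then Poly_Mapping.mapp (\<lambda>b' p. lk p (fdeg F i b - fdeg F (i - 1) b')) (fdiff F i b) else 0)"

definition cdiff :: "('b, 'n::linorder, 'k::field) gfree \<Rightarrow> nat \<Rightarrow> ('b \<Rightarrow>\<^sub>0 'k) \<Rightarrow> ('b \<Rightarrow>\<^sub>0 'k)" where
  "cdiff F i = linext (cdiff_column F i)"

lemma lin_cdiff: "lin (cdiff F i)" by (simp add: cdiff_def lin_linext)

lemma lookup_mapp0: "f b 0 = 0 \<Longrightarrow> lk (Poly_Mapping.mapp f v) b = f b (lk v b)"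
  by (simp add: lookup_mapp when_def in_keys_iff)

lemma lookup_cdiff_column: "lk (cdiff_column F i b) b' =
   (if b \<in> fbasis F i then lk (lk (fdiff F i b) b') (fdeg F i b - fdeg F (i - 1) b') else 0)"
  by (simp add: cdiff_column_def lookup_mapp0)

lemma fdiff_single:
  assumes "graded F" "b \<in> fbasis F (Suc i)"
  shows "lk (cdiff_column F (Suc i) b) b' \<noteq> 0 \<Longrightarrow> b' \<in> fbasis F i \<and> (\<exists>\<delta>. fdeg F (Suc i) b = \<delta> + fdeg F i b' \<and>
      lk (fdiff F (Suc i) b) b' = Poly_Mapping.single \<delta> (lk (cdiff_column F (Suc i) b) b'))"
    and "lk (cdiff_column F (Suc i) b) b' = 0 \<Longrightarrow> lk (fdiff F (Suc i) b) b' = 0"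
proof -
  let ?p = "lk (fdiff F (Suc i) b) b'"
  let ?\<delta> = "fdeg F (Suc i) b - fdeg F i b'"
  have m: "m = ?\<delta> \<and> m + fdeg F i b' = fdeg F (Suc i) b" if "m \<in> ks ?p" for m
  proof -
    have "m + fdeg F i b' = fdeg F (Suc i) b" using assms that by (auto simp: graded_def)
    then show ?thesis by (metis add_diff_cancel_right')
  qed
  have p: "?p = Poly_Mapping.single ?\<delta> (lk (cdiff_column F (Suc i) b) b')"
  proof (rule poly_mapping_eqI)
    fix m
    have "lk (cdiff_column F (Suc i) b) b' = lk ?p ?\<delta>" using assms(2) by (simp add: lookup_cdiff_column)
    moreover have "m \<noteq> ?\<delta> \<Longrightarrow> lk ?p m = 0" using m[of m] by (auto simp: in_keys_iff)
    ultimately show "lk ?p m = lk (Poly_Mapping.single ?\<delta> (lk (cdiff_column F (Suc i) b) b')) m"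
      by (cases "m = ?\<delta>") (auto simp: lookup_single)
  qed
  then show "lk (cdiff_column F (Suc i) b) b' = 0 \<Longrightarrow> ?p = 0" by simp
  assume nz: "lk (cdiff_column F (Suc i) b) b' \<noteq> 0"
  then have "lk ?p ?\<delta> \<noteq> 0" using assms(2) by (simp add: lookup_cdiff_column)
  then have k: "?\<delta> \<in> ks ?p" by (simp add: in_keys_iff)
  then have "b' \<in> ks (fdiff F (Suc i) b)" by (auto simp: in_keys_iff)
  then have "b' \<in> fbasis F i" using assms by (auto simp: graded_def fcarrier_def)
  then show "b' \<in> fbasis F i \<and> (\<exists>\<delta>. fdeg F (Suc i) b = \<delta> + fdeg F i b' \<and>
      ?p = Poly_Mapping.single \<delta> (lk (cdiff_column F (Suc i) b) b'))" using p m[OF k] by metis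
qed

text \<open>The degree-\<alpha> component modulo the ideal. Subtraction of exponents is truncated,
  so the membership test is what guarantees that the degree of b divides \<alpha>.\<close>

definition comp :: "('n::linorder \<Rightarrow> 'n \<Rightarrow> bool) \<Rightarrow> ('b, 'n, 'k::field) gfree \<Rightarrow> nat \<Rightarrow> 'n monom \<Rightarrow>
    ('b \<Rightarrow>\<^sub>0 ('n, 'k) mpoly) \<Rightarrow> ('b \<Rightarrow>\<^sub>0 'k)" where
  "comp prec F i \<alpha> v = Poly_Mapping.mapp (\<lambda>b p. if b \<in> part_basis prec F UNIV \<alpha> i then lk p (\<alpha> - fdeg F i b) else 0) v"

definition lift :: "('b, 'n::linorder, 'k::field) gfree \<Rightarrow> nat \<Rightarrow> 'n monom \<Rightarrow> ('b \<Rightarrow>\<^sub>0 'k) \<Rightarrow> ('b \<Rightarrow>\<^sub>0 ('n, 'k) mpoly)" where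
  "lift F i \<alpha> x = Poly_Mapping.mapp (\<lambda>b c. Poly_Mapping.single (\<alpha> - fdeg F i b) c) x"

lemma lookup_comp: "lk (comp prec F i \<alpha> v) b = (if b \<in> part_basis prec F UNIV \<alpha> i then lk (lk v b) (\<alpha> - fdeg F i b) else 0)"
  by (simp add: comp_def lookup_mapp0)

lemma lookup_lift: "lk (lift F i \<alpha> x) b = Poly_Mapping.single (\<alpha> - fdeg F i b) (lk x b)"
  by (simp add: lift_def lookup_mapp0)

lemma comp_span_on: "comp prec F i \<alpha> v \<in> span_on (part_basis prec F UNIV \<alpha> i)"
  by (simp add: span_on_iff lookup_comp)

lemma comp_add: "comp prec F i \<alpha> (v + w) = comp prec F i \<alpha> v + comp prec F i \<alpha> w"
  by (rule poly_mapping_eqI) (simp add: lookup_comp lookup_add)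

lemma comp_diff: "comp prec F i \<alpha> (v - w) = comp prec F i \<alpha> v - comp prec F i \<alpha> w"
  by (rule poly_mapping_eqI) (simp add: lookup_comp lookup_minus)

lemma comp_0 [simp]: "comp prec F i \<alpha> 0 = 0"
  by (rule poly_mapping_eqI) (simp add: lookup_comp)

lemma comp_sum: "comp prec F i \<alpha> (sum h S) = (\<Sum>j\<in>S. comp prec F i \<alpha> (h j))"
  by (induction S rule: infinite_finite_induct) (auto simp: comp_add)

lemma lift_fcarrier: "x \<in> span_on (part_basis prec F W \<alpha> i) \<Longrightarrow> lift F i \<alpha> x \<in> fcarrier F i"
  by (auto simp: fcarrier_def in_keys_iff lookup_lift span_on_iff part_basis_def)

lemma comp_lift:
  assumes "x \<in> span_on (part_basis prec F UNIV \<alpha> i)"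
  shows "comp prec F i \<beta> (lift F i \<alpha> x) = (if \<beta> = \<alpha> then x else 0)"
proof (rule poly_mapping_eqI)
  fix b
  show "lk (comp prec F i \<beta> (lift F i \<alpha> x)) b = lk (if \<beta> = \<alpha> then x else 0) b"
  proof (cases "b \<in> part_basis prec F UNIV \<alpha> i \<and> b \<in> part_basis prec F UNIV \<beta> i")
    case True
    then obtain c d where "\<alpha> = c + fdeg F i b" "\<beta> = d + fdeg F i b" by (auto simp: part_basis_def)
    then show ?thesis using True by (auto simp: lookup_comp lookup_lift lookup_single)
  next
    case False
    then show ?thesis using assms by (auto simp: lookup_comp lookup_lift span_on_iff)
  qed
qed

lemma fzero_comp:
  fixes prec :: "'n::{finite,linorder} \<Rightarrow> 'n \<Rightarrow> bool" and v :: "'b \<Rightarrow>\<^sub>0 ('n, 'k::field) mpoly"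
  assumes "v \<in> fcarrier F i"
  shows "fzero prec v \<longleftrightarrow> (\<forall>\<alpha>. comp prec F i \<alpha> v = 0)"
proof
  assume z: "fzero prec v"
  show "\<forall>\<alpha>. comp prec F i \<alpha> v = 0"
  proof (intro allI poly_mapping_eqI)
    fix \<alpha> b
    show "lk (comp prec F i \<alpha> v) b = lk 0 b"
      using z by (auto simp: lookup_comp fzero_iff part_basis_def)
  qed
next
  assume z: "\<forall>\<alpha>. comp prec F i \<alpha> v = 0"
  show "fzero prec v"
    unfolding fzero_iff
  proof (intro allI impI)
    fix b m assume m: "std prec m"
    show "lk (lk v b) m = 0"
    proof (cases "b \<in> fbasis F i")
      case True
      then have b: "b \<in> part_basis prec F UNIV (m + fdeg F i b) i" using m by (auto simp: part_basis_def)
      have "lk (comp prec F i (m + fdeg F i b) v) b = 0" using z by simp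
      then show ?thesis using b by (simp add: lookup_comp)
    next
      case False
      then have "lk v b = 0" using assms by (auto simp: fcarrier_def in_keys_iff)
      then show ?thesis by simp
    qed
  qed
qed

lemma lookup_mult_single:
  fixes p :: "('n::linorder, 'k::field) mpoly"
  shows "lk (p * Poly_Mapping.single m c) (d + m) = lk p d * c"
    and "(\<And>d. e \<noteq> d + m) \<Longrightarrow> lk (p * Poly_Mapping.single m c) e = 0"
proof -
  have eq: "p * Poly_Mapping.single m c = (\<Sum>k\<in>ks p. Poly_Mapping.single (k + m) (lk p k * c))"
  proof -
    have "p * Poly_Mapping.single m c = (\<Sum>k\<in>ks p. Poly_Mapping.single k (lk p k)) * Poly_Mapping.single m c"
      by (simp add: poly_mapping_sum_singles)
    then show ?thesis by (simp add: sum_distrib_right mult_single)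
  qed
  have "lk (p * Poly_Mapping.single m c) (d + m) = (\<Sum>k\<in>ks p. if k = d then lk p k * c else 0)"
    unfolding eq lookup_sum by (intro sum.cong refl) (auto simp: lookup_single when_def)
  then show "lk (p * Poly_Mapping.single m c) (d + m) = lk p d * c"
    by (simp add: in_keys_iff)
  assume "\<And>d. e \<noteq> d + m"
  then show "lk (p * Poly_Mapping.single m c) e = 0"
    unfolding eq lookup_sum by (intro sum.neutral) (auto simp: lookup_single when_def)
qed

lemma fd_fcarrier:
  assumes "graded F" "v \<in> fcarrier F (Suc i)"
  shows "fd F (Suc i) v \<in> fcarrier F i"
proof -
  have "ks (fd F (Suc i) v) \<subseteq> (\<Union>b\<in>ks v. ks (pscale (lk v b) (fdiff F (Suc i) b)))"
    unfolding fd_def by (rule keys_sum)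
  also have "\<dots> \<subseteq> (\<Union>b\<in>ks v. ks (fdiff F (Suc i) b))" by (auto simp: in_keys_iff)
  also have "\<dots> \<subseteq> fbasis F i"
    using assms by (auto simp: fcarrier_def graded_def)
  finally show ?thesis by (simp add: fcarrier_def)
qed

text \<open>An entry with monomial e moves the cofactor d to d + e. If d + e is standard, so is d;
  thus dropping nonstandard terms before applying the differential loses nothing.\<close>

lemma comp_fd:
  assumes g: "graded F" and v: "v \<in> fcarrier F (Suc i)"
  shows "comp prec F i \<alpha> (fd F (Suc i) v) = res_diff (cdiff F) (part_basis prec F UNIV \<alpha>) (Suc i) (comp prec F (Suc i) \<alpha> v)"
proof (rule poly_mapping_eqI)
  fix b'
  show "lk (comp prec F i \<alpha> (fd F (Suc i) v)) b' =
      lk (res_diff (cdiff F) (part_basis prec F UNIV \<alpha>) (Suc i) (comp prec F (Suc i) \<alpha> v)) b'"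
  proof (cases "b' \<in> part_basis prec F UNIV \<alpha> i")
    case True
    then obtain c where c: "\<alpha> = c + fdeg F i b'" "std prec c" "b' \<in> fbasis F i" by (auto simp: part_basis_def)
    have "lk (comp prec F i \<alpha> (fd F (Suc i) v)) b' = lk (lk (fd F (Suc i) v) b') c"
      using True c by (simp add: lookup_comp)
    also have "\<dots> = (\<Sum>b\<in>ks v. lk (lk v b * lk (fdiff F (Suc i) b) b') c)"
      by (simp add: fd_linext lookup_linext lookup_sum)
    also have "\<dots> = (\<Sum>b\<in>ks v. lk (comp prec F (Suc i) \<alpha> v) b * lk (cdiff_column F (Suc i) b) b')"
    proof (rule sum.cong[OF refl])
      fix b assume "b \<in> ks v"
      then have b: "b \<in> fbasis F (Suc i)" using v by (auto simp: fcarrier_def)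
      show "lk (lk v b * lk (fdiff F (Suc i) b) b') c = lk (comp prec F (Suc i) \<alpha> v) b * lk (cdiff_column F (Suc i) b) b'"
      proof (cases "lk (cdiff_column F (Suc i) b) b' = 0")
        case True
        then show ?thesis using fdiff_single(2)[OF g b] by simp
      next
        case False
        then obtain e where e: "fdeg F (Suc i) b = e + fdeg F i b'"
          "lk (fdiff F (Suc i) b) b' = Poly_Mapping.single e (lk (cdiff_column F (Suc i) b) b')"
          using fdiff_single(1)[OF g b] by blast
        show ?thesis
        proof (cases "\<exists>d. c = d + e")
          case True
          then obtain d where d: "c = d + e" by blast
          then have ad: "\<alpha> = d + fdeg F (Suc i) b" using c e by (simp add: add.assoc)
          moreover have "std prec d" using c(2) d std_add by blast
          ultimately have "b \<in> part_basis prec F UNIV \<alpha> (Suc i)" using b by (auto simp: part_basis_def)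
          then have "lk (comp prec F (Suc i) \<alpha> v) b = lk (lk v b) d" using ad by (simp add: lookup_comp)
          then show ?thesis using lookup_mult_single(1) e(2) d by simp
        next
          case False
          have "b \<notin> part_basis prec F UNIV \<alpha> (Suc i)"
          proof
            assume "b \<in> part_basis prec F UNIV \<alpha> (Suc i)"
            then obtain d where "\<alpha> = d + fdeg F (Suc i) b" by (auto simp: part_basis_def)
            then have "c + fdeg F i b' = (d + e) + fdeg F i b'" using c e by (simp add: add.assoc)
            then show False using False by (metis add_right_cancel)
          qed
          then show ?thesis using lookup_mult_single(2)[of c e "lk v b"] e(2) False by (simp add: lookup_comp)
        qed
      qed
    qed
    also have "\<dots> = lk (cdiff F (Suc i) (comp prec F (Suc i) \<alpha> v)) b'"
    proof -
      have "ks (comp prec F (Suc i) \<alpha> v) \<subseteq> ks v" by (auto simp: in_keys_iff lookup_comp split: if_splits)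
      then show ?thesis unfolding cdiff_def by (subst lookup_linext_superset[of "ks v"]) auto
    qed
    finally show ?thesis using True by simp
  next
    case False
    then show ?thesis by (simp add: lookup_comp)
  qed
qed

lemma cycles_comp:
  fixes F :: "('b, 'n::{finite,linorder}, 'k::field) gfree"
  assumes "graded F" "v \<in> fcarrier F (Suc i)"
  shows "fzero prec (fd F (Suc i) v) \<longleftrightarrow> (\<forall>\<alpha>. comp prec F (Suc i) \<alpha> v \<in> cycles (cdiff F) (part_basis prec F UNIV \<alpha>) (Suc i))"
  unfolding fzero_comp[OF fd_fcarrier[OF assms]] comp_fd[OF assms] by (simp add: cycles_def comp_span_on)

lemma fcarrier_diff: "v \<in> fcarrier F i \<Longrightarrow> w \<in> fcarrier F i \<Longrightarrow> v - w \<in> fcarrier F i"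
  using keys_diff[of v w] by (auto simp: fcarrier_def)

lemma fcarrier_sum: "(\<And>j. j \<in> S \<Longrightarrow> h j \<in> fcarrier F i) \<Longrightarrow> sum h S \<in> fcarrier F i"
  using keys_sum[of h S] unfolding fcarrier_def by blast

text \<open>Preimages are found in each multidegree separately. Only the finitely many multidegrees
  occurring in v matter, so the lifts can be added up to one preimage.\<close>

lemma boundaries_comp:
  fixes F :: "('b, 'n::{finite,linorder}, 'k::field) gfree"
  assumes g: "graded F" and v: "v \<in> fcarrier F i"
  shows "(\<exists>w\<in>fcarrier F (Suc i). fzero prec (v - fd F (Suc i) w)) \<longleftrightarrow>
    (\<forall>\<alpha>. comp prec F i \<alpha> v \<in> boundaries (cdiff F) (part_basis prec F UNIV \<alpha>) i)"
proof
  assume "\<exists>w\<in>fcarrier F (Suc i). fzero prec (v - fd F (Suc i) w)"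
  then obtain w where w: "w \<in> fcarrier F (Suc i)" "fzero prec (v - fd F (Suc i) w)" by blast
  show "\<forall>\<alpha>. comp prec F i \<alpha> v \<in> boundaries (cdiff F) (part_basis prec F UNIV \<alpha>) i"
  proof
    fix \<alpha>
    have "comp prec F i \<alpha> (v - fd F (Suc i) w) = 0"
      using w fzero_comp[OF fcarrier_diff[OF v fd_fcarrier[OF g w(1)]]] by blast
    then have "comp prec F i \<alpha> v = res_diff (cdiff F) (part_basis prec F UNIV \<alpha>) (Suc i) (comp prec F (Suc i) \<alpha> w)"
      by (simp add: comp_diff comp_fd[OF g w(1)] del: res_diff_simps)
    then show "comp prec F i \<alpha> v \<in> boundaries (cdiff F) (part_basis prec F UNIV \<alpha>) i"
      unfolding boundaries_def by (rule image_eqI) (rule comp_span_on)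
  qed
next
  assume "\<forall>\<alpha>. comp prec F i \<alpha> v \<in> boundaries (cdiff F) (part_basis prec F UNIV \<alpha>) i"
  then have "\<forall>\<alpha>. \<exists>y. y \<in> span_on (part_basis prec F UNIV \<alpha> (Suc i)) \<and>
      comp prec F i \<alpha> v = res_diff (cdiff F) (part_basis prec F UNIV \<alpha>) (Suc i) y"
    unfolding boundaries_def by blast
  then obtain y where y: "\<And>\<alpha>. y \<alpha> \<in> span_on (part_basis prec F UNIV \<alpha> (Suc i))"
    "\<And>\<alpha>. comp prec F i \<alpha> v = res_diff (cdiff F) (part_basis prec F UNIV \<alpha>) (Suc i) (y \<alpha>)" by metis
  define A where "A = (\<Union>b\<in>ks v. (\<lambda>m. m + fdeg F i b) ` ks (lk v b))"
  have fin: "finite A" by (simp add: A_def)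
  have A: "comp prec F i \<alpha> v = 0" if "\<alpha> \<notin> A" for \<alpha>
  proof (rule poly_mapping_eqI)
    fix b
    have "lk (lk v b) (\<alpha> - fdeg F i b) = 0" if bY: "b \<in> part_basis prec F UNIV \<alpha> i"
    proof (rule ccontr)
      obtain c where c: "\<alpha> = c + fdeg F i b" using bY by (auto simp: part_basis_def)
      assume "lk (lk v b) (\<alpha> - fdeg F i b) \<noteq> 0"
      then have "b \<in> ks v" "c \<in> ks (lk v b)" using c by (auto simp: in_keys_iff)
      then show False using \<open>\<alpha> \<notin> A\<close> c by (auto simp: A_def)
    qed
    then show "lk (comp prec F i \<alpha> v) b = lk 0 b" by (simp add: lookup_comp)
  qed
  define w where "w = (\<Sum>\<alpha>\<in>A. lift F (Suc i) \<alpha> (y \<alpha>))"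
  have w: "w \<in> fcarrier F (Suc i)" unfolding w_def using y(1) by (intro fcarrier_sum lift_fcarrier)
  have cw: "comp prec F (Suc i) \<beta> w = (if \<beta> \<in> A then y \<beta> else 0)" for \<beta>
    using fin by (simp add: w_def comp_sum comp_lift[OF y(1)])
  have "comp prec F i \<beta> (v - fd F (Suc i) w) = 0" for \<beta>
    using y(2)[of \<beta>] A[of \<beta>] by (simp add: comp_diff comp_fd[OF g w] cw linD[OF lin_cdiff] linD[OF lin_restr])
  then have "fzero prec (v - fd F (Suc i) w)"
    using fzero_comp[OF fcarrier_diff[OF v fd_fcarrier[OF g w]]] by blast
  then show "\<exists>w\<in>fcarrier F (Suc i). fzero prec (v - fd F (Suc i) w)" using w by blast
qed

section \<open>Tor by removing variables\<close>

definition comparables :: "('n \<Rightarrow> 'n \<Rightarrow> bool) \<Rightarrow> 'n \<Rightarrow> 'n set" where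
  "comparables prec v = {w. w = v \<or> prec v w \<or> prec w v}"

abbreviation "sv v \<equiv> Poly_Mapping.single v (1::nat)"

text \<open>This describes the kernel of the map from A_W to the ring without v: it is spanned by
  the standard multiples of x_v, and the other factor runs over the standard monomials in the
  variables of W comparable to v.\<close>

lemma std_plus_single:
  assumes lt: "\<And>i j. prec i j \<Longrightarrow> i < (j::'n::linorder)"
  shows "std prec (d + sv v) \<and> ks (d + sv v) \<subseteq> W \<longleftrightarrow> v \<in> W \<and> std prec d \<and> ks d \<subseteq> W \<inter> comparables prec v"
proof -
  have k: "ks (d + sv v) = insert v (ks d)" by (simp add: keys_plus_nat)
  have "std prec (d + sv v) \<longleftrightarrow> std prec d \<and> ks d \<subseteq> comparables prec v"
  proof (intro iffI conjI)
    assume s: "std prec (d + sv v)"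
    show "std prec d" using s by (rule std_add)
    show "ks d \<subseteq> comparables prec v"
    proof
      fix w assume "w \<in> ks d"
      then show "w \<in> comparables prec v" using s unfolding std_def k comparables_def by (cases w v rule: linorder_cases) auto
    qed
  next
    assume h: "std prec d \<and> ks d \<subseteq> comparables prec v"
    show "std prec (d + sv v)" unfolding std_def k
    proof (intro ballI impI)
      fix i j assume ij: "i \<in> insert v (ks d)" "j \<in> insert v (ks d)" "i < j"
      have nb: "w = v \<or> prec v w \<or> prec w v" if "w \<in> ks d" for w using h that by (auto simp: comparables_def)
      consider "i = v" "j \<in> ks d" | "j = v" "i \<in> ks d" | "i \<in> ks d" "j \<in> ks d" using ij by auto
      then show "prec i j"
      proof cases
        case 1
        then show ?thesis using nb[of j] ij(3) lt[of j v] by auto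
      next
        case 2
        then show ?thesis using nb[of i] ij(3) lt[of v i] by auto
      next
        case 3
        then show ?thesis using h ij(3) by (simp add: std_def)
      qed
    qed
  qed
  then show ?thesis using k by auto
qed

text \<open>The exact sequence on bases: a label belongs to the quotient if its cofactor is not
  divisible by x_v, and otherwise to the kernel, with the degree lowered by x_v. In degrees not
  divisible by x_v there is no kernel.\<close>

lemma part_basis_split:
  assumes lt: "\<And>i j. prec i j \<Longrightarrow> i < (j::'n::linorder)" and v: "v \<in> W"
  shows "part_basis prec F W (\<beta> + sv v) i = part_basis prec F (W - {v}) (\<beta> + sv v) i \<union> part_basis prec F (W \<inter> comparables prec v) \<beta> i"
    and "part_basis prec F (W - {v}) (\<beta> + sv v) i \<inter> part_basis prec F (W \<inter> comparables prec v) \<beta> i = {}"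
    and "lk \<alpha> v = 0 \<Longrightarrow> part_basis prec F W \<alpha> i = part_basis prec F (W - {v}) \<alpha> i"
proof -
  show "part_basis prec F W (\<beta> + sv v) i = part_basis prec F (W - {v}) (\<beta> + sv v) i \<union> part_basis prec F (W \<inter> comparables prec v) \<beta> i"
  proof (intro set_eqI iffI)
    fix b assume "b \<in> part_basis prec F W (\<beta> + sv v) i"
    then obtain c where c: "b \<in> fbasis F i" "\<beta> + sv v = c + fdeg F i b" "std prec c" "ks c \<subseteq> W"
      by (auto simp: part_basis_def)
    show "b \<in> part_basis prec F (W - {v}) (\<beta> + sv v) i \<union> part_basis prec F (W \<inter> comparables prec v) \<beta> i"
    proof (cases "v \<in> ks c")
      case True
      define d where "d = c - sv v"
      have d: "c = d + sv v" using monom_diff[of c v] True by (simp add: d_def in_keys_iff)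
      have "\<beta> + sv v = d + fdeg F i b + sv v" using c(2) d by (simp add: ac_simps)
      then have "\<beta> = d + fdeg F i b" by simp
      moreover have "std prec d \<and> ks d \<subseteq> W \<inter> comparables prec v"
        using std_plus_single[OF lt, of prec d v W] c(3,4) d by simp
      ultimately show ?thesis using c(1) by (auto simp: part_basis_def)
    next
      case False
      then show ?thesis using c by (auto simp: part_basis_def)
    qed
  next
    fix b assume "b \<in> part_basis prec F (W - {v}) (\<beta> + sv v) i \<union> part_basis prec F (W \<inter> comparables prec v) \<beta> i"
    then show "b \<in> part_basis prec F W (\<beta> + sv v) i"
    proof
      assume "b \<in> part_basis prec F (W \<inter> comparables prec v) \<beta> i"
      then obtain d where d: "b \<in> fbasis F i" "\<beta> = d + fdeg F i b" "std prec d" "ks d \<subseteq> W \<inter> comparables prec v"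
        by (auto simp: part_basis_def)
      have "\<beta> + sv v = (d + sv v) + fdeg F i b" using d(2) by (simp add: ac_simps)
      moreover have "std prec (d + sv v) \<and> ks (d + sv v) \<subseteq> W"
        using std_plus_single[OF lt, of prec d v W] d(3,4) v by simp
      ultimately show ?thesis using d(1) unfolding part_basis_def by blast
    qed (auto simp: part_basis_def)
  qed
  have False if b: "b \<in> part_basis prec F (W - {v}) (\<beta> + sv v) i" "b \<in> part_basis prec F (W \<inter> comparables prec v) \<beta> i" for b
  proof -
    obtain c d where c: "\<beta> + sv v = c + fdeg F i b" "ks c \<subseteq> W - {v}" and d: "\<beta> = d + fdeg F i b"
      using b by (auto simp: part_basis_def)
    have "c + fdeg F i b = (d + sv v) + fdeg F i b" using c d by (simp add: ac_simps)
    then have "c = d + sv v" by simp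
    then show False using c(2) by (auto simp: keys_plus_nat)
  qed
  then show "part_basis prec F (W - {v}) (\<beta> + sv v) i \<inter> part_basis prec F (W \<inter> comparables prec v) \<beta> i = {}" by blast
  show "part_basis prec F W \<alpha> i = part_basis prec F (W - {v}) \<alpha> i" if "lk \<alpha> v = 0"
  proof -
    have "v \<notin> ks c" if "\<alpha> = c + fdeg F i b" for c b
      using that \<open>lk \<alpha> v = 0\<close> by (simp add: in_keys_iff lookup_add)
    then show ?thesis unfolding part_basis_def by blast
  qed
qed

lemma total_deg_add: "total_deg (a + b) = total_deg a + total_deg b"
  by (simp add: total_deg_def lookup_add sum.distrib)

lemma total_deg_single [simp]: "total_deg (Poly_Mapping.single v n) = n"
  by (simp add: total_deg_def lookup_single when_def)

lemma total_deg_0_iff: "total_deg \<alpha> = 0 \<longleftrightarrow> \<alpha> = 0"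
  by (auto simp: total_deg_def poly_mapping_eq_iff fun_eq_iff)

text \<open>A label c that reaches b has a cofactor dividing that of b, and divisors of standard
  monomials in the variables of W are of the same kind. So labels outside the basis for W never
  reach b.\<close>

lemma cdiff_restrict:
  assumes g: "graded F" and b: "b \<in> part_basis prec F W \<alpha> j" and u: "\<And>c. c \<in> ks u \<Longrightarrow> c \<in> fbasis F (Suc j) \<and> (\<exists>e. \<alpha> = e + fdeg F (Suc j) c)"
  shows "lk (cdiff F (Suc j) (restr (part_basis prec F W \<alpha> (Suc j)) u)) b = lk (cdiff F (Suc j) u) b"
proof -
  let ?r = "restr (part_basis prec F W \<alpha> (Suc j)) u"
  have "lk (cdiff F (Suc j) ?r) b = (\<Sum>c\<in>ks u. lk ?r c * lk (cdiff_column F (Suc j) c) b)"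
    unfolding cdiff_def by (rule lookup_linext_superset) auto
  also have "\<dots> = (\<Sum>c\<in>ks u. lk u c * lk (cdiff_column F (Suc j) c) b)"
  proof (rule sum.cong[OF refl])
    fix c assume c: "c \<in> ks u"
    show "lk ?r c * lk (cdiff_column F (Suc j) c) b = lk u c * lk (cdiff_column F (Suc j) c) b"
    proof (cases "c \<in> part_basis prec F W \<alpha> (Suc j) \<or> lk (cdiff_column F (Suc j) c) b = 0")
      case False
      obtain \<gamma> where \<gamma>: "\<alpha> = \<gamma> + fdeg F (Suc j) c" "c \<in> fbasis F (Suc j)" using u[OF c] by blast
      obtain e where e: "fdeg F (Suc j) c = e + fdeg F j b"
        using fdiff_single(1)[OF g \<gamma>(2)] False by blast
      obtain \<gamma>' where \<gamma>': "\<alpha> = \<gamma>' + fdeg F j b" "ks \<gamma>' \<subseteq> W" "std prec \<gamma>'" using b by (auto simp: part_basis_def)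
      have "\<gamma>' + fdeg F j b = (\<gamma> + e) + fdeg F j b" using \<gamma> \<gamma>' e by (simp add: ac_simps)
      then have "\<gamma>' = \<gamma> + e" by simp
      then have "ks \<gamma> \<subseteq> W" "std prec \<gamma>" using \<gamma>'(2,3) std_add(1) by (auto simp: keys_plus_nat)
      then have "c \<in> part_basis prec F W \<alpha> (Suc j)" using \<gamma> by (auto simp: part_basis_def)
      then show ?thesis using False by simp
    qed auto
  qed
  also have "\<dots> = lk (cdiff F (Suc j) u) b" by (simp add: cdiff_def lookup_linext)
  finally show ?thesis .
qed

lemma part_basis_mono: "W \<subseteq> W' \<Longrightarrow> part_basis prec F W \<alpha> i \<subseteq> part_basis prec F W' \<alpha> i"
  by (auto simp: part_basis_def)

lemma res_diff_res_diff_subset: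
  assumes g: "graded F" and x: "x \<in> span_on (part_basis prec F W \<alpha> (Suc i))"
    and dd: "res_diff (cdiff F) (part_basis prec F UNIV \<alpha>) i (res_diff (cdiff F) (part_basis prec F UNIV \<alpha>) (Suc i) x) = 0"
  shows "res_diff (cdiff F) (part_basis prec F W \<alpha>) i (res_diff (cdiff F) (part_basis prec F W \<alpha>) (Suc i) x) = 0"
proof (cases i)
  case (Suc j)
  show ?thesis
  proof (rule poly_mapping_eqI)
    fix b
    show "lk (res_diff (cdiff F) (part_basis prec F W \<alpha>) i (res_diff (cdiff F) (part_basis prec F W \<alpha>) (Suc i) x)) b = lk 0 b"
    proof (cases "b \<in> part_basis prec F W \<alpha> j")
      case True
      let ?u = "restr (part_basis prec F UNIV \<alpha> i) (cdiff F (Suc i) x)"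
      have e: "restr (part_basis prec F W \<alpha> i) ?u = restr (part_basis prec F W \<alpha> i) (cdiff F (Suc i) x)"
        using part_basis_mono[of W UNIV prec F \<alpha> i] by (intro poly_mapping_eqI) auto
      have "lk (res_diff (cdiff F) (part_basis prec F W \<alpha>) i (res_diff (cdiff F) (part_basis prec F W \<alpha>) (Suc i) x)) b =
          lk (cdiff F i (restr (part_basis prec F W \<alpha> i) ?u)) b"
        using True Suc by (simp add: e[unfolded Suc])
      also have "\<dots> = lk (cdiff F i ?u) b"
        using Suc by (intro cdiff_restrict[OF g True, of ?u, folded Suc]) (auto simp: part_basis_def)
      also have "\<dots> = lk (res_diff (cdiff F) (part_basis prec F UNIV \<alpha>) i (res_diff (cdiff F) (part_basis prec F UNIV \<alpha>) (Suc i) x)) b"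
        using True part_basis_mono[of W UNIV prec F \<alpha> j] Suc by auto
      finally show ?thesis unfolding dd .
    qed (simp add: Suc)
  qed
qed simp

text \<open>A label reached from the kernel part has a cofactor divisible by x_v, so it is not in
  the quotient part.\<close>

lemma cdiff_triangular:
  assumes g: "graded F" and x: "x \<in> span_on (part_basis prec F (W \<inter> comparables prec v) \<beta> (Suc i))"
  shows "restr (part_basis prec F (W - {v}) (\<beta> + sv v) i) (cdiff F (Suc i) x) = 0"
proof (rule poly_mapping_eqI)
  fix b
  have "lk (cdiff F (Suc i) x) b = 0" if b: "b \<in> part_basis prec F (W - {v}) (\<beta> + sv v) i"
    unfolding cdiff_def lookup_linext
  proof (rule sum.neutral, rule ballI, rule ccontr)
    fix c assume c: "c \<in> ks x" and nz: "lk x c * lk (cdiff_column F (Suc i) c) b \<noteq> 0"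
    have "c \<in> part_basis prec F (W \<inter> comparables prec v) \<beta> (Suc i)" using c x by (auto simp: span_on_def)
    then obtain d where d: "c \<in> fbasis F (Suc i)" "\<beta> = d + fdeg F (Suc i) c" by (auto simp: part_basis_def)
    obtain e where e: "fdeg F (Suc i) c = e + fdeg F i b"
      using fdiff_single(1)[OF g d(1)] nz by fastforce
    obtain \<gamma> where \<gamma>: "\<beta> + sv v = \<gamma> + fdeg F i b" "ks \<gamma> \<subseteq> W - {v}" using b by (auto simp: part_basis_def)
    have "\<gamma> + fdeg F i b = (d + e + sv v) + fdeg F i b" using \<gamma>(1) d(2) e by (simp add: ac_simps)
    then have "\<gamma> = d + e + sv v" by simp
    then show False using \<gamma>(2) by (auto simp: keys_plus_nat)
  qed
  then show "lk (restr (part_basis prec F (W - {v}) (\<beta> + sv v) i) (cdiff F (Suc i) x)) b = lk 0 b" by simp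
qed

section \<open>Homology of a resolution of k with coefficients in A_W\<close>

locale resolution =
  fixes prec :: "'n::{finite,linorder} \<Rightarrow> 'n \<Rightarrow> bool" and F :: "('b, 'n, 'k::field) gfree"
  assumes F: "graded_free_resolution prec F" and lt: "\<And>i j. prec i j \<Longrightarrow> i < j"
begin

abbreviation "YU \<alpha> \<equiv> part_basis prec F UNIV \<alpha>"

lemma graded: "graded F"
  using F unfolding graded_free_resolution_def graded_def by blast

lemma aug_deg: "b \<in> fbasis F 0 \<Longrightarrow> faug F b \<noteq> 0 \<Longrightarrow> fdeg F 0 b = 0"
  using F unfolding graded_free_resolution_def by blast

lemma aug_surj: "\<exists>v\<in>fcarrier F 0. feps F v = c"
  using F unfolding graded_free_resolution_def by blast

lemma aug_exact: "v \<in> fcarrier F 0 \<Longrightarrow> feps F v = 0 \<longleftrightarrow> (\<forall>\<alpha>. comp prec F 0 \<alpha> v \<in> boundaries (cdiff F) (YU \<alpha>) 0)"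
  using F boundaries_comp[OF graded, of v 0] unfolding graded_free_resolution_def One_nat_def by blast

lemma exact: "v \<in> fcarrier F (Suc i) \<Longrightarrow> fzero prec (fd F (Suc i) v) \<longleftrightarrow>
    (\<exists>w\<in>fcarrier F (Suc (Suc i)). fzero prec (v - fd F (Suc (Suc i)) w))"
  using F unfolding graded_free_resolution_def by (metis le_add1 plus_1_eq_Suc)

lemma zero_in: "0 \<in> boundaries (cdiff F) Y i" "0 \<in> cycles (cdiff F) Y i"
  by (rule pm.subspace_0[OF subspace_boundaries[of "cdiff F", OF lin_cdiff]],
      rule pm.subspace_0[OF subspace_cycles[of "cdiff F", OF lin_cdiff]])

lemma exact_UNIV: "cycles (cdiff F) (YU \<alpha>) (Suc i) \<subseteq> boundaries (cdiff F) (YU \<alpha>) (Suc i)"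
proof
  fix x assume x: "x \<in> cycles (cdiff F) (YU \<alpha>) (Suc i)"
  then have xc: "x \<in> span_on (YU \<alpha> (Suc i))" by (simp add: cycles_def)
  let ?v = "lift F (Suc i) \<alpha> x"
  have v: "?v \<in> fcarrier F (Suc i)" by (rule lift_fcarrier[OF xc])
  have "fzero prec (fd F (Suc i) ?v)"
    unfolding cycles_comp[OF graded v] comp_lift[OF xc] using x zero_in by auto
  then have "\<forall>\<beta>. comp prec F (Suc i) \<beta> ?v \<in> boundaries (cdiff F) (YU \<beta>) (Suc i)"
    using exact[OF v] boundaries_comp[OF graded v] by blast
  then have "comp prec F (Suc i) \<alpha> ?v \<in> boundaries (cdiff F) (YU \<alpha>) (Suc i)" by blast
  then show "x \<in> boundaries (cdiff F) (YU \<alpha>) (Suc i)" by (simp add: comp_lift[OF xc])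
qed

text \<open>The definition of a resolution expresses that consecutive maps compose to 0 through the
  equivalence in the exactness condition: an image differs from itself by 0, hence is a
  cycle.\<close>

lemma dd_UNIV: "x \<in> span_on (YU \<alpha> (Suc i)) \<Longrightarrow> res_diff (cdiff F) (YU \<alpha>) i (res_diff (cdiff F) (YU \<alpha>) (Suc i) x) = 0"
proof (cases i)
  case (Suc j)
  assume xc: "x \<in> span_on (YU \<alpha> (Suc i))"
  let ?w = "lift F (Suc i) \<alpha> x"
  have w: "?w \<in> fcarrier F (Suc i)" by (rule lift_fcarrier[OF xc])
  have v: "fd F (Suc i) ?w \<in> fcarrier F (Suc j)" using fd_fcarrier[OF graded w] Suc by simp
  have "fzero prec (fd F (Suc i) ?w - fd F (Suc i) ?w)" by (simp add: fzero_iff)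
  then have "\<exists>w\<in>fcarrier F (Suc (Suc j)). fzero prec (fd F (Suc i) ?w - fd F (Suc (Suc j)) w)"
    using w unfolding Suc by blast
  then have "fzero prec (fd F (Suc j) (fd F (Suc i) ?w))" using exact[OF v] by blast
  then have "comp prec F (Suc j) \<alpha> (fd F (Suc i) ?w) \<in> cycles (cdiff F) (YU \<alpha>) (Suc j)"
    unfolding cycles_comp[OF graded v] by blast
  then have "res_diff (cdiff F) (YU \<alpha>) (Suc i) x \<in> cycles (cdiff F) (YU \<alpha>) (Suc j)"
    using comp_fd[OF graded w, of prec \<alpha>] comp_lift[OF xc, of \<alpha>] Suc by (simp del: res_diff_simps)
  then show ?thesis by (simp add: cycles_def Suc del: res_diff_simps)
qed simp

definition aug :: "('b \<Rightarrow>\<^sub>0 'k) \<Rightarrow> 'k" where "aug x = (\<Sum>b\<in>ks x. lk x b * faug F b)"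

lemma aug_superset: "finite S \<Longrightarrow> ks x \<subseteq> S \<Longrightarrow> aug x = (\<Sum>b\<in>S. lk x b * faug F b)"
  unfolding aug_def by (intro sum.mono_neutral_left) (auto simp: in_keys_iff)

lemma YU0: "b \<in> YU 0 0 \<longleftrightarrow> b \<in> fbasis F 0 \<and> fdeg F 0 b = 0"
proof -
  have "c + d = 0 \<longleftrightarrow> c = 0 \<and> d = 0" for c d :: "'n monom"
    by (auto simp: poly_mapping_eq_iff fun_eq_iff lookup_add)
  then have "(\<exists>c. 0 = c + fdeg F 0 b \<and> std prec c \<and> ks c \<subseteq> UNIV) \<longleftrightarrow> fdeg F 0 b = 0"
    by (metis std_0 subset_UNIV)
  then show ?thesis by (simp add: part_basis_def)
qed

lemma feps_comp: "v \<in> fcarrier F 0 \<Longrightarrow> feps F v = aug (comp prec F 0 0 v)"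
proof -
  assume v: "v \<in> fcarrier F 0"
  have "ks (comp prec F 0 0 v) \<subseteq> ks v" by (auto simp: in_keys_iff lookup_comp split: if_splits)
  then have "aug (comp prec F 0 0 v) = (\<Sum>b\<in>ks v. lk (comp prec F 0 0 v) b * faug F b)"
    by (intro aug_superset) auto
  also have "\<dots> = feps F v" unfolding feps_def
  proof (rule sum.cong[OF refl])
    fix b assume "b \<in> ks v"
    then have b: "b \<in> fbasis F 0" using v by (auto simp: fcarrier_def)
    show "lk (comp prec F 0 0 v) b * faug F b = lk (lk v b) 0 * faug F b"
      using aug_deg[OF b] b by (cases "faug F b = 0") (auto simp: lookup_comp YU0)
  qed
  finally show ?thesis by simp
qed

text \<open>The augmentation can be nonzero only in multidegree 0; in all other multidegrees every
  element lies in its kernel and hence is a boundary.\<close>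

lemma exact_aug: "x \<in> span_on (YU \<alpha> 0) \<Longrightarrow> x \<in> boundaries (cdiff F) (YU \<alpha>) 0 \<longleftrightarrow> \<alpha> \<noteq> 0 \<or> aug x = 0"
proof -
  assume xc: "x \<in> span_on (YU \<alpha> 0)"
  let ?v = "lift F 0 \<alpha> x"
  have v: "?v \<in> fcarrier F 0" by (rule lift_fcarrier[OF xc])
  have "x \<in> boundaries (cdiff F) (YU \<alpha>) 0 \<longleftrightarrow> (\<forall>\<beta>. comp prec F 0 \<beta> ?v \<in> boundaries (cdiff F) (YU \<beta>) 0)"
    unfolding comp_lift[OF xc] using zero_in(1) by auto
  also have "\<dots> \<longleftrightarrow> feps F ?v = 0" using aug_exact[OF v] by blast
  also have "\<dots> \<longleftrightarrow> aug (if \<alpha> = 0 then x else 0) = 0"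
    using feps_comp[OF v] comp_lift[OF xc, of 0] by auto
  also have "\<dots> \<longleftrightarrow> \<alpha> \<noteq> 0 \<or> aug x = 0" by (auto simp: aug_def)
  finally show ?thesis .
qed

text \<open>Any element with augmentation 1 represents a basis.\<close>

lemma has_quot_dim_UNIV_0: "has_quot_dim (cycles (cdiff F) (YU 0) 0) (boundaries (cdiff F) (YU 0) 0) 1"
proof -
  obtain v where v: "v \<in> fcarrier F 0" "feps F v = 1" using aug_surj by blast
  define x1 where "x1 = comp prec F 0 0 v"
  have x1: "aug x1 = 1" "x1 \<in> span_on (YU 0 0)" using feps_comp[OF v(1)] v(2) comp_span_on by (auto simp: x1_def)
  have c: "cycles (cdiff F) (YU 0) 0 = span_on (YU 0 0)" by (auto simp: cycles_def)
  have augd: "aug (x - pscale c x1) = aug x - c" for x c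
  proof -
    have "aug (x - pscale c x1) = (\<Sum>b\<in>ks x \<union> ks x1. lk (x - pscale c x1) b * faug F b)"
      by (rule aug_superset) (auto simp: in_keys_iff lookup_minus)
    also have "\<dots> = (\<Sum>b\<in>ks x \<union> ks x1. lk x b * faug F b) - c * (\<Sum>b\<in>ks x \<union> ks x1. lk x1 b * faug F b)"
      by (simp add: lookup_minus left_diff_distrib sum_subtractf sum_distrib_left mult.assoc)
    also have "\<dots> = aug x - c * aug x1"
      using aug_superset[of "ks x \<union> ks x1" x] aug_superset[of "ks x \<union> ks x1" x1] by simp
    finally show ?thesis using x1 by simp
  qed
  have sub: "x - pscale c x1 \<in> span_on (YU 0 0)" if "x \<in> span_on (YU 0 0)" for x c
    using that x1(2) subspace_span_on pm.subspace_diff pm.subspace_scale by blast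
  have "aug (pscale c x1) = c" for c
  proof -
    have "aug (pscale c x1) = (\<Sum>b\<in>ks x1. lk (pscale c x1) b * faug F b)"
      by (rule aug_superset) (auto simp: in_keys_iff)
    then show ?thesis using x1(1) by (simp add: aug_def mult.assoc flip: sum_distrib_left)
  qed
  then have ind: "pscale c x1 \<in> boundaries (cdiff F) (YU 0) 0 \<Longrightarrow> c = 0" for c
    using exact_aug[of "pscale c x1" 0] x1(2) subspace_span_on pm.subspace_scale by metis
  show ?thesis unfolding has_quot_dim_def
  proof (intro exI[of _ "\<lambda>_. x1"] conjI ballI allI impI)
    show "x1 \<in> cycles (cdiff F) (YU 0) 0" for i using x1 c by simp
    fix x assume x: "x \<in> cycles (cdiff F) (YU 0) 0"
    have "x - pscale (aug x) x1 \<in> boundaries (cdiff F) (YU 0) 0"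
      using exact_aug[OF sub[of x "aug x"]] x c augd by simp
    then show "\<exists>c. x - (\<Sum>i<1::nat. pscale (c i) x1) \<in> boundaries (cdiff F) (YU 0) 0"
      by (intro exI[of _ "\<lambda>_. aug x"]) (simp add: lessThan_Suc)
  qed (use ind in auto)
qed

lemma has_quot_dim_UNIV: "has_quot_dim (cycles (cdiff F) (YU \<alpha>) i) (boundaries (cdiff F) (YU \<alpha>) i) (if i = 0 \<and> \<alpha> = 0 then 1 else 0)"
proof (cases "i = 0 \<and> \<alpha> = 0")
  case True
  then show ?thesis using has_quot_dim_UNIV_0 by simp
next
  case False
  have "cycles (cdiff F) (YU \<alpha>) i \<subseteq> boundaries (cdiff F) (YU \<alpha>) i"
  proof (cases i)
    case 0
    then show ?thesis using False exact_aug by (auto simp: cycles_def)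
  qed (use exact_UNIV in simp)
  then show ?thesis using False by (auto simp: has_quot_dim_0_iff)
qed

abbreviation "H W \<alpha> i \<equiv> has_quot_dim (cycles (cdiff F) (part_basis prec F W \<alpha>) i) (boundaries (cdiff F) (part_basis prec F W \<alpha>) i)"

text \<open>The dimension of the degree-\<alpha> part of Tor_i(A_W, k) for i = |\<alpha>|, the only
  i for which it can be nonzero.\<close>

definition betti_in :: "'n set \<Rightarrow> 'n monom \<Rightarrow> nat" where
  "betti_in W \<alpha> = quot_dim (cycles (cdiff F) (part_basis prec F W \<alpha>) (total_deg \<alpha>)) (boundaries (cdiff F) (part_basis prec F W \<alpha>) (total_deg \<alpha>))"

lemma H_quot_dim: "H W \<alpha> i n \<Longrightarrow>
    quot_dim (cycles (cdiff F) (part_basis prec F W \<alpha>) i) (boundaries (cdiff F) (part_basis prec F W \<alpha>) i) = n"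
  by (intro quot_dim_eq subspace_boundaries lin_cdiff)

lemma subcomplex: "v \<in> W \<Longrightarrow> subcomplex (cdiff F) (part_basis prec F W (\<beta> + sv v))
    (part_basis prec F (W - {v}) (\<beta> + sv v)) (part_basis prec F (W \<inter> comparables prec v) \<beta>)"
proof (rule subcomplex.intro)
  assume v: "v \<in> W"
  show "part_basis prec F W (\<beta> + sv v) i = part_basis prec F (W - {v}) (\<beta> + sv v) i \<union> part_basis prec F (W \<inter> comparables prec v) \<beta> i" for i
    using lt v by (rule part_basis_split(1))
  show "part_basis prec F (W - {v}) (\<beta> + sv v) i \<inter> part_basis prec F (W \<inter> comparables prec v) \<beta> i = {}" for i
    using lt v by (rule part_basis_split(2))
  show "restr (part_basis prec F (W - {v}) (\<beta> + sv v) i) (cdiff F (Suc i) x) = 0"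
    if "x \<in> span_on (part_basis prec F (W \<inter> comparables prec v) \<beta> (Suc i))" for i x
    using cdiff_triangular[OF graded that] .
  show "res_diff (cdiff F) (part_basis prec F W (\<beta> + sv v)) i (res_diff (cdiff F) (part_basis prec F W (\<beta> + sv v)) (Suc i) x) = 0"
    if x: "x \<in> span_on (part_basis prec F W (\<beta> + sv v) (Suc i))" for i x
  proof (rule res_diff_res_diff_subset[OF graded x])
    have "x \<in> span_on (YU (\<beta> + sv v) (Suc i))" using x part_basis_mono[OF subset_UNIV[of W], of prec F "\<beta> + sv v" "Suc i"] unfolding span_on_def by blast
    then show "res_diff (cdiff F) (YU (\<beta> + sv v)) i (res_diff (cdiff F) (YU (\<beta> + sv v)) (Suc i) x) = 0" by (rule dd_UNIV)
  qed
qed (rule lin_cdiff)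

lemma part_basis_same: "v \<in> W \<Longrightarrow> lk \<alpha> v = 0 \<Longrightarrow> part_basis prec F (W - {v}) \<alpha> = part_basis prec F W \<alpha>"
  using part_basis_split(3)[OF lt, of prec v W \<alpha> F] by (simp add: fun_eq_iff)

text \<open>Tensoring the resolution with the quotients of \<open>A\<close> by sets of variables, the exact sequence
  of multiplication by one further variable shows both that the homology is concentrated on the
  diagonal and how its dimensions are computed.\<close>

lemma H_step:
  assumes v: "v \<in> W" and \<alpha>: "\<alpha> = \<beta> + sv v"
    and IH1: "\<And>i. \<exists>n. H W \<alpha> i n \<and> (i \<noteq> total_deg \<alpha> \<longrightarrow> n = 0)"
    and IH2: "\<And>i. \<exists>n. H (W \<inter> comparables prec v) \<beta> i n \<and> (i \<noteq> total_deg \<beta> \<longrightarrow> n = 0)"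
  shows "i \<noteq> total_deg \<alpha> \<Longrightarrow> H (W - {v}) \<alpha> i 0"
    and "H (W - {v}) \<alpha> (total_deg \<alpha>) (betti_in W \<alpha> + betti_in (W \<inter> comparables prec v) \<beta>)"
proof -
  interpret S: subcomplex "cdiff F" "part_basis prec F W \<alpha>" "part_basis prec F (W - {v}) \<alpha>" "part_basis prec F (W \<inter> comparables prec v) \<beta>"
    unfolding \<alpha> by (rule subcomplex[OF v])
  have td: "total_deg \<alpha> = Suc (total_deg \<beta>)" by (simp add: \<alpha> total_deg_add)
  have h1: "H W \<alpha> (total_deg \<alpha>) (betti_in W \<alpha>)" using IH1[of "total_deg \<alpha>"] H_quot_dim unfolding betti_in_def by metis
  have h2: "H (W \<inter> comparables prec v) \<beta> (total_deg \<beta>) (betti_in (W \<inter> comparables prec v) \<beta>)"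
    using IH2[of "total_deg \<beta>"] H_quot_dim unfolding betti_in_def by metis
  have z1: "H W \<alpha> i 0" if "i \<noteq> total_deg \<alpha>" for i using IH1[of i] that by auto
  have z2: "H (W \<inter> comparables prec v) \<beta> i 0" if "i \<noteq> total_deg \<beta>" for i using IH2[of i] that by auto
  show "H (W - {v}) \<alpha> i 0" if "i \<noteq> total_deg \<alpha>"
    unfolding has_quot_dim_0_iff
  proof (rule S.les_vanish)
    show "cycles (cdiff F) (part_basis prec F W \<alpha>) i \<subseteq> boundaries (cdiff F) (part_basis prec F W \<alpha>) i" using z1[OF that] by (simp add: has_quot_dim_0_iff)
    show "cycles (cdiff F) (part_basis prec F (W \<inter> comparables prec v) \<beta>) j \<subseteq> boundaries (cdiff F) (part_basis prec F (W \<inter> comparables prec v) \<beta>) j"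
      if "i = Suc j" for j using z2[of j] \<open>i \<noteq> total_deg \<alpha>\<close> that td by (simp add: has_quot_dim_0_iff)
  qed
  show "H (W - {v}) \<alpha> (total_deg \<alpha>) (betti_in W \<alpha> + betti_in (W \<inter> comparables prec v) \<beta>)"
    unfolding td
  proof (rule S.les_dim)
    show "cycles (cdiff F) (part_basis prec F (W \<inter> comparables prec v) \<beta>) (Suc (total_deg \<beta>)) \<subseteq>
        boundaries (cdiff F) (part_basis prec F (W \<inter> comparables prec v) \<beta>) (Suc (total_deg \<beta>))"
      using z2[of "Suc (total_deg \<beta>)"] by (simp add: has_quot_dim_0_iff)
    show "cycles (cdiff F) (part_basis prec F W \<alpha>) (total_deg \<beta>) \<subseteq> boundaries (cdiff F) (part_basis prec F W \<alpha>) (total_deg \<beta>)"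
      using z1[of "total_deg \<beta>"] td by (simp add: has_quot_dim_0_iff)
  qed (use h1 h2 td in auto)
qed

text \<open>Two nested inductions: on the total degree, which takes care of the kernel term with its
  lowered degree, and inside one degree on the set of removed variables, starting from A itself,
  where the homology is k.\<close>

lemma H_exists: "\<exists>n. H W \<alpha> i n \<and> (i \<noteq> total_deg \<alpha> \<longrightarrow> n = 0)"
proof (induction "total_deg \<alpha>" arbitrary: \<alpha> W i rule: less_induct)
  case less
  \<comment> \<open>Stated for complements, so that removing variables becomes an induction over a
    finite set.\<close>
  have "\<forall>i. \<exists>n. H (- U) \<alpha> i n \<and> (i \<noteq> total_deg \<alpha> \<longrightarrow> n = 0)" for U
  proof (induction U rule: finite_induct[OF finite])
    case 1
    have "\<exists>n. H UNIV \<alpha> i n \<and> (i \<noteq> total_deg \<alpha> \<longrightarrow> n = 0)" for i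
      by (rule exI[of _ "if i = 0 \<and> \<alpha> = 0 then 1 else 0"]) (use has_quot_dim_UNIV[of \<alpha> i] total_deg_0_iff in auto)
    then show ?case by simp
  next
    case (2 v U)
    have v: "v \<in> - U" and U: "- insert v U = - U - {v}" using 2 by auto
    show ?case
    proof (cases "lk \<alpha> v = 0")
      case True
      then show ?thesis unfolding U using part_basis_same[OF v True] 2 by simp
    next
      case False
      define \<beta> where "\<beta> = \<alpha> - sv v"
      have \<alpha>: "\<alpha> = \<beta> + sv v" using monom_diff[of \<alpha> v] False by (simp add: \<beta>_def)
      have "total_deg \<beta> < total_deg \<alpha>" by (simp add: \<alpha> total_deg_add)
      then have IH2: "\<exists>n. H (- U \<inter> comparables prec v) \<beta> i n \<and> (i \<noteq> total_deg \<beta> \<longrightarrow> n = 0)" for i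
        using less by blast
      have IH1: "\<exists>n. H (- U) \<alpha> i n \<and> (i \<noteq> total_deg \<alpha> \<longrightarrow> n = 0)" for i using 2 by blast
      note st = H_step[OF v \<alpha> IH1 IH2]
      show ?thesis unfolding U using st by metis
    qed
  qed
  then have "\<exists>n. H (- (- W)) \<alpha> i n \<and> (i \<noteq> total_deg \<alpha> \<longrightarrow> n = 0)" by blast
  then show ?case by simp
qed

lemma betti_in_UNIV: "betti_in UNIV \<alpha> = (if \<alpha> = 0 then 1 else 0)"
  unfolding betti_in_def using H_quot_dim[OF has_quot_dim_UNIV[of \<alpha> "total_deg \<alpha>"]] total_deg_0_iff[of \<alpha>] by auto

lemma betti_in_step: "v \<in> W \<Longrightarrow> betti_in (W - {v}) (\<beta> + sv v) = betti_in W (\<beta> + sv v) + betti_in (W \<inter> comparables prec v) \<beta>"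
  using H_quot_dim[OF H_step(2)[OF _ refl H_exists H_exists]] by (simp add: betti_in_def[of "W - {v}"])

lemma betti_in_same: "v \<in> W \<Longrightarrow> lk \<alpha> v = 0 \<Longrightarrow> betti_in (W - {v}) \<alpha> = betti_in W \<alpha>"
  by (simp add: betti_in_def part_basis_same)

lemma tensor_homology: "tensor_homology_dim F i \<alpha> = (if i = total_deg \<alpha> then betti_in {} \<alpha> else 0)"
proof -
  have Y: "part_basis prec F {} \<alpha> i = {b \<in> fbasis F i. fdeg F i b = \<alpha>}" for i
  proof -
    have "(\<exists>c. \<alpha> = c + fdeg F i b \<and> std prec c \<and> ks c \<subseteq> {}) \<longleftrightarrow> fdeg F i b = \<alpha>" for b
      by auto
    then show ?thesis by (simp add: part_basis_def)
  qed
  have tp: "tensor_part F i \<alpha> = span_on (part_basis prec F {} \<alpha> i)" for i by (simp add: tensor_part_def span_on_def Y)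
  have td: "tensor_d F i x = res_diff (cdiff F) (part_basis prec F {} \<alpha>) i x" if x: "x \<in> span_on (part_basis prec F {} \<alpha> i)" for i x
  proof (cases i)
    case 0
    then show ?thesis by (simp add: tensor_d_def)
  next
    case (Suc j)
    show ?thesis
    proof (rule poly_mapping_eqI)
      fix b
      have m: "lk (Poly_Mapping.map (\<lambda>p. lk p 0) q) b = lk (lk q b) 0" for q :: "'b \<Rightarrow>\<^sub>0 ('n, 'k) mpoly"
        by (simp add: Poly_Mapping.map.rep_eq when_def)
      have "lk (tensor_d F i x) b = (\<Sum>c\<in>ks x. lk x c * lk (lk (fdiff F i c) b) 0)"
        using Suc by (simp add: tensor_d_def lookup_sum m)
      also have "\<dots> = (\<Sum>c\<in>ks x. lk x c * (if b \<in> part_basis prec F {} \<alpha> j then lk (cdiff_column F i c) b else 0))"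
      proof (rule sum.cong[OF refl])
        fix c assume "c \<in> ks x"
        then have "c \<in> part_basis prec F {} \<alpha> i" using x by (auto simp: span_on_def)
        then have c: "c \<in> fbasis F (Suc j)" "fdeg F (Suc j) c = \<alpha>" using Y Suc by auto
        have "lk (lk (fdiff F (Suc j) c) b) 0 = (if b \<in> part_basis prec F {} \<alpha> j then lk (cdiff_column F (Suc j) c) b else 0)"
        proof (cases "lk (cdiff_column F (Suc j) c) b = 0")
          case True
          then show ?thesis using fdiff_single(2)[OF graded c(1)] by simp
        next
          case False
          then obtain d where d: "b \<in> fbasis F j" "fdeg F (Suc j) c = d + fdeg F j b"
            "lk (fdiff F (Suc j) c) b = Poly_Mapping.single d (lk (cdiff_column F (Suc j) c) b)"
            using fdiff_single(1)[OF graded c(1)] by blast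
          have "fdeg F j b = d + fdeg F j b \<longleftrightarrow> d = 0" by simp
          then have "b \<in> part_basis prec F {} \<alpha> j \<longleftrightarrow> d = 0" unfolding Y using d(1,2) c(2) by simp
          then show ?thesis using d(3) by (simp add: lookup_single when_def)
        qed
        then show "lk x c * lk (lk (fdiff F i c) b) 0 =
            lk x c * (if b \<in> part_basis prec F {} \<alpha> j then lk (cdiff_column F i c) b else 0)" using Suc by simp
      qed
      also have "\<dots> = lk (res_diff (cdiff F) (part_basis prec F {} \<alpha>) i x) b"
        using Suc by (simp add: cdiff_def lookup_linext)
      finally show "lk (tensor_d F i x) b = lk (res_diff (cdiff F) (part_basis prec F {} \<alpha>) i x) b" .
    qed
  qed
  have "{v \<in> tensor_part F i \<alpha>. tensor_d F i v = 0} = cycles (cdiff F) (part_basis prec F {} \<alpha>) i"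
    using td by (auto simp: tp cycles_def simp del: res_diff_simps)
  moreover have "tensor_d F (Suc i) ` tensor_part F (Suc i) \<alpha> = boundaries (cdiff F) (part_basis prec F {} \<alpha>) i"
    unfolding boundaries_def tp by (rule image_cong[OF refl td])
  ultimately have t: "tensor_homology_dim F i \<alpha> =
      quot_dim (cycles (cdiff F) (part_basis prec F {} \<alpha>) i) (boundaries (cdiff F) (part_basis prec F {} \<alpha>) i)"
    by (simp add: tensor_homology_dim_def)
  obtain n where n: "H {} \<alpha> i n" "i \<noteq> total_deg \<alpha> \<longrightarrow> n = 0" using H_exists by blast
  then show ?thesis using t H_quot_dim[OF n(1)] by (auto simp: betti_in_def)
qed

end

section \<open>The bar resolution\<close>

abbreviation "ev b \<equiv> Poly_Mapping.single b 1"

text \<open>In degree \<alpha> a label b carries the cofactor \<alpha> - \<open>sum_list b\<close>.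
  Cofactor 1 is sent to 0, as in the normalized bar resolution.\<close>

definition bar_htpy :: "('n::linorder \<Rightarrow> 'n \<Rightarrow> bool) \<Rightarrow> 'n monom \<Rightarrow> ('n monom list \<Rightarrow>\<^sub>0 'k::field) \<Rightarrow> ('n monom list \<Rightarrow>\<^sub>0 'k)" where
  "bar_htpy prec \<alpha> = linext (\<lambda>b. if \<exists>c. \<alpha> = c + sum_list b \<and> c \<noteq> 0 \<and> std prec c then ev ((\<alpha> - sum_list b) # b) else 0)"

text \<open>The differential of the bar resolution, determined recursively by the contracting homotopy
  \<open>bar_htpy\<close>, which moves the coefficient of a basis element into its label.\<close>

fun bar_diff :: "('n::linorder \<Rightarrow> 'n \<Rightarrow> bool) \<Rightarrow> 'n monom list \<Rightarrow> ('n monom list \<Rightarrow>\<^sub>0 'k::field)" where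
  "bar_diff prec [] = 0"
| "bar_diff prec (a # b) = ev b - bar_htpy prec (a + sum_list b) (bar_diff prec b)"

definition valid :: "('n::linorder \<Rightarrow> 'n \<Rightarrow> bool) \<Rightarrow> 'n monom list \<Rightarrow> bool" where
  "valid prec b \<longleftrightarrow> (\<forall>a\<in>set b. std prec a \<and> a \<noteq> 0)"

definition bar :: "('n::linorder \<Rightarrow> 'n \<Rightarrow> bool) \<Rightarrow> ('n monom list, 'n, 'k::field) gfree" where
  "bar prec = \<lparr>fbasis = (\<lambda>i. {b. length b = i \<and> valid prec b}), fdeg = (\<lambda>i. sum_list),
     fdiff = (\<lambda>i b. Poly_Mapping.mapp (\<lambda>b' c. Poly_Mapping.single (sum_list b - sum_list b') c) (bar_diff prec b)),
     faug = (\<lambda>b. 1)\<rparr>"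

lemma bar_simps [simp]: "fbasis (bar prec) i = {b. length b = i \<and> valid prec b}"
  "fdeg (bar prec) i = sum_list" "faug (bar prec) b = 1"
  by (simp_all add: bar_def)

lemma lookup_fdiff_bar: "lk (fdiff (bar prec) i b) b' = Poly_Mapping.single (sum_list b - sum_list b') (lk (bar_diff prec b) b')"
  by (simp add: bar_def lookup_mapp0)

lemma monom_add_eq_0: "c + d = (0 :: 'n monom) \<longleftrightarrow> c = 0 \<and> d = 0"
  by (auto simp: poly_mapping_eq_iff fun_eq_iff lookup_add)

lemma lin_bar_htpy: "lin (bar_htpy prec \<alpha>)" by (simp add: bar_htpy_def lin_linext)

lemma bar_htpy_ev:
  "bar_htpy prec (c + sum_list b) (ev b) = (if c \<noteq> 0 \<and> std prec c then ev (c # b) else (0 :: _ \<Rightarrow>\<^sub>0 'k::field))"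
proof -
  have "(\<exists>c'. c + sum_list b = c' + sum_list b \<and> c' \<noteq> 0 \<and> std prec c') \<longleftrightarrow> c \<noteq> 0 \<and> std prec c" by auto
  then show ?thesis by (simp add: bar_htpy_def linext_single)
qed

lemma bar_htpy_ev_0: "(\<nexists>c. \<alpha> = c + sum_list b \<and> c \<noteq> 0 \<and> std prec c) \<Longrightarrow> bar_htpy prec \<alpha> (ev b) = (0 :: _ \<Rightarrow>\<^sub>0 'k::field)"
  by (auto simp: bar_htpy_def linext_single)

lemma lin_ext_eq:
  assumes "lin f" "lin g" "\<And>b. b \<in> ks x \<Longrightarrow> f (ev b) = g (ev b)"
  shows "f x = g x"
proof -
  have x: "x = (\<Sum>b\<in>ks x. pscale (lk x b) (ev b))"
  proof (rule poly_mapping_eqI)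
    fix k
    have "lk (\<Sum>b\<in>ks x. pscale (lk x b) (ev b)) k = (\<Sum>b\<in>ks x. if b = k then lk x b else 0)"
      unfolding lookup_sum by (intro sum.cong refl) (auto simp: lookup_single when_def)
    then show "lk x k = lk (\<Sum>b\<in>ks x. pscale (lk x b) (ev b)) k" by (simp add: in_keys_iff)
  qed
  have "f x = (\<Sum>b\<in>ks x. pscale (lk x b) (f (ev b)))" by (subst (1) x) (simp add: linD[OF assms(1)])
  also have "\<dots> = (\<Sum>b\<in>ks x. pscale (lk x b) (g (ev b)))" using assms(3) by (intro sum.cong refl) simp
  also have "\<dots> = g x" by (subst (3) x) (simp add: linD[OF assms(2)])
  finally show ?thesis .
qed

lemma keys_bar_htpy:
  fixes x :: "'n::linorder monom list \<Rightarrow>\<^sub>0 'k::field"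
  assumes "b \<in> ks (bar_htpy prec \<alpha> x)"
  obtains c b' where "b' \<in> ks x" "\<alpha> = c + sum_list b'" "c \<noteq> 0" "std prec c" "b = c # b'"
proof -
  let ?f = "\<lambda>b. if \<exists>c. \<alpha> = c + sum_list b \<and> c \<noteq> 0 \<and> std prec c then ev ((\<alpha> - sum_list b) # b) else (0 :: _ \<Rightarrow>\<^sub>0 'k)"
  have "lk (bar_htpy prec \<alpha> x) b \<noteq> 0" using assms by (simp add: in_keys_iff)
  then have "(\<Sum>b'\<in>ks x. lk x b' * lk (?f b') b) \<noteq> 0" by (simp add: bar_htpy_def lookup_linext)
  then obtain b' where b': "b' \<in> ks x" "lk x b' * lk (?f b') b \<noteq> 0" by (rule sum.not_neutral_contains_not_neutral)
  then have nz: "lk (?f b') b \<noteq> 0" by auto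
  then obtain c where c: "\<alpha> = c + sum_list b'" "c \<noteq> 0" "std prec c" by (auto split: if_splits)
  then have f: "?f b' = ev (c # b')" by auto
  have "lk (ev (c # b') :: _ \<Rightarrow>\<^sub>0 'k) b \<noteq> 0" using nz unfolding f .
  then have "b = c # b'" by (auto simp: lookup_single when_def split: if_splits)
  then show ?thesis using that b' c by blast
qed

lemma keys_bar_diff:
  assumes "valid prec b" "b' \<in> ks (bar_diff prec b :: _ \<Rightarrow>\<^sub>0 'k::field)"
  shows "valid prec b' \<and> Suc (length b') = length b \<and> (\<exists>e. sum_list b = e + sum_list b')"
  using assms
proof (induction b arbitrary: b')
  case (Cons a b)
  have v: "valid prec b" using Cons.prems by (simp add: valid_def)
  have "b' \<in> ks (ev b :: _ \<Rightarrow>\<^sub>0 'k) \<union> ks (bar_htpy prec (a + sum_list b) (bar_diff prec b) :: _ \<Rightarrow>\<^sub>0 'k)"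
    using Cons.prems(2) keys_diff[of "ev b" "bar_htpy prec (a + sum_list b) (bar_diff prec b) :: _ \<Rightarrow>\<^sub>0 'k"] by auto
  then show ?case
  proof
    assume "b' \<in> ks (ev b :: _ \<Rightarrow>\<^sub>0 'k)"
    then show ?thesis using v by auto
  next
    assume "b' \<in> ks (bar_htpy prec (a + sum_list b) (bar_diff prec b) :: _ \<Rightarrow>\<^sub>0 'k)"
    then obtain c d where d: "d \<in> ks (bar_diff prec b :: _ \<Rightarrow>\<^sub>0 'k)" "a + sum_list b = c + sum_list d" "c \<noteq> 0" "std prec c" "b' = c # d"
      by (rule keys_bar_htpy)
    have "valid prec d \<and> Suc (length d) = length b" using Cons.IH[OF v d(1)] by simp
    moreover have "sum_list (a # b) = 0 + sum_list b'" using d(2,5) by simp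
    ultimately show ?thesis using d(3-5) by (auto simp: valid_def)
  qed
qed simp

lemma graded_bar: "graded (bar prec :: ('n monom list, 'n::linorder, 'k::field) gfree)"
  unfolding graded_def
proof (intro allI ballI conjI)
  fix i b assume b: "b \<in> fbasis (bar prec :: ('n monom list, 'n, 'k) gfree) (Suc i)"
  let ?d = "fdiff (bar prec :: ('n monom list, 'n, 'k) gfree) (Suc i) b"
  have k: "b' \<in> ks (bar_diff prec b :: _ \<Rightarrow>\<^sub>0 'k)" if "lk ?d b' \<noteq> 0" for b'
    using that by (auto simp: lookup_fdiff_bar in_keys_iff)
  show "?d \<in> fcarrier (bar prec) i"
    using k keys_bar_diff[of prec b] b by (fastforce simp: fcarrier_def in_keys_iff[of _ ?d])
  fix b' m assume m: "m \<in> ks (lk ?d b')"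
  then have nz: "lk ?d b' \<noteq> 0" by auto
  obtain e where e: "sum_list b = e + sum_list b'" using keys_bar_diff[OF _ k[OF nz]] b by auto
  have "m = sum_list b - sum_list b'" using m by (auto simp: lookup_fdiff_bar split: if_splits)
  then show "m + fdeg (bar prec :: ('n monom list, 'n, 'k) gfree) i b' = fdeg (bar prec :: ('n monom list, 'n, 'k) gfree) (Suc i) b"
    using e by simp
qed

section \<open>Exactness of the bar resolution\<close>

locale bar_complex =
  fixes prec :: "'n::{finite,linorder} \<Rightarrow> 'n \<Rightarrow> bool" and F :: "('n monom list, 'n, 'k::field) gfree"
  assumes F_bar: "F = bar prec"
begin

lemma F_simps: "fbasis F i = {b. length b = i \<and> valid prec b}"
  "fdeg F i = sum_list" "faug F b = 1" and graded_F: "graded F"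
  using graded_bar by (simp_all add: F_bar)

abbreviation "Y \<alpha> \<equiv> part_basis prec F UNIV \<alpha>"

lemma Y_iff: "b \<in> Y \<alpha> i \<longleftrightarrow> length b = i \<and> valid prec b \<and> (\<exists>c. \<alpha> = c + sum_list b \<and> std prec c)"
  by (auto simp: part_basis_def F_simps)

lemma cdiff_column_bar: "valid prec b \<Longrightarrow> length b = Suc i \<Longrightarrow> cdiff_column F (Suc i) b = bar_diff prec b"
  by (rule poly_mapping_eqI) (simp add: lookup_cdiff_column F_simps, simp add: F_bar lookup_fdiff_bar)

lemma cdiff_ev: "valid prec b \<Longrightarrow> length b = Suc i \<Longrightarrow> cdiff F (Suc i) (ev b) = bar_diff prec b"
  by (simp add: cdiff_def linext_single cdiff_column_bar)

lemma bar_htpy_restr: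
  fixes x :: "'n monom list \<Rightarrow>\<^sub>0 'k"
  assumes "\<And>b. b \<in> ks x \<Longrightarrow> valid prec b \<and> length b = i"
  shows "bar_htpy prec \<alpha> (restr (Y \<alpha> i) x) = bar_htpy prec \<alpha> x"
proof -
  have "lin (\<lambda>x. bar_htpy prec \<alpha> (restr (Y \<alpha> i) x))"
    by (simp add: lin_def linD(1,2)[OF lin_bar_htpy] linD(1,2)[OF lin_restr])
  then show ?thesis
  proof (rule lin_ext_eq[OF _ lin_bar_htpy])
    fix b assume b: "b \<in> ks x"
    show "bar_htpy prec \<alpha> (restr (Y \<alpha> i) (ev b)) = bar_htpy prec \<alpha> (ev b :: _ \<Rightarrow>\<^sub>0 'k)"
    proof (cases "b \<in> Y \<alpha> i")
      case True
      then show ?thesis by (simp add: restr_id)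
    next
      case False
      then have "bar_htpy prec \<alpha> (ev b) = (0 :: _ \<Rightarrow>\<^sub>0 'k)"
        using assms[OF b] by (intro bar_htpy_ev_0) (auto simp: Y_iff)
      moreover have "restr (Y \<alpha> i) (ev b) = (0 :: _ \<Rightarrow>\<^sub>0 'k)"
        using False by (intro poly_mapping_eqI) (auto simp: lookup_single when_def)
      ultimately show ?thesis by (simp add: linD[OF lin_bar_htpy])
    qed
  qed
qed

lemma bar_htpy_span_on: "(x :: 'n monom list \<Rightarrow>\<^sub>0 'k) \<in> span_on (Y \<alpha> i) \<Longrightarrow> bar_htpy prec \<alpha> x \<in> span_on (Y \<alpha> (Suc i))"
proof -
  assume x: "x \<in> span_on (Y \<alpha> i)"
  have "b \<in> Y \<alpha> (Suc i)" if bk: "b \<in> ks (bar_htpy prec \<alpha> x)" for b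
  proof -
    obtain c b' where b: "b' \<in> ks x" "\<alpha> = c + sum_list b'" "c \<noteq> 0" "std prec c" "b = c # b'"
      using bk by (rule keys_bar_htpy)
    then have "b' \<in> Y \<alpha> i" using x by (auto simp: span_on_def)
    then have "length b = Suc i" "valid prec b" "\<alpha> = 0 + sum_list b" using b by (auto simp: Y_iff valid_def)
    then show ?thesis using std_0 by (auto simp: Y_iff)
  qed
  then show ?thesis by (auto simp: span_on_def)
qed

text \<open>The homotopy produces only labels with cofactor 1, and those it sends to 0.\<close>

lemma bar_htpy_bar_htpy: "bar_htpy prec \<alpha> (bar_htpy prec \<alpha> x) = (0 :: _ \<Rightarrow>\<^sub>0 'k)"
proof -
  have A: "bar_htpy prec \<alpha> y = (\<lambda>_. 0) y" if "\<And>b. b \<in> ks y \<Longrightarrow> \<alpha> = sum_list b" for y :: "_ \<Rightarrow>\<^sub>0 'k"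
  proof (rule lin_ext_eq[OF lin_bar_htpy])
    show "lin (\<lambda>_. 0 :: _ \<Rightarrow>\<^sub>0 'k)" by (simp add: lin_def)
    fix b assume "b \<in> ks y"
    then have "\<alpha> = sum_list b" by (rule that)
    then show "bar_htpy prec \<alpha> (ev b) = (0 :: _ \<Rightarrow>\<^sub>0 'k)" by (intro bar_htpy_ev_0) auto
  qed
  have B: "\<alpha> = sum_list b" if "b \<in> ks (bar_htpy prec \<alpha> x)" for b
    using that by (rule keys_bar_htpy) simp
  show ?thesis by (rule A[OF B])
qed

lemma res_diff_ev: "b \<in> Y \<alpha> (Suc i) \<Longrightarrow> res_diff (cdiff F) (Y \<alpha>) (Suc i) (ev b) = restr (Y \<alpha> i) (bar_diff prec b)"
  by (simp add: Y_iff cdiff_ev)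

lemma keys_Dv': "valid prec b \<Longrightarrow> c \<in> ks (bar_diff prec b :: _ \<Rightarrow>\<^sub>0 'k) \<Longrightarrow> valid prec c \<and> length c = length b - 1"
  using keys_bar_diff[of prec b c] by auto

text \<open>For a cofactor c other than 1 this is the recursive definition of
  \<open>bar_diff\<close> at c # b. For cofactor 1 the first summand is 0, and the homotopy applied
  to the differential of a # b' gives the label back, because the homotopy squares to 0. The
  excluded case, the empty label in degree 0, carries the homology.\<close>

lemma homotopy:
  assumes x: "x \<in> span_on (Y \<alpha> i)" and "i \<noteq> 0 \<or> \<alpha> \<noteq> 0"
  shows "res_diff (cdiff F) (Y \<alpha>) (Suc i) (bar_htpy prec \<alpha> x) + bar_htpy prec \<alpha> (res_diff (cdiff F) (Y \<alpha>) i x) = x"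
proof -
  note lr = linD[OF lin_res_diff[of "cdiff F", OF lin_cdiff]]
  have l: "lin (\<lambda>x. res_diff (cdiff F) (Y \<alpha>) (Suc i) (bar_htpy prec \<alpha> x) + bar_htpy prec \<alpha> (res_diff (cdiff F) (Y \<alpha>) i x))"
    by (simp add: lin_def lr linD[OF lin_bar_htpy] pm.scale_right_distrib del: res_diff_simps)
  have l2: "lin (\<lambda>x :: 'n monom list \<Rightarrow>\<^sub>0 'k. x)" by (simp add: lin_def)
  show ?thesis
  proof (rule lin_ext_eq[OF l l2])
    fix b assume "b \<in> ks x"
    then have b: "b \<in> Y \<alpha> i" using x by (auto simp: span_on_def)
    then obtain c where c: "\<alpha> = c + sum_list b" "std prec c" "length b = i" "valid prec b" by (auto simp: Y_iff)
    show "res_diff (cdiff F) (Y \<alpha>) (Suc i) (bar_htpy prec \<alpha> (ev b)) + bar_htpy prec \<alpha> (res_diff (cdiff F) (Y \<alpha>) i (ev b)) = ev b"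
    proof (cases "c = 0")
      case False
      have s: "bar_htpy prec \<alpha> (ev b) = (ev (c # b) :: _ \<Rightarrow>\<^sub>0 'k)" using bar_htpy_ev[of prec c b] c False by simp
      have cb: "c # b \<in> Y \<alpha> (Suc i)" using c False std_0 unfolding Y_iff
        by (auto simp: valid_def intro!: exI[of _ 0])
      have in_span_on: "bar_htpy prec \<alpha> (bar_diff prec b :: _ \<Rightarrow>\<^sub>0 'k) \<in> span_on (Y \<alpha> i)"
      proof (cases i)
        case 0
        then show ?thesis using c by (simp add: linD[OF lin_bar_htpy] span_on_iff)
      next
        case (Suc j)
        have "bar_htpy prec \<alpha> (restr (Y \<alpha> j) (bar_diff prec b :: _ \<Rightarrow>\<^sub>0 'k)) = bar_htpy prec \<alpha> (bar_diff prec b)"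
          by (rule bar_htpy_restr) (use keys_Dv'[OF c(4)] c(3) Suc in auto)
        then show ?thesis using bar_htpy_span_on[OF restr_span_on] Suc by metis
      qed
      have "res_diff (cdiff F) (Y \<alpha>) (Suc i) (ev (c # b)) = restr (Y \<alpha> i) (ev b - bar_htpy prec \<alpha> (bar_diff prec b))"
        unfolding res_diff_ev[OF cb] using c by simp
      also have "\<dots> = ev b - bar_htpy prec \<alpha> (bar_diff prec b)"
        using b in_span_on by (simp add: linD[OF lin_restr] restr_id span_on_def)
      finally have 1: "res_diff (cdiff F) (Y \<alpha>) (Suc i) (bar_htpy prec \<alpha> (ev b)) = ev b - bar_htpy prec \<alpha> (bar_diff prec b)"
        unfolding s .
      have 2: "bar_htpy prec \<alpha> (res_diff (cdiff F) (Y \<alpha>) i (ev b)) = bar_htpy prec \<alpha> (bar_diff prec b)"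
      proof (cases i)
        case 0
        then show ?thesis using c by simp
      next
        case (Suc j)
        have "res_diff (cdiff F) (Y \<alpha>) i (ev b) = restr (Y \<alpha> j) (bar_diff prec b)" using res_diff_ev[of b \<alpha> j] b Suc by blast
        moreover have "bar_htpy prec \<alpha> (restr (Y \<alpha> j) (bar_diff prec b :: _ \<Rightarrow>\<^sub>0 'k)) = bar_htpy prec \<alpha> (bar_diff prec b)"
          by (rule bar_htpy_restr) (use keys_Dv'[OF c(4)] c(3) Suc in auto)
        ultimately show ?thesis by simp
      qed
      show ?thesis unfolding 1 2 by simp
    next
      case True
      then have "i \<noteq> 0" using assms(2) c by auto
      then obtain j where j: "i = Suc j" by (cases i) auto
      then obtain a b' where ab: "b = a # b'" using c(3) by (cases b) auto
      have a: "a \<noteq> 0" "std prec a" "valid prec b'" "length b' = j" using c ab j by (auto simp: valid_def)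
      have \<alpha>: "\<alpha> = a + sum_list b'" using c True ab by simp
      have 1: "bar_htpy prec \<alpha> (ev b) = (0 :: _ \<Rightarrow>\<^sub>0 'k)" using c True by (intro bar_htpy_ev_0) auto
      have "res_diff (cdiff F) (Y \<alpha>) i (ev b) = restr (Y \<alpha> j) (bar_diff prec b)" using res_diff_ev[of b \<alpha> j] b j by blast
      moreover have "bar_htpy prec \<alpha> (restr (Y \<alpha> j) (bar_diff prec b :: _ \<Rightarrow>\<^sub>0 'k)) = bar_htpy prec \<alpha> (bar_diff prec b)"
        by (rule bar_htpy_restr) (use keys_Dv'[OF c(4)] c(3) j in auto)
      ultimately have "bar_htpy prec \<alpha> (res_diff (cdiff F) (Y \<alpha>) i (ev b)) = bar_htpy prec \<alpha> (bar_diff prec b)" by simp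
      also have "\<dots> = bar_htpy prec \<alpha> (ev b') - bar_htpy prec \<alpha> (bar_htpy prec \<alpha> (bar_diff prec b'))"
        by (simp add: ab \<alpha> linD[OF lin_bar_htpy])
      also have "\<dots> = ev b" using bar_htpy_ev[of prec a b'] a by (simp add: bar_htpy_bar_htpy ab \<alpha>)
      finally show ?thesis unfolding 1 lr(3) by simp
    qed
  qed
qed

text \<open>Write s for the homotopy and y for the differential of b'. The differential of a # b' is
  b' - s y; applying d gives y - d s y = s d y, and d y = 0 by hypothesis. Only in the degree of b
  itself does the recursive definition apply so directly.\<close>

lemma dd_ev_top:
  assumes IH: "\<And>b. valid prec b \<Longrightarrow> length b = Suc j \<Longrightarrow> b \<in> Y \<alpha> (Suc j) \<Longrightarrow>
      res_diff (cdiff F) (Y \<alpha>) j (res_diff (cdiff F) (Y \<alpha>) (Suc j) (ev b)) = 0"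
    and b: "valid prec b" "length b = Suc (Suc j)" "\<alpha> = sum_list b"
  shows "res_diff (cdiff F) (Y \<alpha>) (Suc j) (res_diff (cdiff F) (Y \<alpha>) (Suc (Suc j)) (ev b)) = 0"
proof -
  note lr = linD[OF lin_res_diff[of "cdiff F", OF lin_cdiff]]
  obtain a b' where ab: "b = a # b'" using b by (cases b) auto
  have a: "a \<noteq> 0" "std prec a" "valid prec b'" "length b' = Suc j" using b ab by (auto simp: valid_def)
  have \<alpha>: "\<alpha> = a + sum_list b'" using b ab by simp
  have \<alpha>0: "\<alpha> \<noteq> 0" using a(1) \<alpha> by (simp add: monom_add_eq_0)
  have bY: "b \<in> Y \<alpha> (Suc (Suc j))" using b std_0 by (auto simp: Y_iff intro!: exI[of _ 0])
  have b'Y: "b' \<in> Y \<alpha> (Suc j)" using a \<alpha> by (auto simp: Y_iff)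
  let ?D = "res_diff (cdiff F) (Y \<alpha>)"
  let ?y = "?D (Suc j) (ev b')"
  have y: "?y \<in> span_on (Y \<alpha> j)" by simp
  have s: "bar_htpy prec \<alpha> (bar_diff prec b') = bar_htpy prec \<alpha> ?y"
    unfolding res_diff_ev[OF b'Y] using keys_Dv'[OF a(3)] a(4) by (intro bar_htpy_restr[symmetric]) auto
  have Db: "bar_diff prec b = ev b' - bar_htpy prec \<alpha> ?y"
    unfolding ab bar_diff.simps using s unfolding \<alpha>[symmetric] by (simp only:)
  have "?D (Suc (Suc j)) (ev b) = restr (Y \<alpha> (Suc j)) (ev b' - bar_htpy prec \<alpha> ?y)"
    unfolding res_diff_ev[OF bY] Db ..
  also have "\<dots> = ev b' - bar_htpy prec \<alpha> ?y"
    using b'Y bar_htpy_span_on[OF y] by (simp add: linD[OF lin_restr] restr_id span_on_def del: res_diff_simps)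
  finally have "?D (Suc j) (?D (Suc (Suc j)) (ev b)) = ?y - ?D (Suc j) (bar_htpy prec \<alpha> ?y)"
    by (simp only: lr)
  also have "\<dots> = bar_htpy prec \<alpha> (?D j ?y)"
    using homotopy[OF y disjI2[OF \<alpha>0]] by (metis add_diff_cancel_left')
  also have "?D j ?y = 0" using IH[OF a(3,4) b'Y] .
  finally show ?thesis by (simp only: linD[OF lin_bar_htpy])
qed

text \<open>Reduction to the degree of b: the scalars do not depend on \<alpha>, and a label reached
  in degree \<alpha> is also present in the smaller degree, because divisors of standard monomials
  are standard.\<close>

lemma dd_ev: "b \<in> Y \<alpha> (Suc i) \<Longrightarrow> res_diff (cdiff F) (Y \<alpha>) i (res_diff (cdiff F) (Y \<alpha>) (Suc i) (ev b)) = 0"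
proof (induction i arbitrary: b \<alpha>)
  case (Suc j)
  let ?\<beta> = "sum_list b"
  have v: "valid prec b" "length b = Suc (Suc j)" using Suc.prems by (auto simp: Y_iff)
  have top: "res_diff (cdiff F) (Y ?\<beta>) (Suc j) (res_diff (cdiff F) (Y ?\<beta>) (Suc (Suc j)) (ev b)) = 0"
    by (rule dd_ev_top[OF Suc.IH v refl])
  have bY: "b \<in> Y ?\<beta> (Suc (Suc j))" using v std_0 by (auto simp: Y_iff intro!: exI[of _ 0])
  have k: "c \<in> fbasis F (Suc j) \<and> (\<exists>e. ?\<beta> = e + fdeg F (Suc j) c)" if "c \<in> ks (bar_diff prec b :: _ \<Rightarrow>\<^sub>0 'k)" for c
    using keys_bar_diff[OF v(1) that] v(2) by (auto simp: F_simps)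
  obtain \<gamma> where \<gamma>: "\<alpha> = \<gamma> + ?\<beta>" using Suc.prems by (auto simp: Y_iff)
  have k\<alpha>: "c \<in> fbasis F (Suc j) \<and> (\<exists>e. \<alpha> = e + fdeg F (Suc j) c)" if ck: "c \<in> ks (bar_diff prec b :: _ \<Rightarrow>\<^sub>0 'k)" for c
  proof -
    obtain e where "?\<beta> = e + fdeg F (Suc j) c" using k[OF ck] by blast
    then have "\<alpha> = (\<gamma> + e) + fdeg F (Suc j) c" using \<gamma> by (simp add: ac_simps)
    then show ?thesis using k[OF ck] by blast
  qed
  show ?case
  proof (rule poly_mapping_eqI)
    fix b2
    show "lk (res_diff (cdiff F) (Y \<alpha>) (Suc j) (res_diff (cdiff F) (Y \<alpha>) (Suc (Suc j)) (ev b))) b2 = lk 0 b2"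
    proof (cases "b2 \<in> Y \<alpha> j")
      case True
      have "lk (cdiff F (Suc j) (bar_diff prec b)) b2 = 0"
      proof (rule ccontr)
        assume "lk (cdiff F (Suc j) (bar_diff prec b)) b2 \<noteq> 0"
        then obtain c where c: "c \<in> ks (bar_diff prec b :: _ \<Rightarrow>\<^sub>0 'k)" "lk (bar_diff prec b) c * lk (cdiff_column F (Suc j) c) b2 \<noteq> 0"
          unfolding cdiff_def lookup_linext by (rule sum.not_neutral_contains_not_neutral)
        obtain e where e: "?\<beta> = e + sum_list c" "c \<in> fbasis F (Suc j)" using k[OF c(1)] by (auto simp: F_simps)
        obtain e' where e': "sum_list c = e' + sum_list b2" "b2 \<in> fbasis F j"
          using fdiff_single(1)[OF graded_F e(2), of b2] c(2) by (auto simp: F_simps)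
        obtain d where d: "\<alpha> = d + sum_list b2" "std prec d" using True by (auto simp: Y_iff)
        have "d + sum_list b2 = (\<gamma> + (e + e')) + sum_list b2" using d(1) \<gamma> e(1) e'(1) by (simp add: ac_simps)
        then have "d = \<gamma> + (e + e')" by simp
        then have "std prec (e + e')" using d(2) std_add(2) by blast
        moreover have "?\<beta> = (e + e') + sum_list b2" using e(1) e'(1) by (simp add: ac_simps)
        ultimately have b2: "b2 \<in> Y ?\<beta> j" using e'(2) by (auto simp: Y_iff F_simps)
        have "lk (cdiff F (Suc j) (bar_diff prec b)) b2 = lk (res_diff (cdiff F) (Y ?\<beta>) (Suc j) (res_diff (cdiff F) (Y ?\<beta>) (Suc (Suc j)) (ev b))) b2"
          unfolding res_diff_ev[OF bY] using cdiff_restrict[OF graded_F b2 k] b2 by simp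
        then show False using top \<open>lk (cdiff F (Suc j) (bar_diff prec b)) b2 \<noteq> 0\<close> by (simp del: res_diff_simps)
      qed
      then show ?thesis
        unfolding res_diff_ev[OF Suc.prems] using cdiff_restrict[OF graded_F True k\<alpha>] True by simp
    qed simp
  qed
qed simp

lemma dd_bar: "x \<in> span_on (Y \<alpha> (Suc i)) \<Longrightarrow> res_diff (cdiff F) (Y \<alpha>) i (res_diff (cdiff F) (Y \<alpha>) (Suc i) x) = 0"
proof -
  assume x: "x \<in> span_on (Y \<alpha> (Suc i))"
  note lr = linD[OF lin_res_diff[of "cdiff F", OF lin_cdiff]]
  have "lin (\<lambda>x. res_diff (cdiff F) (Y \<alpha>) i (res_diff (cdiff F) (Y \<alpha>) (Suc i) x))" by (simp add: lin_def lr del: res_diff_simps)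
  moreover have "lin (\<lambda>_ :: 'n monom list \<Rightarrow>\<^sub>0 'k. 0 :: 'n monom list \<Rightarrow>\<^sub>0 'k)" by (simp add: lin_def)
  ultimately show ?thesis
    by (rule lin_ext_eq) (use x in \<open>auto simp: span_on_def simp del: res_diff_simps intro!: dd_ev\<close>)
qed

lemma bar_resolution: "graded_free_resolution prec F"
  unfolding graded_free_resolution_def
proof (intro conjI)
  show "\<forall>i. \<forall>b\<in>fbasis F (Suc i). fdiff F (Suc i) b \<in> fcarrier F i \<and>
        (\<forall>b'. \<forall>m\<in>ks (lk (fdiff F (Suc i) b) b'). m + fdeg F i b' = fdeg F (Suc i) b)"
    using graded_F unfolding graded_def .
  show "\<forall>b\<in>fbasis F 0. faug F b \<noteq> 0 \<longrightarrow> fdeg F 0 b = 0" by (simp add: F_simps)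
  have eps: "feps F v = lk (lk v []) 0" if "v \<in> fcarrier F 0" for v
  proof -
    have "ks v \<subseteq> {[]}" using that by (auto simp: fcarrier_def F_simps)
    then have "feps F v = (\<Sum>b\<in>{[]}. lk (lk v b) 0 * faug F b)"
      unfolding feps_def by (intro sum.mono_neutral_left) (auto simp: in_keys_iff)
    then show ?thesis by (simp add: F_simps)
  qed
  show "\<forall>c. \<exists>v\<in>fcarrier F 0. feps F v = c"
  proof
    fix c :: 'k
    let ?v = "Poly_Mapping.single [] (Poly_Mapping.single 0 c) :: _ \<Rightarrow>\<^sub>0 ('n, 'k) mpoly"
    have "?v \<in> fcarrier F 0" by (auto simp: fcarrier_def F_simps valid_def split: if_splits)
    moreover then have "feps F ?v = c" using eps[of ?v] by simp
    ultimately show "\<exists>v\<in>fcarrier F 0. feps F v = c" by blast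
  qed
  have z: "0 \<in> boundaries (cdiff F) (Y \<alpha>) i" for \<alpha> i by (rule pm.subspace_0[OF subspace_boundaries[of "cdiff F", OF lin_cdiff]])
  have ex: "x \<in> boundaries (cdiff F) (Y \<alpha>) i" if "x \<in> cycles (cdiff F) (Y \<alpha>) i" "i \<noteq> 0 \<or> \<alpha> \<noteq> 0" for x \<alpha> i
  proof -
    have x: "x \<in> span_on (Y \<alpha> i)" "res_diff (cdiff F) (Y \<alpha>) i x = 0" using that(1) by (auto simp: cycles_def simp del: res_diff_simps)
    have "x = res_diff (cdiff F) (Y \<alpha>) (Suc i) (bar_htpy prec \<alpha> x)"
      using homotopy[OF x(1) that(2)] unfolding x(2) by (simp add: linD[OF lin_bar_htpy] del: res_diff_simps)
    then show ?thesis unfolding boundaries_def using bar_htpy_span_on[OF x(1)] by (rule image_eqI)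
  qed
  \<comment> \<open>A label of length one has nonzero degree, so in degree 0 only 0 is a
    boundary.\<close>
  have Y0: "Y 0 (Suc 0) = {}"
  proof -
    have False if "b \<in> Y 0 (Suc 0)" for b
      using that by (auto simp: Y_iff valid_def length_Suc_conv monom_add_eq_0 eq_commute[of 0])
    then show ?thesis by blast
  qed
  show "\<forall>v\<in>fcarrier F 0. feps F v = 0 \<longleftrightarrow> (\<exists>w\<in>fcarrier F 1. fzero prec (v - fd F 1 w))"
  proof
    fix v assume v: "v \<in> fcarrier F 0"
    have nil: "[] \<in> Y 0 0" by (auto simp: Y_iff valid_def intro!: exI[of _ 0])
    have c0: "comp prec F 0 0 v = 0 \<longleftrightarrow> feps F v = 0"
    proof
      assume "comp prec F 0 0 v = 0"
      then have "lk (comp prec F 0 0 v) [] = 0" by simp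
      then show "feps F v = 0" using nil eps[OF v] by (simp add: lookup_comp F_simps)
    next
      assume f: "feps F v = 0"
      show "comp prec F 0 0 v = 0"
      proof (rule poly_mapping_eqI)
        fix b show "lk (comp prec F 0 0 v) b = lk 0 b"
          using f eps[OF v] by (auto simp: lookup_comp F_simps Y_iff)
      qed
    qed
    have "(\<exists>w\<in>fcarrier F (Suc 0). fzero prec (v - fd F (Suc 0) w)) \<longleftrightarrow>
        (\<forall>\<alpha>. comp prec F 0 \<alpha> v \<in> boundaries (cdiff F) (Y \<alpha>) 0)" by (rule boundaries_comp[OF graded_F v])
    also have "\<dots> \<longleftrightarrow> comp prec F 0 0 v = 0"
    proof
      assume "\<forall>\<alpha>. comp prec F 0 \<alpha> v \<in> boundaries (cdiff F) (Y \<alpha>) 0"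
      then have "comp prec F 0 0 v \<in> boundaries (cdiff F) (Y 0) 0" by blast
      then show "comp prec F 0 0 v = 0" unfolding boundaries_def Y0
        by (auto simp: span_on_def linD[OF lin_cdiff] linD[OF lin_restr])
    next
      assume c: "comp prec F 0 0 v = 0"
      show "\<forall>\<alpha>. comp prec F 0 \<alpha> v \<in> boundaries (cdiff F) (Y \<alpha>) 0"
      proof
        fix \<alpha> show "comp prec F 0 \<alpha> v \<in> boundaries (cdiff F) (Y \<alpha>) 0"
          using c z ex[of "comp prec F 0 \<alpha> v" \<alpha> 0] comp_span_on[of prec F 0 \<alpha> v] by (cases "\<alpha> = 0") (auto simp: cycles_def)
      qed
    qed
    finally show "feps F v = 0 \<longleftrightarrow> (\<exists>w\<in>fcarrier F 1. fzero prec (v - fd F 1 w))" using c0 by simp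
  qed
  show "\<forall>i\<ge>1. \<forall>v\<in>fcarrier F i. fzero prec (fd F i v) \<longleftrightarrow> (\<exists>w\<in>fcarrier F (Suc i). fzero prec (v - fd F (Suc i) w))"
  proof (intro allI impI ballI)
    fix i v assume "1 \<le> i" "v \<in> fcarrier F i"
    then obtain j where j: "i = Suc j" by (cases i) auto
    have v: "v \<in> fcarrier F (Suc j)" using \<open>v \<in> fcarrier F i\<close> j by simp
    have "cycles (cdiff F) (Y \<alpha>) (Suc j) = boundaries (cdiff F) (Y \<alpha>) (Suc j)" for \<alpha>
    proof
      show "cycles (cdiff F) (Y \<alpha>) (Suc j) \<subseteq> boundaries (cdiff F) (Y \<alpha>) (Suc j)" using ex by auto
      show "boundaries (cdiff F) (Y \<alpha>) (Suc j) \<subseteq> cycles (cdiff F) (Y \<alpha>) (Suc j)"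
      proof
        fix x assume "x \<in> boundaries (cdiff F) (Y \<alpha>) (Suc j)"
        then obtain y where "y \<in> span_on (Y \<alpha> (Suc (Suc j)))" "x = res_diff (cdiff F) (Y \<alpha>) (Suc (Suc j)) y"
          unfolding boundaries_def by blast
        then show "x \<in> cycles (cdiff F) (Y \<alpha>) (Suc j)" using dd_bar[of y \<alpha> "Suc j"] by (auto simp: cycles_def)
      qed
    qed
    then show "fzero prec (fd F i v) \<longleftrightarrow> (\<exists>w\<in>fcarrier F (Suc i). fzero prec (v - fd F (Suc i) w))"
      unfolding j cycles_comp[OF graded_F v] boundaries_comp[OF graded_F v] by simp
  qed
qed

end

lemma ex_resolution:
  "\<exists>F :: ('n monom list, 'n, 'k::field) gfree. graded_free_resolution (prec :: 'n::{finite,linorder} \<Rightarrow> 'n \<Rightarrow> bool) F"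
  using bar_complex.bar_resolution[OF bar_complex.intro[OF refl]] by blast

section \<open>The series of alternating chain counts\<close>

definition is_chain :: "('n::linorder \<Rightarrow> 'n \<Rightarrow> bool) \<Rightarrow> 'n set \<Rightarrow> bool" where
  "is_chain prec V \<longleftrightarrow> (\<forall>i\<in>V. \<forall>j\<in>V. i < j \<longrightarrow> prec i j)"

text \<open>The number f(V) of the overview: minus the reduced Euler characteristic of the order
  complex on V.\<close>

definition chain_euler :: "('n::linorder \<Rightarrow> 'n \<Rightarrow> bool) \<Rightarrow> 'n set \<Rightarrow> int" where
  "chain_euler prec V = (\<Sum>F | F \<subseteq> V \<and> is_chain prec F. (- 1) ^ card F)"

definition xt :: "'n \<Rightarrow> ('n, int) mpoly fps" where
  "xt v = fps_X * fps_const (pvar v)"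

definition chain_series :: "('n::{finite,linorder} \<Rightarrow> 'n \<Rightarrow> bool) \<Rightarrow> ('n, int) mpoly fps" where
  "chain_series prec = (\<Sum>V\<in>UNIV. of_int (chain_euler prec V) * (\<Prod>v\<in>V. xt v))"

lemma sqf_insert: "v \<notin> V \<Longrightarrow> sqf (insert v V) = sv v + sqf V"
  by (rule poly_mapping_eqI) (auto simp: lookup_add lookup_single when_def)

lemma sqf_empty [simp]: "sqf {} = 0"
  by (rule poly_mapping_eqI) simp

lemma prod_xt: "(\<Prod>v\<in>V. xt v) = fps_const (pmonom (sqf V)) * fps_X ^ card V"
proof -
  have "finite V" by simp
  then show ?thesis
  proof (induction V rule: finite_induct)
    case empty
    then show ?case by (simp add: pmonom_def)
  next
    case (insert v V)
    have "pvar v * pmonom (sqf V) = (pmonom (sqf (insert v V)) :: ('a, int) mpoly)"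
      using insert by (simp add: pvar_def pmonom_def mult_single sqf_insert)
    then have c: "fps_const (pvar v) * fps_const (pmonom (sqf V)) = (fps_const (pmonom (sqf (insert v V))) :: ('a, int) mpoly fps)"
      by simp
    have PQ: "fps_X * P * (Q * fps_X ^ n) = P * Q * fps_X ^ Suc n" for P Q :: "('a, int) mpoly fps" and n
      by (simp add: ac_simps)
    have "(\<Prod>w\<in>insert v V. xt w) = xt v * (fps_const (pmonom (sqf V)) * fps_X ^ card V)"
      using insert by simp
    also have "\<dots> = fps_const (pvar v) * fps_const (pmonom (sqf V)) * fps_X ^ Suc (card V)"
      unfolding xt_def by (rule PQ)
    also have "\<dots> = fps_const (pmonom (sqf (insert v V))) * fps_X ^ card (insert v V)"
      using insert c by simp
    finally show ?case .
  qed
qed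

lemma alternating_Pow: "finite A \<Longrightarrow> (\<Sum>X\<in>Pow A. (- 1) ^ card X) = (if A = {} then 1 else 0 :: int)"
  using prod_diff_conv_sum[of A "\<lambda>_. 1 :: int" "\<lambda>_. 1"] by (auto simp: power_0_left)

lemma alternating_interval:
  assumes "finite V" "S \<subseteq> V"
  shows "(\<Sum>F | S \<subseteq> F \<and> F \<subseteq> V. (- 1) ^ card F) = (if S = V then (- 1) ^ card V else 0 :: int)"
proof -
  have fin: "finite S" "finite (V - S)" using assms finite_subset by auto
  have "{F. S \<subseteq> F \<and> F \<subseteq> V} = (\<lambda>X. S \<union> X) ` Pow (V - S)"
  proof
    show "{F. S \<subseteq> F \<and> F \<subseteq> V} \<subseteq> (\<lambda>X. S \<union> X) ` Pow (V - S)"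
    proof
      fix F assume "F \<in> {F. S \<subseteq> F \<and> F \<subseteq> V}"
      then have "F = S \<union> (F - S)" "F - S \<in> Pow (V - S)" by auto
      then show "F \<in> (\<lambda>X. S \<union> X) ` Pow (V - S)" by (rule image_eqI)
    qed
  qed (use assms in auto)
  moreover have "inj_on (\<lambda>X. S \<union> X) (Pow (V - S))" by (auto simp: inj_on_def)
  ultimately have "(\<Sum>F | S \<subseteq> F \<and> F \<subseteq> V. (- 1) ^ card F) = (\<Sum>X\<in>Pow (V - S). (- 1) ^ card (S \<union> X) :: int)"
    by (simp add: sum.reindex)
  also have "\<dots> = (\<Sum>X\<in>Pow (V - S). (- 1) ^ card S * (- 1) ^ card X)"
  proof (rule sum.cong[OF refl])
    fix X assume "X \<in> Pow (V - S)"
    then have "card (S \<union> X) = card S + card X" using fin finite_subset by (intro card_Un_disjoint) auto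
    then show "(- 1) ^ card (S \<union> X) = ((- 1) ^ card S * (- 1) ^ card X :: int)" by (simp add: power_add)
  qed
  also have "\<dots> = (- 1) ^ card S * (if V - S = {} then 1 else 0)"
    using alternating_Pow[OF fin(2)] by (simp flip: sum_distrib_left)
  also have "\<dots> = (if S = V then (- 1) ^ card V else 0)" using assms(2) by auto
  finally show ?thesis .
qed

lemma is_chain_iff: "is_chain prec F \<longleftrightarrow> edges_in prec F = {}"
proof -
  have "edges_in prec F = {} \<longleftrightarrow> (\<forall>g\<in>mingens prec. \<not> ks g \<subseteq> F)" by (auto simp: edges_in_def)
  also have "\<dots> \<longleftrightarrow> is_chain prec F"
  proof
    assume L: "\<forall>g\<in>mingens prec. \<not> ks g \<subseteq> F"
    show "is_chain prec F" unfolding is_chain_def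
    proof (intro ballI impI, rule ccontr)
      fix i j assume "i \<in> F" "j \<in> F" "i < j" "\<not> prec i j"
      then have "edge_monom i j \<in> mingens prec" "ks (edge_monom i j) \<subseteq> F" by (auto simp: edge_in_mingens)
      then show False using L by blast
    qed
  next
    assume c: "is_chain prec F"
    show "\<forall>g\<in>mingens prec. \<not> ks g \<subseteq> F"
    proof
      fix g assume "g \<in> mingens prec"
      then obtain i j where "i < j" "\<not> prec i j" "ks g = {i, j}" by (rule mingensE)
      then show "\<not> ks g \<subseteq> F" using c by (auto simp: is_chain_def)
    qed
  qed
  finally show ?thesis by simp
qed

text \<open>A set F is a chain iff it contains no edge, so its indicator is the alternating sum over
  all sets of edges inside F. After exchanging the sums, the sets F between supp(I) and V cancel
  unless supp(I) = V.\<close>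

lemma chain_euler_supports:
  fixes prec :: "'n::{finite,linorder} \<Rightarrow> 'n \<Rightarrow> bool"
  shows "chain_euler prec V = (- 1) ^ card V * (\<Sum>I | I \<subseteq> mingens prec \<and> support I = V. (- 1) ^ card I)"
proof -
  have "chain_euler prec V = (\<Sum>F\<in>Pow V. (- 1) ^ card F * (if is_chain prec F then 1 else 0))"
    unfolding chain_euler_def by (rule sum.mono_neutral_cong_left) auto
  also have "\<dots> = (\<Sum>F\<in>Pow V. (- 1) ^ card F * (\<Sum>I\<in>Pow (edges_in prec F). (- 1) ^ card I))"
    by (simp add: is_chain_iff alternating_Pow)
  also have "\<dots> = (\<Sum>F\<in>Pow V. \<Sum>I\<in>Pow (edges_in prec V). if support I \<subseteq> F then (- 1) ^ card F * (- 1) ^ card I else 0)"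
  proof (rule sum.cong[OF refl])
    fix F assume F: "F \<in> Pow V"
    have "(\<Sum>I\<in>Pow (edges_in prec F). (- 1) ^ card F * (- 1) ^ card I) =
        (\<Sum>I\<in>Pow (edges_in prec V). if support I \<subseteq> F then (- 1) ^ card F * (- 1) ^ card I else (0::int))"
    proof (rule sum.mono_neutral_cong_left)
      have s: "I \<subseteq> edges_in prec F \<longleftrightarrow> support I \<subseteq> F" if I: "I \<subseteq> edges_in prec V" for I
      proof -
        have "finite I" using I by (rule finite_subset) simp
        then have "support I = \<Union>(ks ` I)" by (rule support_eq)
        then show ?thesis using I by (auto simp: edges_in_def)
      qed
      show "Pow (edges_in prec F) \<subseteq> Pow (edges_in prec V)" using F by (auto simp: edges_in_def)
      then show "(- 1) ^ card F * (- 1) ^ card I = (if support I \<subseteq> F then (- 1) ^ card F * (- 1) ^ card I else (0::int))"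
        if "I \<in> Pow (edges_in prec F)" for I using s[of I] that by auto
      show "\<forall>I\<in>Pow (edges_in prec V) - Pow (edges_in prec F).
          (if support I \<subseteq> F then (- 1) ^ card F * (- 1) ^ card I else 0) = (0::int)"
      proof
        fix I assume "I \<in> Pow (edges_in prec V) - Pow (edges_in prec F)"
        then have "\<not> support I \<subseteq> F" using s[of I] by auto
        then show "(if support I \<subseteq> F then (- 1) ^ card F * (- 1) ^ card I else 0) = (0::int)" by simp
      qed
    qed simp
    then show "(- 1) ^ card F * (\<Sum>I\<in>Pow (edges_in prec F). (- 1) ^ card I) =
        (\<Sum>I\<in>Pow (edges_in prec V). if support I \<subseteq> F then (- 1) ^ card F * (- 1) ^ card I else (0::int))"
      by (simp add: sum_distrib_left)
  qed
  also have "\<dots> = (\<Sum>I\<in>Pow (edges_in prec V). \<Sum>F\<in>Pow V. if support I \<subseteq> F then (- 1) ^ card F * (- 1) ^ card I else 0)"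
    by (rule sum.swap)
  also have "\<dots> = (\<Sum>I\<in>Pow (edges_in prec V). if support I = V then (- 1) ^ card V * (- 1) ^ card I else 0)"
  proof (rule sum.cong[OF refl])
    fix I assume "I \<in> Pow (edges_in prec V)"
    then have I: "I \<subseteq> edges_in prec V" by simp
    then have "finite I" by (rule finite_subset) simp
    then have "support I \<subseteq> V" using I by (auto simp: support_eq edges_in_def)
    have "(\<Sum>F\<in>Pow V. if support I \<subseteq> F then (- 1) ^ card F * (- 1) ^ card I else 0) =
        (\<Sum>F | support I \<subseteq> F \<and> F \<subseteq> V. (- 1) ^ card F * (- 1) ^ card I :: int)"
      by (rule sum.mono_neutral_cong_right) auto
    also have "\<dots> = (if support I = V then (- 1) ^ card V else 0) * (- 1) ^ card I"
      using alternating_interval[OF _ \<open>support I \<subseteq> V\<close>] by (simp flip: sum_distrib_right)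
    finally show "(\<Sum>F\<in>Pow V. if support I \<subseteq> F then (- 1) ^ card F * (- 1) ^ card I else 0) =
        (if support I = V then (- 1) ^ card V * (- 1) ^ card I else (0::int))" by simp
  qed
  also have "\<dots> = (\<Sum>I | I \<subseteq> mingens prec \<and> support I = V. (- 1) ^ card V * (- 1) ^ card I)"
  proof (rule sum.mono_neutral_cong_right)
    show "{I. I \<subseteq> mingens prec \<and> support I = V} \<subseteq> Pow (edges_in prec V)"
      using edges_in_iff[of _ prec V] by blast
    show "\<forall>I\<in>Pow (edges_in prec V) - {I. I \<subseteq> mingens prec \<and> support I = V}.
       (if support I = V then (- 1) ^ card V * (- 1) ^ card I else 0) = (0::int)"
      by (auto simp: edges_in_def)
  qed auto
  finally show ?thesis by (simp add: sum_distrib_left)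
qed

text \<open>For a forest both exponents depend on the support alone, so the series may be collected
  by supports.\<close>

lemma W_series_eq:
  fixes prec :: "'n::{finite,linorder} \<Rightarrow> 'n \<Rightarrow> bool"
  assumes \<F>: "\<And>I. I \<in> \<F> \<Longrightarrow> I \<noteq> {} \<and> I \<subseteq> mingens prec \<and> excess0 I"
    and e: "\<And>V. V \<noteq> {} \<Longrightarrow> (\<Sum>I\<in>{I \<in> \<F>. support I = V}. (- 1) ^ cl I) = chain_euler prec V"
  shows "W_series \<F> = chain_series prec"
proof -
  have fin: "finite \<F>"
    by (rule finite_subset[of _ "Pow (mingens prec)"]) (use \<F> in auto)
  let ?g = "\<lambda>I. (- 1) ^ cl I * fps_const (pmonom (mlcm I)) * fps_X ^ (cl I + card I) :: ('n, int) mpoly fps"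
  have "sum ?g \<F> = (\<Sum>V\<in>UNIV. sum ?g {I \<in> \<F>. support I = V})"
    using fin by (intro sum.group[symmetric]) auto
  also have "\<dots> = (\<Sum>V\<in>UNIV. of_int (\<Sum>I\<in>{I \<in> \<F>. support I = V}. (- 1) ^ cl I) * (\<Prod>v\<in>V. xt v))"
  proof (rule sum.cong[OF refl])
    fix V :: "'n set"
    have "?g I = of_int ((- 1) ^ cl I) * (\<Prod>v\<in>V. xt v)" if "I \<in> {I \<in> \<F>. support I = V}" for I
      using that \<F>[of I] mlcm_sqf[of I prec] by (auto simp: prod_xt excess0_def mult.assoc)
    then have "sum ?g {I \<in> \<F>. support I = V} = (\<Sum>I\<in>{I \<in> \<F>. support I = V}. of_int ((- 1) ^ cl I) * (\<Prod>v\<in>V. xt v))"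
      by (rule sum.cong[OF refl])
    then show "sum ?g {I \<in> \<F>. support I = V} =
        of_int (\<Sum>I\<in>{I \<in> \<F>. support I = V}. (- 1) ^ cl I) * (\<Prod>v\<in>V. xt v)"
      by (simp only: sum_distrib_right of_int_sum)
  qed
  also have "\<dots> = (\<Sum>V\<in>UNIV - {{}}. of_int (\<Sum>I\<in>{I \<in> \<F>. support I = V}. (- 1) ^ cl I) * (\<Prod>v\<in>V. xt v))"
  proof (rule sum.mono_neutral_right)
    have "{I \<in> \<F>. support I = {}} = {}" using \<F> support_nonempty by blast
    then have "(\<Sum>I\<in>{I \<in> \<F>. support I = {}}. (- 1) ^ cl I) = (0 :: int)" by (simp only: sum.empty)
    then show "\<forall>V\<in>UNIV - (UNIV - {{}}). of_int (\<Sum>I\<in>{I \<in> \<F>. support I = V}. (- 1) ^ cl I) * (\<Prod>v\<in>V. xt v) = 0"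
      by auto
  qed auto
  also have "\<dots> = (\<Sum>V\<in>UNIV - {{}}. of_int (chain_euler prec V) * (\<Prod>v\<in>V. xt v))"
    using e by (intro sum.cong refl) simp
  finally have 1: "W_series \<F> = 1 + (\<Sum>V\<in>UNIV - {{}}. of_int (chain_euler prec V) * (\<Prod>v\<in>V. xt v))"
    by (simp add: W_series_def)
  have "{F. F \<subseteq> {} \<and> is_chain prec F} = {{}}" by (auto simp: is_chain_def)
  then have "chain_euler prec {} = 1" by (simp add: chain_euler_def)
  then have "chain_series prec = 1 + (\<Sum>V\<in>UNIV - {{}}. of_int (chain_euler prec V) * (\<Prod>v\<in>V. xt v))"
    unfolding chain_series_def by (subst sum.remove[of _ "{}"]) auto
  with 1 show ?thesis by simp
qed

text \<open>On forests with support V the parities of cl(I) and |I| differ by that of |V|.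
  Cancellation can therefore be checked on |I|, which changes by one along a matched edge or a
  toggle.\<close>

lemma W_series_eq_card:
  fixes prec :: "'n::{finite,linorder} \<Rightarrow> 'n \<Rightarrow> bool"
  assumes \<F>: "\<And>I. I \<in> \<F> \<Longrightarrow> I \<noteq> {} \<and> I \<subseteq> mingens prec \<and> excess0 I"
    and e: "\<And>V. V \<noteq> {} \<Longrightarrow> (\<Sum>I\<in>{I \<in> \<F>. support I = V}. (- 1) ^ card I) =
      (\<Sum>I | I \<noteq> {} \<and> I \<subseteq> mingens prec \<and> support I = V. (- 1) ^ card I :: int)"
  shows "W_series \<F> = chain_series prec"
proof (rule W_series_eq[OF \<F>])
  fix V :: "'n set" assume V: "V \<noteq> {}"
  have "(- 1) ^ cl I = ((- 1) ^ card V * (- 1) ^ card I :: int)" if "I \<in> \<F>" "support I = V" for I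
  proof -
    have "cl I + card I = card V" using \<F>[OF that(1)] that(2) by (simp add: excess0_def)
    then have "(- 1) ^ card V = ((- 1) ^ cl I * (- 1) ^ card I :: int)" by (metis power_add)
    then show ?thesis by (simp add: mult.assoc flip: power_mult_distrib)
  qed
  then have "(\<Sum>I\<in>{I \<in> \<F>. support I = V}. (- 1) ^ cl I) =
      (- 1) ^ card V * (\<Sum>I\<in>{I \<in> \<F>. support I = V}. (- 1) ^ card I :: int)"
    by (simp add: sum_distrib_left)
  also have "\<dots> = chain_euler prec V"
  proof -
    have "{I. I \<noteq> {} \<and> I \<subseteq> mingens prec \<and> support I = V} = {I. I \<subseteq> mingens prec \<and> support I = V}"
      using V by auto
    then show ?thesis unfolding e[OF V] chain_euler_supports by simp
  qed
  finally show "(\<Sum>I\<in>{I \<in> \<F>. support I = V}. (- 1) ^ cl I) = chain_euler prec V" .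
qed

text \<open>Both series of the theorem have this shape, the Hilbert series by definition and the
  Poincare series by concentration on the diagonal. Recursions between such series become identities
  between functions of \<alpha>.\<close>

definition multigraded_fps :: "('n::finite monom \<Rightarrow> int) \<Rightarrow> ('n, int) mpoly fps" where
  "multigraded_fps h = Abs_fps (\<lambda>d. Abs_poly_mapping (\<lambda>\<alpha>. if total_deg \<alpha> = d then h \<alpha> else 0))"

lemma finite_total_deg: "finite {\<alpha> :: 'n::finite monom. total_deg \<alpha> = d}"
proof (induction d)
  case 0
  have "{\<alpha> :: 'n monom. total_deg \<alpha> = 0} = {0}" by (auto simp: total_deg_0_iff)
  then show ?case by simp
next
  case (Suc d)
  have "{\<alpha> :: 'n monom. total_deg \<alpha> = Suc d} \<subseteq> (\<Union>v\<in>UNIV. (\<lambda>\<beta>. \<beta> + sv v) ` {\<alpha>. total_deg \<alpha> = d})"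
  proof
    fix \<alpha> :: "'n monom" assume a: "\<alpha> \<in> {\<alpha>. total_deg \<alpha> = Suc d}"
    then have "\<alpha> \<noteq> 0" using total_deg_0_iff[of \<alpha>] by auto
    then obtain v where "lk \<alpha> v > 0" by (auto simp: poly_mapping_eq_iff fun_eq_iff)
    then have e: "\<alpha> = (\<alpha> - sv v) + sv v" using monom_diff[of \<alpha> v] by simp
    then have "total_deg (\<alpha> - sv v) + 1 = Suc d" using a total_deg_add[of "\<alpha> - sv v" "sv v"] by simp
    then show "\<alpha> \<in> (\<Union>v\<in>UNIV. (\<lambda>\<beta>. \<beta> + sv v) ` {\<alpha>. total_deg \<alpha> = d})" using e by auto
  qed
  then show ?case by (rule finite_subset) (use Suc in auto)
qed

lemma lookup_multigraded_fps: "lk (fps_nth (multigraded_fps h) d) \<alpha> = (if total_deg \<alpha> = d then h \<alpha> else 0)"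
proof -
  have "{\<alpha>. (if total_deg \<alpha> = d then h \<alpha> else 0) \<noteq> 0} \<subseteq> {\<alpha>. total_deg \<alpha> = d}" by auto
  then have "finite {\<alpha>. (if total_deg \<alpha> = d then h \<alpha> else 0) \<noteq> 0}" using finite_total_deg finite_subset by blast
  then show ?thesis by (simp add: multigraded_fps_def)
qed

lemma multigraded_fps_eqI:
  assumes "\<And>d \<alpha>. lk (fps_nth g d) \<alpha> = (if total_deg \<alpha> = d then h \<alpha> else 0)"
  shows "g = multigraded_fps h"
  by (rule fps_ext, rule poly_mapping_eqI) (simp add: assms lookup_multigraded_fps)

lemma lookup_pvar_mult:
  fixes p :: "('n::linorder, int) mpoly"
  shows "lk (pvar v * p) \<alpha> = (if lk \<alpha> v > 0 then lk p (\<alpha> - sv v) else 0)"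
proof -
  have eq: "pvar v * p = (\<Sum>k\<in>ks p. Poly_Mapping.single (k + sv v) (lk p k))"
  proof -
    have "pvar v * p = pvar v * (\<Sum>k\<in>ks p. Poly_Mapping.single k (lk p k))"
      by (simp add: poly_mapping_sum_singles)
    then show ?thesis by (simp add: pvar_def sum_distrib_left mult_single add.commute)
  qed
  have "k + sv v = \<alpha> \<longleftrightarrow> lk \<alpha> v > 0 \<and> k = \<alpha> - sv v" for k
    using monom_diff[of \<alpha> v] by (auto simp: lookup_add)
  then have "lk (pvar v * p) \<alpha> = (\<Sum>k\<in>ks p. if lk \<alpha> v > 0 \<and> k = \<alpha> - sv v then lk p k else 0)"
    unfolding eq lookup_sum lookup_single when_def by simp
  also have "\<dots> = (if lk \<alpha> v > 0 then lk p (\<alpha> - sv v) else 0)"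
    by (auto simp: in_keys_iff)
  finally show ?thesis .
qed

lemma xt_multigraded_fps: "xt v * multigraded_fps (g :: 'n::{finite,linorder} monom \<Rightarrow> int) = multigraded_fps (\<lambda>\<alpha>. if lk \<alpha> v > 0 then g (\<alpha> - sv v) else 0)"
proof (rule multigraded_fps_eqI)
  fix d \<alpha>
  have n: "fps_nth (xt v * multigraded_fps g) d = (if d = 0 then 0 else pvar v * fps_nth (multigraded_fps g) (d - 1))"
    by (simp add: xt_def mult.assoc)
  show "lk (fps_nth (xt v * multigraded_fps g) d) \<alpha> =
      (if total_deg \<alpha> = d then (if lk \<alpha> v > 0 then g (\<alpha> - sv v) else 0) else 0)"
  proof (cases "lk \<alpha> v > 0")
    case True
    have "total_deg \<alpha> = total_deg (\<alpha> - sv v) + 1"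
      using monom_diff[OF True] total_deg_add[of "\<alpha> - sv v" "sv v"] by simp
    then show ?thesis using True unfolding n by (auto simp: lookup_pvar_mult lookup_multigraded_fps)
  next
    case False
    then show ?thesis unfolding n by (simp add: lookup_pvar_mult)
  qed
qed

lemma multigraded_fps_add: "multigraded_fps g + multigraded_fps h = multigraded_fps (\<lambda>\<alpha>. g \<alpha> + h \<alpha>)"
  by (rule multigraded_fps_eqI) (simp add: lookup_add lookup_multigraded_fps)

lemma total_deg_zero [simp]: "total_deg 0 = 0"
  by (simp add: total_deg_0_iff)

lemma multigraded_fps_1: "multigraded_fps (\<lambda>\<alpha>. if \<alpha> = 0 then 1 else 0) = 1"
  by (rule multigraded_fps_eqI[symmetric]) (auto simp: lookup_one when_def total_deg_0_iff)

lemma multigraded_fps_twist: "fps_compose (multigraded_fps h) (- fps_X) = multigraded_fps (\<lambda>\<alpha>. (- 1) ^ total_deg \<alpha> * h \<alpha>)"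
proof (rule multigraded_fps_eqI)
  fix d \<alpha>
  have m: "lk ((- 1) ^ d * p) \<alpha> = (- 1) ^ d * lk p \<alpha>" for p :: "('a, int) mpoly"
    by (cases "even d") auto
  show "lk (fps_nth (fps_compose (multigraded_fps h) (- fps_X)) d) \<alpha> =
      (if total_deg \<alpha> = d then (- 1) ^ total_deg \<alpha> * h \<alpha> else 0)"
    by (simp add: fps_compose_uminus' m lookup_multigraded_fps)
qed

section \<open>Hilbert series of the rings A_W, in t and in -t\<close>

definition hilb_in :: "('n::{finite,linorder} \<Rightarrow> 'n \<Rightarrow> bool) \<Rightarrow> 'n set \<Rightarrow> ('n, int) mpoly fps" where
  "hilb_in prec W = multigraded_fps (\<lambda>\<alpha>. if std prec \<alpha> \<and> ks \<alpha> \<subseteq> W then 1 else 0)"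

definition signed_hilb_in :: "('n::{finite,linorder} \<Rightarrow> 'n \<Rightarrow> bool) \<Rightarrow> 'n set \<Rightarrow> ('n, int) mpoly fps" where
  "signed_hilb_in prec W = multigraded_fps (\<lambda>\<alpha>. if std prec \<alpha> \<and> ks \<alpha> \<subseteq> W then (- 1) ^ total_deg \<alpha> else 0)"

lemma hilb_in_twist: "fps_compose (hilb_in prec W) (- fps_X) = signed_hilb_in prec W"
  unfolding hilb_in_def signed_hilb_in_def multigraded_fps_twist by (rule arg_cong[where f = multigraded_fps]) auto

context
  fixes prec :: "'n::{finite,linorder} \<Rightarrow> 'n \<Rightarrow> bool"
  assumes lt: "\<And>i j. prec i j \<Longrightarrow> i < j"
begin

lemma std_rec:
  assumes v: "v \<in> W"
  shows "std prec \<alpha> \<and> ks \<alpha> \<subseteq> W \<longleftrightarrow> (std prec \<alpha> \<and> ks \<alpha> \<subseteq> W - {v}) \<or>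
    (lk \<alpha> v > 0 \<and> std prec (\<alpha> - sv v) \<and> ks (\<alpha> - sv v) \<subseteq> W \<inter> comparables prec v)"
    and "lk \<alpha> v > 0 \<Longrightarrow> \<not> ks \<alpha> \<subseteq> W - {v}"
proof -
  show 2: "lk \<alpha> v > 0 \<Longrightarrow> \<not> ks \<alpha> \<subseteq> W - {v}"
  proof -
    assume "lk \<alpha> v > 0"
    then have "v \<in> ks \<alpha>" by (simp add: in_keys_iff)
    then show ?thesis by blast
  qed
  show "std prec \<alpha> \<and> ks \<alpha> \<subseteq> W \<longleftrightarrow> (std prec \<alpha> \<and> ks \<alpha> \<subseteq> W - {v}) \<or>
    (lk \<alpha> v > 0 \<and> std prec (\<alpha> - sv v) \<and> ks (\<alpha> - sv v) \<subseteq> W \<inter> comparables prec v)"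
  proof (cases "lk \<alpha> v > 0")
    case True
    have "std prec \<alpha> \<and> ks \<alpha> \<subseteq> W \<longleftrightarrow> v \<in> W \<and> std prec (\<alpha> - sv v) \<and> ks (\<alpha> - sv v) \<subseteq> W \<inter> comparables prec v"
      using std_plus_single[OF lt, of prec "\<alpha> - sv v" v W] monom_diff[OF True] by simp
    then show ?thesis using v True 2 by auto
  next
    case False
    then have "v \<notin> ks \<alpha>" by (simp add: in_keys_iff)
    then show ?thesis using False by auto
  qed
qed

lemma hilb_in_rec: "v \<in> W \<Longrightarrow> hilb_in prec W = hilb_in prec (W - {v}) + xt v * hilb_in prec (W \<inter> comparables prec v)"
  unfolding hilb_in_def xt_multigraded_fps multigraded_fps_add
  by (rule arg_cong[where f = multigraded_fps], rule ext) (use std_rec in auto)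

text \<open>The sign change moves the shifted term to the other side; in this form the recursion is
  that of the Betti numbers.\<close>

lemma signed_hilb_in_rec: "v \<in> W \<Longrightarrow> signed_hilb_in prec (W - {v}) = signed_hilb_in prec W + xt v * signed_hilb_in prec (W \<inter> comparables prec v)"
proof -
  assume v: "v \<in> W"
  have sgn: "(- 1) ^ total_deg \<alpha> = - ((- 1) ^ total_deg (\<alpha> - sv v) :: int)" if "lk \<alpha> v > 0" for \<alpha> :: "'n monom"
    using monom_diff[OF that] total_deg_add[of "\<alpha> - sv v" "sv v"] by simp
  show ?thesis unfolding signed_hilb_in_def xt_multigraded_fps multigraded_fps_add
    by (rule arg_cong[where f = multigraded_fps], rule ext) (use std_rec[OF v] sgn in auto)
qed

lemma is_chain_insert: "v \<notin> F \<Longrightarrow> is_chain prec (insert v F) \<longleftrightarrow> is_chain prec F \<and> F \<subseteq> comparables prec v"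
  using std_plus_single[OF lt, of prec "sqf F" v UNIV]
  by (simp add: std_def is_chain_def keys_plus_nat)

text \<open>The standard monomials with support F contribute the product of t x_v / (1 - t x_v) over
  v in F. This is the sum over all chains F, brought to the common denominator.\<close>

definition chain_numerator :: "'n set \<Rightarrow> ('n, int) mpoly fps" where
  "chain_numerator W = (\<Sum>F | F \<subseteq> W \<and> is_chain prec F. (\<Prod>v\<in>F. xt v) * (\<Prod>v\<in>W - F. 1 - xt v))"

text \<open>Chains either avoid v or arise by adding v to a chain of elements comparable to v; the
  elements not comparable to v then contribute only their denominators.\<close>

lemma chain_numerator_rec:
  assumes v: "v \<in> W"
  shows "chain_numerator W = (1 - xt v) * chain_numerator (W - {v}) +
    xt v * (\<Prod>w\<in>W - comparables prec v. 1 - xt w) * chain_numerator (W \<inter> comparables prec v - {v})"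
proof -
  let ?t = "\<lambda>F. (\<Prod>v\<in>F. xt v) * (\<Prod>v\<in>W - F. 1 - xt v) :: ('n, int) mpoly fps"
  let ?A = "{F. F \<subseteq> W - {v} \<and> is_chain prec F}" and ?B = "{F. F \<subseteq> W \<inter> comparables prec v - {v} \<and> is_chain prec F}"
  have "{F. F \<subseteq> W \<and> is_chain prec F} = ?A \<union> insert v ` ?B"
  proof (intro set_eqI iffI)
    fix F assume F: "F \<in> {F. F \<subseteq> W \<and> is_chain prec F}"
    show "F \<in> ?A \<union> insert v ` ?B"
    proof (cases "v \<in> F")
      case True
      then have i: "F = insert v (F - {v})" by auto
      have "is_chain prec (insert v (F - {v}))" using F i by simp
      then have "is_chain prec (F - {v}) \<and> F - {v} \<subseteq> comparables prec v" using is_chain_insert[of v "F - {v}"] by simp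
      then have "F - {v} \<in> ?B" using F by auto
      then show ?thesis using i by blast
    qed (use F in auto)
  next
    fix F assume "F \<in> ?A \<union> insert v ` ?B"
    then show "F \<in> {F. F \<subseteq> W \<and> is_chain prec F}"
    proof
      assume "F \<in> insert v ` ?B"
      then obtain G where G: "F = insert v G" "G \<subseteq> W \<inter> comparables prec v - {v}" "is_chain prec G" by auto
      then have "is_chain prec F" using is_chain_insert[of v G] by auto
      then show ?thesis using G v by auto
    qed auto
  qed
  moreover have "?A \<inter> insert v ` ?B = {}" by auto
  ultimately have "chain_numerator W = sum ?t ?A + sum ?t (insert v ` ?B)"
    unfolding chain_numerator_def by (simp add: sum.union_disjoint)
  also have "sum ?t ?A = (1 - xt v) * chain_numerator (W - {v})"
    unfolding chain_numerator_def sum_distrib_left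
  proof (rule sum.cong[OF refl])
    fix F assume F: "F \<in> ?A"
    then have "W - F = insert v (W - {v} - F)" using v by auto
    then have "(\<Prod>v\<in>W - F. 1 - xt v) = (1 - xt v) * (\<Prod>v\<in>W - {v} - F. 1 - xt v)" by simp
    then show "?t F = (1 - xt v) * ((\<Prod>v\<in>F. xt v) * (\<Prod>v\<in>W - {v} - F. 1 - xt v))" by (simp add: ac_simps)
  qed
  also have "sum ?t (insert v ` ?B) = (\<Sum>F\<in>?B. ?t (insert v F))"
    by (rule sum.reindex_cong[of "insert v"]) (auto simp: inj_on_def)
  also have "\<dots> = xt v * (\<Prod>w\<in>W - comparables prec v. 1 - xt w) * chain_numerator (W \<inter> comparables prec v - {v})"
    unfolding chain_numerator_def sum_distrib_left
  proof (rule sum.cong[OF refl])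
    fix F assume F: "F \<in> ?B"
    have "W - insert v F = (W - comparables prec v) \<union> (W \<inter> comparables prec v - {v} - F)"
      using F by (auto simp: comparables_def)
    then have "(\<Prod>w\<in>W - insert v F. 1 - xt w) =
        (\<Prod>w\<in>W - comparables prec v. 1 - xt w) * (\<Prod>w\<in>W \<inter> comparables prec v - {v} - F. 1 - xt w)"
      by (simp only: , subst prod.union_disjoint) auto
    moreover have "(\<Prod>w\<in>insert v F. xt w) = xt v * (\<Prod>w\<in>F. xt w)" using F by (subst prod.insert) auto
    ultimately show "?t (insert v F) = xt v * (\<Prod>w\<in>W - comparables prec v. 1 - xt w) *
        ((\<Prod>w\<in>F. xt w) * (\<Prod>w\<in>W \<inter> comparables prec v - {v} - F. 1 - xt w))" by (simp add: ac_simps)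
  qed
  finally show ?thesis .
qed

text \<open>After clearing denominators the exact sequence for v becomes the splitting of chains by
  whether they contain v.\<close>

lemma hilb_in_chain_numerator: "hilb_in prec W * (\<Prod>v\<in>W. 1 - xt v) = chain_numerator W"
proof (induction "card W" arbitrary: W rule: less_induct)
  case less
  show ?case
  proof (cases "W = {}")
    case True
    have "{F. F \<subseteq> {} \<and> is_chain prec F} = {{}}" by (auto simp: is_chain_def)
    moreover have "hilb_in prec {} = 1"
      unfolding hilb_in_def multigraded_fps_1[symmetric] by (rule arg_cong[where f = multigraded_fps]) auto
    ultimately show ?thesis using True by (simp add: chain_numerator_def)
  next
    case False
    then obtain v where v: "v \<in> W" by blast
    let ?N = "W \<inter> comparables prec v"
    have vN: "v \<in> ?N" using v by (simp add: comparables_def)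
    have c: "card (W - {v}) < card W" "card (?N - {v}) < card W"
      using v by (intro psubset_card_mono; auto)+
    have N: "hilb_in prec ?N = hilb_in prec (?N - {v}) + xt v * hilb_in prec ?N"
      using hilb_in_rec[OF vN] by (simp add: Int_assoc)
    \<comment> \<open>Everything in ?N is comparable to v, so x_v is a free polynomial variable of
      the ring on ?N.\<close>
    then have N': "(1 - xt v) * hilb_in prec ?N = hilb_in prec (?N - {v})" by (simp add: algebra_simps)
    have pW: "(\<Prod>w\<in>W. 1 - xt w) = (1 - xt v) * (\<Prod>w\<in>W - {v}. 1 - xt w :: ('n, int) mpoly fps)"
      using v by (simp add: prod.remove)
    have "W - {v} = (W - comparables prec v) \<union> (?N - {v})" by (auto simp: comparables_def)
    then have pN: "(\<Prod>w\<in>W - {v}. 1 - xt w :: ('n, int) mpoly fps) =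
        (\<Prod>w\<in>W - comparables prec v. 1 - xt w) * (\<Prod>w\<in>?N - {v}. 1 - xt w)"
      by (simp add: prod.union_disjoint disjoint_iff)
    have "hilb_in prec W * (\<Prod>w\<in>W. 1 - xt w) =
        (1 - xt v) * (hilb_in prec (W - {v}) * (\<Prod>w\<in>W - {v}. 1 - xt w)) +
        xt v * ((1 - xt v) * hilb_in prec ?N) * (\<Prod>w\<in>W - {v}. 1 - xt w)"
      unfolding pW hilb_in_rec[OF v] by (simp add: algebra_simps)
    also have "\<dots> = (1 - xt v) * chain_numerator (W - {v}) + xt v * (\<Prod>w\<in>W - comparables prec v. 1 - xt w) *
        (hilb_in prec (?N - {v}) * (\<Prod>w\<in>?N - {v}. 1 - xt w))"
      unfolding N' less[OF c(1)] by (simp add: pN ac_simps)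
    also have "\<dots> = chain_numerator W" unfolding less[OF c(2)] chain_numerator_rec[OF v] ..
    finally show ?thesis .
  qed
qed

lemma chain_series_twist: "fps_compose (chain_series prec) (- fps_X) = (\<Sum>V\<in>UNIV. of_int ((- 1) ^ card V * chain_euler prec V) * (\<Prod>v\<in>V. xt v))"
proof -
  have y: "fps_compose (xt v) (- fps_X) = - xt v" for v :: 'n
  proof (rule fps_ext)
    fix n show "fps_nth (fps_compose (xt v) (- fps_X)) n = fps_nth (- xt v) n"
      by (simp add: fps_compose_uminus' xt_def)
  qed
  have oc: "fps_compose (of_int c) (- fps_X) = (of_int c :: ('n, int) mpoly fps)" for c
    by (metis fps_of_int fps_const_compose)
  have "fps_compose (of_int c * (\<Prod>v\<in>V. xt v)) (- fps_X) = of_int ((- 1) ^ card V * c) * (\<Prod>v\<in>V. xt v)"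
    for c and V :: "'n set"
    by (simp add: fps_compose_mult_distrib fps_compose_prod_distrib y prod_uminus oc)
  then show ?thesis by (simp add: chain_series_def fps_compose_sum_distrib)
qed

text \<open>Expanding the denominators over the complement of F into sets X and collecting by V = F
  \<union> X leaves, for each V, the alternating count of its chains up to the sign of V.\<close>

lemma chain_numerator_UNIV: "chain_numerator UNIV = fps_compose (chain_series prec) (- fps_X)"
proof -
  let ?Y = "\<lambda>V. \<Prod>v\<in>V. xt v :: ('n, int) mpoly fps"
  have "chain_numerator UNIV = (\<Sum>F | is_chain prec F. \<Sum>X | X \<inter> F = {}. (- 1) ^ card X * ?Y (F \<union> X))"
    unfolding chain_numerator_def
  proof (rule sum.cong)
    fix F assume "F \<in> {F. is_chain prec F}"
    have "(\<Prod>v\<in>UNIV - F. 1 - xt v :: ('n, int) mpoly fps) = (\<Sum>X\<in>Pow (UNIV - F). (- 1) ^ card X * ?Y X)"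
      by (subst prod_diff_conv_sum) auto
    also have "Pow (UNIV - F) = {X. X \<inter> F = {}}" by auto
    finally have "?Y F * (\<Prod>v\<in>UNIV - F. 1 - xt v) = (\<Sum>X | X \<inter> F = {}. ?Y F * ((- 1) ^ card X * ?Y X))"
      by (simp add: sum_distrib_left)
    also have "\<dots> = (\<Sum>X | X \<inter> F = {}. (- 1) ^ card X * ?Y (F \<union> X))"
    proof (rule sum.cong[OF refl])
      fix X assume "X \<in> {X. X \<inter> F = {}}"
      then have "?Y (F \<union> X) = ?Y F * ?Y X" by (intro prod.union_disjoint) auto
      then show "?Y F * ((- 1) ^ card X * ?Y X) = (- 1) ^ card X * ?Y (F \<union> X)" by simp
    qed
    finally show "?Y F * (\<Prod>v\<in>UNIV - F. 1 - xt v) = (\<Sum>X | X \<inter> F = {}. (- 1) ^ card X * ?Y (F \<union> X))" .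
  qed simp
  also have "\<dots> = (\<Sum>(F, X)\<in>(SIGMA F:{F. is_chain prec F}. {X. X \<inter> F = {}}). (- 1) ^ card X * ?Y (F \<union> X))"
    by (rule sum.Sigma) auto
  also have "\<dots> = (\<Sum>(V, F)\<in>(SIGMA V:UNIV. {F. F \<subseteq> V \<and> is_chain prec F}). (- 1) ^ card (V - F) * ?Y V)"
    by (rule sum.reindex_bij_witness[of _ "\<lambda>(V, F). (F, V - F)" "\<lambda>(F, X). (F \<union> X, F)"])
      (auto simp: Un_Diff Diff_triv Un_absorb1)
  also have "\<dots> = (\<Sum>V\<in>UNIV. \<Sum>F | F \<subseteq> V \<and> is_chain prec F. (- 1) ^ card (V - F) * ?Y V)"
    by (rule sum.Sigma[symmetric]) auto
  also have "\<dots> = (\<Sum>V\<in>UNIV. of_int ((- 1) ^ card V * chain_euler prec V) * ?Y V)"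
  proof (rule sum.cong[OF refl])
    fix V :: "'n set"
    have "(- 1) ^ card (V - F) = (of_int ((- 1) ^ card V * (- 1) ^ card F) :: ('n, int) mpoly fps)" if "F \<subseteq> V" for F
    proof -
      have "card V = card (V - F) + card F" using card_mono[OF _ that] that by (simp add: card_Diff_subset)
      then have "(- 1) ^ card V = ((- 1) ^ card (V - F) * (- 1) ^ card F :: int)" by (metis power_add)
      then show ?thesis by (simp add: mult.assoc flip: power_mult_distrib)
    qed
    then have "(\<Sum>F | F \<subseteq> V \<and> is_chain prec F. (- 1) ^ card (V - F) * ?Y V) =
        (\<Sum>F | F \<subseteq> V \<and> is_chain prec F. of_int ((- 1) ^ card V * (- 1) ^ card F) * ?Y V)"
      by (intro sum.cong refl) auto
    then show "(\<Sum>F | F \<subseteq> V \<and> is_chain prec F. (- 1) ^ card (V - F) * ?Y V) =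
        of_int ((- 1) ^ card V * chain_euler prec V) * ?Y V"
      by (simp add: chain_euler_def sum_distrib_left sum_distrib_right)
  qed
  finally show ?thesis unfolding chain_series_twist .
qed

lemma hilbert_chain_series: "hilb_in prec UNIV * (\<Prod>v\<in>UNIV. 1 - xt v) = fps_compose (chain_series prec) (- fps_X)"
  unfolding hilb_in_chain_numerator chain_numerator_UNIV ..

lemma hilbert_W0': "signed_hilb_in prec UNIV * (\<Prod>v\<in>UNIV. 1 + xt v) = chain_series prec"
proof -
  have tw: "fps_compose (fps_compose g (- fps_X)) (- fps_X) = (g :: ('n, int) mpoly fps)" for g
    by (rule fps_ext) (simp add: fps_compose_uminus' mult.assoc[symmetric] flip: power_mult_distrib)
  have y: "fps_compose (1 - xt v) (- fps_X) = 1 + xt v" for v :: 'n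
  proof (rule fps_ext)
    fix n show "fps_nth (fps_compose (1 - xt v) (- fps_X)) n = fps_nth (1 + xt v) n"
      by (cases "n = 0") (auto simp: fps_compose_uminus' xt_def)
  qed
  have "fps_compose (hilb_in prec UNIV * (\<Prod>v\<in>UNIV. 1 - xt v)) (- fps_X) = chain_series prec"
    unfolding hilbert_chain_series tw ..
  then show ?thesis by (simp add: fps_compose_mult_distrib fps_compose_prod_distrib y hilb_in_twist)
qed

text \<open>The difference of the two sides is 0 at UNIV and obeys the same linear recursion, whose
  last term raises the degree in t. Induction on that degree, and inside it on the removed
  variables, makes all its coefficients 0.\<close>

lemma signed_hilb_in_unique:
  assumes U: "G UNIV = 1" and rec: "\<And>W v. v \<in> W \<Longrightarrow> G (W - {v}) = G W + xt v * G (W \<inter> comparables prec v)"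
  shows "G W * signed_hilb_in prec UNIV = signed_hilb_in prec W"
proof -
  define D where "D W = G W * signed_hilb_in prec UNIV - signed_hilb_in prec W" for W
  have D: "D (W - {v}) = D W + xt v * D (W \<inter> comparables prec v)" if "v \<in> W" for W v
    unfolding D_def rec[OF that] signed_hilb_in_rec[OF that] by (simp add: algebra_simps)
  have DU: "D UNIV = 0" by (simp add: D_def U)
  have A: "fps_nth (D (- S)) d = 0" for S d
  proof (induction d arbitrary: S)
    case 0
    show ?case
    proof (induction S rule: finite_induct[OF finite])
      case (2 v S)
      have "- insert v S = - S - {v}" by auto
      then show ?case using D[of v "- S"] 2 by (simp add: xt_def)
    qed (simp add: DU)
  next
    case (Suc d)
    note IH = Suc
    show ?case
    proof (induction S rule: finite_induct[OF finite])
      case (2 v S)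
      have "fps_nth (D (- S \<inter> comparables prec v)) d = 0" using IH[of "- (- S \<inter> comparables prec v)"] by simp
      then have "fps_nth (xt v * D (- S \<inter> comparables prec v)) (Suc d) = 0" by (simp add: xt_def mult.assoc)
      moreover have "- insert v S = - S - {v}" by auto
      ultimately show ?case using D[of v "- S"] 2 by simp
    qed (simp add: DU)
  qed
  have "D W = 0" by (rule fps_ext) (use A[of "- W"] in simp)
  then show ?thesis by (simp add: D_def)
qed

lemma signed_hilb_in_empty: "signed_hilb_in prec {} = 1"
  unfolding signed_hilb_in_def multigraded_fps_1[symmetric] by (rule arg_cong[where f = multigraded_fps], rule ext) auto

end

section \<open>nbc-sets\<close>

text \<open>Having at least three vertices makes the two circuit edges at a vertex different. So the
  ends of an edge of a circuit stay covered without it.\<close>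

lemma circuit_other_edge:
  assumes "circuit C" "c \<in> C" "v \<in> c"
  obtains c' where "c' \<in> C" "c' \<noteq> c" "v \<in> c'"
proof -
  obtain p where p: "distinct p" "length p \<ge> 3" and C: "C = {{p ! i, p ! (Suc i mod length p)} | i. i < length p}"
    using assms(1) by (auto simp: circuit_def)
  let ?n = "length p"
  have "\<exists>i<?n. v = p ! i"
  proof -
    obtain i where i: "i < ?n" "c = {p ! i, p ! (Suc i mod ?n)}" using assms(2) C by auto
    moreover have "Suc i mod ?n < ?n" using p(2) by (intro mod_less_divisor) auto
    ultimately show ?thesis using assms(3) by auto
  qed
  then obtain i where i: "i < ?n" "v = p ! i" by blast
  \<comment> \<open>The predecessor of i in cyclic order.\<close>
  define j where "j = (if i = 0 then ?n - 1 else i - 1)"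
  have j: "j < ?n" "Suc j mod ?n = i" using i p(2) by (auto simp: j_def)
  define k where "k = Suc i mod ?n"
  have k: "k < ?n" "k \<noteq> j"
  proof -
    show "k < ?n" using p(2) unfolding k_def by (intro mod_less_divisor) auto
    show "k \<noteq> j"
    proof (cases "Suc i = ?n")
      case True
      then show ?thesis using p(2) by (auto simp: k_def j_def)
    next
      case False
      then have "k = Suc i" using i by (simp add: k_def)
      then show ?thesis using i False p(2) by (auto simp: j_def)
    qed
  qed
  have 1: "{p ! i, p ! k} \<in> C" using i C by (auto simp: k_def)
  have "{p ! j, p ! (Suc j mod ?n)} \<in> C" unfolding C using j(1) by blast
  then have 2: "{p ! j, p ! i} \<in> C" unfolding j(2) .
  have "p ! j \<noteq> p ! k" using p(1) j(1) k by (simp add: nth_eq_iff_index_eq)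
  then have "{p ! i, p ! k} \<noteq> {p ! j, p ! i}" by (auto simp: doubleton_eq_iff)
  then have "{p ! i, p ! k} \<noteq> c \<or> {p ! j, p ! i} \<noteq> c" by blast
  then show ?thesis using that 1 2 i(2) by blast
qed

lemma circuit_nonempty: "circuit C \<Longrightarrow> C \<noteq> {}"
proof -
  assume "circuit C"
  then obtain p where p: "length p \<ge> 3" "C = {{p ! i, p ! (Suc i mod length p)} | i. i < length p}"
    by (auto simp: circuit_def)
  then have "0 < length p" by auto
  then show ?thesis using p(2) by blast
qed

text \<open>Turns connectedness of edges into reachability of vertices.\<close>

lemma edge_path:
  assumes I: "I \<subseteq> mingens (prec :: 'n::{finite,linorder} \<Rightarrow> 'n \<Rightarrow> bool)" and "(m, m') \<in> (adj I)\<^sup>+" "u \<in> ks m" "w \<in> ks m'"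
  shows "(\<lambda>x y. {x, y} \<in> ks ` I)\<^sup>*\<^sup>* u w"
proof -
  let ?r = "\<lambda>x y. {x, y} \<in> ks ` I"
  have e: "?r\<^sup>*\<^sup>* x y" if xy: "g \<in> I" "x \<in> ks g" "y \<in> ks g" for g x y
  proof (cases "x = y")
    case False
    have "g \<in> mingens prec" using I xy by auto
    then obtain i j where "ks g = {i, j}" by (rule mingensE)
    then have "ks g = {x, y}" using xy False by auto
    then have "?r x y" using xy(1) by (metis imageI)
    then show ?thesis by (rule r_into_rtranclp)
  qed simp
  show ?thesis using assms(2,4)
  proof (induction arbitrary: w rule: trancl_induct)
    case (base y)
    then obtain x where "x \<in> ks m" "x \<in> ks y" "m \<in> I" "y \<in> I" by (auto simp: adj_def)
    then show ?case using e[of m u x] e[of y x w] assms(3) base.prems by auto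
  next
    case (step y z)
    then obtain x where x: "x \<in> ks y" "x \<in> ks z" "z \<in> I" by (auto simp: adj_def)
    show ?case using step.IH[OF x(1)] e[OF x(3,2) step.prems] by (rule rtranclp_trans)
  qed
qed

text \<open>Edges are added one at a time. An edge with both ends in one class would close a path of
  that class to a circuit.\<close>

lemma excess0_if_no_circuit:
  fixes prec :: "'n::{finite,linorder} \<Rightarrow> 'n \<Rightarrow> bool"
  assumes "I \<subseteq> mingens prec" "\<And>C. circuit C \<Longrightarrow> \<not> C \<subseteq> ks ` I"
  shows "excess0 I"
  using finite_edges[OF assms(1)] assms
proof (induction I rule: finite_induct)
  case empty
  then show ?case by (simp add: excess0_def)
next
  case (insert e I)
  have I: "I \<subseteq> mingens prec" and e: "e \<in> mingens prec" using insert.prems(1) by auto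
  have "\<not> C \<subseteq> ks ` I" if "circuit C" for C using insert.prems(2)[OF that] by auto
  then have ex: "excess0 I" using insert.IH I by blast
  show ?case
  proof (rule excess0_insert[OF I ex e insert.hyps(2)])
    fix C assume C: "C \<in> comps I"
    show "\<not> ks e \<subseteq> \<Union>(ks ` C)"
    proof
      assume "ks e \<subseteq> \<Union>(ks ` C)"
      moreover obtain u w where uw: "u < w" "ks e = {u, w}" using e by (rule mingensE)
      ultimately obtain m m' where m: "m \<in> C" "u \<in> ks m" "m' \<in> C" "w \<in> ks m'" by auto
      let ?r = "\<lambda>x y. {x, y} \<in> ks ` I"
      have "?r\<^sup>*\<^sup>* u w" using edge_path[OF I comps_props(4)[OF I C m(1,3)] m(2,4)] .
      then obtain xs' where "rtrancl_path ?r u xs' w" by (auto simp: rtranclp_eq_rtrancl_path)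
      then obtain xs where xs: "rtrancl_path ?r u xs w" "distinct (u # xs)" by (rule rtrancl_path_distinct)
      have ne: "xs \<noteq> []" using xs(1) uw(1) by (auto elim: rtrancl_path.cases)
      then have last: "last xs = w" using rtrancl_path_last[OF xs(1)] by simp
      let ?p = "u # xs"
      have step: "{?p ! i, xs ! i} \<in> ks ` I" if "i < length xs" for i
        using rtrancl_path_nth[OF xs(1) that] .
      have "length xs \<noteq> 1"
      proof
        assume l: "length xs = 1"
        then have "xs ! 0 = w" using last ne by (simp add: last_conv_nth)
        then have "ks e \<in> ks ` I" using step[of 0] l uw(2) by simp
        then obtain g where "g \<in> I" "ks g = ks e" by auto
        then have "g = e" using mingens_sqf[of g prec] mingens_sqf[OF e] I by (metis subsetD)
        then show False using insert.hyps(2) \<open>g \<in> I\<close> by simp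
      qed
      then have len: "length ?p \<ge> 3" using ne by (cases xs rule: list.exhaust) (auto simp: Suc_le_eq neq_Nil_conv)
      define D where "D = {{?p ! i, ?p ! (Suc i mod length ?p)} | i. i < length ?p}"
      have "circuit D" unfolding circuit_def D_def using xs(2) len by blast
      moreover have "D \<subseteq> ks ` insert e I"
      proof
        fix d assume "d \<in> D"
        then obtain i where i: "i < length ?p" "d = {?p ! i, ?p ! (Suc i mod length ?p)}" unfolding D_def by blast
        show "d \<in> ks ` insert e I"
        proof (cases "i < length xs")
          case True
          then have "d = {?p ! i, xs ! i}" using i by simp
          then show ?thesis using step[OF True] by auto
        next
          case False
          then have il: "i = length xs" using i by simp
          then have "?p ! i = w" using last ne by (simp add: last_conv_nth nth_Cons')
          moreover have "Suc i mod length ?p = 0" using il by simp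
          ultimately have "d = ks e" using i(2) uw(2) by (simp add: insert_commute)
          then show ?thesis by simp
        qed
      qed
      ultimately show False using insert.prems(2) by blast
    qed
  qed
qed

section \<open>Broken edges and the cancelling involution\<close>

definition broken_edge :: "('n::{finite,linorder} \<Rightarrow> 'n \<Rightarrow> bool) \<Rightarrow> 'n monom set \<Rightarrow> 'n monom \<Rightarrow> bool" where
  "broken_edge prec I e \<longleftrightarrow> e \<in> mingens prec \<and> (\<exists>C. circuit C \<and> C \<subseteq> ks ` I \<union> {ks e} \<and> ks e \<in> C \<and>
     (\<forall>i j. {i, j} \<in> C \<longrightarrow> edge_monom i j \<le> e))"

lemma graph_of_eq: "I \<subseteq> mingens (prec :: 'n::{finite,linorder} \<Rightarrow> 'n \<Rightarrow> bool) \<Longrightarrow> graph_of I = ks ` I"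
proof (intro set_eqI iffI)
  fix x assume "x \<in> graph_of I"
  then obtain i j where "x = {i, j}" "edge_monom i j \<in> I" by (auto simp: graph_of_def)
  then show "x \<in> ks ` I" by (metis imageI keys_edge_monom)
next
  fix x assume "I \<subseteq> mingens prec" "x \<in> ks ` I"
  then obtain g where g: "g \<in> I" "g \<in> mingens prec" "x = ks g" by auto
  obtain i j where "g = edge_monom i j" "ks g = {i, j}" using g(2) by (rule mingensE)
  then show "x \<in> graph_of I" unfolding graph_of_def using g by blast
qed

lemma nbc_set_iff: "nbc_set prec I \<longleftrightarrow> I \<noteq> {} \<and> I \<subseteq> mingens prec \<and> (\<forall>e. \<not> broken_edge prec I e)"
proof -
  have "(\<exists>i j. edge_monom i j \<in> mingens prec \<and> (\<exists>C. circuit C \<and> C \<subseteq> graph_of I \<union> {{i, j}} \<and> {i, j} \<in> C \<and>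
           (\<forall>i' j'. {i', j'} \<in> C \<longrightarrow> edge_monom i' j' \<le> edge_monom i j))) \<longleftrightarrow> (\<exists>e. broken_edge prec I e)"
    if I: "I \<subseteq> mingens prec"
  proof
    assume "\<exists>i j. edge_monom i j \<in> mingens prec \<and> (\<exists>C. circuit C \<and> C \<subseteq> graph_of I \<union> {{i, j}} \<and> {i, j} \<in> C \<and>
           (\<forall>i' j'. {i', j'} \<in> C \<longrightarrow> edge_monom i' j' \<le> edge_monom i j))"
    then obtain i j where "edge_monom i j \<in> mingens prec \<and> (\<exists>C. circuit C \<and> C \<subseteq> graph_of I \<union> {{i, j}} \<and> {i, j} \<in> C \<and>
           (\<forall>i' j'. {i', j'} \<in> C \<longrightarrow> edge_monom i' j' \<le> edge_monom i j))" by blast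
    then have "broken_edge prec I (edge_monom i j)" unfolding broken_edge_def keys_edge_monom graph_of_eq[OF I] .
    then show "\<exists>e. broken_edge prec I e" ..
  next
    assume "\<exists>e. broken_edge prec I e"
    then obtain e where e: "broken_edge prec I e" ..
    then have "e \<in> mingens prec" by (simp add: broken_edge_def)
    then obtain i j where ij: "e = edge_monom i j" by (rule mingensE)
    show "\<exists>i j. edge_monom i j \<in> mingens prec \<and> (\<exists>C. circuit C \<and> C \<subseteq> graph_of I \<union> {{i, j}} \<and> {i, j} \<in> C \<and>
           (\<forall>i' j'. {i', j'} \<in> C \<longrightarrow> edge_monom i' j' \<le> edge_monom i j))"
      using e unfolding broken_edge_def ij keys_edge_monom graph_of_eq[OF I] by blast
  qed
  then show ?thesis unfolding nbc_set_def by blast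
qed

text \<open>The largest edge of a circuit inside I would be a broken edge, so nbc-sets contain no
  circuit.\<close>

lemma excess0_nbc:
  fixes prec :: "'n::{finite,linorder} \<Rightarrow> 'n \<Rightarrow> bool"
  assumes "nbc_set prec I"
  shows "excess0 I"
proof (rule excess0_if_no_circuit)
  show I: "I \<subseteq> mingens prec" using assms by (simp add: nbc_set_iff)
  fix C :: "'n set set" assume C: "circuit C"
  show "\<not> C \<subseteq> ks ` I"
  proof
    assume sub: "C \<subseteq> ks ` I"
    let ?G = "{g \<in> I. ks g \<in> C}"
    have fin: "finite ?G" using finite_edges[OF I] by simp
    obtain c where "c \<in> C" using circuit_nonempty[OF C] by blast
    then have ne: "?G \<noteq> {}" using sub by auto
    have m: "Max ?G \<in> ?G" by (rule Max_in[OF fin ne])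
    have "edge_monom i j \<le> Max ?G" if ij: "{i, j} \<in> C" for i j
    proof -
      obtain g where g: "g \<in> I" "ks g = {i, j}" using sub ij by (metis (full_types) imageE subsetD)
      have "g \<in> mingens prec" using g I by auto
      then have "card {i, j} = 2" "g = sqf {i, j}" using mingens_card[of g prec] mingens_sqf[of g prec] g(2) by auto
      then have "g = edge_monom i j" using edge_monom_sqf[of i j] by (cases "i = j") auto
      then show ?thesis using g ij fin by (intro Max_ge) auto
    qed
    then have "broken_edge prec I (Max ?G)" unfolding broken_edge_def using m I C sub by auto
    then show False using assms by (simp add: nbc_set_iff)
  qed
qed

definition toggle :: "'a \<Rightarrow> 'a set \<Rightarrow> 'a set" where
  "toggle e I = (if e \<in> I then I - {e} else insert e I)"

lemma toggle_toggle [simp]: "toggle e (toggle e I) = I"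
  by (auto simp: toggle_def)

text \<open>\<open>broken_edge\<close> looks at I with e added, so it sees no difference.\<close>

lemma broken_edge_toggle: "broken_edge prec I e \<Longrightarrow> broken_edge prec (toggle e I) e"
proof -
  have "ks ` I \<union> {ks e} = ks ` toggle e I \<union> {ks e}" by (auto simp: toggle_def)
  then show "broken_edge prec I e \<Longrightarrow> broken_edge prec (toggle e I) e" by (simp add: broken_edge_def)
qed

text \<open>A circuit with maximum smaller than \<open>e\<close> does not contain \<open>e\<close>, so toggling \<open>e\<close> does not affect it.\<close>

lemma broken_edge_toggle_less:
  assumes "e \<in> mingens prec" "e' < e" "broken_edge prec (toggle e I) e'"
  shows "broken_edge prec I e'"
proof -
  obtain C where C: "circuit C" "C \<subseteq> ks ` toggle e I \<union> {ks e'}" "ks e' \<in> C"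
    "\<forall>i j. {i, j} \<in> C \<longrightarrow> edge_monom i j \<le> e'" and e': "e' \<in> mingens prec"
    using assms(3) by (auto simp: broken_edge_def)
  obtain i j where "e = edge_monom i j" "ks e = {i, j}" using assms(1) by (rule mingensE)
  then have "ks e \<notin> C" using C(4) assms(2) by (metis not_le)
  then have "C \<subseteq> ks ` I \<union> {ks e'}" using C(2) by (auto simp: toggle_def split: if_splits)
  then show ?thesis using C e' by (auto simp: broken_edge_def)
qed

text \<open>Each end of e lies on a second edge of the circuit, and that edge is kept.\<close>

lemma support_toggle:
  assumes I: "I \<subseteq> mingens (prec :: 'n::{finite,linorder} \<Rightarrow> 'n \<Rightarrow> bool)" and b: "broken_edge prec I e"
  shows "support (toggle e I) = support I"
proof -
  have fin: "finite I" by (rule finite_edges[OF I])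
  obtain C where C: "circuit C" "C \<subseteq> ks ` I \<union> {ks e}" "ks e \<in> C" using b by (auto simp: broken_edge_def)
  have "ks e \<subseteq> \<Union>(ks ` (I - {e}))"
  proof
    fix v assume "v \<in> ks e"
    then obtain c' where "c' \<in> C" "c' \<noteq> ks e" "v \<in> c'" by (rule circuit_other_edge[OF C(1,3)])
    then show "v \<in> \<Union>(ks ` (I - {e}))" using C(2) by auto
  qed
  then have "\<Union>(ks ` toggle e I) = \<Union>(ks ` I)" by (auto simp: toggle_def)
  moreover have "finite (toggle e I)" using fin by (simp add: toggle_def)
  ultimately show ?thesis using fin by (simp add: support_eq)
qed

lemma card_toggle: "finite I \<Longrightarrow> (- 1) ^ card (toggle e I) = - ((- 1) ^ card I :: int)"
proof (cases "e \<in> I")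
  case True
  assume "finite I"
  then have "card I = Suc (card (I - {e}))" using True by (simp only: card_Suc_Diff1)
  then have "(- 1) ^ card I = - ((- 1) ^ card (I - {e}) :: int)" by (simp only: power_Suc mult_minus1)
  then show ?thesis using True by (simp add: toggle_def del: card_Diff_insert)
qed (simp add: toggle_def)

text \<open>The involution toggles the smallest broken edge. This edge stays broken and no smaller
  one becomes broken, since a circuit with a smaller maximum avoids it; so the toggled set selects
  the same edge.\<close>

lemma nbc_euler:
  fixes prec :: "'n::{finite,linorder} \<Rightarrow> 'n \<Rightarrow> bool"
  shows "(\<Sum>I\<in>{I \<in> {I. nbc_set prec I}. support I = V}. (- 1) ^ card I :: int) =
    (\<Sum>I | I \<noteq> {} \<and> I \<subseteq> mingens prec \<and> support I = V. (- 1) ^ card I)"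
proof -
  let ?A = "{I. I \<noteq> {} \<and> I \<subseteq> mingens prec \<and> support I = V}"
  let ?N = "{I \<in> {I. nbc_set prec I}. support I = V}"
  let ?B = "{I \<in> ?A. \<exists>e. broken_edge prec I e}"
  define m where "m I = Min {e. broken_edge prec I e}" for I
  have fin: "finite ?A" by (rule finite_subset[of _ "Pow (mingens prec)"]) auto
  have fb: "finite {e. broken_edge prec I e}" for I
    by (rule finite_subset[of _ "mingens prec"]) (auto simp: broken_edge_def)
  have mb: "broken_edge prec I (m I)" if "\<exists>e. broken_edge prec I e" for I
    using Min_in[OF fb[of I]] that unfolding m_def by blast
  have mle: "m I \<le> e" if "broken_edge prec I e" for I e unfolding m_def using fb that by (intro Min_le) auto
  have tb: "toggle (m I) I \<in> ?B \<and> m (toggle (m I) I) = m I" if I: "I \<in> ?B" for I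
  proof -
    have I': "I \<subseteq> mingens prec" "support I = V" "I \<noteq> {}" and ex: "\<exists>e. broken_edge prec I e" using I by auto
    note b = mb[OF ex]
    have e: "m I \<in> mingens prec" using b by (simp add: broken_edge_def)
    let ?T = "toggle (m I) I"
    have T: "?T \<subseteq> mingens prec" using I' e by (auto simp: toggle_def)
    have s: "support ?T = V" using support_toggle[OF I'(1) b] I'(2) by simp
    have "V \<noteq> {}" using support_nonempty[OF I'(1,3)] I'(2) by simp
    then have "?T \<noteq> {}" using s by auto
    moreover have bT: "broken_edge prec ?T (m I)" by (rule broken_edge_toggle[OF b])
    moreover have "m ?T = m I"
    proof (rule antisym)
      show "m ?T \<le> m I" by (rule mle[OF bT])
      show "m I \<le> m ?T"
      proof (rule ccontr)
        assume "\<not> m I \<le> m ?T"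
        moreover have "broken_edge prec ?T (m ?T)" using mb bT by blast
        ultimately have "broken_edge prec I (m ?T)" using broken_edge_toggle_less[OF e] by auto
        then show False using mle \<open>\<not> m I \<le> m ?T\<close> by blast
      qed
    qed
    ultimately show ?thesis using T s by auto
  qed
  have "(\<Sum>I\<in>?B. (- 1) ^ card I :: int) = (\<Sum>I\<in>?B. - ((- 1) ^ card I))"
  proof (rule sum.reindex_bij_witness[of _ "\<lambda>I. toggle (m I) I" "\<lambda>I. toggle (m I) I"])
    fix I assume I: "I \<in> ?B"
    then have "finite I" using finite_edges by blast
    then show "- ((- 1) ^ card (toggle (m I) I)) = ((- 1) ^ card I :: int)" by (simp add: card_toggle)
  qed (use tb in auto)
  then have "(\<Sum>I\<in>?B. (- 1) ^ card I :: int) = 0" by (simp add: sum_negf)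
  moreover have "?A = ?N \<union> ?B" by (auto simp: nbc_set_iff)
  moreover have "?N \<inter> ?B = {}" by (auto simp: nbc_set_iff)
  ultimately have "(\<Sum>I\<in>?A. (- 1) ^ card I :: int) = (\<Sum>I\<in>?N. (- 1) ^ card I)"
    using fin by (metis (no_types, lifting) add.right_neutral finite_Un sum.union_disjoint)
  then show ?thesis by simp
qed

lemma W_series_nbc: "W_series {I. nbc_set prec I} = chain_series (prec :: 'n::{finite,linorder} \<Rightarrow> 'n \<Rightarrow> bool)"
proof (rule W_series_eq_card[OF _ nbc_euler])
  fix I assume "I \<in> {I. nbc_set prec I}"
  then have "nbc_set prec I" by simp
  then show "I \<noteq> {} \<and> I \<subseteq> mingens prec \<and> excess0 I" using excess0_nbc by (simp add: nbc_set_iff)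
qed

section \<open>Sting-chains\<close>

lemma sum_subsets_insert:
  fixes P :: "'a set \<Rightarrow> bool"
  assumes "finite V" "y \<notin> V"
  shows "(\<Sum>F | F \<subseteq> insert y V \<and> P F. (- 1) ^ card F :: int) =
    (\<Sum>F | F \<subseteq> V \<and> P F. (- 1) ^ card F) - (\<Sum>F | F \<subseteq> V \<and> P (insert y F). (- 1) ^ card F)"
proof -
  let ?A = "{F. F \<subseteq> V \<and> P F}" and ?B = "{F. F \<subseteq> V \<and> P (insert y F)}"
  have "{F. F \<subseteq> insert y V \<and> P F} = ?A \<union> insert y ` ?B"
  proof (intro set_eqI iffI)
    fix F assume F: "F \<in> {F. F \<subseteq> insert y V \<and> P F}"
    show "F \<in> ?A \<union> insert y ` ?B"
    proof (cases "y \<in> F")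
      case True
      then have "F = insert y (F - {y})" by auto
      moreover have "F - {y} \<in> ?B" using F True by (auto simp: insert_absorb)
      ultimately show ?thesis by blast
    qed (use F in auto)
  qed auto
  moreover have "?A \<inter> insert y ` ?B = {}" using assms(2) by auto
  moreover have "finite ?A" "finite ?B" using assms(1) by auto
  ultimately have "(\<Sum>F | F \<subseteq> insert y V \<and> P F. (- 1) ^ card F :: int) =
      (\<Sum>F\<in>?A. (- 1) ^ card F) + (\<Sum>F\<in>insert y ` ?B. (- 1) ^ card F)"
    by (simp add: sum.union_disjoint)
  also have "(\<Sum>F\<in>insert y ` ?B. (- 1) ^ card F :: int) = (\<Sum>F\<in>?B. (- 1) ^ card (insert y F))"
    by (rule sum.reindex_cong[of "insert y"]) (use assms(2) in \<open>auto simp: inj_on_def\<close>)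
  also have "\<dots> = (\<Sum>F\<in>?B. - ((- 1) ^ card F))"
  proof (rule sum.cong[OF refl])
    fix F assume "F \<in> ?B"
    then have "finite F" "y \<notin> F" using assms finite_subset by auto
    then show "(- 1) ^ card (insert y F) = - ((- 1) ^ card F :: int)" by simp
  qed
  finally show ?thesis by (simp add: sum_negf)
qed

text \<open>Up to sign the contribution to f of the chains with least element p. Together with f it
  satisfies a closed recursion on the smallest vertex.\<close>

definition chain_euler_above :: "('n::linorder \<Rightarrow> 'n \<Rightarrow> bool) \<Rightarrow> 'n \<Rightarrow> 'n set \<Rightarrow> int" where
  "chain_euler_above prec p V = (\<Sum>F | F \<subseteq> V \<and> is_chain prec F \<and> (\<forall>x\<in>F. prec p x). (- 1) ^ card F)"

text \<open>If s lies above p, the edge from p to s is not a generator and s has to be attached to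
  q; otherwise the condition on sting-chains forbids the edge to q and s is attached to p.\<close>

definition gap_edges :: "('n \<Rightarrow> 'n \<Rightarrow> bool) \<Rightarrow> 'n \<Rightarrow> 'n \<Rightarrow> 'n set \<Rightarrow> 'n monom set" where
  "gap_edges prec p q Z = insert (edge_monom p q) ((\<lambda>s. if prec p s then edge_monom s q else edge_monom p s) ` Z)"

text \<open>Unions of sting-chains are built by scanning the vertices in increasing order: \<open>p\<close> is the last
  chain vertex of the current sting-chain, \<open>Z\<close> is the set of vertices passed since then.  Once the
  next chain vertex is known, transitivity leaves exactly one way to attach each vertex in \<open>Z\<close>.\<close>

fun scan :: "('n \<Rightarrow> 'n \<Rightarrow> bool) \<Rightarrow> 'n \<Rightarrow> 'n set \<Rightarrow> 'n list \<Rightarrow> 'n monom set set"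
  and scans :: "('n \<Rightarrow> 'n \<Rightarrow> bool) \<Rightarrow> 'n list \<Rightarrow> 'n monom set set" where
  "scan prec p Z [] = {}"
| "scan prec p Z (y # ys) = scan prec p (insert y Z) ys \<union>
     (if prec p y then {} else (\<lambda>J. gap_edges prec p y Z \<union> J) ` (scans prec ys \<union> scan prec y {} ys))"
| "scans prec [] = {{}}"
| "scans prec (y # ys) = scan prec y {} ys"

definition scan_inv :: "'n::linorder \<Rightarrow> 'n set \<Rightarrow> 'n list \<Rightarrow> bool" where
  "scan_inv p Z ys \<longleftrightarrow> sorted_wrt (<) ys \<and> (\<forall>z\<in>Z. p < z \<and> (\<forall>y\<in>set ys. z < y)) \<and> (\<forall>y\<in>set ys. p < y)"

lemma scan_inv_Cons:
  assumes "scan_inv p Z (y # ys)"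
  shows "scan_inv p (insert y Z) ys" "scan_inv y {} ys" "sorted_wrt (<) ys" "p < y"
    "p \<notin> insert y (set ys)" "Z \<inter> insert y (set ys) = {}" "p \<notin> Z" "\<forall>s\<in>Z. p < s \<and> s < y" "y \<notin> set ys"
  using assms by (auto simp: scan_inv_def)

text \<open>An uncovered end lies in no class, so e cannot close a cycle.\<close>

lemma excess0_insert_leaf:
  fixes prec :: "'n::{finite,linorder} \<Rightarrow> 'n \<Rightarrow> bool"
  assumes I: "I \<subseteq> mingens prec" "excess0 I" and e: "e \<in> mingens prec" "\<not> ks e \<subseteq> support I"
  shows "excess0 (insert e I)"
proof -
  have s: "support I = \<Union>(ks ` I)" by (rule support_eq[OF finite_edges[OF I(1)]])
  then have "e \<notin> I" using e(2) by auto
  moreover have "\<not> ks e \<subseteq> \<Union>(ks ` C)" if "C \<in> comps I" for C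
    using comps_props(2)[OF I(1)] that e(2) s by blast
  ultimately show ?thesis using excess0_insert[OF I e(1)] by blast
qed

text \<open>The sting-chain with chain vertices c and vertex set V: the attachment of the remaining
  vertices is forced.\<close>

fun sting_of_path :: "('n::linorder \<Rightarrow> 'n \<Rightarrow> bool) \<Rightarrow> 'n set \<Rightarrow> 'n list \<Rightarrow> 'n monom set" where
  "sting_of_path prec V (p # q # c) = gap_edges prec p q {s \<in> V. p < s \<and> s < q} \<union> sting_of_path prec V (q # c)"
| "sting_of_path prec V _ = {}"

lemma sting_of_path_iff: "e \<in> sting_of_path prec V c \<longleftrightarrow>
  (\<exists>j. Suc j < length c \<and> e \<in> gap_edges prec (c ! j) (c ! Suc j) {s \<in> V. c ! j < s \<and> s < c ! Suc j})"
proof (induction prec V c rule: sting_of_path.induct)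
  case (1 prec V p q c)
  let ?P = "\<lambda>c j. Suc j < length c \<and> e \<in> gap_edges prec (c ! j) (c ! Suc j) {s \<in> V. c ! j < s \<and> s < c ! Suc j}"
  have ex: "(\<exists>j. Q j) \<longleftrightarrow> Q 0 \<or> (\<exists>j. Q (Suc j))" for Q :: "nat \<Rightarrow> bool"
    by (metis not0_implies_Suc)
  have "(\<exists>j. ?P (p # q # c) j) \<longleftrightarrow> ?P (p # q # c) 0 \<or> (\<exists>j. ?P (p # q # c) (Suc j))"
    by (rule ex)
  then show ?case using 1 by simp
qed auto

lemma sting_of_path_cong: "(\<And>s. hd c < s \<Longrightarrow> s \<in> V \<longleftrightarrow> s \<in> V') \<Longrightarrow> sorted_wrt (<) c \<Longrightarrow> sting_of_path prec V c = sting_of_path prec V' c"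
proof (induction c rule: sting_of_path.induct[of _ undefined undefined])
  case (1 _ _ p q c)
  then have "{s \<in> V. p < s \<and> s < q} = {s \<in> V'. p < s \<and> s < q}" by auto
  moreover have "sting_of_path prec V (q # c) = sting_of_path prec V' (q # c)"
    using 1 by (auto dest: less_trans)
  ultimately show ?case by simp
qed auto

lemma gap_unique:
  fixes c :: "'a::linorder list"
  assumes c: "sorted_wrt (<) c" and i: "Suc i < length c" "c ! i < s" "s < c ! Suc i"
  shows "s \<notin> set c" "Suc j < length c \<Longrightarrow> c ! j < s \<Longrightarrow> s < c ! Suc j \<Longrightarrow> j = i"
proof -
  have mono: "c ! a \<le> c ! b" if "a \<le> b" "b < length c" for a b
    using sorted_wrt_nth_less[OF c, of a b] that by (cases "a = b") auto
  show "s \<notin> set c"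
  proof
    assume "s \<in> set c"
    then obtain k where k: "k < length c" "s = c ! k" by (auto simp: in_set_conv_nth)
    show False
    proof (cases "k \<le> i")
      case True then show False using mono[of k i] i k by auto
    next
      case False then show False using mono[of "Suc i" k] i k by auto
    qed
  qed
  show "j = i" if j: "Suc j < length c" "c ! j < s" "s < c ! Suc j"
  proof (rule linorder_cases[of j i])
    assume "j < i" then show ?thesis using mono[of "Suc j" i] i j by auto
  next
    assume "i < j" then show ?thesis using mono[of "Suc i" j] i j by auto
  qed
qed

context
  fixes prec :: "'n::{finite,linorder} \<Rightarrow> 'n \<Rightarrow> bool"
  assumes lt: "\<And>i j. prec i j \<Longrightarrow> i < j" and tr: "\<And>i j k. prec i j \<Longrightarrow> prec j k \<Longrightarrow> prec i k"
begin

lemma chain_euler_insert: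
  assumes "\<And>x. x \<in> V \<Longrightarrow> y < x"
  shows "chain_euler prec (insert y V) = chain_euler prec V - chain_euler_above prec y V"
proof -
  have y: "y \<notin> V" using assms by auto
  have "is_chain prec (insert y F) \<longleftrightarrow> is_chain prec F \<and> (\<forall>x\<in>F. prec y x)" if "F \<subseteq> V" for F
    using assms that unfolding is_chain_def by (auto dest: less_asym)
  then have "{F. F \<subseteq> V \<and> is_chain prec (insert y F)} = {F. F \<subseteq> V \<and> is_chain prec F \<and> (\<forall>x\<in>F. prec y x)}" by auto
  then show ?thesis unfolding chain_euler_def chain_euler_above_def
    using sum_subsets_insert[of V y "is_chain prec"] y by simp
qed

text \<open>By transitivity everything above y is above p as well, so once y is above p, the chains
  through y are counted without reference to p.\<close>

lemma chain_euler_above_insert: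
  assumes "\<And>x. x \<in> V \<Longrightarrow> y < x"
  shows "chain_euler_above prec p (insert y V) =
    chain_euler_above prec p V - (if prec p y then chain_euler_above prec y V else 0)"
proof -
  have y: "y \<notin> V" using assms by auto
  let ?P = "\<lambda>F. is_chain prec F \<and> (\<forall>x\<in>F. prec p x)"
  have "?P (insert y F) \<longleftrightarrow> prec p y \<and> is_chain prec F \<and> (\<forall>x\<in>F. prec y x)" if F: "F \<subseteq> V" for F
  proof
    assume h: "?P (insert y F)"
    then have "is_chain prec F" by (auto simp: is_chain_def)
    moreover have "prec y x" if "x \<in> F" for x using h that F assms[of x] by (auto simp: is_chain_def)
    ultimately show "prec p y \<and> is_chain prec F \<and> (\<forall>x\<in>F. prec y x)" using h by auto
  next
    assume h: "prec p y \<and> is_chain prec F \<and> (\<forall>x\<in>F. prec y x)"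
    have "is_chain prec (insert y F)" unfolding is_chain_def
    proof (intro ballI impI)
      fix i j assume ij: "i \<in> insert y F" "j \<in> insert y F" "i < j"
      show "prec i j"
      proof (cases "i = y")
        case True
        then show ?thesis using ij h by auto
      next
        case False
        then have "i \<in> F" using ij by simp
        then have "y < i" using F assms by auto
        then have "j \<in> F" using ij by auto
        then show ?thesis using h \<open>i \<in> F\<close> ij(3) by (auto simp: is_chain_def)
      qed
    qed
    then show "?P (insert y F)" using h tr by blast
  qed
  then have "{F. F \<subseteq> V \<and> ?P (insert y F)} =
      {F. F \<subseteq> V \<and> prec p y \<and> is_chain prec F \<and> (\<forall>x\<in>F. prec y x)}" by auto
  then have "chain_euler_above prec p (insert y V) = chain_euler_above prec p V -
      (\<Sum>F | F \<subseteq> V \<and> prec p y \<and> is_chain prec F \<and> (\<forall>x\<in>F. prec y x). (- 1) ^ card F)"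
    unfolding chain_euler_above_def using sum_subsets_insert[of V y ?P] y by simp
  then show ?thesis by (simp add: chain_euler_above_def)
qed

lemma gap_edges_props:
  assumes pq: "p < q" "\<not> prec p q" and Z: "\<forall>s\<in>Z. p < s \<and> s < q"
  shows "gap_edges prec p q Z \<subseteq> mingens prec" "support (gap_edges prec p q Z) = insert p (insert q Z)"
    "card (gap_edges prec p q Z) = Suc (card Z)"
    "e \<in> gap_edges prec p q Z \<Longrightarrow> \<exists>x\<in>insert p Z. x \<in> ks e"
    "edge_monom p s \<in> gap_edges prec p q Z \<Longrightarrow> p < s \<Longrightarrow> s \<le> q"
    "edge_monom p q \<in> gap_edges prec p q Z"
proof -
  let ?g = "\<lambda>s. if prec p s then edge_monom s q else edge_monom p s"
  note Z = Z[rule_format]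
  \<comment> \<open>If s is above p, it is not below q, since p would then be below q.\<close>
  have g: "?g s \<in> mingens prec" if "s \<in> Z" for s
    using Z[OF that] pq tr[of p s q] by (auto simp: edge_in_mingens)
  show 1: "gap_edges prec p q Z \<subseteq> mingens prec"
  proof -
    have "?g ` Z \<subseteq> mingens prec" using g by blast
    moreover have "edge_monom p q \<in> mingens prec" using pq by (simp add: edge_in_mingens)
    ultimately show ?thesis unfolding gap_edges_def by blast
  qed
  show "support (gap_edges prec p q Z) = insert p (insert q Z)"
    unfolding support_eq[OF finite_edges[OF 1]] by (auto simp: gap_edges_def split: if_splits)
  have inj: "inj_on ?g Z"
  proof (rule inj_onI)
    fix s t assume st: "s \<in> Z" "t \<in> Z" "?g s = ?g t"
    have "ks (?g s) = ks (?g t)" using st(3) by (rule arg_cong)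
    then show "s = t" using Z[OF st(1)] Z[OF st(2)] by (auto simp: doubleton_eq_iff split: if_splits)
  qed
  have "edge_monom p q \<notin> ?g ` Z"
  proof
    assume "edge_monom p q \<in> ?g ` Z"
    then obtain s where s: "s \<in> Z" "edge_monom p q = ?g s" by blast
    have "ks (edge_monom p q) = ks (?g s)" using s(2) by (rule arg_cong)
    then show False using Z[OF s(1)] pq(1) by (auto simp: doubleton_eq_iff split: if_splits)
  qed
  then show "card (gap_edges prec p q Z) = Suc (card Z)"
    unfolding gap_edges_def by (subst card_insert_disjoint) (simp_all only: card_image[OF inj] finite_imageI[OF finite] not_False_eq_True)
  show "\<exists>x\<in>insert p Z. x \<in> ks e" if "e \<in> gap_edges prec p q Z"
    using that by (auto simp: gap_edges_def split: if_splits)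
  show "s \<le> q" if s: "edge_monom p s \<in> gap_edges prec p q Z" "p < s"
  proof -
    have "ks (edge_monom p s) \<subseteq> support (gap_edges prec p q Z)"
      using s(1) unfolding support_eq[OF finite_edges[OF 1]] by blast
    then have "s \<in> insert p (insert q Z)"
      unfolding \<open>support (gap_edges prec p q Z) = insert p (insert q Z)\<close> by simp
    then show ?thesis using s(2) Z[of s] by auto
  qed
qed (simp add: gap_edges_def)

text \<open>Built from J by the edge from p to q, which brings the new vertex p, and then by one new
  leaf for each passed vertex.\<close>

lemma excess0_gap:
  assumes pq: "p < q" "\<not> prec p q" and Z: "\<forall>s\<in>Z. p < s \<and> s < q"
    and J: "J \<subseteq> mingens prec" "excess0 J" "p \<notin> support J" "support J \<inter> Z = {}"
  shows "excess0 (gap_edges prec p q Z \<union> J)"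
proof -
  have "finite Z" by simp
  then show ?thesis using Z J(4)
  proof (induction Z rule: finite_induct)
    case empty
    have "excess0 (insert (edge_monom p q) J)"
      using pq J by (intro excess0_insert_leaf) (auto simp: edge_in_mingens)
    then show ?case by (simp add: gap_edges_def)
  next
    case (insert s Z)
    let ?I = "gap_edges prec p q Z \<union> J"
    let ?e = "if prec p s then edge_monom s q else edge_monom p s"
    have Zp: "\<forall>s\<in>Z. p < s \<and> s < q" using insert.prems by auto
    have ex: "excess0 ?I" using insert by auto
    have s: "p < s" "s < q" using insert.prems by auto
    note gp = gap_edges_props[OF pq Zp]
    have I: "?I \<subseteq> mingens prec" using gp(1) J(1) by auto
    have sI: "support ?I = insert p (insert q Z) \<union> support J"
      using gp(2) support_Un[OF finite_edges[OF gp(1)] finite_edges[OF J(1)]] by simp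
    have "s \<notin> support ?I" unfolding sI using s insert by auto
    then have "excess0 (insert ?e ?I)"
      using I ex s tr[of p s q] pq(2) by (intro excess0_insert_leaf) (auto simp: edge_in_mingens)
    moreover have "insert ?e ?I = gap_edges prec p q (insert s Z) \<union> J" by (auto simp: gap_edges_def)
    ultimately show ?case by simp
  qed
qed

text \<open>The last claim on \<open>scan\<close>, an edge from p to a vertex not yet passed, is
  what separates its two branches when sums are split.\<close>

lemma scan_props:
  "(\<forall>p Z. scan_inv p Z ys \<longrightarrow> (\<forall>I\<in>scan prec p Z ys. I \<subseteq> mingens prec \<and> support I = insert p (Z \<union> set ys) \<and>
      excess0 I \<and> (\<exists>q\<in>set ys. edge_monom p q \<in> I))) \<and>
   (sorted_wrt (<) ys \<longrightarrow> (\<forall>I\<in>scans prec ys. I \<subseteq> mingens prec \<and> support I = set ys \<and> excess0 I))"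
proof (induction ys)
  case Nil
  then show ?case by (auto simp: excess0_def)
next
  case (Cons y ys)
  have A: "I \<subseteq> mingens prec \<and> support I = insert p (Z \<union> set ys) \<and> excess0 I \<and> (\<exists>q\<in>set ys. edge_monom p q \<in> I)"
    if "scan_inv p Z ys" "I \<in> scan prec p Z ys" for p Z I using Cons that by blast
  have B: "I \<subseteq> mingens prec \<and> support I = set ys \<and> excess0 I"
    if "sorted_wrt (<) ys" "I \<in> scans prec ys" for I using Cons that by blast
  show ?case
  proof (intro conjI allI impI ballI)
    fix I assume "sorted_wrt (<) (y # ys)" "I \<in> scans prec (y # ys)"
    then have h: "scan_inv y {} ys" "I \<in> scan prec y {} ys" by (auto simp: scan_inv_def)
    then show "I \<subseteq> mingens prec" "support I = set (y # ys)" "excess0 I" using A[OF h] by auto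
  next
    fix p Z I assume inv: "scan_inv p Z (y # ys)" and I: "I \<in> scan prec p Z (y # ys)"
    note i = scan_inv_Cons[OF inv]
    have "I \<subseteq> mingens prec \<and> support I = insert p (Z \<union> set (y # ys)) \<and> excess0 I \<and>
        (\<exists>q\<in>set (y # ys). edge_monom p q \<in> I)"
    proof (cases "I \<in> scan prec p (insert y Z) ys")
      case True
      then show ?thesis using A[OF i(1) True] by auto
    next
      case False
      then obtain J where J: "\<not> prec p y" "I = gap_edges prec p y Z \<union> J" "J \<in> scans prec ys \<union> scan prec y {} ys"
        using I by (auto split: if_splits)
      have J': "J \<subseteq> mingens prec" "set ys \<subseteq> support J" "support J \<subseteq> insert y (set ys)" "excess0 J"
        using J(3) A[OF i(2)] B[OF i(3)] by auto
      note gp = gap_edges_props[OF i(4) J(1) i(8)]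
      have "support I = insert p (insert y Z) \<union> support J"
        unfolding J(2) using gp(2) support_Un[OF finite_edges[OF gp(1)] finite_edges[OF J'(1)]] by simp
      then have "support I = insert p (Z \<union> set (y # ys))" using J'(2,3) by auto
      moreover have "excess0 I" unfolding J(2)
        using J' i(5,6) by (intro excess0_gap[OF i(4) J(1) i(8)]) auto
      ultimately show ?thesis using gp(1,6) J'(1) J(2) by auto
    qed
    then show "I \<subseteq> mingens prec" "support I = insert p (Z \<union> set (y # ys))" "excess0 I"
      "\<exists>q\<in>set (y # ys). edge_monom p q \<in> I" by auto
  qed
qed

lemma scan_props1:
  assumes "scan_inv p Z ys" "I \<in> scan prec p Z ys"
  shows "I \<subseteq> mingens prec" "support I = insert p (Z \<union> set ys)" "excess0 I" "\<exists>q\<in>set ys. edge_monom p q \<in> I"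
  using scan_props[of ys] assms by blast+

lemma scans_props1:
  assumes "sorted_wrt (<) ys" "I \<in> scans prec ys"
  shows "I \<subseteq> mingens prec" "support I = set ys" "excess0 I"
  using scan_props[of ys] assms by blast+

lemma finite_scan: "scan_inv p Z ys \<Longrightarrow> finite (scan prec p Z ys)" "sorted_wrt (<) ys \<Longrightarrow> finite (scans prec ys)"
proof -
  have fin: "finite (Pow (mingens prec))" by simp
  show "finite (scan prec p Z ys)" if "scan_inv p Z ys"
    using scan_props1(1)[OF that] by (intro finite_subset[OF _ fin]) blast
  show "finite (scans prec ys)" if "sorted_wrt (<) ys"
    using scans_props1(1)[OF that] by (intro finite_subset[OF _ fin]) blast
qed

text \<open>A scanned set is a forest on 1 + |Z| + |ys| vertices, so the summand is minus
  (-1)^cl(I). The right side is minus f of the set of p and ys; that it does not involve the passed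
  vertices Z lets the induction close.\<close>

lemma scan_sum:
  "(\<forall>p Z. scan_inv p Z ys \<longrightarrow> (\<Sum>I\<in>scan prec p Z ys. (- 1) ^ (card I + card Z + length ys)) =
      chain_euler_above prec p (set ys) - chain_euler prec (set ys)) \<and>
   (sorted_wrt (<) ys \<longrightarrow> (\<Sum>I\<in>scans prec ys. (- 1) ^ (card I + length ys)) = chain_euler prec (set ys))"
proof (induction ys)
  case Nil
  have "{F. F \<subseteq> {} \<and> is_chain prec F} = {{}}" "{F. F \<subseteq> {} \<and> is_chain prec F \<and> (\<forall>x\<in>F. prec p x)} = {{}}" for p
    by (auto simp: is_chain_def)
  then show ?case unfolding chain_euler_def chain_euler_above_def by simp
next
  case (Cons y ys)
  have A: "(\<Sum>I\<in>scan prec p Z ys. (- 1) ^ (card I + card Z + length ys)) =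
      chain_euler_above prec p (set ys) - chain_euler prec (set ys)" if "scan_inv p Z ys" for p Z
    using Cons that by blast
  have B: "(\<Sum>I\<in>scans prec ys. (- 1) ^ (card I + length ys)) = chain_euler prec (set ys)"
    if "sorted_wrt (<) ys" using Cons that by blast
  show ?case
  proof (intro conjI allI impI)
    assume s: "sorted_wrt (<) (y # ys)"
    then have inv: "scan_inv y {} ys" by (simp add: scan_inv_def)
    have "(\<Sum>I\<in>scans prec (y # ys). (- 1) ^ (card I + length (y # ys))) =
        - (\<Sum>I\<in>scan prec y {} ys. (- 1) ^ (card I + card ({} :: 'n set) + length ys) :: int)"
      by (simp add: sum_negf)
    also have "\<dots> = chain_euler prec (set (y # ys))"
      unfolding A[OF inv] using chain_euler_insert[of "set ys" y] s by simp
    finally show "(\<Sum>I\<in>scans prec (y # ys). (- 1) ^ (card I + length (y # ys))) = chain_euler prec (set (y # ys))" .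
  next
    fix p Z assume inv: "scan_inv p Z (y # ys)"
    note i = scan_inv_Cons[OF inv]
    have yl: "\<And>x. x \<in> set ys \<Longrightarrow> y < x" using inv by (simp add: scan_inv_def)
    let ?w = "\<lambda>I. (- 1) ^ (card I + card Z + length (y # ys)) :: int"
    let ?S1 = "scan prec p (insert y Z) ys" and ?T = "scans prec ys \<union> scan prec y {} ys"
    have "card (insert y Z) = Suc (card Z)" using i(6) by (subst card_insert_disjoint) auto
    then have s1: "sum ?w ?S1 = chain_euler_above prec p (set ys) - chain_euler prec (set ys)"
      using A[OF i(1)] by simp
    have rhs: "chain_euler_above prec p (set (y # ys)) - chain_euler prec (set (y # ys)) =
        chain_euler_above prec p (set ys) - chain_euler prec (set ys) +
        (if prec p y then 0 else chain_euler_above prec y (set ys))"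
      using chain_euler_insert[OF yl] chain_euler_above_insert[OF yl, where p = p] by simp
    show "sum ?w (scan prec p Z (y # ys)) = chain_euler_above prec p (set (y # ys)) - chain_euler prec (set (y # ys))"
    proof (cases "prec p y")
      case True
      then show ?thesis unfolding rhs using s1 by simp
    next
      case False
      let ?G = "gap_edges prec p y Z"
      note gp = gap_edges_props[OF i(4) False i(8)]
      have TJ: "J \<subseteq> mingens prec" "support J \<subseteq> insert y (set ys)" if J: "J \<in> ?T" for J
        using J scan_props1[OF i(2), of J] scans_props1[OF i(3), of J] by auto
      have dis: "?G \<inter> J = {}" if J: "J \<in> ?T" for J
      proof -
        have False if e: "e \<in> ?G" "e \<in> J" for e
        proof -
          obtain x where x: "x \<in> insert p Z" "x \<in> ks e" using gp(4)[OF e(1)] by blast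
          have "x \<in> support J" using x(2) e(2) support_eq[OF finite_edges[OF TJ(1)[OF J]]] by blast
          then show False using TJ(2)[OF J] x(1) i(5,6) by auto
        qed
        then show ?thesis by blast
      qed
      have inj: "inj_on (\<lambda>J. ?G \<union> J) ?T"
      proof (rule inj_onI)
        fix J J' assume J: "J \<in> ?T" "J' \<in> ?T" "?G \<union> J = ?G \<union> J'"
        then show "J = J'" using dis[OF J(1)] dis[OF J(2)] by blast
      qed
      \<comment> \<open>Sets of the first kind join p to a vertex beyond y, whereas in the others
        all edges from p to larger vertices end at y or before.\<close>
      have disj: "?S1 \<inter> (\<lambda>J. ?G \<union> J) ` ?T = {}"
      proof -
        have False if I: "I \<in> ?S1" "J \<in> ?T" "I = ?G \<union> J" for I J
        proof -
          obtain q where q: "q \<in> set ys" "edge_monom p q \<in> I" using scan_props1(4)[OF i(1) I(1)] by blast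
          have "edge_monom p q \<in> ?G \<or> edge_monom p q \<in> J" using q(2) I(3) by simp
          then show False
          proof
            assume "edge_monom p q \<in> ?G"
            then have "q \<le> y" using gp(5)[of q] i(5) q(1) inv by (auto simp: scan_inv_def)
            then show False using yl[OF q(1)] by simp
          next
            assume "edge_monom p q \<in> J"
            then have "ks (edge_monom p q) \<subseteq> support J" using support_eq[OF finite_edges[OF TJ(1)[OF I(2)]]] by blast
            then have "p \<in> support J" by simp
            then show False using TJ(2)[OF I(2)] i(5) by auto
          qed
        qed
        then show ?thesis by blast
      qed
      have disT: "scans prec ys \<inter> scan prec y {} ys = {}"
        using scan_props1(2)[OF i(2)] scans_props1(2)[OF i(3)] i(9) by fastforce
      have fin: "finite ?S1" "finite (scans prec ys)" "finite (scan prec y {} ys)"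
        using finite_scan i by blast+
      have sg: "?w (?G \<union> J) = (- 1) ^ (card J + length ys)" if J: "J \<in> ?T" for J
      proof -
        have "card (?G \<union> J) = Suc (card Z) + card J"
          using card_Un_disjoint[OF finite_edges[OF gp(1)] finite_edges[OF TJ(1)[OF J]] dis[OF J]] gp(3) by simp
        \<comment> \<open>The gap contributes |Z| + 1 edges, so the sign depends on J and ys
          alone.\<close>
        then have "card (?G \<union> J) + card Z + length (y # ys) = 2 * (card Z + 1) + (card J + length ys)" by simp
        then show ?thesis by (simp only: power_add power_mult) simp
      qed
      have "sum ?w (scan prec p Z (y # ys)) = sum ?w ?S1 + sum ?w ((\<lambda>J. ?G \<union> J) ` ?T)"
        using False fin disj by (simp add: sum.union_disjoint)
      also have "sum ?w ((\<lambda>J. ?G \<union> J) ` ?T) = (\<Sum>J\<in>?T. (- 1) ^ (card J + length ys))"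
        using sg by (subst sum.reindex[OF inj]) (auto intro!: sum.cong)
      also have "\<dots> = (\<Sum>J\<in>scans prec ys. (- 1) ^ (card J + length ys)) + (\<Sum>J\<in>scan prec y {} ys. (- 1) ^ (card J + length ys))"
        using fin disT by (intro sum.union_disjoint) auto
      also have "\<dots> = chain_euler_above prec y (set ys)" using B[OF i(3)] A[OF i(2)] by simp
      finally show ?thesis unfolding rhs s1 using False by simp
    qed
  qed
qed

section \<open>Sting-chains as sets determined by their path\<close>

lemma sting_of_path_props:
  assumes "sorted_wrt (<) c" "successively (\<lambda>a b. \<not> prec a b) c"
  shows "sting_of_path prec V c \<subseteq> mingens prec"
    "2 \<le> length c \<Longrightarrow> set c \<subseteq> V \<Longrightarrow> support (sting_of_path prec V c) = {s \<in> V. hd c \<le> s \<and> s \<le> last c}"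
proof -
  have "sting_of_path prec V c \<subseteq> mingens prec \<and>
    (2 \<le> length c \<longrightarrow> set c \<subseteq> V \<longrightarrow> support (sting_of_path prec V c) = {s \<in> V. hd c \<le> s \<and> s \<le> last c})"
    using assms
  proof (induction c rule: sting_of_path.induct[of _ undefined undefined])
    case (1 _ _ p q c)
    have pq: "p < q" "\<not> prec p q" "\<forall>s\<in>{s \<in> V. p < s \<and> s < q}. p < s \<and> s < q" using 1 by auto
    note gp = gap_edges_props[OF pq]
    have IH: "sting_of_path prec V (q # c) \<subseteq> mingens prec"
      "2 \<le> length (q # c) \<Longrightarrow> set (q # c) \<subseteq> V \<Longrightarrow> support (sting_of_path prec V (q # c)) = {s \<in> V. q \<le> s \<and> s \<le> last (q # c)}"
      using 1 by auto
    have "support (sting_of_path prec V (p # q # c)) = {s \<in> V. p \<le> s \<and> s \<le> last (q # c)}" if V: "set (p # q # c) \<subseteq> V"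
    proof -
      have s: "support (sting_of_path prec V (p # q # c)) = insert p (insert q {s \<in> V. p < s \<and> s < q}) \<union> support (sting_of_path prec V (q # c))"
        using gp(2) support_Un[OF finite_edges[OF gp(1)] finite_edges[OF IH(1)]] by simp
      have last: "q \<le> last (q # c)" using 1(2) last_in_set[of "q # c"] by (auto simp: order_less_imp_le)
      show ?thesis
      proof (cases "c = []")
        case True
        then have "support (sting_of_path prec V (q # c)) = {}" using support_eq[of "{} :: 'n monom set"] by simp
        then show ?thesis unfolding s using True V pq(1) by (auto simp: order.order_iff_strict)
      next
        case False
        then have "2 \<le> length (q # c)" by (cases c) auto
        then show ?thesis unfolding s using IH(2) V pq(1) last by auto
      qed
    qed
    then show ?case using gp(1) IH(1) by simp
  qed auto
  then show "sting_of_path prec V c \<subseteq> mingens prec"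
    "2 \<le> length c \<Longrightarrow> set c \<subseteq> V \<Longrightarrow> support (sting_of_path prec V c) = {s \<in> V. hd c \<le> s \<and> s \<le> last c}" by blast+
qed

lemma edge_monom_eqD: "edge_monom i j = edge_monom r s \<Longrightarrow> i < j \<Longrightarrow> r < s \<Longrightarrow> i = r \<and> j = s"
  for i j r s :: 'n
proof -
  assume h: "edge_monom i j = edge_monom r s" "i < j" "r < s"
  have "{i, j} = {r, s}" using arg_cong[OF h(1), of ks] by simp
  then show ?thesis using h(2,3) by (metis doubleton_eq_iff order.asym)
qed

lemma gap_edgesE:
  assumes "e \<in> gap_edges prec p q {s \<in> V. p < s \<and> s < q}"
  obtains "e = edge_monom p q" | s where "s \<in> V" "p < s" "s < q" "prec p s" "e = edge_monom s q"
    | s where "s \<in> V" "p < s" "s < q" "\<not> prec p s" "e = edge_monom p s"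
  using assms by (auto simp: gap_edges_def split: if_splits)

text \<open>Every passed vertex is covered by some edge, and the conditions leave a single candidate
  for it; hence path and support determine I.\<close>

lemma sting_stcD:
  assumes "sting_chain prec I"
  shows "\<exists>c. 2 \<le> length c \<and> sorted_wrt (<) c \<and> successively (\<lambda>a b. \<not> prec a b) c \<and> set c \<subseteq> support I \<and>
    hd c = Min (support I) \<and> last c = Max (support I) \<and> I = sting_of_path prec (support I) c"
proof -
  have I: "I \<subseteq> mingens prec" using assms by (simp add: sting_chain_def)
  let ?V = "support I"
  obtain c where c: "2 \<le> length c" "sorted_wrt (<) c"
    "\<And>j. Suc j < length c \<Longrightarrow> edge_monom (c ! j) (c ! Suc j) \<in> I"
    "hd c = Min ?V" "last c = Max ?V"
    and edge: "\<And>r s. r < s \<Longrightarrow> edge_monom r s \<in> I \<Longrightarrow> \<exists>j. Suc j < length c \<and>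
              (edge_monom r s = edge_monom (c ! j) (c ! Suc j) \<or>
               r = c ! j \<and> s < c ! Suc j \<and> edge_monom s (c ! Suc j) \<notin> I \<or>
               r > c ! j \<and> s = c ! Suc j \<and> prec (c ! j) r)"
    using assms unfolding sting_chain_def by blast
  have sup: "?V = \<Union>(ks ` I)" by (rule support_eq[OF finite_edges[OF I]])
  have less: "c ! j < c ! Suc j" if "Suc j < length c" for j
    using c(2) that by (intro sorted_wrt_nth_less) auto
  have suc: "successively (\<lambda>a b. \<not> prec a b) c" unfolding successively_conv_nth
  proof (intro allI impI)
    fix j assume j: "Suc j < length c"
    show "\<not> prec (c ! j) (c ! Suc j)"
      using subsetD[OF I c(3)[OF j]] edge_in_mingens[OF less[OF j], of prec] by blast
  qed
  have cV: "set c \<subseteq> ?V"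
  proof
    fix x assume "x \<in> set c"
    then obtain j where j: "j < length c" "x = c ! j" by (auto simp: in_set_conv_nth)
    have "\<exists>i. Suc i < length c \<and> x \<in> {c ! i, c ! Suc i}"
    proof (cases j)
      case 0
      then show ?thesis using j c(1) by (intro exI[of _ 0]) auto
    next
      case (Suc i)
      then show ?thesis using j by (intro exI[of _ i]) auto
    qed
    then obtain i where i: "Suc i < length c" "x \<in> ks (edge_monom (c ! i) (c ! Suc i))" by auto
    then show "x \<in> ?V" unfolding sup using c(3)[OF i(1)] by blast
  qed
  have "I = sting_of_path prec ?V c"
  proof
    show "I \<subseteq> sting_of_path prec ?V c"
    proof
      fix e assume e: "e \<in> I"
      then obtain r s where rs: "r < s" "\<not> prec r s" "e = edge_monom r s"
        using I unfolding mingens_def by blast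
      have V: "r \<in> ?V" "s \<in> ?V" unfolding sup using e rs(3) by force+
      obtain j where j: "Suc j < length c"
          "e = edge_monom (c ! j) (c ! Suc j) \<or> r = c ! j \<and> s < c ! Suc j \<or> r > c ! j \<and> s = c ! Suc j \<and> prec (c ! j) r"
        using edge[OF rs(1)] e unfolding rs(3) by blast
      have "e \<in> gap_edges prec (c ! j) (c ! Suc j) {s \<in> ?V. c ! j < s \<and> s < c ! Suc j}"
        using j(2)
      proof (elim disjE conjE)
        assume h: "r = c ! j" "s < c ! Suc j"
        then show ?thesis using rs V unfolding gap_edges_def by (intro insertI2 image_eqI[of _ _ s]) auto
      next
        assume h: "c ! j < r" "s = c ! Suc j" "prec (c ! j) r"
        then show ?thesis using rs V unfolding gap_edges_def by (intro insertI2 image_eqI[of _ _ r]) auto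
      qed (simp add: gap_edges_def)
      then show "e \<in> sting_of_path prec ?V c" using j(1) unfolding sting_of_path_iff by blast
    qed
    show "sting_of_path prec ?V c \<subseteq> I"
    proof
      fix e assume "e \<in> sting_of_path prec ?V c"
      then obtain j where j: "Suc j < length c"
          "e \<in> gap_edges prec (c ! j) (c ! Suc j) {s \<in> ?V. c ! j < s \<and> s < c ! Suc j}"
        unfolding sting_of_path_iff by blast
      \<comment> \<open>As s is not a chain vertex, an edge at s belongs to the unique gap
        containing s and ends at one of the two chain vertices of that gap.\<close>
      have key: "edge_monom s (c ! Suc j) \<in> I \<and> prec (c ! j) s \<or> edge_monom (c ! j) s \<in> I \<and> \<not> prec (c ! j) s"
        if s: "s \<in> ?V" "c ! j < s" "s < c ! Suc j" for s
      proof -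
        obtain e' where e': "e' \<in> I" "s \<in> ks e'" using s(1) unfolding sup by blast
        then obtain r t where rt: "r < t" "\<not> prec r t" "e' = edge_monom r t"
          using I unfolding mingens_def by blast
        have srt: "s = r \<or> s = t" using e'(2) rt(3) by simp
        have ns: "s \<notin> set c" using gap_unique(1)[OF c(2) j(1) s(2,3)] .
        obtain i where i: "Suc i < length c"
            "e' = edge_monom (c ! i) (c ! Suc i) \<or> r = c ! i \<and> t < c ! Suc i \<or> r > c ! i \<and> t = c ! Suc i \<and> prec (c ! i) r"
          using edge[OF rt(1)] e'(1) unfolding rt(3) by blast
        have ci: "c ! i \<in> set c" "c ! Suc i \<in> set c" using i(1) by auto
        show ?thesis using i(2)
        proof (elim disjE conjE)
          assume "e' = edge_monom (c ! i) (c ! Suc i)"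
          then show ?thesis using e'(2) ci ns by auto
        next
          assume h: "r = c ! i" "t < c ! Suc i"
          then have "s = t" using srt ns ci by auto
          moreover have "i = j" using gap_unique(2)[OF c(2) j(1) s(2,3) i(1)] h rt(1) \<open>s = t\<close> by simp
          ultimately show ?thesis using e'(1) rt h by simp
        next
          assume h: "c ! i < r" "t = c ! Suc i" "prec (c ! i) r"
          then have "s = r" using srt ns ci by auto
          moreover have "i = j" using gap_unique(2)[OF c(2) j(1) s(2,3) i(1)] h rt(1) \<open>s = r\<close> by simp
          ultimately show ?thesis using e'(1) rt h by simp
        qed
      qed
      show "e \<in> I" using j(2)
      proof (cases rule: gap_edgesE)
        case 1
        then show ?thesis using c(3)[OF j(1)] by simp
      next
        case (2 s)
        then show ?thesis using key[of s] by blast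
      next
        case (3 s)
        then show ?thesis using key[of s] by blast
      qed
    qed
  qed
  then show ?thesis using c suc cV by blast
qed

lemma sting_stcI:
  assumes c: "2 \<le> length c" "sorted_wrt (<) c" "successively (\<lambda>a b. \<not> prec a b) c"
    and V: "set c \<subseteq> V" "\<And>v. v \<in> V \<Longrightarrow> hd c \<le> v \<and> v \<le> last c"
  shows "sting_chain prec (sting_of_path prec V c)" "support (sting_of_path prec V c) = V"
proof -
  let ?I = "sting_of_path prec V c"
  show sup: "support ?I = V" using sting_of_path_props(2)[OF c(2,3) c(1) V(1)] V(2) by blast
  have hl: "hd c \<in> V" "last c \<in> V" using V(1) c(1) by (auto intro!: subsetD[OF V(1)] hd_in_set last_in_set)
  have less: "c ! j < c ! Suc j" if "Suc j < length c" for j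
    using c(2) that by (intro sorted_wrt_nth_less) auto
  have mm: "hd c = Min V" "last c = Max V"
    using hl V(2) by (auto intro!: Min_eqI[symmetric] Max_eqI[symmetric])
  have edge: "\<exists>j. Suc j < length c \<and>
              (edge_monom r s = edge_monom (c ! j) (c ! Suc j) \<or>
               r = c ! j \<and> s < c ! Suc j \<and> edge_monom s (c ! Suc j) \<notin> ?I \<or>
               r > c ! j \<and> s = c ! Suc j \<and> prec (c ! j) r)" if rs: "r < s" "edge_monom r s \<in> ?I" for r s
  proof -
    obtain j where j: "Suc j < length c"
        "edge_monom r s \<in> gap_edges prec (c ! j) (c ! Suc j) {s \<in> V. c ! j < s \<and> s < c ! Suc j}"
      using rs(2) unfolding sting_of_path_iff by blast
    show ?thesis using j(2)
    proof (cases rule: gap_edgesE)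
      case 1
      then show ?thesis using j(1) by blast
    next
      case (2 x)
      then show ?thesis using j(1) edge_monom_eqD[OF 2(5) rs(1) 2(3)] by blast
    next
      case (3 x)
      then have x: "r = c ! j" "s = x" using edge_monom_eqD[OF 3(5) rs(1) 3(2)] by auto
      \<comment> \<open>Such an edge could only come from the same gap, which would put x above the
        chain vertex it is attached to.\<close>
      have "edge_monom x (c ! Suc j) \<notin> ?I"
      proof
        assume "edge_monom x (c ! Suc j) \<in> ?I"
        then obtain i where i: "Suc i < length c"
            "edge_monom x (c ! Suc j) \<in> gap_edges prec (c ! i) (c ! Suc i) {s \<in> V. c ! i < s \<and> s < c ! Suc i}"
          unfolding sting_of_path_iff by blast
        have nx: "x \<notin> set c" using gap_unique(1)[OF c(2) j(1) 3(2,3)] .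
        have ci: "c ! i \<in> set c" "c ! Suc i \<in> set c" using i(1) by auto
        show False using i(2)
        proof (cases rule: gap_edgesE)
          case 1
          then show False using edge_monom_eqD[OF 1 3(3) less[OF i(1)]] ci nx by auto
        next
          case (2 y)
          then have y: "x = y" "c ! Suc j = c ! Suc i" using edge_monom_eqD[OF 2(5) 3(3) 2(3)] by auto
          then have "i = j" using gap_unique(2)[OF c(2) j(1) 3(2,3) i(1)] 2 by simp
          then show False using 2(4) 3(4) y(1) by simp
        next
          case (3 y)
          then show False using edge_monom_eqD[OF 3(5) \<open>x < c ! Suc j\<close> 3(2)] ci nx by auto
        qed
      qed
      then show ?thesis using x 3 j(1) by blast
    qed
  qed
  have ce: "edge_monom (c ! j) (c ! Suc j) \<in> ?I" if "Suc j < length c" for j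
    unfolding sting_of_path_iff using that by (auto simp: gap_edges_def)
  show "sting_chain prec ?I" unfolding sting_chain_def sup
    using sting_of_path_props(1)[OF c(2,3)] c(1,2) mm ce edge by blast
qed

text \<open>The list us runs through the remaining vertices of the current sting-chain, c through
  those of them that are chain vertices; the last vertex must be one.\<close>

definition chain_in :: "'n \<Rightarrow> 'n list \<Rightarrow> 'n list \<Rightarrow> bool" where
  "chain_in p us c \<longleftrightarrow> c \<noteq> [] \<and> set c \<subseteq> set us \<and> sorted_wrt (<) (p # c) \<and> last c = last us \<and>
     successively (\<lambda>a b. \<not> prec a b) (p # c)"

text \<open>The sting-chain under construction consumes an initial part us of the list, and J is the
  union of the later members. The branches of \<open>scan\<close> correspond to whether y is the
  next chain vertex.\<close>

lemma scan_iff: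
  "scan_inv p Z ys \<Longrightarrow> I \<in> scan prec p Z ys \<longleftrightarrow> (\<exists>us vs c J. ys = us @ vs \<and> chain_in p us c \<and> J \<in> scans prec vs \<and>
      I = sting_of_path prec (insert p (Z \<union> set us)) (p # c) \<union> J)"
proof (induction ys arbitrary: p Z I)
  case Nil
  then show ?case by (auto simp: chain_in_def)
next
  case (Cons y ys)
  note i = scan_inv_Cons[OF Cons.prems]
  have yl: "y < x" if "x \<in> set ys" for x using i(2) that by (simp add: scan_inv_def)
  have gap: "sting_of_path prec (insert p (Z \<union> set (y # us))) (p # y # c) =
      gap_edges prec p y Z \<union> sting_of_path prec (insert y (set us)) (y # c)" if us: "set us \<subseteq> set ys" "sorted_wrt (<) (y # c)" for us c
  proof -
    have "{s \<in> insert p (Z \<union> set (y # us)). p < s \<and> s < y} = Z"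
      using i(8) us yl by (auto dest: less_asym)
    moreover have "sting_of_path prec (insert p (Z \<union> set (y # us))) (y # c) = sting_of_path prec (insert y (set us)) (y # c)"
      using i(4,8) us(2) by (intro sting_of_path_cong) auto
    ultimately show ?thesis by simp
  qed
  show ?case (is "?L \<longleftrightarrow> ?R")
  proof
    assume ?L
    then consider "I \<in> scan prec p (insert y Z) ys"
      | J where "\<not> prec p y" "J \<in> scans prec ys" "I = gap_edges prec p y Z \<union> J"
      | J where "\<not> prec p y" "J \<in> scan prec y {} ys" "I = gap_edges prec p y Z \<union> J"
      by (auto split: if_splits)
    then show ?R
    proof cases
      case 1
      then obtain us vs c J where h: "ys = us @ vs" "chain_in p us c" "J \<in> scans prec vs"
          "I = sting_of_path prec (insert p (insert y Z \<union> set us)) (p # c) \<union> J"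
        unfolding Cons.IH[OF i(1)] by blast
      have "us \<noteq> []" using h(2) by (auto simp: chain_in_def)
      then have "chain_in p (y # us) c" using h(2) by (auto simp: chain_in_def)
      then show ?thesis using h(1,3,4)
        by (intro exI[of _ "y # us"] exI[of _ vs] exI[of _ c] exI[of _ J]) simp
    next
      case (2 J)
      have "chain_in p [y] [y]" using 2(1) i(4) by (simp add: chain_in_def)
      then show ?thesis using 2(2,3) gap[of "[]" "[]"]
        by (intro exI[of _ "[y]"] exI[of _ ys] exI[of _ "[y]"] exI[of _ J]) simp
    next
      case (3 J)
      then obtain us vs c J' where h: "ys = us @ vs" "chain_in y us c" "J' \<in> scans prec vs"
          "J = sting_of_path prec (insert y ({} \<union> set us)) (y # c) \<union> J'"
        unfolding Cons.IH[OF i(2)] by blast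
      have "us \<noteq> []" using h(2) by (auto simp: chain_in_def)
      then have c: "chain_in p (y # us) (y # c)" using h(2) 3(1) i(4)
        by (cases c) (auto simp: chain_in_def)
      have "I = sting_of_path prec (insert p (Z \<union> set (y # us))) (p # y # c) \<union> J'"
        unfolding 3(3) h(4) using gap[of us c] h(1,2) by (auto simp: chain_in_def)
      then show ?thesis using h(1,3) c
        by (intro exI[of _ "y # us"] exI[of _ vs] exI[of _ "y # c"] exI[of _ J']) simp
    qed
  next
    assume ?R
    then obtain us' vs c J where h: "y # ys = us' @ vs" "chain_in p us' c" "J \<in> scans prec vs"
        "I = sting_of_path prec (insert p (Z \<union> set us')) (p # c) \<union> J" by blast
    have "us' \<noteq> []" using h(2) by (auto simp: chain_in_def)
    then obtain us where us: "us' = y # us" "ys = us @ vs" using h(1) by (cases us') auto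
    obtain q c' where c: "c = q # c'" using h(2) by (cases c) (auto simp: chain_in_def)
    show ?L
    proof (cases "q = y")
      case True
      have np: "\<not> prec p y" using h(2) c True by (simp add: chain_in_def)
      have g: "I = gap_edges prec p y Z \<union> (sting_of_path prec (insert y (set us)) (y # c') \<union> J)"
        using h(2,4) gap[of us c'] us unfolding c True by (auto simp: chain_in_def)
      show ?thesis
      proof (cases "c' = []")
        case True
        have "last us' = y" using True h(2) c \<open>q = y\<close> by (simp add: chain_in_def)
        have "us = []"
        proof (rule ccontr)
          assume "us \<noteq> []"
          then show False using us yl[of "last us"] \<open>last us' = y\<close> by simp
        qed
        then show ?thesis using g np True us h(3) by auto
      next
        case False
        have "us \<noteq> []"
        proof
          assume "us = []"
          then have "set c' \<subseteq> {y}" "\<forall>x\<in>set c'. y < x" using h(2) c True us by (auto simp: chain_in_def)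
          then show False using False by (cases c') auto
        qed
        then have "chain_in y us c'" using h(2) False us unfolding c True by (auto simp: chain_in_def successively_Cons)
        then have "sting_of_path prec (insert y ({} \<union> set us)) (y # c') \<union> J \<in> scan prec y {} ys"
          unfolding Cons.IH[OF i(2)] using us h(3) by blast
        then show ?thesis using g np by simp
      qed
    next
      case False
      then have "q \<in> set us" using h(2) c us by (auto simp: chain_in_def)
      then have "y < q" using yl us by simp
      then have "y \<notin> set c" using h(2) c by (auto simp: chain_in_def)
      then have "chain_in p us c" using h(2) us \<open>q \<in> set us\<close> by (auto simp: chain_in_def split: if_splits)
      then have "I \<in> scan prec p (insert y Z) ys"
        unfolding Cons.IH[OF i(1)] using us h(3,4) by auto
      then show ?thesis by simp
    qed
  qed
qed

text \<open>Peels off the first member of a tuple; as nothing has been passed before y, the vertices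
  consumed are exactly its support.\<close>

lemma scans_Cons_iff:
  assumes s: "sorted_wrt (<) (y # ys)"
  shows "I \<in> scans prec (y # ys) \<longleftrightarrow> (\<exists>us vs I' J. ys = us @ vs \<and> sting_chain prec I' \<and> support I' = set (y # us) \<and>
      J \<in> scans prec vs \<and> I = I' \<union> J)"
proof -
  have inv: "scan_inv y {} ys" using s by (simp add: scan_inv_def)
  have *: "(\<exists>c. chain_in y us c \<and> I' = sting_of_path prec (set (y # us)) (y # c)) \<longleftrightarrow>
      sting_chain prec I' \<and> support I' = set (y # us)" if us: "ys = us @ vs" for us vs I'
  proof -
    have sus: "sorted_wrt (<) (y # us)" using s us by (simp add: sorted_wrt_append)
    have le: "y \<le> v \<and> v \<le> last (y # us)" if "v \<in> set (y # us)" for v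
    proof -
      have "sorted (y # us)" using sus by (rule strict_sorted_imp_sorted)
      moreover obtain i where "i < length (y # us)" "v = (y # us) ! i"
        using \<open>v \<in> set (y # us)\<close> by (metis in_set_conv_nth)
      ultimately have "v \<le> last (y # us)"
        using sorted_nth_mono[of "y # us" i "length us"] last_conv_nth[of "y # us"] by simp
      then show ?thesis using that sus by auto
    qed
    show ?thesis
    proof
      assume "\<exists>c. chain_in y us c \<and> I' = sting_of_path prec (set (y # us)) (y # c)"
      then obtain c where c: "chain_in y us c" "I' = sting_of_path prec (set (y # us)) (y # c)" by blast
      have "us \<noteq> []" using c(1) by (auto simp: chain_in_def)
      then have "last (y # c) = last (y # us)" using c(1) by (simp add: chain_in_def)
      then show "sting_chain prec I' \<and> support I' = set (y # us)"
        using sting_stcI[of "y # c" "set (y # us)"] c le by (auto simp: chain_in_def Suc_le_eq)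
    next
      assume h: "sting_chain prec I' \<and> support I' = set (y # us)"
      then obtain c where c: "2 \<le> length c" "sorted_wrt (<) c" "successively (\<lambda>a b. \<not> prec a b) c"
          "set c \<subseteq> set (y # us)" "hd c = Min (set (y # us))" "last c = Max (set (y # us))"
          "I' = sting_of_path prec (set (y # us)) c" using sting_stcD[of I'] by auto
      have m: "hd c = y" "last c = last (y # us)"
      proof -
        show "hd c = y" unfolding c(5) by (rule Min_eqI) (use le in \<open>auto simp del: last.simps\<close>)
        show "last c = last (y # us)" unfolding c(6)
        proof (rule Max_eqI)
          show "v \<le> last (y # us)" if "v \<in> set (y # us)" for v using le that by blast
          show "last (y # us) \<in> set (y # us)" by (rule last_in_set) simp
        qed simp
      qed
      obtain c' where "c = y # c'" using c(1) m(1) by (cases c) auto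
      then have c': "c = y # c'" "c' \<noteq> []" using c(1) by auto
      have "set c' \<subseteq> set us" using c(2,4) unfolding c' by auto
      moreover have "us \<noteq> []" using calculation c'(2) by auto
      ultimately have "chain_in y us c'" using c(2,3) m(2) c' by (simp add: chain_in_def)
      then show "\<exists>c. chain_in y us c \<and> I' = sting_of_path prec (set (y # us)) (y # c)" using c(7) c'(1) by blast
    qed
  qed
  have "I \<in> scans prec (y # ys) \<longleftrightarrow> (\<exists>us vs I' J. ys = us @ vs \<and>
      (\<exists>c. chain_in y us c \<and> I' = sting_of_path prec (set (y # us)) (y # c)) \<and> J \<in> scans prec vs \<and> I = I' \<union> J)"
    using scan_iff[OF inv, of I] by auto
  also have "\<dots> \<longleftrightarrow> (\<exists>us vs I' J. ys = us @ vs \<and> sting_chain prec I' \<and> support I' = set (y # us) \<and>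
      J \<in> scans prec vs \<and> I = I' \<union> J)"
    using * by (metis (no_types, lifting))
  finally show ?thesis .
qed

lemma sting_chain_support: "sting_chain prec I \<Longrightarrow> I \<subseteq> mingens prec \<and> support I \<noteq> {}"
proof -
  assume s: "sting_chain prec I"
  then have "I \<subseteq> mingens prec" by (simp add: sting_chain_def)
  moreover obtain c where "2 \<le> length c" "set c \<subseteq> support I" using sting_stcD[OF s] by blast
  ultimately show ?thesis by (cases c) auto
qed

definition sting_tuple :: "'n monom set list \<Rightarrow> bool" where
  "sting_tuple Is \<longleftrightarrow> (\<forall>I\<in>set Is. sting_chain prec I) \<and>
     successively (\<lambda>I J. Max (support I) < Min (support J)) Is"

lemma sting_tuple_Union:
  assumes "sting_tuple Is"
  shows "\<Union>(set Is) \<subseteq> mingens prec" "support (\<Union>(set Is)) = (\<Union>I\<in>set Is. support I)"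
proof -
  have I: "I \<subseteq> mingens prec" if "I \<in> set Is" for I
    using assms that sting_chain_support by (auto simp: sting_tuple_def)
  then show sub: "\<Union>(set Is) \<subseteq> mingens prec" by blast
  have "support I = \<Union>(ks ` I)" if "I \<in> set Is" for I using support_eq finite_edges[OF I[OF that]] by blast
  then show "support (\<Union>(set Is)) = (\<Union>I\<in>set Is. support I)"
    unfolding support_eq[OF finite_edges[OF sub]] by auto
qed

lemma sting_tuple_less:
  "sting_tuple (I # Is) \<Longrightarrow> J \<in> set Is \<Longrightarrow> x \<in> support I \<Longrightarrow> y \<in> support J \<Longrightarrow> x < y"
proof (induction Is arbitrary: I x)
  case (Cons K Is)
  have K: "support K \<noteq> {}" using Cons.prems(1) sting_chain_support by (simp add: sting_tuple_def)
  have less: "x < z" if "z \<in> support K" for z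
  proof -
    have "x \<le> Max (support I)" "Min (support K) \<le> z" using Cons.prems(3) that by auto
    then show ?thesis using Cons.prems(1) by (auto simp: sting_tuple_def)
  qed
  show ?case
  proof (cases "J = K")
    case True
    then show ?thesis using less Cons.prems(4) by simp
  next
    case False
    obtain z where z: "z \<in> support K" using K by blast
    have "z < y" using Cons.IH[of K z] Cons.prems z False by (auto simp: sting_tuple_def)
    then show ?thesis using less[OF z] by simp
  qed
qed simp

text \<open>Later supports lie beyond earlier ones, so the sorted support of the union is a
  concatenation and the first member can be peeled off.\<close>

lemma sting_tuple_scans: "sting_tuple Is \<Longrightarrow> \<Union>(set Is) \<in> scans prec (sorted_list_of_set (support (\<Union>(set Is))))"
proof (induction Is)
  case Nil
  have "support ({} :: 'n monom set) = {}" using support_eq[of "{} :: 'n monom set"] by simp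
  then show ?case by simp
next
  case (Cons I Is)
  let ?U = "\<Union>(set Is)"
  have Is: "sting_tuple Is" using Cons.prems by (cases Is) (auto simp: sting_tuple_def)
  have I: "sting_chain prec I" "support I \<noteq> {}"
    using Cons.prems sting_chain_support by (auto simp: sting_tuple_def)
  have sup: "support (I \<union> ?U) = support I \<union> support ?U"
    using sting_tuple_Union(2)[OF Cons.prems] sting_tuple_Union(2)[OF Is] by simp
  have less: "x < y" if "x \<in> support I" "y \<in> support ?U" for x y
    using that sting_tuple_Union(2)[OF Is] sting_tuple_less[OF Cons.prems] by blast
  let ?l = "sorted_list_of_set"
  have "support I \<inter> support ?U = {}" using less by blast
  then have split: "?l (support (I \<union> ?U)) = ?l (support I) @ ?l (support ?U)"
    using less by (intro sorted_list_of_set_unique[THEN iffD1]) (auto simp: sup sorted_wrt_append card_Un_disjoint)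
  obtain y us where us: "?l (support I) = y # us"
    using I(2) by (metis finite list.exhaust sorted_list_of_set_eq_Nil_iff)
  have "set (y # us) = support I" using us by (metis finite set_sorted_list_of_set)
  moreover have "sorted_wrt (<) (y # us @ ?l (support ?U))"
    using strict_sorted_list_of_set[of "support (I \<union> ?U)"] unfolding split us by simp
  ultimately have "I \<union> ?U \<in> scans prec (y # us @ ?l (support ?U))"
    using scans_Cons_iff I(1) Cons.IH[OF Is] by blast
  then show ?case unfolding split[unfolded us] by (simp add: split us)
qed

lemma scans_sting_tuple:
  "sorted_wrt (<) ys \<Longrightarrow> I \<in> scans prec ys \<Longrightarrow> \<exists>Is. sting_tuple Is \<and> I = \<Union>(set Is)"
proof (induction ys arbitrary: I rule: length_induct)
  case (1 ys)
  show ?case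
  proof (cases ys)
    case Nil
    then show ?thesis using 1 by (intro exI[of _ "[]"]) (simp add: sting_tuple_def)
  next
    case (Cons y zs)
    obtain us vs I' J where h: "zs = us @ vs" "sting_chain prec I'" "support I' = set (y # us)"
        "J \<in> scans prec vs" "I = I' \<union> J"
      using 1(3) scans_Cons_iff[of y zs I] 1(2) unfolding Cons by blast
    have vs: "sorted_wrt (<) vs" "\<And>x z. x \<in> set (y # us) \<Longrightarrow> z \<in> set vs \<Longrightarrow> x < z"
      using 1(2) unfolding Cons h(1) by (auto simp: sorted_wrt_append)
    obtain Is where Is: "sting_tuple Is" "J = \<Union>(set Is)"
      using 1(1)[rule_format, OF _ vs(1) h(4)] Cons h(1) by auto
    have "Max (support I') < Min (support K)" if K: "K \<in> set Is" for K
    proof -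
      have "support K \<subseteq> set vs"
        using scans_props1(2)[OF vs(1) h(4)] sting_tuple_Union(2)[OF Is(1)] Is(2) K by auto
      moreover have "support K \<noteq> {}" using Is(1) K sting_chain_support by (auto simp: sting_tuple_def)
      ultimately have "Min (support K) \<in> set vs" using Min_in[OF finite, of "support K"] by blast
      moreover have "Max (support I') \<in> set (y # us)" unfolding h(3) by (rule Max_in) auto
      ultimately show ?thesis using vs(2) by blast
    qed
    then have "sting_tuple (I' # Is)" using Is(1) h(2) by (cases Is) (auto simp: sting_tuple_def)
    then show ?thesis using h(5) Is(2) by (intro exI[of _ "I' # Is"]) simp
  qed
qed

lemma sting_unions_eq:
  assumes "V \<noteq> {}"
  shows "{I \<in> sting_unions prec. support I = V} = scans prec (sorted_list_of_set V)"
proof (intro set_eqI iffI)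
  fix I assume "I \<in> {I \<in> sting_unions prec. support I = V}"
  then show "I \<in> scans prec (sorted_list_of_set V)"
    using sting_tuple_scans by (auto simp: sting_unions_def sting_tuple_def)
next
  fix I assume I: "I \<in> scans prec (sorted_list_of_set V)"
  have s: "sorted_wrt (<) (sorted_list_of_set V)" by simp
  have sup: "support I = V" using scans_props1(2)[OF s I] by simp
  obtain Is where Is: "sting_tuple Is" "I = \<Union>(set Is)" using scans_sting_tuple[OF s I] by blast
  have "Is \<noteq> []"
    using sting_tuple_Union(2)[OF Is(1)] sup assms Is(2) by auto
  then show "I \<in> {I \<in> sting_unions prec. support I = V}"
    using Is sup by (auto simp: sting_unions_def sting_tuple_def)
qed

lemma W_series_sting: "W_series (sting_unions prec) = chain_series prec"
proof (rule W_series_eq)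
  have sc: "I \<in> scans prec (sorted_list_of_set (support I)) \<and> support I \<noteq> {}" if "I \<in> sting_unions prec" for I
  proof -
    obtain Is where Is: "Is \<noteq> []" "sting_tuple Is" "I = \<Union>(set Is)"
      using \<open>I \<in> sting_unions prec\<close> by (auto simp: sting_unions_def sting_tuple_def)
    obtain J where "J \<in> set Is" using Is(1) by (cases Is) auto
    then have "support I \<noteq> {}"
      using Is sting_chain_support[of J] unfolding Is(3) sting_tuple_Union(2)[OF Is(2)] by (auto simp: sting_tuple_def)
    then show ?thesis using sting_tuple_scans[OF Is(2)] Is(3) by simp
  qed
  show "I \<noteq> {} \<and> I \<subseteq> mingens prec \<and> excess0 I" if I: "I \<in> sting_unions prec" for I
  proof -
    have "I \<noteq> {}" using sc[OF I] support_eq[of "{} :: 'n monom set"] by auto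
    then show ?thesis
      using scans_props1[OF _ conjunct1[OF sc[OF I]]] by simp
  qed
  fix V :: "'n set" assume V: "V \<noteq> {}"
  have s: "sorted_wrt (<) (sorted_list_of_set V)" by simp
  have "(\<Sum>I\<in>{I \<in> sting_unions prec. support I = V}. (- 1) ^ cl I :: int) =
      (\<Sum>I\<in>scans prec (sorted_list_of_set V). (- 1) ^ (card I + length (sorted_list_of_set V)))"
    unfolding sting_unions_eq[OF V]
  proof (rule sum.cong[OF refl])
    fix I assume "I \<in> scans prec (sorted_list_of_set V)"
    then have "excess0 I" "support I = V" using scans_props1[OF s] by simp_all
    \<comment> \<open>On forests cl(I) and |I| + |V| have the same parity.\<close>
    then have "card I + length (sorted_list_of_set V) = 2 * card I + cl I" by (simp add: excess0_def)
    then show "(- 1) ^ cl I = ((- 1) ^ (card I + length (sorted_list_of_set V)) :: int)"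
      by (simp only: power_add power_mult) simp
  qed
  also have "\<dots> = chain_euler prec V"
    using scan_sum[of "sorted_list_of_set V"] by simp
  finally show "(\<Sum>I\<in>{I \<in> sting_unions prec. support I = V}. (- 1) ^ cl I) = chain_euler prec V" .
qed

end

section \<open>The denominator of the Poincare series\<close>

text \<open>The part of degree \<alpha> in S is the line spanned by one monomial, which lies in the
  ideal iff it is not standard.\<close>

lemma hilb_dim_eq:
  fixes prec :: "'n::{finite,linorder} \<Rightarrow> 'n \<Rightarrow> bool"
  shows "hilb_dim TYPE('k::field) prec \<alpha> = (if std prec \<alpha> then 1 else 0)"
proof -
  let ?S = "{p :: ('n, 'k) mpoly. ks p \<subseteq> {\<alpha>}}"
  have sub: "pm.subspace (ideal_a prec \<inter> ?S)"
  proof (rule pm.subspaceI)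
    fix x y :: "('n, 'k) mpoly" and c :: 'k
    have 0: "ks (x + y) \<subseteq> ks x \<union> ks y" by (rule Poly_Mapping.keys_add)
    have 1: "ks (pscale c x) \<subseteq> ks x" by (auto simp: in_keys_iff lookup_pscale when_def split: if_splits)
    show "0 \<in> ideal_a prec \<inter> ?S" by (simp add: ideal_iff)
    show "x + y \<in> ideal_a prec \<inter> ?S" if "x \<in> ideal_a prec \<inter> ?S" "y \<in> ideal_a prec \<inter> ?S"
      using that 0 unfolding ideal_iff Int_iff by blast
    show "pscale c x \<in> ideal_a prec \<inter> ?S" if "x \<in> ideal_a prec \<inter> ?S"
      using that 1 unfolding ideal_iff Int_iff by blast
  qed
  have single: "p = pscale (lk p \<alpha>) (Poly_Mapping.single \<alpha> 1)" if "p \<in> ?S" for p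
  proof (rule poly_mapping_eqI)
    fix m
    have "m \<noteq> \<alpha> \<Longrightarrow> lk p m = 0" using that by (auto simp: in_keys_iff)
    then show "lk p m = lk (pscale (lk p \<alpha>) (Poly_Mapping.single \<alpha> 1)) m"
      by (cases "m = \<alpha>") (auto simp: lookup_pscale lookup_single)
  qed
  have "has_quot_dim ?S (ideal_a prec \<inter> ?S) (if std prec \<alpha> then 1 else 0)"
  proof (cases "std prec \<alpha>")
    case False
    then have "?S \<subseteq> ideal_a prec" by (auto simp: ideal_iff)
    then show ?thesis using False by (simp add: has_quot_dim_0_iff)
  next
    case True
    have "pscale c (Poly_Mapping.single \<alpha> 1) \<in> ideal_a prec \<longleftrightarrow> c = 0" for c :: 'k
    proof -
      have "ks (pscale c (Poly_Mapping.single \<alpha> 1)) = (if c = 0 then {} else {\<alpha>})"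
        by (auto simp: in_keys_iff lookup_pscale lookup_single when_def split: if_splits)
      then show ?thesis using True by (simp add: ideal_iff)
    qed
    moreover have "\<exists>c :: nat \<Rightarrow> 'k. v - pscale (c 0) (Poly_Mapping.single \<alpha> 1) \<in> ideal_a prec \<inter> ?S" if "v \<in> ?S" for v
    proof -
      have z: "v - pscale (lk v \<alpha>) (Poly_Mapping.single \<alpha> 1) = 0" using single[OF that] by simp
      have "v - pscale (lk v \<alpha>) (Poly_Mapping.single \<alpha> 1) \<in> ideal_a prec \<inter> ?S"
        unfolding z by (simp add: ideal_iff)
      then show ?thesis by (intro exI[of _ "\<lambda>_. lk v \<alpha>"])
    qed
    ultimately have "has_quot_dim ?S (ideal_a prec \<inter> ?S) 1"
      unfolding has_quot_dim_def by (intro exI[of _ "\<lambda>_. Poly_Mapping.single \<alpha> 1"]) simp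
    then show ?thesis using True by simp
  qed
  then have "quot_dim ?S (ideal_a prec \<inter> ?S) = (if std prec \<alpha> then 1 else 0)"
    by (rule quot_dim_eq[OF sub])
  then show ?thesis by (simp add: hilb_dim_def)
qed

lemma hilbert_series_eq: "hilbert_series TYPE('k::field) prec = hilb_in prec UNIV"
  unfolding hilbert_series_def hilb_in_def multigraded_fps_def hilb_dim_eq
  by (rule arg_cong[where f = Abs_fps]) (auto intro!: ext arg_cong[where f = Abs_poly_mapping])

lemma poincare_series_chain_series:
  fixes prec :: "'n::{finite,linorder} \<Rightarrow> 'n \<Rightarrow> bool"
  assumes lt: "\<And>i j. prec i j \<Longrightarrow> i < j"
  shows "poincare_series TYPE('k::field) prec * chain_series prec = (\<Prod>v\<in>UNIV. 1 + xt v)"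
proof -
  let ?F = "SOME F :: ('n monom list, 'n, 'k) gfree. graded_free_resolution prec F"
  interpret resolution prec ?F
    using someI_ex[OF ex_resolution] lt by unfold_locales
  \<comment> \<open>The series of Tor(A_W, k); for W = {} it is the Poincare series of k.\<close>
  define G where "G W = multigraded_fps (\<lambda>\<alpha>. int (betti_in W \<alpha>))" for W
  have "poincare_series TYPE('k) prec = G {}"
    unfolding poincare_series_def tor_dim_def tensor_homology G_def multigraded_fps_def
    by (rule arg_cong[where f = Abs_fps]) (auto intro!: ext arg_cong[where f = Abs_poly_mapping])
  moreover have "G UNIV = 1"
    unfolding G_def betti_in_UNIV multigraded_fps_1[symmetric] by (rule arg_cong[where f = multigraded_fps]) auto
  moreover have "G (W - {v}) = G W + xt v * G (W \<inter> comparables prec v)" if v: "v \<in> W" for W v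
    unfolding G_def xt_multigraded_fps multigraded_fps_add
  proof (rule arg_cong[where f = multigraded_fps], rule ext)
    fix \<alpha> :: "'n monom"
    show "int (betti_in (W - {v}) \<alpha>) = int (betti_in W \<alpha>) + (if 0 < lk \<alpha> v then int (betti_in (W \<inter> comparables prec v) (\<alpha> - sv v)) else 0)"
    proof (cases "0 < lk \<alpha> v")
      case True
      then have "\<alpha> = (\<alpha> - sv v) + sv v" using monom_diff[of \<alpha> v] by simp
      then show ?thesis using betti_in_step[OF v, of "\<alpha> - sv v"] True by simp
    qed (use betti_in_same[OF v] in simp)
  qed
  ultimately have "poincare_series TYPE('k) prec * signed_hilb_in prec UNIV = 1"
    using signed_hilb_in_unique[where prec = prec and G = G and W = "{}", OF lt] by (simp add: signed_hilb_in_empty[OF lt])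
  moreover have "poincare_series TYPE('k) prec * chain_series prec =
      poincare_series TYPE('k) prec * signed_hilb_in prec UNIV * (\<Prod>v\<in>UNIV. 1 + xt v)"
    using hilbert_W0'[where prec = prec, OF lt] by (simp only: mult.assoc)
  ultimately show ?thesis by simp
qed

text \<open>Sets unmatched by both matchings are among those unmatched by the first, so
  \<open>unmatched1_excess0\<close> covers both families.\<close>

lemma W_series_matching:
  fixes prec :: "'n::{finite,linorder} \<Rightarrow> 'n \<Rightarrow> bool"
  assumes "standard_matching TYPE('k::field) prec [M1, M2]"
  shows "W_series (unmatched prec (\<Union>(set M1) \<union> \<Union>(set M2))) = chain_series prec" "W_series (unmatched prec (\<Union>(set M1))) = chain_series prec"
proof -
  interpret two_step_matching prec "TYPE('k)" M1 M2 using assms by unfold_locales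
  have "I \<noteq> {} \<and> I \<subseteq> mingens prec \<and> excess0 I" if "I \<in> unmatched prec U1" for I
    using unmatched1_excess0[of I] that by (auto simp: unmatched_def)
  moreover have "unmatched prec (U1 \<union> U2) \<subseteq> unmatched prec U1"
    by (auto simp: unmatched_def Field_def)
  ultimately show "W_series (unmatched prec (U1 \<union> U2)) = chain_series prec" "W_series (unmatched prec U1) = chain_series prec"
    using unmatched_euler by (auto intro!: W_series_eq_card)
qed

text \<open>The quotients are stated as products. Both denominators have constant term 1 in t and
  are therefore invertible power series, so the products determine the two series. The nbc form
  serves as the reference for the other forms of W.\<close>

theorem theorem6p7:
  fixes prec :: "'n :: {finite, linorder} \<Rightarrow> 'n \<Rightarrow> bool"
  assumes "irreflp prec" and "transp prec"
    and "\<And>i j. prec i j \<Longrightarrow> i < j"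
  shows
    "poincare_series TYPE('k :: field) prec * W_series {I. nbc_set prec I}
       = (\<Prod>i\<in>UNIV. 1 + fps_X * fps_const (pvar i)) \<and>
     hilbert_series TYPE('k) prec * (\<Prod>i\<in>UNIV. 1 - fps_X * fps_const (pvar i))
       = fps_compose (W_series {I. nbc_set prec I}) (- fps_X) \<and>
     W_series (sting_unions prec) = W_series {I. nbc_set prec I} \<and>
     (\<forall>\<M>\<^sub>1 \<M>\<^sub>2. standard_matching TYPE('k) prec [\<M>\<^sub>1, \<M>\<^sub>2] \<longrightarrow>
        W_series (unmatched prec (\<Union>(set \<M>\<^sub>1) \<union> \<Union>(set \<M>\<^sub>2))) = W_series {I. nbc_set prec I} \<and>
        W_series (unmatched prec (\<Union>(set \<M>\<^sub>1))) = W_series {I. nbc_set prec I})"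
proof -
  have tr: "prec i k" if "prec i j" "prec j k" for i j k
    using assms(2) that by (rule transpD)
  have "hilbert_series TYPE('k) prec * (\<Prod>v\<in>UNIV. 1 - xt v) = fps_compose (chain_series prec) (- fps_X)"
    unfolding hilbert_series_eq by (rule hilbert_chain_series[OF assms(3)])
  moreover have "W_series (sting_unions prec) = chain_series prec"
    using assms(3) tr by (rule W_series_sting)
  ultimately show ?thesis
    unfolding W_series_nbc xt_def[symmetric]
    using poincare_series_chain_series[OF assms(3), where 'k = 'k] W_series_matching[where 'k = 'k] by blast
qed

end
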